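(* Let $k$ be a field of characteristic $\neq 2,3$ containing the cubic roots of $1$ (i.e. containing a primitive cubic root $\omega$ of $1$). (1) If $\bar C$ and $\bar C'$ are two $\mathbb{Z}_2^3$-graded para-Cayley algebras over $k$, then these gradings induce a $\mathbb{Z}_2^8$-grading on the simple Lie algebra $\mathfrak{g}(\bar C,\bar C')$ (of type $E_8$), and this grading is of type $(192,0,0,14)$. (2) If $\mathcal{O}$ and $\mathcal{O}'$ are two Okubo algebras over $k$ with standard $\mathbb{Z}_3^2$-gradings, then these gradings induce a $\mathbb{Z}_3^5$-grading on the simple Lie algebra $\mathfrak{g}(\mathcal{O},\mathcal{O}')$ (of type $E_8$), and this grading is of type $(240,0,0,2)$. Here the induced gradings are those described explicitly in the context.
   Context: A composition algebra $(S,*,n)$ is a vector space over $k$ with bilinear multiplication and a quadratic form $n$ with nondegenerate polar form $n(x,y)=n(x+y)-n(x)-n(y)$ and $n(x*y)=n(x)n(y)$; it is symmetric if $n(x*y,z)=n(x,y*z)$. A Cayley algebra is an eight dimensional unital composition algebra $(C,\cdot,n)$, with conjugation $\bar x=n(x,1)1-x$; its para-Cayley algebra is $\bar C=(C,\bullet,n)$, $x\bullet y=\bar x\cdot\bar y$. $\mathbb{Z}_2^3$-graded para-Cayley algebra: $C=\bigoplus_{\mu\in\mathbb{Z}_2^3}C_\mu$ is a group grading with all eight components one dimensional; equivalently there are nonisotropic $x,y,z\in C$ with $n(1,x)=0$, $n(k1+kx,y)=0$, $n(k1+kx+ky+k(xy),z)=0$ and the grading is determined by $C_{(\bar1,\bar0,\bar0)}=kx$,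 $C_{(\bar0,\bar1,\bar0)}=ky$, $C_{(\bar0,\bar0,\bar1)}=kz$; it is also a grading of $\bar C$. Okubo algebra with standard $\mathbb{Z}_3^2$-grading: an algebra $\mathcal{O}_{\alpha,\beta}$ ($0\ne\alpha,\beta\in k$) with basis $\{x_{i,j}:-1\le i,j\le1,(i,j)\ne(0,0)\}$, $x_{i,j}$ of degree $(\bar\imath,\bar\jmath)\in\mathbb{Z}_3^2$, norm with $n(x_{i,j})=0$, $n(x_{i,j},x_{-i,-j})=1$, other pairs of distinct basis elements orthogonal, and products (those not listed are $0$): $x_{1,0}*x_{1,0}=-\alpha x_{-1,0}$, $x_{1,0}*x_{0,-1}=x_{1,-1}$, $x_{1,0}*x_{-1,-1}=x_{0,-1}$, $x_{1,0}*x_{1,-1}=\alpha x_{-1,-1}$; $x_{-1,0}*x_{-1,0}=-\alpha^{-1}x_{1,0}$, $x_{-1,0}*x_{0,1}=x_{-1,1}$, $x_{-1,0}*x_{1,1}=x_{0,1}$, $x_{-1,0}*x_{-1,1}=\alpha^{-1}x_{1,1}$; $x_{0,1}*x_{1,0}=x_{1,1}$, $x_{0,1}*x_{0,1}=-\beta x_{0,-1}$, $x_{0,1}*x_{1,1}=\beta x_{1,-1}$, $x_{0,1}*x_{1,-1}=x_{1,0}$; $x_{0,-1}*x_{-1,0}=x_{-1,-1}$, $x_{0,-1}*x_{0,-1}=-\beta^{-1}x_{0,1}$, $x_{0,-1}*x_{-1,-1}=\beta^{-1}x_{-1,1}$, $x_{0,-1}*x_{-1,1}=x_{-1,0}$;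 $x_{1,1}*x_{1,0}=\alpha x_{-1,1}$, $x_{1,1}*x_{0,-1}=x_{1,0}$, $x_{1,1}*x_{1,1}=-\alpha\beta x_{-1,-1}$, $x_{1,1}*x_{-1,1}=\beta x_{0,-1}$; $x_{-1,-1}*x_{-1,0}=\alpha^{-1}x_{1,-1}$, $x_{-1,-1}*x_{0,1}=x_{-1,0}$, $x_{-1,-1}*x_{-1,-1}=-(\alpha\beta)^{-1}x_{1,1}$, $x_{-1,-1}*x_{1,-1}=\beta^{-1}x_{0,1}$; $x_{-1,1}*x_{1,0}=x_{0,1}$, $x_{-1,1}*x_{0,1}=\beta x_{-1,-1}$, $x_{-1,1}*x_{-1,-1}=\alpha^{-1}x_{1,0}$, $x_{-1,1}*x_{-1,1}=-\alpha^{-1}\beta x_{1,-1}$; $x_{1,-1}*x_{-1,0}=x_{0,-1}$, $x_{1,-1}*x_{0,-1}=\beta^{-1}x_{1,1}$, $x_{1,-1}*x_{1,1}=\alpha x_{-1,0}$, $x_{1,-1}*x_{1,-1}=-\alpha\beta^{-1}x_{-1,1}$. Triality Lie algebra. $\mathfrak{o}(S,n)=\{d\in\mathrm{End}_k(S):n(d(x),y)+n(x,d(y))=0\ \forall x,y\}$; $\mathfrak{tri}(S)=\{(d_0,d_1,d_2)\in\mathfrak{o}(S,n)^3:d_0(x*y)=d_1(x)*y+x*d_2(y)\ \forall x,y\in S\}$ with componentwise bracket; $\theta(d_0,d_1,d_2)=(d_2,d_0,d_1)$ is an automorphism of it. With $l_x(z)=x*z$, $r_x(z)=z*x$, $\sigma_{x,y}(z)=n(x,z)y-n(y,z)x$,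 put $t_{x,y}=(\sigma_{x,y},\tfrac12n(x,y)\mathrm{id}-r_xl_y,\tfrac12n(x,y)\mathrm{id}-l_xr_y)\in\mathfrak{tri}(S)$. For symmetric composition algebras $(S,*,n)$, $(S',\star,n')$, $\mathfrak{g}(S,S')=\mathfrak{tri}(S)\oplus\mathfrak{tri}(S')\oplus\bigoplus_{i=0}^2\iota_i(S\otimes S')$, where $\iota_i(S\otimes S')$ is a copy of $S\otimes S'$, with bracket: $\mathfrak{tri}(S)\oplus\mathfrak{tri}(S')$ is a subalgebra (direct sum of Lie algebras); $[(d_0,d_1,d_2),\iota_i(x\otimes x')]=\iota_i(d_i(x)\otimes x')$; $[(d_0',d_1',d_2'),\iota_i(x\otimes x')]=\iota_i(x\otimes d_i'(x'))$; $[\iota_i(x\otimes x'),\iota_{i+1}(y\otimes y')]=\iota_{i+2}((x*y)\otimes(x'\star y'))$ (indices mod $3$); $[\iota_i(x\otimes x'),\iota_i(y\otimes y')]=n'(x',y')\theta^i(t_{x,y})+n(x,y)\theta'^i(t'_{x',y'})$, where $\theta',t'$ are the analogues for $S'$. If $S$ is graded by an abelian group $H$, let $\mathfrak{o}(S,n)_\mu=\{d:d(S_\gamma)\subseteq S_{\gamma+\mu}\ \forall\gamma\}$ and $\mathfrak{tri}(S)_\mu=\{(d_0,d_1,d_2)\in\mathfrak{tri}(S):d_i\in\mathfrak{o}(S,n)_\mu,\ i=0,1,2\}$. Induced grading in (1) ($S=\bar C$, $S'=\bar C'$, group $\mathbb{Z}_2^3\times\mathbb{Z}_2^3\times\mathbb{Z}_2^2$):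 $\mathfrak{tri}(S)_\mu$ has degree $(\mu,0,(\bar0,\bar0))$, $\mathfrak{tri}(S')_\nu$ has degree $(0,\nu,(\bar0,\bar0))$, and $\iota_0(S_\mu\otimes S'_\nu)$, $\iota_1(S_\mu\otimes S'_\nu)$, $\iota_2(S_\mu\otimes S'_\nu)$ have degrees $(\mu,\nu,(\bar1,\bar0))$, $(\mu,\nu,(\bar0,\bar1))$, $(\mu,\nu,(\bar1,\bar1))$. Induced grading in (2) ($S=\mathcal{O}$, $S'=\mathcal{O}'$, group $\mathbb{Z}_3^2\times\mathbb{Z}_3^2\times\mathbb{Z}_3$): let $\Theta$ be the order $3$ automorphism of $\mathfrak{g}(S,S')$ restricting to $\theta$ on $\mathfrak{tri}(S)$, to $\theta'$ on $\mathfrak{tri}(S')$, and with $\Theta(\iota_i(x\otimes x'))=\iota_{i+1}(x\otimes x')$. The $\mathbb{Z}_3^2\times\mathbb{Z}_3^2$-degree of $\mathfrak{tri}(S)_\mu$ is $(\mu,0)$, of $\mathfrak{tri}(S')_\nu$ is $(0,\nu)$, of $\iota_i(S_\mu\otimes S'_\nu)$ is $(\mu,\nu)$, and the component of degree $(\mu,\nu,\bar\jmath)$ is the $\omega^j$-eigenspace of $\Theta$ in the component of degree $(\mu,\nu)$. A grading has type $(h_1,\dots,h_l)$ if it has exactly $h_i$ (nonzero) homogeneous components of dimension $i$ for $i=1,\dots,l$, and none of dimension larger than $l$. *)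

theory Defs
  imports
    "HOL-Library.Function_Algebras"
    "HOL-Library.Product_Plus"
    "HOL-Library.Numeral_Type"
    "HOL-Algebra.Algebraic_Closure_Type"
begin

text \<open>
  Conventions. A vector space over \<open>'k\<close> is either a whole type or a subspace of a type; its scalar
  multiplication is passed explicitly. Sums, differences and zero of functions and of pairs are
  the pointwise ones. The groups $\mathbb{Z}_2$ and $\mathbb{Z}_3$ are the types \<open>2\<close> and \<open>3\<close>; the
  type \<open>3\<close> is also the index set $\{0,1,2\}$ (modulo 3) of the constructions below.
\<close>

section \<open>Linear algebra\<close>

definition fun_scale :: "('k \<Rightarrow> 'b \<Rightarrow> 'b) \<Rightarrow> 'k \<Rightarrow> ('a \<Rightarrow> 'b) \<Rightarrow> 'a \<Rightarrow> 'b"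
  where "fun_scale s a f = (\<lambda>x. s a (f x))"

definition bilin ::
  "('k::field \<Rightarrow> 'a::ab_group_add \<Rightarrow> 'a) \<Rightarrow> ('k \<Rightarrow> 'b::ab_group_add \<Rightarrow> 'b)
    \<Rightarrow> ('k \<Rightarrow> 'c::ab_group_add \<Rightarrow> 'c) \<Rightarrow> ('a \<Rightarrow> 'b \<Rightarrow> 'c) \<Rightarrow> bool"
  where "bilin s1 s2 s3 B \<longleftrightarrow>
    (\<forall>x. Vector_Spaces.linear s2 s3 (B x)) \<and> (\<forall>y. Vector_Spaces.linear s1 s3 (\<lambda>x. B x y))"

definition is_basis_of :: "('k::field \<Rightarrow> 'v::ab_group_add \<Rightarrow> 'v) \<Rightarrow> 'v set \<Rightarrow> 'v set \<Rightarrow> bool"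
  where "is_basis_of s V B \<longleftrightarrow>
    B \<subseteq> V \<and> \<not> Modules.module.dependent s B \<and> Modules.module.span s B = V"

definition has_dim :: "('k::field \<Rightarrow> 'v::ab_group_add \<Rightarrow> 'v) \<Rightarrow> 'v set \<Rightarrow> nat \<Rightarrow> bool"
  where "has_dim s V n \<longleftrightarrow> (\<exists>B. is_basis_of s V B \<and> finite B \<and> card B = n)"

text \<open>
  The tensor product of two vector spaces, realized inside the dual of the space of bilinear
  forms: \<open>x \<otimes> y\<close> is evaluation at \<open>(x, y)\<close>, and the tensor product is the span of these (over a
  field this is the usual tensor product).
\<close>

type_synonym ('k, 'v, 'w) tensor = "('v \<Rightarrow> 'w \<Rightarrow> 'k) \<Rightarrow> 'k"

definition tensor ::
  "('k::field \<Rightarrow> 'v::ab_group_add \<Rightarrow> 'v) \<Rightarrow> ('k \<Rightarrow> 'w::ab_group_add \<Rightarrow> 'w)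
    \<Rightarrow> 'v \<Rightarrow> 'w \<Rightarrow> ('k, 'v, 'w) tensor"
  where "tensor s s' x y = (\<lambda>B. if bilin s s' (*) B then B x y else 0)"

definition tensor_space ::
  "('k::field \<Rightarrow> 'v::ab_group_add \<Rightarrow> 'v) \<Rightarrow> ('k \<Rightarrow> 'w::ab_group_add \<Rightarrow> 'w)
    \<Rightarrow> 'v set \<Rightarrow> 'w set \<Rightarrow> ('k, 'v, 'w) tensor set"
  where "tensor_space s s' V W =
    Modules.module.span (fun_scale (*)) {tensor s s' x y | x y. x \<in> V \<and> y \<in> W}"

text \<open>
  The linear map on the tensor product with \<open>x \<otimes> y \<mapsto> \<Phi> x y\<close>, for \<open>\<Phi>\<close> bilinear: write the tensor
  as a sum of pure tensors and apply \<open>\<Phi>\<close> to each. The result does not depend on the chosen sum.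
\<close>

definition tensor_lift ::
  "('k::field \<Rightarrow> 'v::ab_group_add \<Rightarrow> 'v) \<Rightarrow> ('k \<Rightarrow> 'w::ab_group_add \<Rightarrow> 'w)
    \<Rightarrow> ('v \<Rightarrow> 'w \<Rightarrow> 'u::ab_group_add) \<Rightarrow> ('k, 'v, 'w) tensor \<Rightarrow> 'u"
  where "tensor_lift s s' \<Phi> T =
    (\<Sum>(x, y)\<leftarrow>(SOME ps. T = (\<Sum>(x, y)\<leftarrow>ps. tensor s s' x y)). \<Phi> x y)"

section \<open>Gradings by a finite abelian group\<close>

text \<open>\<open>V\<close> is the underlying space of the algebra and \<open>m\<close> its product.\<close>

definition group_grading ::
  "('k::field \<Rightarrow> 'v::ab_group_add \<Rightarrow> 'v) \<Rightarrow> 'v set \<Rightarrow> ('v \<Rightarrow> 'v \<Rightarrow> 'v)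
    \<Rightarrow> ('h::{finite,ab_group_add} \<Rightarrow> 'v set) \<Rightarrow> bool"
  where "group_grading s V m D \<longleftrightarrow>
    (\<forall>\<mu>. Modules.module.subspace s (D \<mu>) \<and> D \<mu> \<subseteq> V) \<and>
    (\<forall>v\<in>V. \<exists>!f. (\<forall>\<mu>. f \<mu> \<in> D \<mu>) \<and> v = (\<Sum>\<mu>\<in>UNIV. f \<mu>)) \<and>
    (\<forall>\<mu> \<nu>. \<forall>x\<in>D \<mu>. \<forall>y\<in>D \<nu>. m x y \<in> D (\<mu> + \<nu>))"

definition grading_type ::
  "('k::field \<Rightarrow> 'v::ab_group_add \<Rightarrow> 'v) \<Rightarrow> ('h \<Rightarrow> 'v set) \<Rightarrow> nat list \<Rightarrow> bool"
  where "grading_type s D hs \<longleftrightarrow>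
    (\<forall>\<mu>. \<exists>d \<le> length hs. has_dim s (D \<mu>) d) \<and>
    (\<forall>i\<in>{1..length hs}. card {\<mu>. has_dim s (D \<mu>) i} = hs ! (i - 1))"

section \<open>Lie algebras\<close>

definition lie_algebra ::
  "('k::field \<Rightarrow> 'v::ab_group_add \<Rightarrow> 'v) \<Rightarrow> 'v set \<Rightarrow> ('v \<Rightarrow> 'v \<Rightarrow> 'v) \<Rightarrow> bool"
  where "lie_algebra s L br \<longleftrightarrow>
    vector_space s \<and> Modules.module.subspace s L \<and>
    (\<forall>x\<in>L. \<forall>y\<in>L. br x y \<in> L) \<and>
    (\<forall>x\<in>L. \<forall>y\<in>L. \<forall>z\<in>L. br (x + y) z = br x z + br y z \<and> br z (x + y) = br z x + br z y) \<and>
    (\<forall>a. \<forall>x\<in>L. \<forall>y\<in>L. br (s a x) y = s a (br x y) \<and> br x (s a y) = s a (br x y)) \<and>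
    (\<forall>x\<in>L. br x x = 0) \<and>
    (\<forall>x\<in>L. \<forall>y\<in>L. \<forall>z\<in>L. br x (br y z) + br y (br z x) + br z (br x y) = 0)"

definition lie_ideal ::
  "('k::field \<Rightarrow> 'v::ab_group_add \<Rightarrow> 'v) \<Rightarrow> 'v set \<Rightarrow> ('v \<Rightarrow> 'v \<Rightarrow> 'v) \<Rightarrow> 'v set \<Rightarrow> bool"
  where "lie_ideal s L br J \<longleftrightarrow>
    Modules.module.subspace s J \<and> J \<subseteq> L \<and> (\<forall>x\<in>L. \<forall>y\<in>J. br x y \<in> J)"

definition simple_lie_algebra ::
  "('k::field \<Rightarrow> 'v::ab_group_add \<Rightarrow> 'v) \<Rightarrow> 'v set \<Rightarrow> ('v \<Rightarrow> 'v \<Rightarrow> 'v) \<Rightarrow> bool"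
  where "simple_lie_algebra s L br \<longleftrightarrow>
    lie_algebra s L br \<and> (\<exists>x\<in>L. \<exists>y\<in>L. br x y \<noteq> 0) \<and>
    (\<forall>J. lie_ideal s L br J \<longrightarrow> J = {0} \<or> J = L)"

subsection \<open>Type \<open>E\<^sub>8\<close>\<close>

text \<open>
  The roots of \<open>E\<^sub>8\<close> in orthonormal coordinates are \<open>\<plusminus>\<epsilon>\<^sub>i \<plusminus> \<epsilon>\<^sub>j\<close> with \<open>i \<noteq> j\<close>, and \<open>(\<plusminus>1/2, \<dots>, \<plusminus>1/2)\<close> with
  an even number of minus signs. The vectors below are the doubles of the roots.
\<close>

definition E8_double_roots :: "(8 \<Rightarrow> int) set"
  where "E8_double_roots = {v. ((\<forall>i. even (v i)) \<or> (\<forall>i. odd (v i))) \<and>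
    (\<Sum>i\<in>UNIV. (v i)\<^sup>2) = 8 \<and> 4 dvd (\<Sum>i\<in>UNIV. v i)}"

text \<open>
  A Lie algebra (characteristic not 2) is the Chevalley algebra of type \<open>E\<^sub>8\<close> if it has a Chevalley
  basis. As 2 is invertible, the Cartan subalgebra is described by the orthonormal coordinates
  \<open>t i\<close>, rather than by simple coroots: the coroot of \<open>\<alpha>\<close> is \<open>\<Sum>i. \<alpha>\<^sub>i t\<^sub>i\<close>.
\<close>

definition has_E8_chevalley_basis ::
  "('k::field \<Rightarrow> 'v::ab_group_add \<Rightarrow> 'v) \<Rightarrow> 'v set \<Rightarrow> ('v \<Rightarrow> 'v \<Rightarrow> 'v) \<Rightarrow> bool"
  where "has_E8_chevalley_basis s L br \<longleftrightarrow>
    (\<exists>(t :: 8 \<Rightarrow> 'v) (e :: (8 \<Rightarrow> int) \<Rightarrow> 'v).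
      inj t \<and> inj_on e E8_double_roots \<and> range t \<inter> e ` E8_double_roots = {} \<and>
      is_basis_of s L (range t \<union> e ` E8_double_roots) \<and>
      (\<forall>i j. br (t i) (t j) = 0) \<and>
      (\<forall>i. \<forall>v\<in>E8_double_roots. br (t i) (e v) = s (of_int (v i) / 2) (e v)) \<and>
      (\<forall>v\<in>E8_double_roots. br (e v) (e (- v)) = (\<Sum>i\<in>UNIV. s (of_int (v i) / 2) (t i))) \<and>
      (\<forall>v\<in>E8_double_roots. \<forall>w\<in>E8_double_roots. v + w \<in> E8_double_roots \<longrightarrow>
         br (e v) (e w) = e (v + w) \<or> br (e v) (e w) = - e (v + w)) \<and>
      (\<forall>v\<in>E8_double_roots. \<forall>w\<in>E8_double_roots. v + w \<noteq> 0 \<and> v + w \<notin> E8_double_roots \<longrightarrow>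
         br (e v) (e w) = 0))"

text \<open>
  The extension of scalars, to an algebraic closure, of the \<open>n\<close>-dimensional Lie algebra with
  structure constants \<open>c\<close>, on coordinate vectors (functions vanishing from \<open>n\<close> on).
\<close>

definition ext_space :: "nat \<Rightarrow> (nat \<Rightarrow> 'k::field alg_closure) set"
  where "ext_space n = {u. \<forall>l\<ge>n. u l = 0}"

definition ext_bracket ::
  "nat \<Rightarrow> (nat \<Rightarrow> nat \<Rightarrow> nat \<Rightarrow> 'k::field)
    \<Rightarrow> (nat \<Rightarrow> 'k alg_closure) \<Rightarrow> (nat \<Rightarrow> 'k alg_closure) \<Rightarrow> nat \<Rightarrow> 'k alg_closure"
  where "ext_bracket n c u v =
    (\<lambda>l. if l < n then \<Sum>i<n. \<Sum>j<n. u i * v j * to_ac (c i j l) else 0)"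

definition lie_of_type_E8 ::
  "('k::field \<Rightarrow> 'v::ab_group_add \<Rightarrow> 'v) \<Rightarrow> 'v set \<Rightarrow> ('v \<Rightarrow> 'v \<Rightarrow> 'v) \<Rightarrow> bool"
  where "lie_of_type_E8 s L br \<longleftrightarrow> lie_algebra s L br \<and>
    (\<exists>n (b :: nat \<Rightarrow> 'v) c.
      inj_on b {..<n} \<and> is_basis_of s L (b ` {..<n}) \<and>
      (\<forall>i<n. \<forall>j<n. br (b i) (b j) = (\<Sum>l<n. s (c i j l) (b l))) \<and>
      has_E8_chevalley_basis (fun_scale (*)) (ext_space n) (ext_bracket n c))"

section \<open>Composition algebras\<close>

record ('k, 'v) normed_alg =
  scl :: "'k \<Rightarrow> 'v \<Rightarrow> 'v"
  mul :: "'v \<Rightarrow> 'v \<Rightarrow> 'v"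
  nrm :: "'v \<Rightarrow> 'k"

definition polar :: "('k::field, 'v::ab_group_add) normed_alg \<Rightarrow> 'v \<Rightarrow> 'v \<Rightarrow> 'k"
  where "polar S x y = nrm S (x + y) - nrm S x - nrm S y"

definition algebra_with_quadratic_form :: "('k::field, 'v::ab_group_add) normed_alg \<Rightarrow> bool"
  where "algebra_with_quadratic_form S \<longleftrightarrow>
    vector_space (scl S) \<and> bilin (scl S) (scl S) (scl S) (mul S) \<and>
    (\<forall>a x. nrm S (scl S a x) = a\<^sup>2 * nrm S x) \<and> bilin (scl S) (scl S) (*) (polar S)"

definition composition_algebra :: "('k::field, 'v::ab_group_add) normed_alg \<Rightarrow> bool"
  where "composition_algebra S \<longleftrightarrow> algebra_with_quadratic_form S \<and>
    (\<forall>x. (\<forall>y. polar S x y = 0) \<longrightarrow> x = 0) \<and>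
    (\<forall>x y. nrm S (mul S x y) = nrm S x * nrm S y)"

definition cayley_algebra :: "('k::field, 'v::ab_group_add) normed_alg \<Rightarrow> 'v \<Rightarrow> bool"
  where "cayley_algebra C u \<longleftrightarrow> composition_algebra C \<and>
    (\<forall>x. mul C u x = x \<and> mul C x u = x) \<and> has_dim (scl C) UNIV 8"

definition conjugate :: "('k::field, 'v::ab_group_add) normed_alg \<Rightarrow> 'v \<Rightarrow> 'v \<Rightarrow> 'v"
  where "conjugate C u x = scl C (polar C x u) u - x"

definition para :: "('k::field, 'v::ab_group_add) normed_alg \<Rightarrow> 'v \<Rightarrow> ('k, 'v) normed_alg"
  where "para C u = C\<lparr>mul := (\<lambda>x y. mul C (conjugate C u x) (conjugate C u y))\<rparr>"

definition Z2_cubed_graded_cayley ::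
  "('k::field, 'v::ab_group_add) normed_alg \<Rightarrow> 'v \<Rightarrow> (2 \<times> 2 \<times> 2 \<Rightarrow> 'v set) \<Rightarrow> bool"
  where "Z2_cubed_graded_cayley C u D \<longleftrightarrow> cayley_algebra C u \<and>
    group_grading (scl C) UNIV (mul C) D \<and> (\<forall>\<mu>. has_dim (scl C) (D \<mu>) 1)"

text \<open>
  The multiplication table of the Okubo algebra: an entry \<open>((a, b), (c, d))\<close> stands for
  \<open>x\<^sub>a * x\<^sub>b = c x\<^sub>d\<close>; products without an entry are zero.
\<close>

definition okubo_table ::
  "'k::field \<Rightarrow> 'k \<Rightarrow> (((3 \<times> 3) \<times> (3 \<times> 3)) \<times> ('k \<times> (3 \<times> 3))) list"
  where "okubo_table \<alpha> \<beta> =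
   [(((1, 0), (1, 0)), (- \<alpha>, (-1, 0))),
    (((1, 0), (0, -1)), (1, (1, -1))),
    (((1, 0), (-1, -1)), (1, (0, -1))),
    (((1, 0), (1, -1)), (\<alpha>, (-1, -1))),
    (((-1, 0), (-1, 0)), (- inverse \<alpha>, (1, 0))),
    (((-1, 0), (0, 1)), (1, (-1, 1))),
    (((-1, 0), (1, 1)), (1, (0, 1))),
    (((-1, 0), (-1, 1)), (inverse \<alpha>, (1, 1))),
    (((0, 1), (1, 0)), (1, (1, 1))),
    (((0, 1), (0, 1)), (- \<beta>, (0, -1))),
    (((0, 1), (1, 1)), (\<beta>, (1, -1))),
    (((0, 1), (1, -1)), (1, (1, 0))),
    (((0, -1), (-1, 0)), (1, (-1, -1))),
    (((0, -1), (0, -1)), (- inverse \<beta>, (0, 1))),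
    (((0, -1), (-1, -1)), (inverse \<beta>, (-1, 1))),
    (((0, -1), (-1, 1)), (1, (-1, 0))),
    (((1, 1), (1, 0)), (\<alpha>, (-1, 1))),
    (((1, 1), (0, -1)), (1, (1, 0))),
    (((1, 1), (1, 1)), (- (\<alpha> * \<beta>), (-1, -1))),
    (((1, 1), (-1, 1)), (\<beta>, (0, -1))),
    (((-1, -1), (-1, 0)), (inverse \<alpha>, (1, -1))),
    (((-1, -1), (0, 1)), (1, (-1, 0))),
    (((-1, -1), (-1, -1)), (- inverse (\<alpha> * \<beta>), (1, 1))),
    (((-1, -1), (1, -1)), (inverse \<beta>, (0, 1))),
    (((-1, 1), (1, 0)), (1, (0, 1))),
    (((-1, 1), (0, 1)), (\<beta>, (-1, -1))),
    (((-1, 1), (-1, -1)), (inverse \<alpha>, (1, 0))),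
    (((-1, 1), (-1, 1)), (- (inverse \<alpha> * \<beta>), (1, -1))),
    (((1, -1), (-1, 0)), (1, (0, -1))),
    (((1, -1), (0, -1)), (inverse \<beta>, (1, 1))),
    (((1, -1), (1, 1)), (\<alpha>, (-1, 0))),
    (((1, -1), (1, -1)), (- (\<alpha> * inverse \<beta>), (-1, 1)))]"

text \<open>The value of \<open>x\<close> at \<open>0\<close> plays no role.\<close>

definition okubo_algebra ::
  "'k::field \<Rightarrow> 'k \<Rightarrow> ('k, 'v::ab_group_add) normed_alg \<Rightarrow> (3 \<times> 3 \<Rightarrow> 'v) \<Rightarrow> bool"
  where "okubo_algebra \<alpha> \<beta> S x \<longleftrightarrow> \<alpha> \<noteq> 0 \<and> \<beta> \<noteq> 0 \<and>
    algebra_with_quadratic_form S \<and>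
    inj_on x (- {0}) \<and> is_basis_of (scl S) UNIV (x ` (- {0})) \<and>
    (\<forall>a. a \<noteq> 0 \<longrightarrow> nrm S (x a) = 0) \<and>
    (\<forall>a b. a \<noteq> 0 \<and> b \<noteq> 0 \<longrightarrow> polar S (x a) (x b) = (if b = - a then 1 else 0)) \<and>
    (\<forall>a b. a \<noteq> 0 \<and> b \<noteq> 0 \<longrightarrow> mul S (x a) (x b) =
       (case map_of (okubo_table \<alpha> \<beta>) (a, b) of None \<Rightarrow> 0 | Some (c, d) \<Rightarrow> scl S c (x d)))"

definition okubo_grading ::
  "('k::field, 'v::ab_group_add) normed_alg \<Rightarrow> (3 \<times> 3 \<Rightarrow> 'v) \<Rightarrow> 3 \<times> 3 \<Rightarrow> 'v set"
  where "okubo_grading S x \<mu> = (if \<mu> = 0 then {0} else Modules.module.span (scl S) {x \<mu>})"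

section \<open>The triality Lie algebra\<close>

definition orth_lie :: "('k::field, 'v::ab_group_add) normed_alg \<Rightarrow> ('v \<Rightarrow> 'v) set"
  where "orth_lie S = {d. Vector_Spaces.linear (scl S) (scl S) d \<and>
    (\<forall>x y. polar S (d x) y + polar S x (d y) = 0)}"

definition tri :: "('k::field, 'v::ab_group_add) normed_alg \<Rightarrow> (3 \<Rightarrow> 'v \<Rightarrow> 'v) set"
  where "tri S = {d. (\<forall>i. d i \<in> orth_lie S) \<and>
    (\<forall>x y. d 0 (mul S x y) = mul S (d 1 x) y + mul S x (d 2 y))}"

definition tri_deg ::
  "('k::field, 'v::ab_group_add) normed_alg \<Rightarrow> ('h::ab_group_add \<Rightarrow> 'v set) \<Rightarrow> 'h
    \<Rightarrow> (3 \<Rightarrow> 'v \<Rightarrow> 'v) set"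
  where "tri_deg S D \<mu> = {d \<in> tri S. \<forall>i \<gamma>. d i ` D \<gamma> \<subseteq> D (\<gamma> + \<mu>)}"

text \<open>\<open>shift i\<close> is \<open>\<theta>\<^sup>i\<close>, where \<open>\<theta> (d\<^sub>0, d\<^sub>1, d\<^sub>2) = (d\<^sub>2, d\<^sub>0, d\<^sub>1)\<close>.\<close>

definition shift :: "3 \<Rightarrow> (3 \<Rightarrow> 'a) \<Rightarrow> 3 \<Rightarrow> 'a"
  where "shift i d = (\<lambda>j. d (j - i))"

definition sigma_elt :: "('k::field, 'v::ab_group_add) normed_alg \<Rightarrow> 'v \<Rightarrow> 'v \<Rightarrow> 'v \<Rightarrow> 'v"
  where "sigma_elt S x y = (\<lambda>z. scl S (polar S x z) y - scl S (polar S y z) x)"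

definition t_elt :: "('k::field, 'v::ab_group_add) normed_alg \<Rightarrow> 'v \<Rightarrow> 'v \<Rightarrow> 3 \<Rightarrow> 'v \<Rightarrow> 'v"
  where "t_elt S x y = (\<lambda>i.
    if i = 0 then sigma_elt S x y
    else if i = 1 then (\<lambda>z. scl S (polar S x y / 2) z - mul S (mul S y z) x)
    else (\<lambda>z. scl S (polar S x y / 2) z - mul S x (mul S z y)))"

section \<open>The Lie algebra \<open>\<gg>(S, S')\<close>\<close>

text \<open>
  An element \<open>(d, d', T)\<close> stands for \<open>d + d' + \<Sum>i. \<iota>\<^sub>i (T i)\<close> with \<open>d \<in> tri S\<close>, \<open>d' \<in> tri S'\<close> and
  \<open>T i \<in> S \<otimes> S'\<close>.
\<close>

type_synonym ('k, 'v, 'w) g_elt =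
  "(3 \<Rightarrow> 'v \<Rightarrow> 'v) \<times> (3 \<Rightarrow> 'w \<Rightarrow> 'w) \<times> (3 \<Rightarrow> ('k, 'v, 'w) tensor)"

definition g_scale ::
  "('k::field, 'v::ab_group_add) normed_alg \<Rightarrow> ('k, 'w::ab_group_add) normed_alg
    \<Rightarrow> 'k \<Rightarrow> ('k, 'v, 'w) g_elt \<Rightarrow> ('k, 'v, 'w) g_elt"
  where "g_scale S S' a = (\<lambda>(d, d', T).
    (fun_scale (fun_scale (scl S)) a d, fun_scale (fun_scale (scl S')) a d',
     fun_scale (fun_scale (*)) a T))"

definition g_space ::
  "('k::field, 'v::ab_group_add) normed_alg \<Rightarrow> ('k, 'w::ab_group_add) normed_alg
    \<Rightarrow> ('k, 'v, 'w) g_elt set"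
  where "g_space S S' =
    {(d, d', T). d \<in> tri S \<and> d' \<in> tri S' \<and> (\<forall>i. T i \<in> tensor_space (scl S) (scl S') UNIV UNIV)}"

definition tri_bracket :: "(3 \<Rightarrow> 'v \<Rightarrow> 'v) \<Rightarrow> (3 \<Rightarrow> 'v \<Rightarrow> 'v) \<Rightarrow> 3 \<Rightarrow> 'v \<Rightarrow> 'v::ab_group_add"
  where "tri_bracket d e = (\<lambda>i z. d i (e i z) - e i (d i z))"

text \<open>\<open>[(d, d'), \<iota>\<^sub>i T] = \<iota>\<^sub>i (tri_action d d' i T)\<close>\<close>

definition tri_action ::
  "('k::field, 'v::ab_group_add) normed_alg \<Rightarrow> ('k, 'w::ab_group_add) normed_alg
    \<Rightarrow> (3 \<Rightarrow> 'v \<Rightarrow> 'v) \<Rightarrow> (3 \<Rightarrow> 'w \<Rightarrow> 'w) \<Rightarrow> 3 \<Rightarrow> ('k, 'v, 'w) tensor \<Rightarrow> ('k, 'v, 'w) tensor"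
  where "tri_action S S' d d' i = tensor_lift (scl S) (scl S')
    (\<lambda>x x'. tensor (scl S) (scl S') (d i x) x' + tensor (scl S) (scl S') x (d' i x'))"

text \<open>\<open>[\<iota>\<^sub>i T, \<iota>\<^sub>i\<^sub>+\<^sub>1 U] = \<iota>\<^sub>i\<^sub>+\<^sub>2 (tensor_mul T U)\<close>\<close>

definition tensor_mul ::
  "('k::field, 'v::ab_group_add) normed_alg \<Rightarrow> ('k, 'w::ab_group_add) normed_alg
    \<Rightarrow> ('k, 'v, 'w) tensor \<Rightarrow> ('k, 'v, 'w) tensor \<Rightarrow> ('k, 'v, 'w) tensor"
  where "tensor_mul S S' T U =
    tensor_lift (scl S) (scl S') (\<lambda>x x'. tensor_lift (scl S) (scl S')
      (\<lambda>y y'. tensor (scl S) (scl S') (mul S x y) (mul S' x' y')) U) T"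

text \<open>
  \<open>[\<iota>\<^sub>i T, \<iota>\<^sub>i U]\<close> has component \<open>iota_pair\<^sub>1 i T U\<close> in \<open>tri S\<close> and \<open>iota_pair\<^sub>2 i T U\<close> in \<open>tri S'\<close>.
\<close>

definition iota_pair\<^sub>1 ::
  "('k::field, 'v::ab_group_add) normed_alg \<Rightarrow> ('k, 'w::ab_group_add) normed_alg
    \<Rightarrow> 3 \<Rightarrow> ('k, 'v, 'w) tensor \<Rightarrow> ('k, 'v, 'w) tensor \<Rightarrow> 3 \<Rightarrow> 'v \<Rightarrow> 'v"
  where "iota_pair\<^sub>1 S S' i T U =
    tensor_lift (scl S) (scl S') (\<lambda>x x'. tensor_lift (scl S) (scl S')
      (\<lambda>y y'. fun_scale (fun_scale (scl S)) (polar S' x' y') (shift i (t_elt S x y))) U) T"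

definition iota_pair\<^sub>2 ::
  "('k::field, 'v::ab_group_add) normed_alg \<Rightarrow> ('k, 'w::ab_group_add) normed_alg
    \<Rightarrow> 3 \<Rightarrow> ('k, 'v, 'w) tensor \<Rightarrow> ('k, 'v, 'w) tensor \<Rightarrow> 3 \<Rightarrow> 'w \<Rightarrow> 'w"
  where "iota_pair\<^sub>2 S S' i T U =
    tensor_lift (scl S) (scl S') (\<lambda>x x'. tensor_lift (scl S) (scl S')
      (\<lambda>y y'. fun_scale (fun_scale (scl S')) (polar S x y) (shift i (t_elt S' x' y'))) U) T"

text \<open>
  The \<open>\<iota>\<^sub>k\<close>-component collects \<open>[\<iota>\<^sub>k\<^sub>+\<^sub>1, \<iota>\<^sub>k\<^sub>+\<^sub>2]\<close>, and the opposite order with a minus sign.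
\<close>

definition g_bracket ::
  "('k::field, 'v::ab_group_add) normed_alg \<Rightarrow> ('k, 'w::ab_group_add) normed_alg
    \<Rightarrow> ('k, 'v, 'w) g_elt \<Rightarrow> ('k, 'v, 'w) g_elt \<Rightarrow> ('k, 'v, 'w) g_elt"
  where "g_bracket S S' = (\<lambda>(d, d', T) (e, e', U).
    (tri_bracket d e + (\<Sum>i\<in>UNIV. iota_pair\<^sub>1 S S' i (T i) (U i)),
     tri_bracket d' e' + (\<Sum>i\<in>UNIV. iota_pair\<^sub>2 S S' i (T i) (U i)),
     \<lambda>k. tri_action S S' d d' k (U k) - tri_action S S' e e' k (T k)
       + tensor_mul S S' (T (k + 1)) (U (k + 2)) - tensor_mul S S' (U (k + 1)) (T (k + 2))))"

definition Theta :: "('k, 'v, 'w) g_elt \<Rightarrow> ('k, 'v, 'w) g_elt"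
  where "Theta = (\<lambda>(d, d', T). (shift 1 d, shift 1 d', shift 1 T))"

section \<open>The induced gradings\<close>

text \<open>
  The component of degree \<open>(\<mu>, \<nu>)\<close> for the gradings \<open>D\<close> of \<open>S\<close> and \<open>D'\<close> of \<open>S'\<close>: it is spanned by
  \<open>tri(S)\<^sub>\<mu>\<close> if \<open>\<nu> = 0\<close>, by \<open>tri(S')\<^sub>\<nu>\<close> if \<open>\<mu> = 0\<close>, and by the \<open>\<iota>\<^sub>i (S\<^sub>\<mu> \<otimes> S'\<^sub>\<nu>)\<close>.
\<close>

definition g_deg ::
  "('k::field, 'v::ab_group_add) normed_alg \<Rightarrow> ('k, 'w::ab_group_add) normed_alg
    \<Rightarrow> ('h::ab_group_add \<Rightarrow> 'v set) \<Rightarrow> ('l::ab_group_add \<Rightarrow> 'w set)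
    \<Rightarrow> 'h \<Rightarrow> 'l \<Rightarrow> ('k, 'v, 'w) g_elt set"
  where "g_deg S S' D D' \<mu> \<nu> = {(d, d', T).
    d \<in> (if \<nu> = 0 then tri_deg S D \<mu> else {0}) \<and>
    d' \<in> (if \<mu> = 0 then tri_deg S' D' \<nu> else {0}) \<and>
    (\<forall>i. T i \<in> tensor_space (scl S) (scl S') (D \<mu>) (D' \<nu>))}"

definition iota_deg :: "3 \<Rightarrow> 2 \<times> 2"
  where "iota_deg i = (if i = 0 then (1, 0) else if i = 1 then (0, 1) else (1, 1))"

definition para_induced_grading ::
  "('k::field, 'v::ab_group_add) normed_alg \<Rightarrow> ('k, 'w::ab_group_add) normed_alg
    \<Rightarrow> (2 \<times> 2 \<times> 2 \<Rightarrow> 'v set) \<Rightarrow> (2 \<times> 2 \<times> 2 \<Rightarrow> 'w set)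
    \<Rightarrow> (2 \<times> 2 \<times> 2) \<times> (2 \<times> 2 \<times> 2) \<times> (2 \<times> 2) \<Rightarrow> ('k, 'v, 'w) g_elt set"
  where "para_induced_grading S S' D D' = (\<lambda>(\<mu>, \<nu>, \<epsilon>).
    {(d, d', T) \<in> g_deg S S' D D' \<mu> \<nu>.
      (\<epsilon> \<noteq> 0 \<longrightarrow> d = 0 \<and> d' = 0) \<and> (\<forall>i. \<epsilon> \<noteq> iota_deg i \<longrightarrow> T i = 0)})"

definition okubo_induced_grading ::
  "'k::field \<Rightarrow> ('k, 'v::ab_group_add) normed_alg \<Rightarrow> ('k, 'w::ab_group_add) normed_alg
    \<Rightarrow> (3 \<times> 3 \<Rightarrow> 'v set) \<Rightarrow> (3 \<times> 3 \<Rightarrow> 'w set)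
    \<Rightarrow> (3 \<times> 3) \<times> (3 \<times> 3) \<times> 3 \<Rightarrow> ('k, 'v, 'w) g_elt set"
  where "okubo_induced_grading \<omega> S S' D D' = (\<lambda>(\<mu>, \<nu>, j).
    {a \<in> g_deg S S' D D' \<mu> \<nu>.
      Theta a = g_scale S S' (if j = 0 then 1 else if j = 1 then \<omega> else \<omega>\<^sup>2) a})"

end

theory Submission
  imports Defs
begin

text \<open>
  Over an algebraic closure, both kinds of algebras acquire a basis of isotropic vectors, in three
  versions permuted by triality, in which the product is one and the same signed table \<open>sg\<close>, \<open>pr\<close>:
  the multiplication table of the Okubo algebra with \<open>\<alpha> = \<beta> = 1\<close>. With respect to the elements
  \<open>t b\<^sub>p b\<^bsub>-p\<^esub>\<close> of the two triality algebras the Lie algebra \<open>\<gg>(S, S')\<close> then has the weights of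
  $E_8 \supset D_4 \times D_4$, namely the roots of the two copies of $D_4$ and the pairs of weights of
  corresponding 8-dimensional representations, and the products of weight vectors are right up
  to sign, which is enough for a Chevalley basis. Simplicity and the type descend to the base field.

  For the gradings, the homogeneous basis of \<open>\<gg>(S, S')\<close> made of the \<open>t x\<^sub>p x\<^sub>q\<close> and the \<open>\<iota>\<^sub>i (x\<^sub>p \<otimes> x'\<^sub>q)\<close>
  turns dimensions into cardinalities. In the second case each component of nonzero degree
  \<open>(\<mu>, \<nu>)\<close> is spanned by one \<open>\<Theta>\<close>-orbit of size three, and on the component of degree zero, of
  dimension eight and spanned by four orbits, \<open>1 + \<Theta> + \<Theta>\<^sup>2\<close> vanishes.
\<close>

text \<open>Almost every statement about \<open>tri S\<close> rests on the injective half of local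
  triality: a triple is determined by its component at \<open>0\<close>. It reduces identities
  between triples to identities between skew maps, gives \<open>tri S\<close> its 28 basis elements,
  and yields the cyclic relation between three elements \<open>t\<close> behind the Jacobi identity.
  It is proved where isotropic bases exist, over the closure, and descends because a triple extends
  linearly; so here even the Lie algebra structure over the base field relies on the scalar
  extension. The closure also supplies the cube roots of \<alpha> and \<beta>, or the square roots
  of norms, that turn structure constants into signs.

  In the extended basis the structure constants are the images of those over the base field, whereas
  the Chevalley basis comes from a split basis of the same extended algebra; comparing the two is
  how type and simplicity descend. The eigenspaces of \<open>Theta\<close> need no independence
  argument: generators bound their dimensions from above, and the bounds add up to the known
  total.\<close>

text \<open>
  Without this, the simplifier turns eta-expanded sums of functions into pointwise sums.
\<close>

lemmas fun_apply = plus_fun_apply zero_fun_apply minus_apply uminus_apply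

declare fun_apply [simp del]

lemma sum_fun_apply: "(\<Sum>i\<in>A. f i) x = (\<Sum>i\<in>A. f i x)"
  by (induct A rule: infinite_finite_induct) (simp_all add: fun_apply)

section \<open>The index type 3 and linear maps\<close>

lemma UNIV_3: "(UNIV :: 3 set) = {0, 1, 2}"
proof -
  have "x = 0 \<or> x = 1 \<or> x = 2" for x :: 3
  proof (induct x)
    case (of_int z)
    then have "z = 0 \<or> z = 1 \<or> z = 2" by auto
    then show ?case by auto
  qed
  then show ?thesis by auto
qed

lemma sum_3: "(\<Sum>i\<in>(UNIV :: 3 set). f i) = f 0 + f 1 + f 2"
proof -
  have "(0::3) \<noteq> 1" "(0::3) \<noteq> 2" "(1::3) \<noteq> 2" by simp_all
  then show ?thesis unfolding UNIV_3 by (simp add: add.assoc)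
qed

lemma exhaust_3: "(i :: 3) = 0 \<or> i = 1 \<or> i = 2"
  using UNIV_3 by auto

lemma Z3_simps: "- (1 :: 3) = 2" "- (2 :: 3) = 1" "(4 :: 3) = 1" "(3 :: 3) = 0" "(5 :: 3) = 2"
  by simp_all

lemma linearI:
  assumes "vector_space s" and "vector_space t"
    and "\<And>x y. f (x + y) = f x + f y" and "\<And>a x. f (s a x) = t a (f x)"
  shows "Vector_Spaces.linear s t f"
  using assms by (simp add: Vector_Spaces.linear_iff)

lemma linearD:
  assumes "Vector_Spaces.linear s t f"
  shows "f (x + y) = f x + f y" "f (s a x) = t a (f x)" "vector_space s" "vector_space t"
    "f 0 = 0" "f (- x) = - f x" "f (x - y) = f x - f y" "f (sum g A) = (\<Sum>i\<in>A. f (g i))"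
proof -
  interpret Vector_Spaces.linear s t f by fact
  show "f (x + y) = f x + f y" "f (s a x) = t a (f x)" "f 0 = 0" "f (- x) = - f x"
    "f (x - y) = f x - f y" "f (sum g A) = (\<Sum>i\<in>A. f (g i))"
    by (auto simp: add scale diff neg sum)
  show "vector_space s" "vector_space t" by unfold_locales
qed

lemma bilinI:
  assumes "vector_space s1" "vector_space s2" "vector_space s3"
    and "\<And>x y z. B x (y + z) = B x y + B x z" "\<And>x y z. B (x + y) z = B x z + B y z"
    and "\<And>a x y. B x (s2 a y) = s3 a (B x y)" "\<And>a x y. B (s1 a x) y = s3 a (B x y)"
  shows "bilin s1 s2 s3 B"
  using assms unfolding bilin_def by (auto intro!: linearI)

lemma bilinD:
  assumes "bilin s1 s2 s3 B"
  shows "B x (y + z) = B x y + B x z" "B (x' + y') z' = B x' z' + B y' z'"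
    "B x (s2 a y) = s3 a (B x y)" "B (s1 a x') y = s3 a (B x' y)"
    "B x 0 = 0" "B 0 y = 0" "B x (- y) = - B x y" "B (- x) y = - B x y"
    "B x (y - z) = B x y - B x z" "B (x' - y') z' = B x' z' - B y' z'"
    "B x (sum g A) = (\<Sum>i\<in>A. B x (g i))" "B (sum h A) y = (\<Sum>i\<in>A. B (h i) y)"
    "vector_space s1" "vector_space s2" "vector_space s3"
proof -
  have r: "Vector_Spaces.linear s2 s3 (B x)" for x
    using assms unfolding bilin_def by auto
  have l: "Vector_Spaces.linear s1 s3 (\<lambda>x. B x y)" for y
    using assms unfolding bilin_def by auto
  show "B x (y + z) = B x y + B x z" "B x (s2 a y) = s3 a (B x y)"
    "B x 0 = 0" "B x (- y) = - B x y" "B x (y - z) = B x y - B x z" "B x (sum g A) = (\<Sum>i\<in>A. B x (g i))"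
    by (rule linearD[OF r])+
  show "B (x' + y') z' = B x' z' + B y' z'" "B (s1 a x') y = s3 a (B x' y)"
    "B 0 y = 0" "B (- x) y = - B x y"
    "B (x' - y') z' = B x' z' - B y' z'" "B (sum h A) y = (\<Sum>i\<in>A. B (h i) y)"
    by (rule linearD[OF l])+
  show "vector_space s1" "vector_space s2" "vector_space s3"
    by (rule linearD[OF l] linearD[OF r])+
qed

lemma vector_space_field: "vector_space ((*) :: 'k::field \<Rightarrow> 'k \<Rightarrow> 'k)"
  by unfold_locales (auto simp: algebra_simps)

lemma vector_space_fun_scale:
  assumes "vector_space s" shows "vector_space (fun_scale s)"
proof -
  interpret vector_space s by fact
  show ?thesis by unfold_locales (auto simp: fun_scale_def fun_eq_iff fun_apply algebra_simps)
qed

section \<open>Coordinate systems\<close>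

text \<open>An indexed basis together with coordinate functions, so that sums run over labels
  instead of vectors. The last clause carries the independence of the family. The values of
  \<open>co\<close> outside \<open>L\<close> and \<open>I\<close> are left open, which allows
  explicit formulas for it later.\<close>

definition coord_system ::
  "('k::field \<Rightarrow> 'v::ab_group_add \<Rightarrow> 'v) \<Rightarrow> 'v set \<Rightarrow> 'i set \<Rightarrow> ('i \<Rightarrow> 'v) \<Rightarrow> ('v \<Rightarrow> 'i \<Rightarrow> 'k) \<Rightarrow> bool"
  where "coord_system s L I B co \<longleftrightarrow>
    finite I \<and> Modules.module.subspace s L \<and> B ` I \<subseteq> L \<and>
    (\<forall>v\<in>L. v = (\<Sum>p\<in>I. s (co v p) (B p))) \<and>
    (\<forall>c. \<forall>q\<in>I. co (\<Sum>p\<in>I. s (c p) (B p)) q = c q)"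

context vector_space
begin

lemma coord_systemD:
  assumes "coord_system scale L I B co"
  shows "finite I" "subspace L" "p \<in> I \<Longrightarrow> B p \<in> L" "v \<in> L \<Longrightarrow> v = (\<Sum>p\<in>I. co v p *s B p)"
    "q \<in> I \<Longrightarrow> co (\<Sum>p\<in>I. c p *s B p) q = c q"
  using assms unfolding coord_system_def by auto

lemma coord_system_sum_in:
  assumes "coord_system scale L I B co"
  shows "(\<Sum>p\<in>I. c p *s B p) \<in> L"
  by (intro subspace_sum subspace_scale coord_systemD[OF assms])

lemma coord_system_linear:
  assumes "coord_system scale L I B co" and "v \<in> L" "w \<in> L" "q \<in> I"
  shows "co (v + w) q = co v q + co w q" "co (a *s v) q = a * co v q"
proof -
  have v: "v = (\<Sum>p\<in>I. co v p *s B p)" and w: "w = (\<Sum>p\<in>I. co w p *s B p)"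
    using coord_systemD(4)[OF assms(1)] assms by blast+
  have "v + w = (\<Sum>p\<in>I. (co v p + co w p) *s B p)"
    by (subst v, subst w) (simp add: scale_left_distrib sum.distrib)
  then show "co (v + w) q = co v q + co w q"
    using coord_systemD(5)[OF assms(1,4)] by simp
  have "a *s v = (\<Sum>p\<in>I. (a * co v p) *s B p)"
    by (subst v) (simp add: scale_sum_right)
  then show "co (a *s v) q = a * co v q"
    using coord_systemD(5)[OF assms(1,4)] by simp
qed

lemma coord_system_basis:
  assumes "coord_system scale L I B co" and "q \<in> I" "p \<in> I"
  shows "co (B p) q = (if p = q then 1 else 0)"
proof -
  have "B p = (\<Sum>r\<in>I. (if r = p then 1 else 0) *s B r)"
    using assms(3) coord_systemD(1)[OF assms(1)] by (simp add: if_distrib[of "\<lambda>c. c *s _"] cong: if_cong)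
  then have "co (B p) q = co (\<Sum>r\<in>I. (if r = p then 1 else 0) *s B r) q" by simp
  then show ?thesis using coord_systemD(5)[OF assms(1,2)] by simp
qed

lemma coord_system_inj:
  assumes "coord_system scale L I B co" shows "inj_on B I"
  by (rule inj_onI) (metis coord_system_basis[OF assms] zero_neq_one)

lemma coord_system_is_basis:
  assumes "coord_system scale L I B co" shows "is_basis_of scale L (B ` I)"
proof -
  note D = coord_systemD[OF assms]
  have inj: "inj_on B I" by (rule coord_system_inj[OF assms])
  have fin: "finite (B ` I)" using D by simp
  have "independent (B ` I)"
    unfolding dependent_finite[OF fin]
  proof
    assume "\<exists>u. (\<exists>v\<in>B ` I. u v \<noteq> 0) \<and> (\<Sum>v\<in>B ` I. u v *s v) = 0"
    then obtain u q where q: "q \<in> I" and u: "u (B q) \<noteq> 0" and z: "(\<Sum>v\<in>B ` I. u v *s v) = 0"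
      by blast
    have "(\<Sum>p\<in>I. u (B p) *s B p) = 0"
      using z inj by (simp add: sum.reindex)
    moreover have "(\<Sum>p\<in>I. 0 *s B p) = 0" by simp
    ultimately have "u (B q) = 0"
      using D(5)[OF q, of "\<lambda>p. u (B p)"] D(5)[OF q, of "\<lambda>p. 0"] by simp
    then show False using u by simp
  qed
  moreover have "span (B ` I) = L"
  proof
    show "span (B ` I) \<subseteq> L" using D by (intro span_minimal) auto
    show "L \<subseteq> span (B ` I)"
    proof
      fix v assume "v \<in> L"
      have "(\<Sum>p\<in>I. co v p *s B p) \<in> span (B ` I)"
        by (intro span_sum span_scale span_base) auto
      then show "v \<in> span (B ` I)" using D(4)[OF \<open>v \<in> L\<close>] by simp
    qed
  qed
  ultimately show ?thesis using D unfolding is_basis_of_def by auto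
qed

lemma is_basis_coord_system:
  assumes "is_basis_of scale L (B ` I)" "inj_on B I" "finite I"
  shows "coord_system scale L I B (\<lambda>v p. representation (B ` I) v (B p))"
proof -
  have b: "B ` I \<subseteq> L" "independent (B ` I)" "span (B ` I) = L"
    using assms unfolding is_basis_of_def by auto
  have fin: "finite (B ` I)" using assms by simp
  have "v = (\<Sum>p\<in>I. representation (B ` I) v (B p) *s B p)" if "v \<in> L" for v
  proof -
    have "(\<Sum>w\<in>B ` I. representation (B ` I) v w *s w) = v"
      by (rule sum_representation_eq) (use b that fin in auto)
    then show ?thesis using assms(2) by (simp add: sum.reindex)
  qed
  moreover have "representation (B ` I) (\<Sum>p\<in>I. c p *s B p) (B q) = c q" if q: "q \<in> I" for c q
  proof -
    have *: "representation (B ` I) (\<Sum>p\<in>I. c p *s B p) = (\<lambda>w. \<Sum>p\<in>I. representation (B ` I) (c p *s B p) w)"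
      by (intro representation_sum b span_scale) (auto intro: span_base)
    have "representation (B ` I) (\<Sum>p\<in>I. c p *s B p) (B q) = (\<Sum>p\<in>I. c p * (if B q = B p then 1 else 0))"
      unfolding * by (auto intro!: sum.cong simp: representation_scale[OF b(2)] span_base representation_basis[OF b(2)])
    also have "\<dots> = (\<Sum>p\<in>I. if q = p then c p else 0)"
      using assms(2) q by (intro sum.cong) (auto simp: inj_on_def)
    also have "\<dots> = c q" using assms(3) q by simp
    finally show ?thesis .
  qed
  ultimately show ?thesis
    using assms(3) b subspace_span[of "B ` I"] unfolding coord_system_def by auto
qed

lemma coord_system_has_dim:
  assumes "coord_system scale L I B co"
  shows "has_dim scale L (card I)"
  using coord_system_is_basis[OF assms] coord_system_inj[OF assms] coord_systemD(1)[OF assms]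
  unfolding has_dim_def by (metis card_image finite_imageI)

lemma has_dim_unique:
  assumes "has_dim scale V m" "has_dim scale V n" shows "m = n"
  using assms unfolding has_dim_def is_basis_of_def by (metis basis_card_eq_dim order_refl)

end

section \<open>Tensors\<close>

lemma tensor_bilin:
  assumes "vector_space s" "vector_space s'"
  shows "bilin s s' (fun_scale (*)) (tensor s s')"
  using assms
  by (intro bilinI vector_space_fun_scale vector_space_field)
     (auto simp: tensor_def fun_scale_def fun_eq_iff fun_apply bilinD)

text \<open>Scalar multiples need no case of their own: a scalar is absorbed into the first factor
  of a pure tensor, and \<open>V\<close> is closed under scaling.\<close>

lemma tensor_induct [consumes 5, case_names zero add tensor]:
  fixes s :: "'k::field \<Rightarrow> 'v::ab_group_add \<Rightarrow> 'v" and s' :: "'k \<Rightarrow> 'w::ab_group_add \<Rightarrow> 'w"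
  assumes T: "T \<in> tensor_space s s' V W" and s: "vector_space s" "vector_space s'"
    and V: "Modules.module.subspace s V" and W: "Modules.module.subspace s' W"
    and z: "P 0" and a: "\<And>T U. P T \<Longrightarrow> P U \<Longrightarrow> P (T + U)"
    and t: "\<And>x y. x \<in> V \<Longrightarrow> y \<in> W \<Longrightarrow> P (tensor s s' x y)"
  shows "P T"
proof -
  interpret F: vector_space "fun_scale ((*) :: 'k \<Rightarrow> _) :: _ \<Rightarrow> (('v \<Rightarrow> 'w \<Rightarrow> 'k) \<Rightarrow> 'k) \<Rightarrow> _"
    by (intro vector_space_fun_scale vector_space_field)
  interpret V: vector_space s by fact
  show ?thesis
    using T[unfolded tensor_space_def]
  proof (induct rule: F.span_induct_alt)
    case base then show ?case using z .
  next
    case (step c w T)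
    then obtain x y where w: "w = tensor s s' x y" "x \<in> V" "y \<in> W" by auto
    have "fun_scale (*) c w = tensor s s' (s c x) y"
      using bilinD(4)[OF tensor_bilin[OF s]] w by metis
    then show ?case using a t step w V.subspace_scale[OF V] by metis
  qed
qed

lemma tensor_space_subspace:
  fixes s :: "'k::field \<Rightarrow> 'v::ab_group_add \<Rightarrow> 'v" and s' :: "'k \<Rightarrow> 'w::ab_group_add \<Rightarrow> 'w"
  shows  "Modules.module.subspace (fun_scale (*)) (tensor_space s s' V W)"
proof -
  interpret F: vector_space "fun_scale ((*) :: 'k \<Rightarrow> _) :: _ \<Rightarrow> (('v \<Rightarrow> 'w \<Rightarrow> 'k) \<Rightarrow> 'k) \<Rightarrow> _"
    by (intro vector_space_fun_scale vector_space_field)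
  show ?thesis unfolding tensor_space_def by (rule F.subspace_span)
qed

lemma tensor_space_tensor:
  fixes s :: "'k::field \<Rightarrow> 'v::ab_group_add \<Rightarrow> 'v" and s' :: "'k \<Rightarrow> 'w::ab_group_add \<Rightarrow> 'w"
  shows "x \<in> V \<Longrightarrow> y \<in> W \<Longrightarrow> tensor s s' x y \<in> tensor_space s s' V W"
proof -
  interpret F: vector_space "fun_scale ((*) :: 'k \<Rightarrow> _) :: _ \<Rightarrow> (('v \<Rightarrow> 'w \<Rightarrow> 'k) \<Rightarrow> 'k) \<Rightarrow> _"
    by (intro vector_space_fun_scale vector_space_field)
  show "x \<in> V \<Longrightarrow> y \<in> W \<Longrightarrow> tensor s s' x y \<in> tensor_space s s' V W"
    unfolding tensor_space_def by (rule F.span_base) auto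
qed

lemma tensor_space_closed:
  fixes s :: "'k::field \<Rightarrow> 'v::ab_group_add \<Rightarrow> 'v" and s' :: "'k \<Rightarrow> 'w::ab_group_add \<Rightarrow> 'w"
  shows "0 \<in> tensor_space s s' V W"
    and "T \<in> tensor_space s s' V W \<Longrightarrow> U \<in> tensor_space s s' V W \<Longrightarrow> T + U \<in> tensor_space s s' V W"
    and "T \<in> tensor_space s s' V W \<Longrightarrow> U \<in> tensor_space s s' V W \<Longrightarrow> T - U \<in> tensor_space s s' V W"
    and "T \<in> tensor_space s s' V W \<Longrightarrow> fun_scale (*) c T \<in> tensor_space s s' V W"
proof -
  interpret F: vector_space "fun_scale ((*) :: 'k \<Rightarrow> _) :: _ \<Rightarrow> (('v \<Rightarrow> 'w \<Rightarrow> 'k) \<Rightarrow> 'k) \<Rightarrow> _"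
    by (intro vector_space_fun_scale vector_space_field)
  show "0 \<in> tensor_space s s' V W"
    and "T \<in> tensor_space s s' V W \<Longrightarrow> U \<in> tensor_space s s' V W \<Longrightarrow> T + U \<in> tensor_space s s' V W"
    and "T \<in> tensor_space s s' V W \<Longrightarrow> U \<in> tensor_space s s' V W \<Longrightarrow> T - U \<in> tensor_space s s' V W"
    and "T \<in> tensor_space s s' V W \<Longrightarrow> fun_scale (*) c T \<in> tensor_space s s' V W"
    using tensor_space_subspace[of s s' V W]
    by (auto intro: F.subspace_0 F.subspace_add F.subspace_diff F.subspace_scale)
qed

lemma tensor_space_mono:
  fixes s :: "'k::field \<Rightarrow> 'v::ab_group_add \<Rightarrow> 'v" and s' :: "'k \<Rightarrow> 'w::ab_group_add \<Rightarrow> 'w"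
  shows "V \<subseteq> V' \<Longrightarrow> W \<subseteq> W' \<Longrightarrow> tensor_space s s' V W \<subseteq> tensor_space s s' V' W'"
proof -
  interpret F: vector_space "fun_scale ((*) :: 'k \<Rightarrow> _) :: _ \<Rightarrow> (('v \<Rightarrow> 'w \<Rightarrow> 'k) \<Rightarrow> 'k) \<Rightarrow> _"
    by (intro vector_space_fun_scale vector_space_field)
  show "V \<subseteq> V' \<Longrightarrow> W \<subseteq> W' \<Longrightarrow> tensor_space s s' V W \<subseteq> tensor_space s s' V' W'"
    unfolding tensor_space_def by (rule F.span_mono) auto
qed

locale tensor_pair =
  V: vector_space s + W: vector_space s'
  for s :: "'k::field \<Rightarrow> 'v::ab_group_add \<Rightarrow> 'v" and s' :: "'k \<Rightarrow> 'w::ab_group_add \<Rightarrow> 'w" +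
  fixes b :: "'i::finite \<Rightarrow> 'v" and cf :: "'i \<Rightarrow> 'v \<Rightarrow> 'k"
    and b' :: "'j::finite \<Rightarrow> 'w" and cf' :: "'j \<Rightarrow> 'w \<Rightarrow> 'k"
  assumes ex: "x = (\<Sum>i\<in>UNIV. s (cf i x) (b i))" and cf: "Vector_Spaces.linear s (*) (cf i)"
    and ex': "x' = (\<Sum>j\<in>UNIV. s' (cf' j x') (b' j))" and cf': "Vector_Spaces.linear s' (*) (cf' j)"
begin

abbreviation "tns \<equiv> tensor s s'"
abbreviation "TS \<equiv> tensor_space s s' UNIV UNIV"

text \<open>In this model of the tensor product, evaluation at a bilinear form is linear by
  definition. The product of two coordinate functionals is the form whose value is the coefficient
  of \<open>tns (b i) (b' j)\<close>.\<close>

definition tco :: "('k, 'v, 'w) tensor \<Rightarrow> 'i \<Rightarrow> 'j \<Rightarrow> 'k"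
  where "tco T i j = T (\<lambda>x x'. cf i x * cf' j x')"

lemma cf_bilin: "bilin s s' (*) (\<lambda>x x'. cf i x * cf' j x')"
  by (intro bilinI vector_space_field V.vector_space_axioms W.vector_space_axioms)
     (auto simp: linearD(1,2)[OF cf] linearD(1,2)[OF cf'] algebra_simps)

lemma tco_simps [simp]:
  "tco (T + U) i j = tco T i j + tco U i j" "tco 0 i j = 0" "tco (T - U) i j = tco T i j - tco U i j"
  "tco (- T) i j = - tco T i j"
  "tco (tns x x') i j = cf i x * cf' j x'" "tco (fun_scale (*) c T) i j = c * tco T i j"
  using cf_bilin[of i j] by (simp_all add: tco_def tensor_def fun_scale_def fun_apply)

lemma tco_sum [simp]: "tco (sum f A) i j = (\<Sum>p\<in>A. tco (f p) i j)"
  by (induct A rule: infinite_finite_induct) simp_all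

lemma tns_bilin: "bilin s s' (fun_scale (*)) tns"
  by (intro tensor_bilin V.vector_space_axioms W.vector_space_axioms)

lemma TS_induct [consumes 1, case_names zero add tensor]:
  assumes "T \<in> TS" "P 0" "\<And>T U. P T \<Longrightarrow> P U \<Longrightarrow> P (T + U)" "\<And>x y. P (tns x y)"
  shows "P T"
  using assms(1)
  by (rule tensor_induct)
     (use assms V.vector_space_axioms W.vector_space_axioms in auto)

lemma bilin_expand:
  assumes "bilin s s' s3 \<Phi>"
  shows "\<Phi> x x' = (\<Sum>i\<in>UNIV. \<Sum>j\<in>UNIV. s3 (cf i x * cf' j x') (\<Phi> (b i) (b' j)))"
proof -
  interpret U: vector_space s3 using assms by (rule bilinD)
  have 1: "\<Phi> x y = (\<Sum>i\<in>UNIV. s3 (cf i x) (\<Phi> (b i) y))" for x y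
    by (subst ex[of x]) (simp add: bilinD[OF assms])
  have 2: "\<Phi> x y = (\<Sum>j\<in>UNIV. s3 (cf' j y) (\<Phi> x (b' j)))" for x y
    by (subst ex'[of y]) (simp add: bilinD[OF assms])
  show ?thesis
    by (subst 1, subst 2) (simp add: U.scale_sum_right)
qed

lemma tensor_expand: assumes "T \<in> TS"
  shows "T = (\<Sum>i\<in>UNIV. \<Sum>j\<in>UNIV. fun_scale (*) (tco T i j) (tns (b i) (b' j)))"
  using assms
proof (induct rule: TS_induct)
  case zero
  have "fun_scale (*) 0 Y = 0" for Y :: "('k,'v,'w) tensor"
    by (simp add: fun_scale_def fun_eq_iff fun_apply)
  then show ?case by simp
next
  case (add T U)
  have *: "fun_scale (*) (c + d) Y = fun_scale (*) c Y + fun_scale (*) d Y" for c d and Y :: "('k,'v,'w) tensor"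
    by (simp add: fun_scale_def fun_eq_iff fun_apply algebra_simps)
  show ?case
    unfolding tco_simps * sum.distrib by (intro arg_cong2[of _ _ _ _ "(+)"] add)
next
  case (tensor x x')
  show ?case unfolding tco_simps by (rule bilin_expand[OF tns_bilin])
qed

lemma tensor_sum_list: assumes "T \<in> TS" shows "\<exists>ps. T = (\<Sum>(x, y)\<leftarrow>ps. tns x y)"
  using assms
proof (induct rule: TS_induct)
  case zero
  then show ?case by (intro exI[of _ "[]"]) simp
next
  case (add T U)
  then obtain ps qs where "T = (\<Sum>(x, y)\<leftarrow>ps. tns x y)" "U = (\<Sum>(x, y)\<leftarrow>qs. tns x y)" by blast
  then show ?case by (intro exI[of _ "ps @ qs"]) simp
next
  case (tensor x x')
  show ?case by (intro exI[of _ "[(x, x')]"]) simp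
qed

text \<open>The right side mentions only \<open>T\<close>, so the value does not depend on the list
  chosen by \<open>SOME\<close>. The inner induction proves the formula for every list of pure
  tensors, with the coordinates of its sum.\<close>

lemma tensor_lift_expand:
  assumes "bilin s s' s3 \<Phi>" and T: "T \<in> TS"
  shows "tensor_lift s s' \<Phi> T = (\<Sum>i\<in>UNIV. \<Sum>j\<in>UNIV. s3 (tco T i j) (\<Phi> (b i) (b' j)))"
proof -
  interpret U: vector_space s3 using assms(1) by (rule bilinD)
  define ps where "ps = (SOME ps. T = (\<Sum>(x, y)\<leftarrow>ps. tns x y))"
  have T_eq: "T = (\<Sum>(x, y)\<leftarrow>ps. tns x y)"
    unfolding ps_def by (rule someI_ex[OF tensor_sum_list[OF T]])
  have *: "(\<Sum>(x, y)\<leftarrow>ps. \<Phi> x y)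
      = (\<Sum>i\<in>UNIV. \<Sum>j\<in>UNIV. s3 (tco (\<Sum>(x, y)\<leftarrow>ps. tns x y) i j) (\<Phi> (b i) (b' j)))" for ps
  proof (induct ps)
    case (Cons p ps)
    obtain x x' where p: "p = (x, x')" by force
    have "(\<Sum>(x, y)\<leftarrow>p # ps. \<Phi> x y) = \<Phi> x x' + (\<Sum>(x, y)\<leftarrow>ps. \<Phi> x y)"
      by (simp add: p)
    also have "\<Phi> x x' = (\<Sum>i\<in>UNIV. \<Sum>j\<in>UNIV. s3 (cf i x * cf' j x') (\<Phi> (b i) (b' j)))"
      by (rule bilin_expand[OF assms(1)])
    finally show ?case
      unfolding Cons by (simp add: p U.scale_left_distrib sum.distrib)
  qed simp
  show ?thesis
    unfolding tensor_lift_def ps_def[symmetric] * T_eq[symmetric] ..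
qed

lemma tensor_lift_tensor:
  assumes "bilin s s' s3 \<Phi>" shows "tensor_lift s s' \<Phi> (tns x x') = \<Phi> x x'"
  using tensor_lift_expand[OF assms, of "tns x x'"] bilin_expand[OF assms, of x x']
  by (simp add: tensor_space_tensor)

lemma tensor_lift_linear:
  assumes "bilin s s' s3 \<Phi>" and "T \<in> TS" "U \<in> TS"
  shows "tensor_lift s s' \<Phi> (T + U) = tensor_lift s s' \<Phi> T + tensor_lift s s' \<Phi> U"
    and "tensor_lift s s' \<Phi> (fun_scale (*) c T) = s3 c (tensor_lift s s' \<Phi> T)"
    and "tensor_lift s s' \<Phi> 0 = 0"
proof -
  interpret U: vector_space s3 using assms(1) by (rule bilinD)
  show "tensor_lift s s' \<Phi> (T + U) = tensor_lift s s' \<Phi> T + tensor_lift s s' \<Phi> U"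
    and "tensor_lift s s' \<Phi> (fun_scale (*) c T) = s3 c (tensor_lift s s' \<Phi> T)"
    and "tensor_lift s s' \<Phi> 0 = 0"
    using assms
    by (simp_all add: tensor_lift_expand[OF assms(1)] tensor_space_closed U.scale_left_distrib
        sum.distrib U.scale_sum_right)
qed

lemma tensor_lift_in:
  assumes "bilin s s' s3 \<Phi>" "T \<in> TS" "Modules.module.subspace s3 A" "\<And>x x'. \<Phi> x x' \<in> A"
  shows "tensor_lift s s' \<Phi> T \<in> A"
proof -
  interpret U: vector_space s3 using assms(1) by (rule bilinD)
  show ?thesis unfolding tensor_lift_expand[OF assms(1,2)]
    by (intro U.subspace_sum U.subspace_scale assms)
qed

text \<open>The bracket of two \<iota>-components is built from maps of four arguments that are
  bilinear in each of the pairs \<open>(x, x')\<close> and \<open>(y, y')\<close>; lifting one pair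
  after the other makes them functions of two tensors.\<close>

definition bilin4 :: "('k \<Rightarrow> 'u::ab_group_add \<Rightarrow> 'u) \<Rightarrow> ('v \<Rightarrow> 'w \<Rightarrow> 'v \<Rightarrow> 'w \<Rightarrow> 'u) \<Rightarrow> bool"
  where "bilin4 s3 \<Psi> \<longleftrightarrow> (\<forall>x x'. bilin s s' s3 (\<Psi> x x')) \<and> (\<forall>y y'. bilin s s' s3 (\<lambda>x x'. \<Psi> x x' y y'))"

definition lift2 :: "('v \<Rightarrow> 'w \<Rightarrow> 'v \<Rightarrow> 'w \<Rightarrow> 'u::ab_group_add)
    \<Rightarrow> ('k, 'v, 'w) tensor \<Rightarrow> ('k, 'v, 'w) tensor \<Rightarrow> 'u"
  where "lift2 \<Psi> T U = tensor_lift s s' (\<lambda>x x'. tensor_lift s s' (\<Psi> x x') U) T"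

context
  fixes s3 :: "'k \<Rightarrow> 'u::ab_group_add \<Rightarrow> 'u" and \<Psi>
  assumes \<Psi>: "bilin4 s3 \<Psi>"
begin

lemma lift2_inner_bilin:
  assumes "U \<in> TS"
  shows "bilin s s' s3 (\<lambda>x x'. tensor_lift s s' (\<Psi> x x') U)"
proof -
  have 1: "bilin s s' s3 (\<Psi> x x')" and 2: "bilin s s' s3 (\<lambda>x x'. \<Psi> x x' y y')" for x x' y y'
    using \<Psi> unfolding bilin4_def by auto
  interpret U: vector_space s3 using 1 by (rule bilinD)
  show ?thesis
    unfolding tensor_lift_expand[OF 1 assms]
    by (intro bilinI V.vector_space_axioms W.vector_space_axioms U.vector_space_axioms)
       (simp_all add: bilinD[OF 2] U.scale_right_distrib sum.distrib U.scale_sum_right mult.commute)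
qed

lemma lift2_tensor: "lift2 \<Psi> (tns x x') (tns y y') = \<Psi> x x' y y'"
proof -
  have 1: "bilin s s' s3 (\<Psi> x x')" for x x'
    using \<Psi> unfolding bilin4_def by auto
  show ?thesis
    unfolding lift2_def tensor_lift_tensor[OF 1] using \<Psi>[unfolded bilin4_def]
    by (subst tensor_lift_tensor) auto
qed

lemma lift2_linear:
  assumes "T \<in> TS" "T' \<in> TS" "U \<in> TS"
  shows "lift2 \<Psi> (T + T') U = lift2 \<Psi> T U + lift2 \<Psi> T' U"
    and "lift2 \<Psi> U (T + T') = lift2 \<Psi> U T + lift2 \<Psi> U T'"
    and "lift2 \<Psi> (fun_scale (*) c T) U = s3 c (lift2 \<Psi> T U)"
    and "lift2 \<Psi> U (fun_scale (*) c T) = s3 c (lift2 \<Psi> U T)"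
    and "lift2 \<Psi> 0 U = 0" "lift2 \<Psi> U 0 = 0"
proof -
  have 1: "bilin s s' s3 (\<Psi> x x')" for x x'
    using \<Psi> unfolding bilin4_def by auto
  interpret U: vector_space s3 using 1 by (rule bilinD)
  have lin: "lift2 \<Psi> U T = (\<Sum>i\<in>UNIV. \<Sum>j\<in>UNIV. s3 (tco U i j) (tensor_lift s s' (\<Psi> (b i) (b' j)) T))"
    if "T \<in> TS" "U \<in> TS" for T U
    unfolding lift2_def by (rule tensor_lift_expand[OF lift2_inner_bilin]) (use that in auto)
  show "lift2 \<Psi> (T + T') U = lift2 \<Psi> T U + lift2 \<Psi> T' U"
    and "lift2 \<Psi> U (T + T') = lift2 \<Psi> U T + lift2 \<Psi> U T'"
    and "lift2 \<Psi> (fun_scale (*) c T) U = s3 c (lift2 \<Psi> T U)"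
    and "lift2 \<Psi> U (fun_scale (*) c T) = s3 c (lift2 \<Psi> U T)"
    and "lift2 \<Psi> 0 U = 0" "lift2 \<Psi> U 0 = 0"
    using assms
    by (simp_all add: lin tensor_space_closed tensor_lift_linear[OF 1] U.scale_left_distrib
        U.scale_right_distrib sum.distrib U.scale_sum_right mult.commute)
qed

lemma lift2_in:
  assumes "T \<in> TS" "U \<in> TS" "Modules.module.subspace s3 A" "\<And>x x' y y'. \<Psi> x x' y y' \<in> A"
  shows "lift2 \<Psi> T U \<in> A"
proof -
  have 1: "bilin s s' s3 (\<Psi> x x')" for x x'
    using \<Psi> unfolding bilin4_def by auto
  show ?thesis unfolding lift2_def
    by (intro tensor_lift_in[OF lift2_inner_bilin] tensor_lift_in[OF 1] assms)
qed

end

end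

section \<open>Lie algebras with a Chevalley basis of type $E_8$\<close>

lemma finite_E8_double_roots: "finite E8_double_roots"
proof -
  have "v i \<in> {-8..8}" if "v \<in> E8_double_roots" for v :: "8 \<Rightarrow> int" and i
  proof -
    have "(v i)\<^sup>2 \<le> (\<Sum>j\<in>UNIV. (v j)\<^sup>2)" by (rule member_le_sum) auto
    also have "\<dots> = 8" using that by (simp add: E8_double_roots_def)
    finally have "\<bar>v i\<bar> * \<bar>v i\<bar> \<le> 8" by (simp add: power2_eq_square)
    moreover have "\<bar>v i\<bar> \<le> \<bar>v i\<bar> * \<bar>v i\<bar>"
    proof (cases "v i = 0")
      case False
      then have "1 * \<bar>v i\<bar> \<le> \<bar>v i\<bar> * \<bar>v i\<bar>" by (intro mult_right_mono) auto
      then show ?thesis by simp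
    qed simp
    ultimately have "\<bar>v i\<bar> \<le> 8" by linarith
    then show ?thesis by auto
  qed
  then have "E8_double_roots \<subseteq> {f. \<forall>x. (x \<in> UNIV \<longrightarrow> f x \<in> {-8..8}) \<and> (x \<notin> UNIV \<longrightarrow> f x = 0)}"
    by auto
  then show ?thesis
    by (rule finite_subset) (rule finite_set_of_finite_funs; simp)
qed

lemma E8_double_rootsD: "v \<in> E8_double_roots \<Longrightarrow> (\<Sum>i\<in>UNIV. v i * v i) = 8"
  by (simp add: E8_double_roots_def power2_eq_square)

lemma uminus_E8: "v \<in> E8_double_roots \<Longrightarrow> - v \<in> E8_double_roots"
  by (auto simp: E8_double_roots_def fun_apply sum_negf)

text \<open>For \<open>c = 2\<close> or \<open>c = - 2\<close> and \<open>k \<noteq> l\<close> this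
  is twice the root \<open>\<epsilon>\<^sub>k \<plusminus> \<epsilon>\<^sub>l\<close> of the
  subsystem \<open>D\<^sub>8\<close>, the supply of explicit roots used below.\<close>

definition D8vec :: "8 \<Rightarrow> 8 \<Rightarrow> int \<Rightarrow> 8 \<Rightarrow> int"
  where "D8vec k l c = (\<lambda>i. (if i = k then 2 else 0) + (if i = l then c else 0))"

lemma D8vec_simps: "k \<noteq> l \<Longrightarrow> D8vec k l c k = 2" "k \<noteq> l \<Longrightarrow> D8vec k l c l = c"
  "i \<noteq> k \<Longrightarrow> i \<noteq> l \<Longrightarrow> D8vec k l c i = 0"
  by (auto simp: D8vec_def)

lemma D8vec_sum: "(\<Sum>i\<in>UNIV. f i * of_int (D8vec k l c i)) = 2 * f k + of_int c * (f l :: 'a::comm_ring_1)"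
proof -
  have "f i * of_int (D8vec k l c i) = (if i = k then 2 * f i else 0) + (if i = l then of_int c * f i else 0)" for i
    by (auto simp: D8vec_def algebra_simps)
  then show ?thesis by (simp add: sum.distrib)
qed

lemma D8vec_root: assumes "k \<noteq> l" "c = 2 \<or> c = - 2" shows "D8vec k l c \<in> E8_double_roots"
proof -
  have 1: "(\<Sum>i\<in>UNIV. D8vec k l c i * D8vec k l c i) = 8"
    using D8vec_sum[of "D8vec k l c" k l c] assms by (auto simp: D8vec_simps)
  have 2: "(\<Sum>i\<in>UNIV. D8vec k l c i) = 2 + c"
    using D8vec_sum[of "\<lambda>_. 1 :: int" k l c] by simp
  have 3: "even (D8vec k l c i)" for i using assms(2) by (auto simp: D8vec_def)
  show ?thesis
    using assms(2) unfolding E8_double_roots_def by (auto simp: power2_eq_square 1 2 3)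
qed

text \<open>The squares of the eight entries add up to \<open>8\<close>. Odd squares are at least
  \<open>1\<close>, so all of them are \<open>1\<close>. Nonzero even squares are at least
  \<open>4\<close>, so some entry is zero, and a nonzero entry has absolute value \<open>2\<close>.
  The zero entry at \<open>m\<close> makes room for a \<open>D\<^sub>8\<close> root whose pairing
  with \<open>v\<close> sees only the entry at \<open>k\<close>.\<close>

lemma E8_root_shape:
  assumes v: "v \<in> E8_double_roots"
  obtains "\<And>i. v i = 1 \<or> v i = - 1"
  | k m where "v k = 2 \<or> v k = - 2" "v m = 0"
proof -
  have s: "(\<Sum>i\<in>UNIV. (v i)\<^sup>2) = 8" using v by (simp add: E8_double_roots_def)
  consider "\<forall>i. even (v i)" | "\<forall>i. odd (v i)" using v by (auto simp: E8_double_roots_def)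
  then show ?thesis
  proof cases
    case 1
    have "\<exists>m. v m = 0"
    proof (rule ccontr)
      assume "\<not> ?thesis"
      then have "4 \<le> (v i)\<^sup>2" for i
      proof -
        obtain w where w: "v i = 2 * w" using 1 by blast
        then have "w \<noteq> 0" using \<open>\<not> (\<exists>m. v m = 0)\<close> by auto
        then have "1 \<le> w\<^sup>2" by (simp add: int_one_le_iff_zero_less)
        then show ?thesis using w by (simp add: power2_eq_square)
      qed
      then have "(\<Sum>i\<in>(UNIV :: 8 set). 4) \<le> (\<Sum>i\<in>UNIV. (v i)\<^sup>2)" by (intro sum_mono) auto
      then show False using s by simp
    qed
    then obtain m where m: "v m = 0" ..
    have "\<exists>k. v k \<noteq> 0"
    proof (rule ccontr)
      assume "\<not> ?thesis"
      then show False using s by simp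
    qed
    then obtain k where k: "v k \<noteq> 0" ..
    obtain w where w: "v k = 2 * w" using 1 by blast
    have "(v k)\<^sup>2 \<le> 8" using s member_le_sum[of k UNIV "\<lambda>j. (v j)\<^sup>2"] by simp
    then have "w\<^sup>2 \<le> 2" using w by (simp add: power2_eq_square)
    moreover have "\<bar>w\<bar> < 2"
    proof (rule ccontr)
      assume "\<not> \<bar>w\<bar> < 2"
      then have "2 * 2 \<le> \<bar>w\<bar> * \<bar>w\<bar>" by (intro mult_mono) auto
      then show False using \<open>w\<^sup>2 \<le> 2\<close> by (simp add: power2_eq_square)
    qed
    then have "w = 1 \<or> w = - 1" using k w by auto
    then show ?thesis using w m by (intro that(2)[of k m]) auto
  next
    case 2
    have ge: "1 \<le> (v i)\<^sup>2" for i
    proof -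
      have "v i \<noteq> 0" using 2 by (metis even_zero)
      then show ?thesis by (simp add: int_one_le_iff_zero_less)
    qed
    have "(v i)\<^sup>2 = 1" for i
    proof (rule ccontr)
      assume "(v i)\<^sup>2 \<noteq> 1"
      then have "1 < (v i)\<^sup>2" using ge[of i] by linarith
      then have "(\<Sum>i\<in>(UNIV :: 8 set). 1) < (\<Sum>i\<in>UNIV. (v i)\<^sup>2)"
        using ge by (intro sum_strict_mono_ex1) auto
      then show False using s by simp
    qed
    then show ?thesis using that(1) by (metis power2_eq_1_iff)
  qed
qed

definition E8_chevalley ::
  "('k::field \<Rightarrow> 'v::ab_group_add \<Rightarrow> 'v) \<Rightarrow> 'v set \<Rightarrow> ('v \<Rightarrow> 'v \<Rightarrow> 'v)
    \<Rightarrow> (8 \<Rightarrow> 'v) \<Rightarrow> ((8 \<Rightarrow> int) \<Rightarrow> 'v) \<Rightarrow> bool"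
  where "E8_chevalley s L br t e \<longleftrightarrow>
      inj t \<and> inj_on e E8_double_roots \<and> range t \<inter> e ` E8_double_roots = {} \<and>
      is_basis_of s L (range t \<union> e ` E8_double_roots) \<and>
      (\<forall>i j. br (t i) (t j) = 0) \<and>
      (\<forall>i. \<forall>v\<in>E8_double_roots. br (t i) (e v) = s (of_int (v i) / 2) (e v)) \<and>
      (\<forall>v\<in>E8_double_roots. br (e v) (e (- v)) = (\<Sum>i\<in>UNIV. s (of_int (v i) / 2) (t i))) \<and>
      (\<forall>v\<in>E8_double_roots. \<forall>w\<in>E8_double_roots. v + w \<in> E8_double_roots \<longrightarrow>
         br (e v) (e w) = e (v + w) \<or> br (e v) (e w) = - e (v + w)) \<and>
      (\<forall>v\<in>E8_double_roots. \<forall>w\<in>E8_double_roots. v + w \<noteq> 0 \<and> v + w \<notin> E8_double_roots \<longrightarrow>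
         br (e v) (e w) = 0)"

lemma has_E8_iff: "has_E8_chevalley_basis s L br \<longleftrightarrow> (\<exists>t e. E8_chevalley s L br t e)"
  unfolding has_E8_chevalley_basis_def E8_chevalley_def ..

lemma E8_chevalleyD:
  assumes "E8_chevalley s L br t e"
  shows "inj t" "inj_on e E8_double_roots" "range t \<inter> e ` E8_double_roots = {}"
    "is_basis_of s L (range t \<union> e ` E8_double_roots)"
    "br (t i) (t j) = 0"
    "v \<in> E8_double_roots \<Longrightarrow> br (t i) (e v) = s (of_int (v i) / 2) (e v)"
    "v \<in> E8_double_roots \<Longrightarrow> br (e v) (e (- v)) = (\<Sum>i\<in>UNIV. s (of_int (v i) / 2) (t i))"
    "v \<in> E8_double_roots \<Longrightarrow> w \<in> E8_double_roots \<Longrightarrow> v + w \<in> E8_double_roots \<Longrightarrow>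
       br (e v) (e w) = e (v + w) \<or> br (e v) (e w) = - e (v + w)"
    "v \<in> E8_double_roots \<Longrightarrow> w \<in> E8_double_roots \<Longrightarrow> v + w \<noteq> 0 \<Longrightarrow> v + w \<notin> E8_double_roots \<Longrightarrow>
       br (e v) (e w) = 0"
  using assms unfolding E8_chevalley_def by (elim conjE; blast)+

section \<open>Ideals of a Lie algebra with a Chevalley basis\<close>

locale bracket_algebra = vector_space s for s :: "'k::field \<Rightarrow> 'v::ab_group_add \<Rightarrow> 'v" +
  fixes L :: "'v set" and br :: "'v \<Rightarrow> 'v \<Rightarrow> 'v"
  assumes lie: "lie_algebra s L br"
begin

lemma subL: "subspace L" using lie unfolding lie_algebra_def by blast

lemmas L_closed = subspace_add[OF subL] subspace_scale[OF subL] subspace_0[OF subL] subspace_neg[OF subL]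
  subspace_diff[OF subL]

lemma br_closed: "x \<in> L \<Longrightarrow> y \<in> L \<Longrightarrow> br x y \<in> L"
  and br_addl: "x \<in> L \<Longrightarrow> y \<in> L \<Longrightarrow> z \<in> L \<Longrightarrow> br (x + y) z = br x z + br y z"
  and br_addr: "x \<in> L \<Longrightarrow> y \<in> L \<Longrightarrow> z \<in> L \<Longrightarrow> br z (x + y) = br z x + br z y"
  and br_scl: "x \<in> L \<Longrightarrow> y \<in> L \<Longrightarrow> br (s a x) y = s a (br x y)"
  and br_scr: "x \<in> L \<Longrightarrow> y \<in> L \<Longrightarrow> br x (s a y) = s a (br x y)"
  and br_self: "x \<in> L \<Longrightarrow> br x x = 0"
  using lie unfolding lie_algebra_def by blast+

lemma br_zero: "x \<in> L \<Longrightarrow> br x 0 = 0" "x \<in> L \<Longrightarrow> br 0 x = 0"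
  using br_scr[of x x 0] br_scl[of x x 0] by simp_all

lemma br_negr: "x \<in> L \<Longrightarrow> y \<in> L \<Longrightarrow> br x (- y) = - br x y"
  using br_scr[of x y "-1"] by simp

lemma br_negl: "x \<in> L \<Longrightarrow> y \<in> L \<Longrightarrow> br (- x) y = - br x y"
  using br_scl[of x y "-1"] by simp

lemma br_anti: assumes "x \<in> L" "y \<in> L" shows "br y x = - br x y"
proof -
  have "0 = br (x + y) (x + y)" using br_self L_closed assms by metis
  also have "\<dots> = (br x x + br y x) + (br x y + br y y)"
    using assms by (simp only: br_addl br_addr L_closed)
  also have "\<dots> = br x y + br y x"
    using assms by (simp add: br_self)
  finally show ?thesis by (simp add: eq_neg_iff_add_eq_0 add.commute)
qed

lemma br_sumr: "x \<in> L \<Longrightarrow> (\<And>i. i \<in> A \<Longrightarrow> f i \<in> L) \<Longrightarrow> br x (sum f A) = (\<Sum>i\<in>A. br x (f i))"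
  by (induct A rule: infinite_finite_induct) (auto simp: br_zero br_addr subspace_sum[OF subL])

lemma br_suml: "x \<in> L \<Longrightarrow> (\<And>i. i \<in> A \<Longrightarrow> f i \<in> L) \<Longrightarrow> br (sum f A) x = (\<Sum>i\<in>A. br (f i) x)"
  by (induct A rule: infinite_finite_induct) (auto simp: br_zero br_addl subspace_sum[OF subL])

lemma scale_cancel_in:
  assumes "subspace J" "s a x \<in> J" "a \<noteq> 0" shows "x \<in> J"
  using subspace_scale[OF assms(1,2), of "inverse a"] assms(3) by simp

text \<open>The nonzero pairings of doubled roots are \<open>\<plusminus>4\<close> and
  \<open>\<plusminus>8\<close>, so inverting \<open>2\<close> is enough. A nonzero element of the
  ideal yields a root vector: if it has a component at a root \<open>w\<close>, bracketing twice
  with \<open>e (- w)\<close> isolates that component; if it is toral, its bracket with a suitable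
  root vector is a nonzero multiple of that vector. One root vector yields all \<open>t l\<close>,
  and these yield all root vectors.\<close>

lemma chevalley_ideal:
  assumes two: "(2 :: 'k) \<noteq> 0" and E8: "has_E8_chevalley_basis s L br"
    and J: "lie_ideal s L br J" and ne: "J \<noteq> {0}"
  shows "J = L"
proof -
  let ?R = E8_double_roots
  obtain t :: "8 \<Rightarrow> 'v" and e where ch: "E8_chevalley s L br t e"
    using E8 unfolding has_E8_iff by blast
  note inj = E8_chevalleyD(1-3)[OF ch] and bas = E8_chevalleyD(4)[OF ch] and tt = E8_chevalleyD(5)[OF ch]
    and te = E8_chevalleyD(6)[OF ch] and ee = E8_chevalleyD(7)[OF ch] and ep = E8_chevalleyD(8)[OF ch]
    and ez = E8_chevalleyD(9)[OF ch]
  have four: "(4 :: 'k) \<noteq> 0" "(8 :: 'k) \<noteq> 0"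
  proof -
    have "(4 :: 'k) = 2 * 2" "(8 :: 'k) = 2 * 2 * 2" by simp_all
    then show "(4 :: 'k) \<noteq> 0" "(8 :: 'k) \<noteq> 0" using two by (metis mult_eq_0_iff)+
  qed
  define B where "B = case_sum t e"
  define I :: "(8 + (8 \<Rightarrow> int)) set" where "I = range Inl \<union> Inr ` ?R"
  have BI: "B ` I = range t \<union> e ` ?R" by (auto simp: B_def I_def image_Un image_image)
  have injB: "inj_on B I"
  proof (rule inj_onI)
    fix p q assume pq: "p \<in> I" "q \<in> I" "B p = B q"
    have disj: "t i \<noteq> e v" if "v \<in> ?R" for i v using inj(3) that by blast
    show "p = q"
    proof (cases p)
      case (Inl i)
      then show ?thesis
        using pq disj by (cases q) (auto simp: B_def I_def injD[OF inj(1)])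
    next
      case (Inr v)
      then show ?thesis
        using pq disj[symmetric] by (cases q) (auto simp: B_def I_def inj_onD[OF inj(2)])
    qed
  qed
  have finI: "finite I" by (simp add: I_def finite_E8_double_roots)
  define co where "co v p = representation (B ` I) v (B p)" for v p
  have cs: "coord_system s L I B co"
    unfolding co_def by (rule is_basis_coord_system) (use bas BI injB finI in auto)
  have tL: "t i \<in> L" for i using coord_systemD(3)[OF cs, of "Inl i"] by (simp add: B_def I_def)
  have eL: "e v \<in> L" if "v \<in> ?R" for v using coord_systemD(3)[OF cs, of "Inr v"] that by (simp add: B_def I_def)
  have decomp: "x = (\<Sum>i\<in>UNIV. s (co x (Inl i)) (t i)) + (\<Sum>v\<in>?R. s (co x (Inr v)) (e v))" if "x \<in> L" for x
  proof -
    have "x = (\<Sum>p\<in>I. s (co x p) (B p))" using coord_systemD(4)[OF cs that] .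
    also have "\<dots> = (\<Sum>p\<in>range Inl. s (co x p) (B p)) + (\<Sum>p\<in>Inr ` ?R. s (co x p) (B p))"
      unfolding I_def by (rule sum.union_disjoint) (auto simp: finite_E8_double_roots)
    also have "\<dots> = (\<Sum>i\<in>UNIV. s (co x (Inl i)) (t i)) + (\<Sum>v\<in>?R. s (co x (Inr v)) (e v))"
      by (simp add: sum.reindex B_def)
    finally show ?thesis .
  qed
  have subJ: "subspace J" and JL: "J \<subseteq> L" and brJ: "\<And>x y. x \<in> L \<Longrightarrow> y \<in> J \<Longrightarrow> br x y \<in> J"
    using J unfolding lie_ideal_def by auto
  have brJ': "br y x \<in> J" if "x \<in> L" "y \<in> J" for x y
    using brJ[OF that] br_anti[of x y] subspace_neg[OF subJ] JL that by auto
  have et: "br (e v) (t i) = s (- of_int (v i) / 2) (e v)" if "v \<in> ?R" for v i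
    using br_anti[OF tL[of i] eL[OF that]] te[OF that, of i] by simp
  define h where "h v = (\<Sum>i\<in>UNIV. s (of_int (v i) / 2) (t i))" for v :: "8 \<Rightarrow> int"
  have hL: "h v \<in> L" for v unfolding h_def by (intro subspace_sum[OF subL] L_closed tL)
  have he: "br (h v) (e w) = s (of_int (\<Sum>i\<in>UNIV. v i * w i) / 4) (e w)" if "w \<in> ?R" for v w
  proof -
    have "br (h v) (e w) = (\<Sum>i\<in>UNIV. br (s (of_int (v i) / 2) (t i)) (e w))"
      unfolding h_def by (rule br_suml[OF eL[OF that]]) (intro L_closed tL)
    also have "\<dots> = (\<Sum>i\<in>UNIV. s (of_int (v i * w i) / 4) (e w))"
      by (simp add: br_scl[OF tL eL[OF that]] te[OF that])
    also have "\<dots> = s (of_int (\<Sum>i\<in>UNIV. v i * w i) / 4) (e w)"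
      by (simp add: scale_sum_left[symmetric] sum_divide_distrib)
    finally show ?thesis .
  qed
  \<comment> \<open>The bracket of \<open>e v\<close> and \<open>e (- v)\<close> is the coroot
    \<open>h v\<close>, which acts on \<open>e w\<close> by a quarter of the pairing of the doubled
    vectors.\<close>
  have step: "e w \<in> J" if "e v \<in> J" "v \<in> ?R" "w \<in> ?R" "(of_int (\<Sum>i\<in>UNIV. v i * w i) :: 'k) \<noteq> 0" for v w
  proof -
    have "h v \<in> J" using brJ'[OF eL[OF uminus_E8[OF that(2)]] that(1)] ee[OF that(2)] by (simp add: h_def)
    then have "br (h v) (e w) \<in> J" using brJ' eL that by blast
    then show ?thesis unfolding he[OF that(3)] using scale_cancel_in[OF subJ] that(4) four by simp
  qed
  \<comment> \<open>The coroots of \<open>\<epsilon>\<^sub>k + \<epsilon>\<^sub>l\<close> and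
    \<open>\<epsilon>\<^sub>k - \<epsilon>\<^sub>l\<close> add up to
    \<open>2 t\<^sub>k\<close>.\<close>
  have tJ: "t k \<in> J" if "k \<noteq> l" "e (D8vec k l 2) \<in> J" "e (D8vec k l (- 2)) \<in> J" for k l
  proof -
    have hJ: "h v \<in> J" if "e v \<in> J" "v \<in> ?R" for v
      using brJ'[OF eL[OF uminus_E8[OF that(2)]] that(1)] ee[OF that(2)] by (simp add: h_def)
    have "s (of_int (D8vec k l c i) / 2) (t i) = s (1 / 2) (s (of_int (D8vec k l c i)) (t i))" for c i by simp
    have "h (D8vec k l 2) + h (D8vec k l (- 2)) = (\<Sum>i\<in>UNIV. s ((of_int (D8vec k l 2 i) + of_int (D8vec k l (- 2) i)) / 2) (t i))"
      unfolding h_def by (simp add: sum.distrib[symmetric] scale_left_distrib[symmetric] add_divide_distrib)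
    also have "\<dots> = (\<Sum>i\<in>UNIV. if i = k then s 2 (t i) else 0)"
      using two that(1) by (intro sum.cong) (auto simp: D8vec_def)
    also have "\<dots> = s 2 (t k)" by simp
    finally have "s 2 (t k) = h (D8vec k l 2) + h (D8vec k l (- 2))" ..
    then have "s 2 (t k) \<in> J"
      using hJ D8vec_root that subspace_add[OF subJ] by (metis (no_types, lifting))
    then show ?thesis using scale_cancel_in[OF subJ] two by blast
  qed
  have full: "J = L" if v: "v \<in> ?R" "e v \<in> J" for v
  proof -
    have ev: "\<exists>k. t k \<in> J" if v: "v \<in> ?R" "e v \<in> J" and km: "v k = 2 \<or> v k = - 2" "v m = 0" for v k m
    proof -
      have "k \<noteq> m" using km by auto
      have "e (D8vec k m c) \<in> J" if "c = 2 \<or> c = - 2" for c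
      proof (rule step[OF v(2,1)])
        show "D8vec k m c \<in> ?R" using D8vec_root[OF \<open>k \<noteq> m\<close> that] .
        have "(\<Sum>i\<in>UNIV. v i * D8vec k m c i) = 2 * v k"
          using D8vec_sum[of v k m c] km by simp
        then show "(of_int (\<Sum>i\<in>UNIV. v i * D8vec k m c i) :: 'k) \<noteq> 0"
          using km four two by auto
      qed
      then show ?thesis using tJ[OF \<open>k \<noteq> m\<close>] by blast
    qed
    have "\<exists>k. t k \<in> J"
      using v(1)
    proof (cases rule: E8_root_shape)
      case 1
      \<comment> \<open>The sign of the second entry makes the pairing with \<open>v\<close> equal
        to \<open>4 * v 0\<close> and not \<open>0\<close>. The new root is even with a zero entry
        at \<open>2\<close>, which reduces this case to the other one.\<close>
      let ?d = "D8vec 0 1 (2 * v 0 * v 1)"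
      have c: "2 * v 0 * v 1 = 2 \<or> 2 * v 0 * v 1 = - 2" using 1[of 0] 1[of 1] by auto
      have d: "?d \<in> ?R" by (rule D8vec_root[OF _ c]) simp
      have "(\<Sum>i\<in>UNIV. v i * ?d i) = 2 * v 0 + 2 * v 0 * v 1 * v 1"
        using D8vec_sum[of v 0 1 "2 * v 0 * v 1"] by simp
      also have "\<dots> = 4 * v 0" using 1[of 1] by auto
      finally have "(of_int (\<Sum>i\<in>UNIV. v i * ?d i) :: 'k) \<noteq> 0"
        using 1[of 0] four two by auto
      then have dJ: "e ?d \<in> J" using step v d by blast
      have "?d 0 = 2" "?d 2 = 0" by (simp_all add: D8vec_def)
      then show ?thesis using ev[OF d dJ, of 0 2] by blast
    next
      case (2 k m)
      then show ?thesis using ev[OF v] by blast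
    qed
    then obtain k where k: "t k \<in> J" ..
    have "t l \<in> J" for l
    proof (cases "l = k")
      case False
      have "e (D8vec l k c) \<in> J" if c: "c = 2 \<or> c = - 2" for c
      proof -
        have d: "D8vec l k c \<in> ?R" by (rule D8vec_root[OF False c])
        have "br (t k) (e (D8vec l k c)) \<in> J" using brJ'[OF eL[OF d] k] .
        moreover have "(of_int (D8vec l k c k) / 2 :: 'k) \<noteq> 0"
          using False c two by (auto simp: D8vec_simps)
        ultimately show ?thesis
          unfolding te[OF d] using scale_cancel_in[OF subJ] by blast
      qed
      then show ?thesis using tJ[OF False] by blast
    qed (use k in simp)
    then have tJall: "t l \<in> J" for l .
    have eJ: "e w \<in> J" if w: "w \<in> ?R" for w
    proof -
      have "\<exists>i. (of_int (w i) :: 'k) \<noteq> 0"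
        using w by (cases rule: E8_root_shape) (metis of_int_1 of_int_minus one_neq_zero neg_equal_0_iff_equal,
            metis of_int_numeral of_int_minus two neg_equal_0_iff_equal)
      then obtain i where i: "(of_int (w i) :: 'k) \<noteq> 0" ..
      have "br (t i) (e w) \<in> J" using brJ'[OF eL[OF w] tJall] .
      then show ?thesis unfolding te[OF w] using scale_cancel_in[OF subJ] i two by simp
    qed
    have "x \<in> J" if "x \<in> L" for x
      by (subst decomp[OF that]) (intro subspace_add[OF subJ] subspace_sum[OF subJ] subspace_scale[OF subJ] tJall eJ)
    then show ?thesis using JL by auto
  qed
  have "\<exists>x\<in>J. x \<noteq> 0" using ne subspace_0[OF subJ] by auto
  then obtain x where x: "x \<in> J" "x \<noteq> 0" by blast
  have xL: "x \<in> L" using x JL by auto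
  show ?thesis
  proof (cases "\<exists>w\<in>?R. co x (Inr w) \<noteq> 0")
    case True
    then obtain w where w: "w \<in> ?R" "co x (Inr w) \<noteq> 0" by blast
    let ?f = "e (- w)"
    have mw: "- w \<in> ?R" using uminus_E8[OF w(1)] .
    have ft: "br ?f (br ?f (t i)) = 0" for i
      by (simp only: et[OF mw] br_scr[OF eL[OF mw] eL[OF mw]] br_self[OF eL[OF mw]] scale_zero_right)
    \<comment> \<open>The system is simply laced: if \<open>u - w\<close> is a root, then the
      pairing of \<open>u\<close> and \<open>w\<close> is \<open>4\<close>, and
      \<open>u - 2 w\<close> has norm \<open>8 + 32 - 16 = 24\<close>, too long for a root and not
      zero. Only \<open>u = w\<close> survives, passing through the coroot
      \<open>h (- w)\<close>.\<close>
    have fe: "br ?f (br ?f (e u)) = (if u = w then s (- 2) ?f else 0)" if u: "u \<in> ?R" for u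
    proof -
      have ww: "(\<Sum>i\<in>UNIV. w i * w i) = 8" using E8_double_rootsD[OF w(1)] .
      have uu: "(\<Sum>i\<in>UNIV. u i * u i) = 8" using E8_double_rootsD[OF u] .
      have q: "(\<Sum>i\<in>UNIV. (u i - c * w i) * (u i - c * w i)) = 8 + c * c * 8 - 2 * c * (\<Sum>i\<in>UNIV. u i * w i)" for c
      proof -
        have "(\<Sum>i\<in>UNIV. (u i - c * w i) * (u i - c * w i)) = (\<Sum>i\<in>UNIV. u i * u i + c * c * (w i * w i) - 2 * c * (u i * w i))"
          by (intro sum.cong) (auto simp: algebra_simps)
        then show ?thesis by (simp add: sum.distrib sum_subtractf sum_distrib_left[symmetric] ww uu)
      qed
      show ?thesis
      proof (cases "u = w")
        case True
        have "br ?f (e w) = h (- w)" using ee[OF mw] by (simp add: h_def)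
        then have "br ?f (br ?f (e w)) = - br (h (- w)) ?f"
          using br_anti[OF hL eL[OF mw]] by simp
        also have "\<dots> = s (- 2) ?f" unfolding he[OF mw] using four by (simp add: fun_apply ww)
        finally show ?thesis using True by simp
      next
        case False
        have nz: "- w + u \<noteq> 0" using False by (metis add.commute add_diff_cancel_left' diff_0_right uminus_add_conv_diff)
        show ?thesis
        proof (cases "- w + u \<in> ?R")
          case True
          have 1: "- w + (- w + u) \<notin> ?R \<and> - w + (- w + u) \<noteq> 0"
          proof -
            have "(\<Sum>i\<in>UNIV. (u i - 1 * w i) * (u i - 1 * w i)) = 8"
              using E8_double_rootsD[OF True] by (simp add: fun_apply algebra_simps)
            then have 4: "(\<Sum>i\<in>UNIV. u i * w i) = 4" unfolding q by simp
            have "(\<Sum>i\<in>UNIV. (- w + (- w + u)) i * (- w + (- w + u)) i) = 24"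
              using q[of 2] 4 by (simp add: fun_apply algebra_simps)
            then show ?thesis using E8_double_rootsD by (fastforce simp: fun_apply)
          qed
          have "br ?f (e (- w + u)) = 0" using ez[OF mw True] 1 by blast
          then show ?thesis using ep[OF mw u True] False br_negr[OF eL[OF mw] eL[OF True]] by auto
        next
          case False
          then show ?thesis using ez[OF mw u nz False] br_zero eL[OF mw] \<open>u \<noteq> w\<close> by simp
        qed
      qed
    qed
    note fL = eL[OF mw]
    have lin: "br ?f (br ?f (y + z)) = br ?f (br ?f y) + br ?f (br ?f z)" if "y \<in> L" "z \<in> L" for y z
      using that fL by (simp add: br_addr br_closed)
    have lins: "br ?f (br ?f (sum g A)) = (\<Sum>i\<in>A. br ?f (br ?f (g i)))" if "\<And>i. i \<in> A \<Longrightarrow> g i \<in> L" for g A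
      using that fL by (simp add: br_sumr br_closed)
    have linc: "br ?f (br ?f (s a y)) = s a (br ?f (br ?f y))" if "y \<in> L" for a y
      using that fL by (simp add: br_scr br_closed)
    have "br ?f (br ?f x) = (\<Sum>i\<in>UNIV. s (co x (Inl i)) (br ?f (br ?f (t i)))) + (\<Sum>v\<in>?R. s (co x (Inr v)) (br ?f (br ?f (e v))))"
      by (subst decomp[OF xL]) (simp add: lin lins linc subspace_sum[OF subL] L_closed tL eL)
    also have "\<dots> = (\<Sum>v\<in>?R. if v = w then s (co x (Inr w) * - 2) ?f else 0)"
      unfolding ft by (simp add: fe) (intro sum.cong; auto)
    also have "\<dots> = s (co x (Inr w) * - 2) ?f" using w(1) finite_E8_double_roots by simp
    finally have "s (co x (Inr w) * - 2) ?f \<in> J"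
      using brJ[OF fL brJ[OF fL x(1)]] by simp
    moreover have "co x (Inr w) * - 2 \<noteq> 0" using w(2) two by simp
    ultimately have "?f \<in> J" using scale_cancel_in[OF subJ] by blast
    then show ?thesis using full[OF mw] by blast
  next
    case False
    then have xt: "x = (\<Sum>i\<in>UNIV. s (co x (Inl i)) (t i))" using decomp[OF xL] by simp
    have "\<exists>k. co x (Inl k) \<noteq> 0"
    proof (rule ccontr)
      assume "\<not> ?thesis"
      then have "(\<Sum>i\<in>UNIV. s (co x (Inl i)) (t i)) = 0" by simp
      then show False using x(2) xt by simp
    qed
    then obtain k where k: "co x (Inl k) \<noteq> 0" ..
    have xe: "br x (e v) = s ((\<Sum>i\<in>UNIV. co x (Inl i) * of_int (v i)) / 2) (e v)" if "v \<in> ?R" for v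
    proof -
      have "br x (e v) = (\<Sum>i\<in>UNIV. br (s (co x (Inl i)) (t i)) (e v))"
        by (subst xt, rule br_suml[OF eL[OF that]]) (intro L_closed tL)
      also have "\<dots> = (\<Sum>i\<in>UNIV. s (co x (Inl i) * of_int (v i) / 2) (e v))"
        by (simp add: br_scl[OF tL eL[OF that]] te[OF that])
      also have "\<dots> = s ((\<Sum>i\<in>UNIV. co x (Inl i) * of_int (v i)) / 2) (e v)"
        by (simp add: scale_sum_left[symmetric] sum_divide_distrib)
      finally show ?thesis .
    qed
    \<comment> \<open>The values of the toral element on the roots
      \<open>\<epsilon>\<^sub>k + \<epsilon>\<^sub>l\<close> and
      \<open>\<epsilon>\<^sub>k - \<epsilon>\<^sub>l\<close> cannot both vanish, since they add up
      to twice its coordinate at \<open>k\<close>.\<close>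
    obtain l :: 8 where l: "l \<noteq> k" by (metis zero_neq_one)
    have ex: "e v \<in> J" if "v \<in> ?R" "(\<Sum>i\<in>UNIV. co x (Inl i) * of_int (v i)) \<noteq> 0" for v
      using brJ'[OF eL[OF that(1)] x(1)] unfolding xe[OF that(1)]
      using scale_cancel_in[OF subJ] that(2) two by simp
    have "2 * co x (Inl k) + 2 * co x (Inl l) \<noteq> 0 \<or> 2 * co x (Inl k) - 2 * co x (Inl l) \<noteq> 0"
    proof (rule ccontr)
      assume a: "\<not> ?thesis"
      have "4 * co x (Inl k) = (2 * co x (Inl k) + 2 * co x (Inl l)) + (2 * co x (Inl k) - 2 * co x (Inl l))" by simp
      also have "\<dots> = 0" using a by simp
      finally show False using k four by simp
    qed
    then have "(\<Sum>i\<in>UNIV. co x (Inl i) * of_int (D8vec k l 2 i)) \<noteq> 0 \<or> (\<Sum>i\<in>UNIV. co x (Inl i) * of_int (D8vec k l (- 2) i)) \<noteq> 0"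
      unfolding D8vec_sum by simp
    moreover have r: "D8vec k l 2 \<in> ?R" "D8vec k l (- 2) \<in> ?R"
      using l by (intro D8vec_root; simp)+
    ultimately show ?thesis
      using full[OF r(1) ex[OF r(1)]] full[OF r(2) ex[OF r(2)]] by blast
  qed
qed

end

text \<open>Type \<open>E\<^sub>8\<close> is defined by a Chevalley basis on coordinate vectors,
  while the basis is constructed on a concrete Lie algebra; it is carried along an isomorphism
  \<open>f\<close> with inverse \<open>g\<close>.\<close>

lemma E8_chevalley_transport:
  assumes vs1: "vector_space s1" and vs2: "vector_space s2"
    and sub: "Modules.module.subspace s1 L1" "Modules.module.subspace s2 L2"
    and to: "\<And>x. x \<in> L1 \<Longrightarrow> f x \<in> L2 \<and> g (f x) = x" and frm: "\<And>y. y \<in> L2 \<Longrightarrow> g y \<in> L1 \<and> f (g y) = y"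
    and add: "\<And>x y. x \<in> L1 \<Longrightarrow> y \<in> L1 \<Longrightarrow> f (x + y) = f x + f y"
    and scale: "\<And>a x. x \<in> L1 \<Longrightarrow> f (s1 a x) = s2 a (f x)"
    and br: "\<And>x y. x \<in> L1 \<Longrightarrow> y \<in> L1 \<Longrightarrow> br1 x y \<in> L1 \<and> f (br1 x y) = br2 (f x) (f y)"
    and E8: "has_E8_chevalley_basis s1 L1 br1"
  shows "has_E8_chevalley_basis s2 L2 br2"
proof -
  let ?R = E8_double_roots
  interpret V1: vector_space s1 by fact
  interpret V2: vector_space s2 by fact
  obtain t e where ch: "E8_chevalley s1 L1 br1 t e" using E8 unfolding has_E8_iff by blast
  note D = E8_chevalleyD[OF ch]
  have bL: "range t \<union> e ` ?R \<subseteq> L1" using D(4) unfolding is_basis_of_def by blast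
  have tL: "t i \<in> L1" and eL: "v \<in> ?R \<Longrightarrow> e v \<in> L1" for i v using bL by auto
  have inj: "inj_on f L1" using to by (metis inj_onI)
  have f0: "f 0 = 0" using scale[OF V1.subspace_0[OF sub(1)], of 0] by simp
  have fneg: "f (- x) = - f x" if "x \<in> L1" for x using scale[OF that, of "-1"] by simp
  have fsum: "f (sum h A) = (\<Sum>i\<in>A. f (h i))" if "\<And>i. i \<in> A \<Longrightarrow> h i \<in> L1" for h and A :: "'i set"
    using that
    by (induct A rule: infinite_finite_induct) (auto simp: f0 add V1.subspace_sum[OF sub(1)])
  let ?B = "range t \<union> e ` ?R"
  have fin: "finite ?B" using finite_E8_double_roots by simp
  have "coord_system s1 L1 ?B (\<lambda>x. x) (\<lambda>v p. module.representation s1 ((\<lambda>x. x) ` ?B) v p)"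
    by (rule V1.is_basis_coord_system) (use D(4) fin in auto)
  then obtain co where cs: "coord_system s1 L1 ?B (\<lambda>x. x) co" by blast
  note C = V1.coord_systemD[OF cs]
  have "coord_system s2 L2 ?B f (\<lambda>y. co (g y))"
    unfolding coord_system_def
  proof (intro conjI ballI allI)
    show "finite ?B" by (rule fin)
    show "V2.subspace L2" by (rule sub)
    show "f ` ?B \<subseteq> L2" using bL to by blast
    have fs: "f (\<Sum>p\<in>?B. s1 (c p) p) = (\<Sum>p\<in>?B. s2 (c p) (f p))" for c
    proof -
      have BL: "p \<in> L1" if "p \<in> ?B" for p using bL that by blast
      have "f (\<Sum>p\<in>?B. s1 (c p) p) = (\<Sum>p\<in>?B. f (s1 (c p) p))"
        by (intro fsum V1.subspace_scale[OF sub(1)] BL)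
      also have "\<dots> = (\<Sum>p\<in>?B. s2 (c p) (f p))" by (intro sum.cong refl scale BL)
      finally show ?thesis .
    qed
    show "y = (\<Sum>p\<in>?B. s2 (co (g y) p) (f p))" if "y \<in> L2" for y
    proof -
      have "g y = (\<Sum>p\<in>?B. s1 (co (g y) p) p)" using C(4) frm[OF that] by blast
      then have "f (g y) = f (\<Sum>p\<in>?B. s1 (co (g y) p) p)" by (rule arg_cong)
      then show ?thesis using frm[OF that] unfolding fs by simp
    qed
    show "co (g (\<Sum>p\<in>?B. s2 (c p) (f p))) q = c q" if "q \<in> ?B" for c q
    proof -
      have "(\<Sum>p\<in>?B. s1 (c p) p) \<in> L1" using V1.coord_system_sum_in[OF cs] .
      then have "g (\<Sum>p\<in>?B. s2 (c p) (f p)) = (\<Sum>p\<in>?B. s1 (c p) p)" using to unfolding fs[symmetric] by blast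
      then show ?thesis using C(5)[OF that, of c] by simp
    qed
  qed
  then have "is_basis_of s2 L2 (f ` ?B)" by (rule V2.coord_system_is_basis)
  then have bas: "is_basis_of s2 L2 (range (f \<circ> t) \<union> (f \<circ> e) ` ?R)"
    by (simp add: image_Un image_comp)
  have "E8_chevalley s2 L2 br2 (f \<circ> t) (f \<circ> e)"
    unfolding E8_chevalley_def
  proof (intro conjI ballI allI impI bas)
    show "inj (f \<circ> t)" using inj D(1) tL by (simp add: inj_on_def)
    show "inj_on (f \<circ> e) ?R" using inj D(2) eL by (simp add: inj_on_def)
    show "range (f \<circ> t) \<inter> (f \<circ> e) ` ?R = {}"
    proof -
      have "f (t i) \<noteq> f (e v)" if "v \<in> ?R" for i v
        using inj_onD[OF inj _ tL eL[OF that]] D(3) that by blast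
      then show ?thesis by auto
    qed
    show "br2 ((f \<circ> t) i) ((f \<circ> t) j) = 0" for i j
      using br[OF tL tL, of i j] D(5) f0 by simp
    show "br2 ((f \<circ> t) i) ((f \<circ> e) v) = s2 (of_int (v i) / 2) ((f \<circ> e) v)" if v: "v \<in> ?R" for i v
      using br[OF tL eL[OF v], of i] D(6)[OF v, of i] scale[OF eL[OF v]] by simp
    show "br2 ((f \<circ> e) v) ((f \<circ> e) (- v)) = (\<Sum>i\<in>UNIV. s2 (of_int (v i) / 2) ((f \<circ> t) i))" if v: "v \<in> ?R" for v
      using br[OF eL[OF v] eL[OF uminus_E8[OF v]]] D(7)[OF v] fsum[of UNIV "\<lambda>i. s1 (of_int (v i) / 2) (t i)"]
        scale[OF tL] V1.subspace_scale[OF sub(1) tL] by simp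
    show "br2 ((f \<circ> e) v) ((f \<circ> e) w) = (f \<circ> e) (v + w) \<or> br2 ((f \<circ> e) v) ((f \<circ> e) w) = - (f \<circ> e) (v + w)"
      if "v \<in> ?R" "w \<in> ?R" "v + w \<in> ?R" for v w
      using br[OF eL[OF that(1)] eL[OF that(2)]] D(8)[OF that] fneg[OF eL[OF that(3)]] by auto
    show "br2 ((f \<circ> e) v) ((f \<circ> e) w) = 0" if "v \<in> ?R" "w \<in> ?R" "v + w \<noteq> 0 \<and> v + w \<notin> ?R" for v w
      using br[OF eL[OF that(1)] eL[OF that(2)]] D(9)[of v w] that f0 by auto
  qed
  then show ?thesis unfolding has_E8_iff by blast
qed

text \<open>By \<open>compat\<close> the two bases have the same structure constants, so
  \<open>L'\<close> is the extension of scalars of \<open>L\<close> to the closure. Its model is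
  left open, and its Chevalley basis need not be related to \<open>B'\<close>.\<close>

locale E8_extension =
  A: bracket_algebra s L br + B: bracket_algebra s' L' br'
  for s :: "'k::field \<Rightarrow> 'v::ab_group_add \<Rightarrow> 'v" and L br
    and s' :: "'k alg_closure \<Rightarrow> 'w::ab_group_add \<Rightarrow> 'w" and L' br' +
  fixes I :: "'i set" and B co B' co'
  assumes two: "(2 :: 'k) \<noteq> 0"
    and cs: "coord_system s L I B co" and cs': "coord_system s' L' I B' co'"
    and compat: "\<And>p q r. p \<in> I \<Longrightarrow> q \<in> I \<Longrightarrow> r \<in> I \<Longrightarrow>
      co' (br' (B' p) (B' q)) r = to_ac (co (br (B p) (B q)) r)"
    and E8': "has_E8_chevalley_basis s' L' br'"
begin

lemmas C = A.coord_systemD[OF cs] and C' = B.coord_systemD[OF cs']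

lemma two': "(2 :: 'k alg_closure) \<noteq> 0"
  using two by (metis to_ac_numeral to_ac_eq_0_iff)

lemma bracket_expand:
  assumes "x \<in> L" "y \<in> L"
  shows "br x y = (\<Sum>p\<in>I. \<Sum>q\<in>I. s (co x p * co y q) (br (B p) (B q)))"
proof -
  have "br x y = br (\<Sum>p\<in>I. s (co x p) (B p)) (\<Sum>q\<in>I. s (co y q) (B q))"
    using C(4) assms by metis
  also have "\<dots> = (\<Sum>p\<in>I. br (s (co x p) (B p)) (\<Sum>q\<in>I. s (co y q) (B q)))"
    by (intro A.br_suml A.subspace_sum[OF A.subL] A.L_closed C)
  also have "\<dots> = (\<Sum>p\<in>I. \<Sum>q\<in>I. br (s (co x p) (B p)) (s (co y q) (B q)))"
    by (intro sum.cong refl A.br_sumr A.L_closed C)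
  also have "\<dots> = (\<Sum>p\<in>I. \<Sum>q\<in>I. s (co x p * co y q) (br (B p) (B q)))"
    by (intro sum.cong refl) (simp add: A.br_scl A.br_scr A.L_closed C A.br_closed)
  finally show ?thesis .
qed

lemma bracket_expand':
  assumes "x \<in> L'" "y \<in> L'"
  shows "br' x y = (\<Sum>p\<in>I. \<Sum>q\<in>I. s' (co' x p * co' y q) (br' (B' p) (B' q)))"
proof -
  have "br' x y = br' (\<Sum>p\<in>I. s' (co' x p) (B' p)) (\<Sum>q\<in>I. s' (co' y q) (B' q))"
    using C'(4) assms by metis
  also have "\<dots> = (\<Sum>p\<in>I. br' (s' (co' x p) (B' p)) (\<Sum>q\<in>I. s' (co' y q) (B' q)))"
    by (intro B.br_suml B.subspace_sum[OF B.subL] B.L_closed C')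
  also have "\<dots> = (\<Sum>p\<in>I. \<Sum>q\<in>I. br' (s' (co' x p) (B' p)) (s' (co' y q) (B' q)))"
    by (intro sum.cong refl B.br_sumr B.L_closed C')
  also have "\<dots> = (\<Sum>p\<in>I. \<Sum>q\<in>I. s' (co' x p * co' y q) (br' (B' p) (B' q)))"
    by (intro sum.cong refl) (simp add: B.br_scl B.br_scr B.L_closed C' B.br_closed)
  finally show ?thesis .
qed

lemma co_sum: "r \<in> I \<Longrightarrow> (\<And>i. i \<in> A \<Longrightarrow> f i \<in> L) \<Longrightarrow> co (sum f A) r = (\<Sum>i\<in>A. co (f i) r)"
proof (induct A rule: infinite_finite_induct)
  case (insert x F)
  then show ?case by (simp add: A.coord_system_linear(1)[OF cs] A.subspace_sum[OF A.subL])
qed (use A.coord_system_linear(2)[OF cs A.L_closed(3) A.L_closed(3), of r 0] in simp_all)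

lemma co_sum': "r \<in> I \<Longrightarrow> (\<And>i. i \<in> A \<Longrightarrow> f i \<in> L') \<Longrightarrow> co' (sum f A) r = (\<Sum>i\<in>A. co' (f i) r)"
proof (induct A rule: infinite_finite_induct)
  case (insert x F)
  then show ?case by (simp add: B.coord_system_linear(1)[OF cs'] B.subspace_sum[OF B.subL])
qed (use B.coord_system_linear(2)[OF cs' B.L_closed(3) B.L_closed(3), of r 0] in simp_all)

lemma co_bracket:
  assumes "x \<in> L" "y \<in> L" "r \<in> I"
  shows "co (br x y) r = (\<Sum>p\<in>I. \<Sum>q\<in>I. co x p * co y q * co (br (B p) (B q)) r)"
proof -
  have "co (br x y) r = (\<Sum>p\<in>I. co (\<Sum>q\<in>I. s (co x p * co y q) (br (B p) (B q))) r)"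
    unfolding bracket_expand[OF assms(1,2)]
    by (intro co_sum assms(3) A.subspace_sum[OF A.subL] A.L_closed A.br_closed C)
  also have "\<dots> = (\<Sum>p\<in>I. \<Sum>q\<in>I. co (s (co x p * co y q) (br (B p) (B q))) r)"
    by (intro sum.cong refl co_sum assms(3) A.L_closed A.br_closed C)
  finally show ?thesis
    using A.coord_system_linear(2)[OF cs A.br_closed[OF C(3) C(3)] A.br_closed[OF C(3) C(3)] assms(3)]
    by (simp cong: sum.cong)
qed

lemma co_bracket':
  assumes "x \<in> L'" "y \<in> L'" "r \<in> I"
  shows "co' (br' x y) r = (\<Sum>p\<in>I. \<Sum>q\<in>I. co' x p * co' y q * to_ac (co (br (B p) (B q)) r))"
proof -
  have "co' (br' x y) r = (\<Sum>p\<in>I. co' (\<Sum>q\<in>I. s' (co' x p * co' y q) (br' (B' p) (B' q))) r)"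
    unfolding bracket_expand'[OF assms(1,2)]
    by (intro co_sum' assms(3) B.subspace_sum[OF B.subL] B.L_closed B.br_closed C')
  also have "\<dots> = (\<Sum>p\<in>I. \<Sum>q\<in>I. co' (s' (co' x p * co' y q) (br' (B' p) (B' q))) r)"
    by (intro sum.cong refl co_sum' assms(3) B.L_closed B.br_closed C')
  finally show ?thesis
    using B.coord_system_linear(2)[OF cs' B.br_closed[OF C'(3) C'(3)] B.br_closed[OF C'(3) C'(3)] assms(3)]
    by (simp add: compat assms(3) cong: sum.cong)
qed

lemma type_E8: "lie_of_type_E8 s L br"
proof -
  define n where "n = card I"
  obtain h where h: "bij_betw h {..<n} I"
    using ex_bij_betw_nat_finite[OF C(1)] unfolding n_def atLeast0LessThan by blast
  have hI: "h i \<in> I" if "i < n" for i using h that by (auto simp: bij_betw_def)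
  define c where "c i j l = co (br (B (h i)) (B (h j))) (h l)" for i j l
  have sumI: "(\<Sum>p\<in>I. f p) = (\<Sum>l<n. f (h l))" for f :: "'i \<Rightarrow> 'z::comm_monoid_add"
    using sum.reindex_bij_betw[OF h, of f] by simp
  let ?b = "\<lambda>i. B (h i)"
  have inj: "inj_on ?b {..<n}"
    using comp_inj_on[of h "{..<n}" B] h A.coord_system_inj[OF cs] by (simp add: bij_betw_def o_def)
  have "?b ` {..<n} = B ` I" using h by (auto simp: bij_betw_def)
  then have bas: "is_basis_of s L (?b ` {..<n})" using A.coord_system_is_basis[OF cs] by simp
  have str: "br (?b i) (?b j) = (\<Sum>l<n. s (c i j l) (?b l))" if "i < n" "j < n" for i j
    using C(4)[OF A.br_closed[OF C(3)[OF hI[OF that(1)]] C(3)[OF hI[OF that(2)]]]]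
    unfolding sumI c_def .
  let ?f = "\<lambda>y l. if l < n then co' y (h l) else 0"
  let ?g = "\<lambda>u. \<Sum>l<n. s' (u l) (B' (h l))"
  have vs: "vector_space (fun_scale (*) :: 'k alg_closure \<Rightarrow> (nat \<Rightarrow> 'k alg_closure) \<Rightarrow> _)"
    by (intro vector_space_fun_scale vector_space_field)
  interpret N: vector_space "fun_scale (*) :: 'k alg_closure \<Rightarrow> (nat \<Rightarrow> 'k alg_closure) \<Rightarrow> _" by (rule vs)
  have gL: "?g u \<in> L'" for u by (intro B.subspace_sum[OF B.subL] B.L_closed C') (use hI in auto)
  have "has_E8_chevalley_basis (fun_scale (*)) (ext_space n) (ext_bracket n c)"
  proof (rule E8_chevalley_transport[OF B.vector_space_axioms vs B.subL _ _ _ _ _ _ E8', where f = ?f and g = ?g])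
    show "N.subspace (ext_space n)"
      by (rule N.subspaceI) (auto simp: ext_space_def fun_scale_def fun_apply)
    show "?f x \<in> ext_space n \<and> ?g (?f x) = x" if "x \<in> L'" for x
      using C'(4)[OF that] unfolding sumI by (simp add: ext_space_def)
    show "?g u \<in> L' \<and> ?f (?g u) = u" if "u \<in> ext_space n" for u
    proof
      have hinv: "the_inv_into {..<n} h (h l) = l" if "l < n" for l
        using h that by (simp add: the_inv_into_f_f bij_betw_def)
      have "?g u = (\<Sum>p\<in>I. s' (u (the_inv_into {..<n} h p)) (B' p))"
        unfolding sumI by (intro sum.cong) (auto simp: hinv)
      then have "co' (?g u) (h l) = u l" if "l < n" for l
        using C'(5)[OF hI[OF that], of "\<lambda>p. u (the_inv_into {..<n} h p)"] that hinv by simp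
      then show "?f (?g u) = u" using that by (auto simp: ext_space_def)
    qed (rule gL)
    show "?f (x + y) = ?f x + ?f y" if "x \<in> L'" "y \<in> L'" for x y
      using B.coord_system_linear(1)[OF cs' that] hI by (auto simp: fun_eq_iff fun_apply)
    show "?f (s' a x) = fun_scale (*) a (?f x)" if "x \<in> L'" for a x
      using B.coord_system_linear(2)[OF cs' that that] hI by (auto simp: fun_eq_iff fun_scale_def)
    show "br' x y \<in> L' \<and> ?f (br' x y) = ext_bracket n c (?f x) (?f y)" if "x \<in> L'" "y \<in> L'" for x y
    proof
      show "br' x y \<in> L'" using B.br_closed that .
      show "?f (br' x y) = ext_bracket n c (?f x) (?f y)"
        unfolding ext_bracket_def
        by (rule ext) (simp add: co_bracket'[OF that hI] sumI c_def)
    qed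
  qed
  then show ?thesis
    unfolding lie_of_type_E8_def using A.lie inj bas str by blast
qed

text \<open>The base change map from \<open>L\<close> to its scalar extension.\<close>

definition extend where "extend v = (\<Sum>p\<in>I. s' (to_ac (co v p)) (B' p))"

lemma extend_L: "extend v \<in> L'"
  unfolding extend_def by (intro B.subspace_sum[OF B.subL] B.L_closed C')

lemma co_extend: "p \<in> I \<Longrightarrow> co' (extend v) p = to_ac (co v p)"
  unfolding extend_def by (rule C')

lemma eq_by_co': "x \<in> L' \<Longrightarrow> y \<in> L' \<Longrightarrow> (\<And>p. p \<in> I \<Longrightarrow> co' x p = co' y p) \<Longrightarrow> x = y"
proof -
  assume xy: "x \<in> L'" "y \<in> L'" and eq: "\<And>p. p \<in> I \<Longrightarrow> co' x p = co' y p"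
  have "x = (\<Sum>p\<in>I. s' (co' x p) (B' p))" by (rule C'(4)[OF xy(1)])
  also have "\<dots> = (\<Sum>p\<in>I. s' (co' y p) (B' p))" by (intro sum.cong) (simp_all add: eq)
  also have "\<dots> = y" by (rule C'(4)[OF xy(2), symmetric])
  finally show "x = y" .
qed

lemma extend_basis: assumes "p \<in> I" shows "extend (B p) = B' p"
  by (rule eq_by_co'[OF extend_L C'(3)[OF assms]])
     (simp add: co_extend A.coord_system_basis[OF cs _ assms] B.coord_system_basis[OF cs' _ assms])

lemma extend_bracket: assumes "x \<in> L" "y \<in> L" shows "extend (br x y) = br' (extend x) (extend y)"
  by (rule eq_by_co'[OF extend_L B.br_closed[OF extend_L extend_L]])
     (simp add: co_extend co_bracket[OF assms] co_bracket'[OF extend_L extend_L] to_ac_sum)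

text \<open>The span \<open>K\<close> over the closure of the image of an ideal \<open>J\<close> is
  an ideal of \<open>L'\<close>, hence zero or everything. Zero forces \<open>J = {0}\<close>, as
  \<open>extend\<close> is injective. If \<open>K\<close> is everything but \<open>J\<close> misses
  some \<open>x\<close>, a linear form that vanishes on \<open>J\<close> and is \<open>1\<close> at
  \<open>x\<close> extends to a form on \<open>L'\<close> that vanishes on \<open>K\<close>, a
  contradiction.\<close>

lemma simple: "simple_lie_algebra s L br"
  unfolding simple_lie_algebra_def
proof (intro conjI allI impI)
  show "lie_algebra s L br" by (rule A.lie)
  obtain t e where ch: "E8_chevalley s' L' br' t e" using E8' unfolding has_E8_iff by blast
  define v where "v = D8vec 0 1 2"
  have v: "v \<in> E8_double_roots" unfolding v_def by (rule D8vec_root) auto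
  have tL: "t i \<in> L'" and eL: "e v \<in> L'" for i
    using E8_chevalleyD(4)[OF ch] v unfolding is_basis_of_def by auto
  have "e v \<noteq> 0"
    using E8_chevalleyD(4)[OF ch] v B.dependent_zero unfolding is_basis_of_def by (metis UnI2 imageI)
  moreover have "br' (t 0) (e v) = e v"
    using E8_chevalleyD(6)[OF ch v, of 0] two' by (simp add: v_def D8vec_def)
  ultimately have ne: "br' (t 0) (e v) \<noteq> 0" by simp
  \<comment> \<open>A zero bracket on \<open>L\<close> has zero structure constants, which would
    make \<open>L'\<close> abelian as well, against \<open>ne\<close>.\<close>
  show "\<exists>x\<in>L. \<exists>y\<in>L. br x y \<noteq> 0"
  proof (rule ccontr)
    assume "\<not> ?thesis"
    then have z: "br (B p) (B q) = 0" if "p \<in> I" "q \<in> I" for p q using C(3) that by blast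
    have "co' (br' (t 0) (e v)) r = co' 0 r" if "r \<in> I" for r
      using B.coord_system_linear(2)[OF cs' B.L_closed(3) B.L_closed(3) that, of 0]
        A.coord_system_linear(2)[OF cs A.L_closed(3) A.L_closed(3) that, of 0]
      by (simp add: co_bracket'[OF tL eL that] z)
    then have "br' (t 0) (e v) = 0"
      by (intro eq_by_co' B.br_closed tL eL B.L_closed)
    then show False using ne by simp
  qed
  fix J assume J: "lie_ideal s L br J"
  have subJ: "A.subspace J" and JL: "J \<subseteq> L" and brJ: "\<And>x y. x \<in> L \<Longrightarrow> y \<in> J \<Longrightarrow> br x y \<in> J"
    using J unfolding lie_ideal_def by auto
  define K where "K = B.span (extend ` J)"
  have KL: "K \<subseteq> L'" unfolding K_def by (rule B.span_minimal) (auto simp: extend_L B.subL)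
  have "lie_ideal s' L' br' K"
    unfolding lie_ideal_def
  proof (intro conjI ballI KL)
    show "B.subspace K" unfolding K_def by (rule B.subspace_span)
    fix x y assume x: "x \<in> L'" and y: "y \<in> K"
    have 1: "br' x (extend z) \<in> K" if z: "z \<in> J" for z
    proof -
      have "br' x (extend z) = br' (\<Sum>p\<in>I. s' (co' x p) (B' p)) (extend z)" using C'(4)[OF x] by simp
      also have "\<dots> = (\<Sum>p\<in>I. br' (s' (co' x p) (B' p)) (extend z))"
        by (intro B.br_suml extend_L B.L_closed C')
      also have "\<dots> = (\<Sum>p\<in>I. s' (co' x p) (extend (br (B p) z)))"
        using z JL by (intro sum.cong refl) (simp add: B.br_scl C' extend_L extend_bracket C(3) extend_basis subsetD)
      also have "\<dots> \<in> K" unfolding K_def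
        by (intro B.span_sum B.span_scale B.span_base imageI brJ C z)
      finally show ?thesis .
    qed
    have "y \<in> L' \<and> br' x y \<in> K"
      using y unfolding K_def
    proof (induct rule: B.span_induct_alt)
      case base
      show ?case using B.br_zero[OF x] B.L_closed(3) by (simp add: B.span_zero)
    next
      case (step c w y)
      then obtain z where z: "z \<in> J" "w = extend z" by blast
      have "br' x (s' c w + y) = s' c (br' x w) + br' x y"
        using step z by (simp add: B.br_addr B.br_scr x extend_L B.L_closed)
      then show ?case
        using step z 1[OF z(1)] unfolding K_def
        by (simp add: B.L_closed extend_L B.span_add B.span_scale)
    qed
    then show "br' x y \<in> K" ..
  qed
  then have KK: "K = {0} \<or> K = L'" using B.chevalley_ideal[OF two' E8'] by blast
  show "J = {0} \<or> J = L"
  proof (rule disjCI, rule ccontr)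
    assume J0: "J \<noteq> L"
    assume "J \<noteq> {0}"
    then obtain z where z: "z \<in> J" "z \<noteq> 0" using A.subspace_0[OF subJ] by auto
    have "extend z \<noteq> 0"
    proof
      assume e0: "extend z = 0"
      have "co z p = 0" if "p \<in> I" for p
        using co_extend[OF that, of z] B.coord_system_linear(2)[OF cs' B.L_closed(3) B.L_closed(3) that, of 0]
        unfolding e0 by simp
      then show False using C(4)[of z] z JL by auto
    qed
    moreover have "extend z \<in> K" unfolding K_def using z by (intro B.span_base imageI)
    ultimately have K: "K = L'" using KK by auto
    obtain x where x: "x \<in> L" "x \<notin> J" using J0 JL by auto
    interpret P: vector_space_pair s "(*) :: 'k \<Rightarrow> 'k \<Rightarrow> 'k"
      by (intro vector_space_pair.intro A.vector_space_axioms vector_space_field)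
    obtain M where M: "M \<subseteq> J" "A.independent M" "J \<subseteq> A.span M"
      using A.maximal_independent_subset by blast
    have "A.span M = J" using M subJ by (simp add: A.span_subspace)
    then have indx: "A.independent (insert x M)" using M(2) x by (simp add: A.independent_insert)
    obtain f where f: "Vector_Spaces.linear s (*) f" "\<And>y. y \<in> insert x M \<Longrightarrow> f y = (if y = x then 1 else 0)"
      using P.linear_independent_extend[OF indx, of "\<lambda>y. if y = x then 1 else 0"] by blast
    have fM: "f y = 0" if "y \<in> J" for y
    proof -
      have "y \<in> A.span M" using M that by blast
      then show ?thesis
      proof (induct rule: A.span_induct_alt)
        case (step c y z)
        then show ?case using f x M(1) by (auto simp: linearD[OF f(1)])
      qed (simp add: linearD[OF f(1)])
    qed
    define f' where "f' y = (\<Sum>p\<in>I. co' y p * to_ac (f (B p)))" for y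
    have f'e: "f' (extend y) = to_ac (f y)" if "y \<in> L" for y
    proof -
      have "f y = f (\<Sum>p\<in>I. s (co y p) (B p))" using C(4)[OF that] by simp
      also have "\<dots> = (\<Sum>p\<in>I. co y p * f (B p))" by (simp add: linearD[OF f(1)])
      finally show ?thesis by (simp add: f'_def co_extend to_ac_sum)
    qed
    have "y \<in> L' \<and> f' y = 0" if "y \<in> K" for y
      using that unfolding K_def
    proof (induct rule: B.span_induct_alt)
      case base
      show ?case using B.coord_system_linear(2)[OF cs' B.L_closed(3) B.L_closed(3), of _ 0]
        by (simp add: f'_def B.L_closed)
    next
      case (step c w y)
      then obtain z where z: "z \<in> J" "w = extend z" by blast
      have "f' (s' c w + y) = c * f' w + f' y"
      proof -
        have "f' (s' c w + y) = (\<Sum>p\<in>I. (c * co' w p + co' y p) * to_ac (f (B p)))"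
          unfolding f'_def using step z extend_L
          by (intro sum.cong refl)
            (simp add: B.coord_system_linear(1)[OF cs'] B.coord_system_linear(2)[OF cs' _ B.L_closed(3)] B.L_closed)
        then show ?thesis
          by (simp add: f'_def algebra_simps sum.distrib sum_distrib_left)
      qed
      then show ?case using step z f'e[of z] fM[OF z(1)] JL extend_L by (auto simp: B.L_closed)
    qed
    then have "f' (extend x) = 0" using K extend_L by blast
    then show False using f'e[OF x(1)] f(2)[of x] by simp
  qed
qed

end

text \<open>
  Signs are no obstacle: if the products of root vectors are right up to sign, then rescaling one
  root vector from each pair of opposite roots by \<open>\<plusminus>1\<close> gives a Chevalley basis.
\<close>

lemma (in bracket_algebra) E8_chevalley_of_signed:
  fixes hc :: "8 \<Rightarrow> 'i" and rt :: "'i \<Rightarrow> 8 \<Rightarrow> int"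
  assumes cs: "coord_system s L (range hc \<union> R) B co" and disj: "range hc \<inter> R = {}" and hc: "inj hc"
    and rt: "bij_betw rt R E8_double_roots"
    and hh: "\<And>i j. br (B (hc i)) (B (hc j)) = 0"
    and hr: "\<And>i p. p \<in> R \<Longrightarrow> br (B (hc i)) (B p) = s (- (of_int (rt p i) / 2)) (B p)"
    and opp: "\<And>p q. p \<in> R \<Longrightarrow> q \<in> R \<Longrightarrow> rt p + rt q = 0 \<Longrightarrow>
      br (B p) (B q) = (\<Sum>i\<in>UNIV. s (of_int (rt p i) / 2) (B (hc i))) \<or>
      br (B p) (B q) = - (\<Sum>i\<in>UNIV. s (of_int (rt p i) / 2) (B (hc i)))"
    and root: "\<And>p q r. p \<in> R \<Longrightarrow> q \<in> R \<Longrightarrow> r \<in> R \<Longrightarrow> rt p + rt q = rt r \<Longrightarrow>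
      br (B p) (B q) = B r \<or> br (B p) (B q) = - B r"
    and nonroot: "\<And>p q. p \<in> R \<Longrightarrow> q \<in> R \<Longrightarrow> rt p + rt q \<noteq> 0 \<Longrightarrow> rt p + rt q \<notin> E8_double_roots \<Longrightarrow>
      br (B p) (B q) = 0"
  shows "has_E8_chevalley_basis s L br"
proof -
  let ?R = E8_double_roots
  note C = coord_systemD[OF cs]
  define idx where "idx = the_inv_into R rt"
  have idx: "idx v \<in> R" "rt (idx v) = v" if "v \<in> ?R" for v
    using rt that unfolding idx_def bij_betw_def
    by (metis the_inv_into_into order_refl, metis f_the_inv_into_f)
  have idx_rt: "idx (rt p) = p" if "p \<in> R" for p
    using rt that unfolding idx_def bij_betw_def by (metis the_inv_into_f_f)
  have idx_bij: "bij_betw idx ?R R"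
    using bij_betw_the_inv_into[OF rt] unfolding idx_def .
  have rtR: "rt p \<in> ?R" if "p \<in> R" for p using rt that by (auto simp: bij_betw_def)
  have finR: "finite R" using C(1) by simp
  \<comment> \<open>An arbitrary numbering, whose purpose is to single out one root of each opposite
    pair.\<close>
  obtain f :: "'i \<Rightarrow> nat" where f: "inj_on f R"
    using finite_imp_inj_to_nat_seg[OF finR] by blast
  \<comment> \<open>The given toral elements act with the negatives of the roots, hence the change
    of sign.\<close>
  define t where "t i = - B (hc i)" for i
  define h where "h v = (\<Sum>i\<in>UNIV. s (of_int (v i) / 2) (t i))" for v :: "8 \<Rightarrow> int"
  have BL: "B p \<in> L" if "p \<in> range hc \<union> R" for p using C(3)[OF that] .
  have tL: "t i \<in> L" for i unfolding t_def by (intro L_closed BL) auto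
  have hm: "h (- v) = - h v" for v by (simp add: h_def fun_apply sum_negf)
  have h_opp: "br (B p) (B q) = h (rt p) \<or> br (B p) (B q) = - h (rt p)"
    if "p \<in> R" "q \<in> R" "rt p + rt q = 0" for p q
    using opp[OF that] by (auto simp: h_def t_def sum_negf)
  \<comment> \<open>The first root vector of each opposite pair is kept, and the second one receives
    the sign that makes their bracket the coroot. The condition speaks of the bracket in the order
    first, second; since \<open>h\<close> is odd, this settles both orders.\<close>
  define eps :: "(8 \<Rightarrow> int) \<Rightarrow> 'k" where
    "eps v = (if f (idx v) < f (idx (- v)) \<or> br (B (idx (- v))) (B (idx v)) = h (- v) then 1 else - 1)" for v
  have eps1: "eps v = 1 \<or> eps v = - 1" for v
    by (auto simp: eps_def)
  have epsy: "s (eps v * a) (s (eps v) y) = s a y" for v a y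
    using eps1[of v] by auto
  define e where "e v = s (eps v) (B (idx v))" for v
  define B2 where "B2 = case_sum t e"
  define I2 :: "(8 + (8 \<Rightarrow> int)) set" where "I2 = range Inl \<union> Inr ` ?R"
  have sum_I2: "(\<Sum>p\<in>I2. g p) = (\<Sum>i\<in>UNIV. g (Inl i)) + (\<Sum>v\<in>?R. g (Inr v))" for g :: "_ \<Rightarrow> 'v"
  proof -
    have "(\<Sum>p\<in>I2. g p) = (\<Sum>p\<in>range Inl. g p) + (\<Sum>p\<in>Inr ` ?R. g p)"
      unfolding I2_def by (rule sum.union_disjoint) (auto simp: finite_E8_double_roots)
    then show ?thesis by (simp add: sum.reindex)
  qed
  have sum_I: "(\<Sum>p\<in>range hc \<union> R. g p) = (\<Sum>i\<in>UNIV. g (hc i)) + (\<Sum>v\<in>?R. g (idx v))" for g :: "'i \<Rightarrow> 'v"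
  proof -
    have "(\<Sum>p\<in>range hc \<union> R. g p) = (\<Sum>p\<in>range hc. g p) + (\<Sum>p\<in>R. g p)"
      by (rule sum.union_disjoint) (use disj finR in auto)
    then show ?thesis
      using sum.reindex_bij_betw[OF idx_bij, of g] by (simp add: sum.reindex[OF hc])
  qed
  define co2 where "co2 x = case_sum (\<lambda>i. - co x (hc i)) (\<lambda>v. eps v * co x (idx v))" for x
  have "coord_system s L I2 B2 co2"
    unfolding coord_system_def
  proof (intro conjI ballI allI)
    show "finite I2" by (simp add: I2_def finite_E8_double_roots)
    show "subspace L" by (rule subL)
    show "B2 ` I2 \<subseteq> L"
      using tL idx(1) BL by (auto simp: B2_def I2_def e_def intro!: L_closed)
    show "x = (\<Sum>p\<in>I2. s (co2 x p) (B2 p))" if "x \<in> L" for x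
    proof -
      have "x = (\<Sum>p\<in>range hc \<union> R. s (co x p) (B p))" by (rule C(4)[OF that])
      also have "\<dots> = (\<Sum>p\<in>I2. s (co2 x p) (B2 p))"
        unfolding sum_I sum_I2
        by (simp add: co2_def B2_def t_def e_def epsy del: scale_scale)
      finally show ?thesis .
    qed
    show "co2 (\<Sum>p\<in>I2. s (c p) (B2 p)) q = c q" if q: "q \<in> I2" for c q
    proof -
      define c' where "c' p = (if p \<in> R then c (Inr (rt p)) * eps (rt p) else - c (Inl (inv_into UNIV hc p)))" for p
      have hcR: "hc i \<notin> R" for i using disj by auto
      have "(\<Sum>p\<in>I2. s (c p) (B2 p)) = (\<Sum>p\<in>range hc \<union> R. s (c' p) (B p))"
        unfolding sum_I sum_I2
        by (simp add: c'_def B2_def t_def e_def hcR inv_f_f[OF hc] idx)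
      then have eq: "co (\<Sum>p\<in>I2. s (c p) (B2 p)) p = c' p" if "p \<in> range hc \<union> R" for p
        using C(5)[OF that] by simp
      show ?thesis
      proof (cases q)
        case (Inl i)
        then show ?thesis using eq[of "hc i"] hcR by (simp add: co2_def c'_def inv_f_f[OF hc])
      next
        case (Inr v)
        then have v: "v \<in> ?R" using q by (auto simp: I2_def)
        then show ?thesis using Inr eq[of "idx v"] idx[OF v] eps1[of v]
          by (auto simp: co2_def c'_def)
      qed
    qed
  qed
  then have bas: "is_basis_of s L (B2 ` I2)" and inj: "inj_on B2 I2"
    by (rule coord_system_is_basis coord_system_inj)+
  have "B2 ` I2 = range t \<union> e ` ?R" by (auto simp: B2_def I2_def image_Un image_image)
  then have bas': "is_basis_of s L (range t \<union> e ` ?R)" using bas by simp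
  have B2D: "p = q" if "B2 p = B2 q" "p \<in> I2" "q \<in> I2" for p q
    by (rule inj_onD[OF inj that])
  have t_inj: "inj t"
    by (rule injI) (use B2D[of "Inl x" "Inl y" for x y] in \<open>simp add: B2_def I2_def\<close>)
  have e_inj: "inj_on e ?R"
  proof (rule inj_onI)
    fix v w assume vw: "v \<in> ?R" "w \<in> ?R" "e v = e w"
    have "Inr v = (Inr w :: 8 + (8 \<Rightarrow> int))"
      by (rule B2D) (use vw in \<open>simp_all add: B2_def I2_def\<close>)
    then show "v = w" by simp
  qed
  have te: "t i \<noteq> e v" if "v \<in> ?R" for i v
  proof
    assume "t i = e v"
    then have "Inl i = (Inr v :: 8 + (8 \<Rightarrow> int))"
      by (intro B2D) (use that in \<open>simp_all add: B2_def I2_def\<close>)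
    then show False by simp
  qed
  have eBL: "B (idx v) \<in> L" if "v \<in> ?R" for v using BL idx(1)[OF that] by blast
  have hcL: "B (hc i) \<in> L" for i using BL by blast
  have ee: "br (e v) (e w) = s (eps v * eps w) (br (B (idx v)) (B (idx w)))" if "v \<in> ?R" "w \<in> ?R" for v w
    using eBL[OF that(1)] eBL[OF that(2)] by (simp add: e_def br_scl br_scr L_closed)
  have pm: "s (eps v * eps w) y = y \<or> s (eps v * eps w) y = - y" for v w y
    using eps1[of v] eps1[of w] by auto
  have "E8_chevalley s L br t e"
    unfolding E8_chevalley_def
  proof (intro conjI ballI allI impI bas' t_inj e_inj)
    show "range t \<inter> e ` ?R = {}" using te by auto
    show "br (t i) (t j) = 0" for i j
      using hh[of i j] by (simp add: t_def br_negl br_negr hcL L_closed)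
    show "br (t i) (e v) = s (of_int (v i) / 2) (e v)" if v: "v \<in> ?R" for i v
      using hr[OF idx(1)[OF v], of i] idx(2)[OF v]
      by (simp add: t_def e_def br_negl br_scr hcL eBL[OF v] L_closed mult.commute)
    show "br (e v) (e w) = 0" if "v \<in> ?R" "w \<in> ?R" "v + w \<noteq> 0 \<and> v + w \<notin> ?R" for v w
      using nonroot[OF idx(1)[OF that(1)] idx(1)[OF that(2)]] idx(2) that by (simp add: ee)
    show "br (e v) (e w) = e (v + w) \<or> br (e v) (e w) = - e (v + w)"
      if "v \<in> ?R" "w \<in> ?R" "v + w \<in> ?R" for v w
    proof -
      have "br (B (idx v)) (B (idx w)) = B (idx (v + w)) \<or> br (B (idx v)) (B (idx w)) = - B (idx (v + w))"
        using root[OF idx(1)[OF that(1)] idx(1)[OF that(2)] idx(1)[OF that(3)]] idx(2) that by simp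
      moreover have "e (v + w) = B (idx (v + w)) \<or> e (v + w) = - B (idx (v + w))"
        using eps1[of "v + w"] by (auto simp: e_def)
      ultimately show ?thesis
        using ee[OF that(1,2)] pm[of v w "br (B (idx v)) (B (idx w))"] by auto
    qed
    show "br (e v) (e (- v)) = (\<Sum>i\<in>UNIV. s (of_int (v i) / 2) (t i))" if v: "v \<in> ?R" for v
    proof -
      note mv = uminus_E8[OF v]
      have v0: "v \<noteq> - v"
      proof
        assume "v = - v"
        then have "v i = 0" for i by (metis fun_apply(4) equal_neg_zero)
        then show False using E8_double_rootsD[OF v] by simp
      qed
      then have "idx v \<noteq> idx (- v)" using idx(2) v mv by metis
      then have fne: "f (idx v) \<noteq> f (idx (- v))" using inj_onD[OF f] idx(1) v mv by metis
      have pos: "br (e v) (e (- v)) = h v" if v: "v \<in> ?R" and lt: "f (idx v) < f (idx (- v))" for v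
      proof -
        note mv = uminus_E8[OF v]
        have 1: "eps v = 1" using lt by (simp add: eps_def)
        have 2: "eps (- v) = (if br (B (idx v)) (B (idx (- v))) = h v then 1 else - 1)"
          using lt by (simp add: eps_def)
        have "br (B (idx v)) (B (idx (- v))) = h v \<or> br (B (idx v)) (B (idx (- v))) = - h v"
          using h_opp[OF idx(1)[OF v] idx(1)[OF mv]] idx(2)[OF v] idx(2)[OF mv] by simp
        then show ?thesis unfolding ee[OF v mv] 1 2 by auto
      qed
      show ?thesis
      proof (cases "f (idx v) < f (idx (- v))")
        case True
        then show ?thesis using pos[OF v] by (simp add: h_def)
      next
        case False
        then have "f (idx (- v)) < f (idx (- (- v)))" using fne by simp
        then have "br (e (- v)) (e (- (- v))) = h (- v)" by (rule pos[OF mv])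
        moreover have "br (e v) (e (- v)) = - br (e (- v)) (e v)"
          by (rule br_anti) (simp_all add: e_def L_closed eBL v mv)
        ultimately show ?thesis by (simp add: hm h_def[symmetric])
      qed
    qed
  qed
  then show ?thesis unfolding has_E8_iff by blast
qed

section \<open>Symmetric composition algebras and triality\<close>

datatype ix = X0 | X1 | X2 | X3 | X4 | X5 | X6 | X7

lemma UNIV_ix: "UNIV = {X0, X1, X2, X3, X4, X5, X6, X7}"
  by (auto intro: ix.exhaust)

instance ix :: finite
  by standard (simp add: UNIV_ix)

lemma sum_ix: "(\<Sum>p\<in>UNIV. f p) = f X0 + f X1 + f X2 + f X3 + f X4 + f X5 + f X6 + f X7"
  by (simp add: UNIV_ix add.assoc)

text \<open>Orders the labels, so that the pairs with \<open>rk p < rk q\<close> represent the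
  two-element subsets.\<close>

primrec rk :: "ix \<Rightarrow> nat" where
  "rk X0 = 0" | "rk X1 = 1" | "rk X2 = 2" | "rk X3 = 3"
| "rk X4 = 4" | "rk X5 = 5" | "rk X6 = 6" | "rk X7 = 7"

lemma rk_inj: "rk p = rk q \<longleftrightarrow> p = q"
  by (cases p; cases q) simp_all

abbreviation fs :: "('k::field, 'v::ab_group_add) normed_alg \<Rightarrow> 'k \<Rightarrow> (3 \<Rightarrow> 'v \<Rightarrow> 'v) \<Rightarrow> 3 \<Rightarrow> 'v \<Rightarrow> 'v"
  where "fs S \<equiv> fun_scale (fun_scale (scl S))"

lemma fs_apply: "fs S a d i z = scl S a (d i z)"
  by (simp add: fun_scale_def)

text \<open>The axioms of a symmetric composition algebra in polarized form: \<open>mul_left\<close>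
  linearizes \<open>(x * y) * x = n(x) y\<close>. The identities are multilinear and speak of the
  polar form alone, so they may be checked on a basis and pass to the scalar extension.\<close>

locale symcomp =
  fixes S :: "('k::field, 'v::ab_group_add) normed_alg"
  assumes two: "(2 :: 'k) \<noteq> 0" and vs: "vector_space (scl S)"
    and mul_bilin: "bilin (scl S) (scl S) (scl S) (mul S)"
    and polar_bilin: "bilin (scl S) (scl S) (*) (polar S)"
    and polar_assoc: "polar S (mul S x y) z = polar S x (mul S y z)"
    and mul_left: "mul S (mul S x y) z + mul S (mul S z y) x = scl S (polar S x z) y"
    and nondeg: "(\<And>y. polar S x y = 0) \<Longrightarrow> x = 0"
begin

sublocale V: vector_space "scl S" by (rule vs)

sublocale F: vector_space "fs S"
  by (intro vector_space_fun_scale vs)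

abbreviation star (infixl "\<star>" 70) where "x \<star> y \<equiv> mul S x y"
abbreviation n where "n \<equiv> polar S"
abbreviation sc (infixr "\<odot>" 75) where "a \<odot> x \<equiv> scl S a x"

lemmas mul_lin [simp] = bilinD(1-12)[OF mul_bilin]
lemmas polar_lin [simp] = bilinD(1-12)[OF polar_bilin]

lemma polar_sym: "n x y = n y x"
  by (simp add: polar_def add.commute algebra_simps)

lemma polar_cyc: "n (x \<star> y) z = n (y \<star> z) x"
  using polar_assoc polar_sym by simp

lemma eq_by_polar: "(\<And>z. n x z = n y z) \<Longrightarrow> x = y"
  using nondeg[of "x - y"] by simp

lemma half: "(1 / 2 + 1 / 2 :: 'k) = 1" "(2 :: 'k) * (1 / 2) = 1"
  using two by (auto simp: field_simps)

lemma half_scale: "(c / 2) \<odot> x + (c / 2) \<odot> x = c \<odot> x"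
proof -
  have "c / 2 + c / 2 = c" using two by (simp add: field_simps)
  then show ?thesis by (metis V.scale_left_distrib)
qed

lemma mul_left': "(x \<star> y) \<star> z = n x z \<odot> y - (z \<star> y) \<star> x"
  using mul_left[of x y z] by (simp add: eq_diff_eq)

lemma mul_right: "x \<star> (y \<star> z) + z \<star> (y \<star> x) = n x z \<odot> y"
proof (rule eq_by_polar)
  fix w
  have "n (x \<star> (y \<star> z)) w = n x ((y \<star> z) \<star> w)"
    by (rule polar_assoc)
  also have "\<dots> = n y w * n x z - n x ((w \<star> z) \<star> y)"
    by (simp add: mul_left'[of y z w])
  also have "n x ((w \<star> z) \<star> y) = n (z \<star> (y \<star> x)) w"
    using polar_assoc polar_sym by metis
  finally show "n (x \<star> (y \<star> z) + z \<star> (y \<star> x)) w = n (n x z \<odot> y) w"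
    by (simp add: mult.commute)
qed

lemma mul_right': "x \<star> (y \<star> z) = n x z \<odot> y - z \<star> (y \<star> x)"
  using mul_right[of x y z] by (simp add: eq_diff_eq)

text \<open>\<open>mul_left'\<close> brings both products to the shape of nested left products by
  \<open>w\<close>, where \<open>mul_left\<close> applies once more. This exchange of the two inner
  factors is what \<open>t_tri\<close> and \<open>t_cyclic\<close> come down to.\<close>

lemma mul_mul: "(w \<star> x) \<star> (y \<star> z) + (w \<star> y) \<star> (x \<star> z)
    = n x (z \<star> w) \<odot> y + n y (z \<star> w) \<odot> x - n x y \<odot> (z \<star> w)"
proof -
  have 1: "(w \<star> x) \<star> (y \<star> z) = n y (z \<star> w) \<odot> x - ((y \<star> z) \<star> x) \<star> w" for x y
    unfolding mul_left'[of w x "y \<star> z"] using polar_assoc polar_sym by metis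
  have "((y \<star> z) \<star> x) \<star> w + ((x \<star> z) \<star> y) \<star> w = n x y \<odot> (z \<star> w)"
    using mul_left[of y z x] polar_sym[of x y] by (metis mul_lin(2) mul_lin(4))
  then show ?thesis
    unfolding 1 by (simp add: algebra_simps)
qed

subsection \<open>The triality Lie algebra\<close>

abbreviation t where "t \<equiv> t_elt S"

lemma t_0: "t x y 0 z = n x z \<odot> y - n y z \<odot> x"
  and t_1: "t x y 1 z = (n x y / 2) \<odot> z - (y \<star> z) \<star> x"
  and t_2: "t x y 2 z = (n x y / 2) \<odot> z - x \<star> (z \<star> y)"
  by (simp_all add: t_elt_def sigma_elt_def)

lemma orth_lieD:
  assumes "d \<in> orth_lie S"
  shows "Vector_Spaces.linear (scl S) (scl S) d" "n (d x) y = - n x (d y)" "n (d x) x = 0"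
proof -
  show "Vector_Spaces.linear (scl S) (scl S) d" and 1: "n (d x) y = - n x (d y)" for x y
    using assms unfolding orth_lie_def by (auto simp: eq_neg_iff_add_eq_0)
  have "2 * n (d x) x = 0"
    using 1[of x x] polar_sym[of x "d x"] by (simp add: eq_neg_iff_add_eq_0)
  then show "n (d x) x = 0" using two by simp
qed

lemma triD:
  assumes "d \<in> tri S"
  shows "d i \<in> orth_lie S" "Vector_Spaces.linear (scl S) (scl S) (d i)"
    "d 0 (x \<star> y) = d 1 x \<star> y + x \<star> d 2 y"
    "n (d i x) y = - n x (d i y)"
  using assms unfolding tri_def orth_lie_def by (auto simp: eq_neg_iff_add_eq_0)

lemma polar_mul_mul: "n (y \<star> z) (x \<star> w) + n (y \<star> w) (x \<star> z) = n x y * n z w"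
proof -
  have "n (y \<star> z) (x \<star> w) + n (y \<star> w) (x \<star> z) = n y (z \<star> (x \<star> w) + w \<star> (x \<star> z))"
    by (simp add: polar_assoc)
  also have "\<dots> = n x y * n z w"
    unfolding mul_right using polar_sym by simp
  finally show ?thesis .
qed

lemma t_orth: "t x y i \<in> orth_lie S"
proof -
  have "Vector_Spaces.linear (scl S) (scl S) (t x y i)"
    using exhaust_3[of i]
    by (auto intro!: linearI vs simp: t_0 t_1 t_2 V.scale_right_distrib V.scale_left_distrib
        V.scale_right_diff_distrib mult.commute)
  moreover have "n (t x y i z) w + n z (t x y i w) = 0" for z w
  proof -
    have 1: "n ((y \<star> z) \<star> x) w + n z ((y \<star> w) \<star> x) = n x y * n z w"
      using polar_mul_mul[of y z x w] polar_assoc polar_sym by metis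
    have 2: "n (x \<star> (z \<star> y)) w + n z (x \<star> (w \<star> y)) = n x y * n z w"
      using polar_mul_mul[of z y w x] polar_assoc polar_sym by (metis mult.commute)
    have h: "n x y / 2 * c + n x y / 2 * c = n x y * c" for c
      using two by (simp add: field_simps)
    consider "i = 0" | "i = 1" | "i = 2" using exhaust_3[of i] by auto
    then show ?thesis
    proof cases
      case 1
      then show ?thesis by (simp add: t_0 polar_sym[of z] mult.commute)
    next
      case 2
      then show ?thesis using 1 h[of "n z w"] by (simp add: t_1 algebra_simps)
    next
      case 3
      then show ?thesis using 2 h[of "n z w"] by (simp add: t_2 algebra_simps)
    qed
  qed
  ultimately show ?thesis unfolding orth_lie_def by blast
qed

lemma t_tri: "t x y \<in> tri S"
proof -
  have "t x y 0 (z \<star> w) = t x y 1 z \<star> w + z \<star> t x y 2 w" for z w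
  proof -
    have e1: "((y \<star> z) \<star> x) \<star> w = n y (z \<star> w) \<odot> x - (w \<star> x) \<star> (y \<star> z)"
      using mul_left'[of "y \<star> z" x w] by (simp add: polar_assoc)
    have e2: "z \<star> (x \<star> (w \<star> y)) = n y (z \<star> w) \<odot> x - (w \<star> y) \<star> (x \<star> z)"
      unfolding mul_right'[of z x "w \<star> y"] using polar_assoc polar_sym by metis
    have e3: "(w \<star> x) \<star> (y \<star> z) = n x (z \<star> w) \<odot> y + n y (z \<star> w) \<odot> x - n x y \<odot> (z \<star> w) - (w \<star> y) \<star> (x \<star> z)"
      using mul_mul[of w x y z] by (simp add: eq_diff_eq)
    have "t x y 1 z \<star> w + z \<star> t x y 2 w
      = n x y \<odot> (z \<star> w) - ((y \<star> z) \<star> x) \<star> w - z \<star> (x \<star> (w \<star> y))"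
      unfolding t_1 t_2 using half_scale[of "n x y" "z \<star> w"] by (simp add: algebra_simps)
    also have "\<dots> = t x y 0 (z \<star> w)"
      unfolding e1 e2 e3 t_0 by (simp add: algebra_simps)
    finally show ?thesis ..
  qed
  then show ?thesis
    unfolding tri_def using t_orth by blast
qed

text \<open>The condition on \<open>d\<close> says that the trilinear form
  \<open>n (x \<star> y) z\<close> is infinitesimally invariant under \<open>d 1\<close>,
  \<open>d 2\<close>, \<open>d 0\<close> in its three arguments. The form is cyclic, so the maps may
  be rotated.\<close>

lemma tri_shift2: assumes d: "d \<in> tri S" shows "shift 2 d \<in> tri S"
proof -
  have "d 1 (x \<star> y) = d 2 x \<star> y + x \<star> d 0 y" for x y
  proof (rule eq_by_polar)
    fix z
    have "n (d 1 (x \<star> y)) z = - n (x \<star> y) (d 1 z)" by (rule triD(4)[OF d])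
    also have "n (x \<star> y) (d 1 z) = n (d 1 z \<star> x) y"
      using polar_cyc by metis
    also have "d 1 z \<star> x = d 0 (z \<star> x) - z \<star> d 2 x"
      using triD(3)[OF d] by simp
    finally show "n (d 1 (x \<star> y)) z = n (d 2 x \<star> y + x \<star> d 0 y) z"
      using polar_cyc[of z "d 2 x" y] polar_cyc[of z x "d 0 y"] triD(4)[OF d, of 0 "z \<star> x" y] by simp
  qed
  then show ?thesis
    using triD(1)[OF d] unfolding tri_def shift_def by (simp add: Z3_simps)
qed

lemma tri_shift: assumes d: "d \<in> tri S" shows "shift i d \<in> tri S"
proof -
  have "shift 1 d = shift 2 (shift 2 d)" "shift 0 d = d"
    by (simp_all add: shift_def fun_eq_iff algebra_simps Z3_simps)
  then show ?thesis
    using exhaust_3[of i] tri_shift2 d by metis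
qed

lemma tri_rule:
  assumes d: "d \<in> tri S"
  shows "d i (x \<star> y) = d (i + 1) x \<star> y + x \<star> d (i + 2) y"
proof -
  have "shift (- i) d \<in> tri S" using tri_shift d by blast
  from triD(3)[OF this, of x y] show ?thesis
    by (simp add: shift_def add.commute)
qed

lemma tri_subspace: "F.subspace (tri S)"
proof (rule F.subspaceI)
  show "0 \<in> tri S"
    by (auto simp: tri_def orth_lie_def fun_apply intro!: linearI vs)
next
  fix d e assume d: "d \<in> tri S" and e: "e \<in> tri S"
  show "d + e \<in> tri S"
    using triD(4)[OF d] triD(4)[OF e] triD(3)[OF d] triD(3)[OF e]
    by (auto simp: tri_def orth_lie_def fun_apply linearD[OF triD(2)[OF d]] linearD[OF triD(2)[OF e]]
        V.scale_right_distrib algebra_simps intro!: linearI vs)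
next
  fix c d assume d: "d \<in> tri S"
  show "fs S c d \<in> tri S"
    using triD(4)[OF d] triD(3)[OF d]
    by (auto simp: tri_def orth_lie_def fs_apply fun_scale_def linearD[OF triD(2)[OF d]]
        V.scale_right_distrib mult.commute intro!: linearI vs)
qed

lemmas tri_closed = F.subspace_0[OF tri_subspace] F.subspace_add[OF tri_subspace]
  F.subspace_scale[OF tri_subspace] F.subspace_diff[OF tri_subspace] F.subspace_neg[OF tri_subspace]

lemma tri_bracket_tri: assumes d: "d \<in> tri S" and e: "e \<in> tri S" shows "tri_bracket d e \<in> tri S"
proof -
  note D = linearD[OF triD(2)[OF d]] and E = linearD[OF triD(2)[OF e]]
  have "Vector_Spaces.linear (scl S) (scl S) (tri_bracket d e i)" for i
    by (intro linearI vs) (simp_all add: tri_bracket_def D E V.scale_right_diff_distrib algebra_simps)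
  moreover have "n (tri_bracket d e i x) y + n x (tri_bracket d e i y) = 0" for i x y
    using triD(4)[OF d] triD(4)[OF e] by (simp add: tri_bracket_def)
  moreover have "tri_bracket d e 0 (x \<star> y) = tri_bracket d e 1 x \<star> y + x \<star> tri_bracket d e 2 y" for x y
    by (simp add: tri_bracket_def triD(3)[OF d] triD(3)[OF e] D E algebra_simps)
  ultimately show ?thesis unfolding tri_def orth_lie_def by blast
qed

lemma t_bilin: "bilin (scl S) (scl S) (fs S) t"
proof (rule bilinI[OF vs vs F.vector_space_axioms])
  show "t x (y + z) = t x y + t x z" for x y z
  proof (intro ext)
    fix i w show "t x (y + z) i w = (t x y + t x z) i w"
      using exhaust_3[of i] by (auto simp: fun_apply t_0 t_1 t_2 V.scale_left_distrib V.scale_right_distrib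
        add_divide_distrib algebra_simps)
  qed
  show "t (x + y) z = t x z + t y z" for x y z
  proof (intro ext)
    fix i w show "t (x + y) z i w = (t x z + t y z) i w"
      using exhaust_3[of i] by (auto simp: fun_apply t_0 t_1 t_2 V.scale_left_distrib V.scale_right_distrib
        add_divide_distrib algebra_simps)
  qed
  show "t x (a \<odot> y) = fs S a (t x y)" for a x y
  proof (intro ext)
    fix i w show "t x (a \<odot> y) i w = fs S a (t x y) i w"
      using exhaust_3[of i] by (auto simp: fs_apply t_0 t_1 t_2 V.scale_right_diff_distrib mult.commute)
  qed
  show "t (a \<odot> x) y = fs S a (t x y)" for a x y
  proof (intro ext)
    fix i w show "t (a \<odot> x) y i w = fs S a (t x y) i w"
      using exhaust_3[of i] by (auto simp: fs_apply t_0 t_1 t_2 V.scale_right_diff_distrib mult.commute)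
  qed
qed

text \<open>In the components at \<open>1\<close> and \<open>2\<close> the two halves of
  \<open>n x y\<close> add up to the whole, and what remains is \<open>mul_left\<close> or
  \<open>mul_right\<close>.\<close>

lemma t_swap: "t y x = - t x y"
proof (intro ext)
  fix i z
  have 1: "(n x y / 2) \<odot> z + (n x y / 2) \<odot> z = (x \<star> z) \<star> y + (y \<star> z) \<star> x"
    and 2: "(n x y / 2) \<odot> z + (n x y / 2) \<odot> z = x \<star> (z \<star> y) + y \<star> (z \<star> x)"
    unfolding half_scale mul_left mul_right by simp_all
  show "t y x i z = (- t x y) i z"
    using exhaust_3[of i] 1 2 polar_sym[of y x]
    by (auto simp: fun_apply t_0 t_1 t_2 algebra_simps eq_diff_eq diff_eq_eq)
qed

lemma t_same: "t x x = 0"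
proof -
  have "t x x + t x x = 0" using t_swap[of x x] by (simp add: eq_neg_iff_add_eq_0)
  then have "fs S 2 (t x x) = 0"
    by (metis F.scale_left_distrib F.scale_one one_add_one)
  then show ?thesis using two by simp
qed

end

text \<open>\<open>tri_inj\<close> is the injective half of local triality. It is an assumption here
  because it is established first for split algebras and then by descent. The basis may depend on
  the index in \<open>3\<close>: over the base field it will be constant, while a split triple has
  one basis for each index.\<close>

locale symcomp8 = symcomp S for S :: "('k::field, 'v::ab_group_add) normed_alg" +
  fixes b bd :: "3 \<Rightarrow> ix \<Rightarrow> 'v"
  assumes dual: "polar S (b i p) (bd i q) = (if p = q then 1 else 0)"
    and expand: "x = (\<Sum>p\<in>UNIV. scl S (polar S x (bd i p)) (b i p))"
    and tri_inj: "d \<in> tri S \<Longrightarrow> d 0 = 0 \<Longrightarrow> d = 0"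
begin

lemma tri_eqI: assumes "d \<in> tri S" "e \<in> tri S" "d 0 = e 0" shows "d = e"
proof -
  have "d - e \<in> tri S" "(d - e) 0 = 0"
    using assms tri_closed by (auto simp: fun_apply)
  then show ?thesis using tri_inj by fastforce
qed

text \<open>Both sides are triality triples, so comparing them at \<open>0\<close> suffices, where
  this is the usual bracket of a skew map with \<open>sigma_elt S x y\<close>. The components at
  \<open>1\<close> and \<open>2\<close> come for free.\<close>

lemma tri_bracket_t:
  assumes d: "d \<in> tri S"
  shows "tri_bracket d (t x y) = t (d 0 x) y + t x (d 0 y)"
proof (rule tri_eqI)
  show "tri_bracket d (t x y) \<in> tri S" "t (d 0 x) y + t x (d 0 y) \<in> tri S"
    by (intro tri_bracket_tri d t_tri tri_closed)+
  show "tri_bracket d (t x y) 0 = (t (d 0 x) y + t x (d 0 y)) 0"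
  proof
    fix z
    show "tri_bracket d (t x y) 0 z = (t (d 0 x) y + t x (d 0 y)) 0 z"
      using triD(4)[OF d, of 0 x z] triD(4)[OF d, of 0 y z]
      by (simp add: tri_bracket_def t_0 fun_apply linearD[OF triD(2)[OF d]] algebra_simps)
  qed
qed

lemma tri_bracket_shift: "tri_bracket (shift i d) (shift i e) = shift i (tri_bracket d e)"
  by (simp add: tri_bracket_def shift_def)

lemma tri_bracket_shift_t:
  assumes d: "d \<in> tri S"
  shows "tri_bracket d (shift i (t x y)) = shift i (t (d i x) y + t x (d i y))"
proof -
  have "d = shift i (shift (- i) d)" by (simp add: shift_def)
  then have "tri_bracket d (shift i (t x y)) = shift i (tri_bracket (shift (- i) d) (t x y))"
    using tri_bracket_shift by metis
  also have "tri_bracket (shift (- i) d) (t x y) = t (d i x) y + t x (d i y)"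
    using tri_bracket_t[OF tri_shift[OF d, of "- i"]] by (simp add: shift_def)
  finally show ?thesis .
qed

text \<open>Only the component at \<open>0\<close> is computed, and there the relation is
  \<open>mul_mul\<close>. It is the Jacobi identity for one element in each of the three
  \<iota>-components; in the Okubo case it also supplies the linear relations between the elements
  \<open>t\<close> of one degree.\<close>

lemma t_cyclic: "t (x \<star> y) z + shift 1 (t (y \<star> z) x) + shift 2 (t (z \<star> x) y) = 0"
proof (rule tri_inj)
  show "t (x \<star> y) z + shift 1 (t (y \<star> z) x) + shift 2 (t (z \<star> x) y) \<in> tri S"
    by (intro tri_closed tri_shift t_tri)
  show "(t (x \<star> y) z + shift 1 (t (y \<star> z) x) + shift 2 (t (z \<star> x) y)) 0 = 0"
  proof
    fix w
    have h: "(n (y \<star> z) x / 2) \<odot> w + (n (z \<star> x) y / 2) \<odot> w = n x (y \<star> z) \<odot> w"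
      using half_scale[of "n (y \<star> z) x"] polar_cyc[of z x y] polar_cyc[of x y z] polar_sym by metis
    have "(y \<star> z) \<star> (w \<star> x) + (y \<star> w) \<star> (z \<star> x)
      = n z (x \<star> y) \<odot> w + n w (x \<star> y) \<odot> z - n z w \<odot> (x \<star> y)"
      by (rule mul_mul)
    then have k: "(y \<star> z) \<star> (w \<star> x) = n z (x \<star> y) \<odot> w + n w (x \<star> y) \<odot> z - n z w \<odot> (x \<star> y) - (y \<star> w) \<star> (z \<star> x)"
      by (simp add: eq_diff_eq)
    have e: "n z (x \<star> y) = n x (y \<star> z)" "n w (x \<star> y) = n (x \<star> y) w"
      using polar_assoc polar_sym by metis+
    show "(t (x \<star> y) z + shift 1 (t (y \<star> z) x) + shift 2 (t (z \<star> x) y)) 0 w = 0 w"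
      using h by (simp add: shift_def fun_apply Z3_simps t_0 t_1 t_2 k e algebra_simps)
  qed
qed

text \<open>The components at \<open>0\<close> of the elements \<open>t (b 0 p) (b 0 q)\<close> are
  the elementary skew maps, and a skew map is determined by its matrix entries above the diagonal.
  By \<open>tri_inj\<close> nothing else has to be compared.\<close>

lemma tri_coord:
  assumes d: "d \<in> tri S"
  shows "d = (\<Sum>(p, q)\<in>{(p, q). rk p < rk q}. fs S (n (d 0 (bd 0 p)) (bd 0 q)) (t (b 0 p) (b 0 q)))"
    (is "d = ?e")
proof (rule tri_eqI)
  let ?L = "{(p, q). rk p < rk q}"
  show "d \<in> tri S" by fact
  show e: "?e \<in> tri S"
    by (intro F.subspace_sum tri_subspace) (auto intro: tri_closed t_tri)
  have e0: "n (?e 0 (bd 0 p)) (bd 0 q) = n (d 0 (bd 0 p)) (bd 0 q)" if "rk p < rk q" for p q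
  proof -
    have [simp]: "n (b 0 r) (bd 0 s) = (if r = s then 1 else 0)" for r s by (rule dual)
    have "n (?e 0 (bd 0 p)) (bd 0 q) = (\<Sum>(r, s)\<in>?L. n (d 0 (bd 0 r)) (bd 0 s) *
       ((if r = p then 1 else 0) * (if s = q then 1 else 0)
         - (if s = p then 1 else 0) * (if r = q then 1 else 0)))"
      by (simp add: sum_fun_apply fs_apply t_0 split_def)
    also have "\<dots> = (\<Sum>x\<in>?L. if x = (p, q) then n (d 0 (bd 0 p)) (bd 0 q) else 0)"
    proof (intro sum.cong refl, clarify)
      fix r s assume "rk r < rk s"
      then show "n (d 0 (bd 0 r)) (bd 0 s) * ((if r = p then 1 else 0) * (if s = q then 1 else 0)
          - (if s = p then 1 else 0) * (if r = q then 1 else 0))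
        = (if (r, s) = (p, q) then n (d 0 (bd 0 p)) (bd 0 q) else 0)"
        using that by (cases "r = p"; cases "s = q"; cases "s = p"; cases "r = q") simp_all
    qed
    also have "\<dots> = n (d 0 (bd 0 p)) (bd 0 q)" using that by simp
    finally show ?thesis .
  qed
  have all: "n (?e 0 (bd 0 p)) (bd 0 q) = n (d 0 (bd 0 p)) (bd 0 q)" for p q
  proof -
    consider "rk p < rk q" | "rk q < rk p" | "p = q" using rk_inj by force
    then show ?thesis
    proof cases
      case 1 then show ?thesis by (rule e0)
    next
      case 2
      have sk: "n (f 0 (bd 0 p)) (bd 0 q) = - n (f 0 (bd 0 q)) (bd 0 p)" if "f \<in> tri S" for f
        using triD(4)[OF that, of 0] polar_sym by metis
      show ?thesis unfolding sk[OF d] sk[OF e] e0[OF 2] ..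
    next
      case 3 then show ?thesis
        using orth_lieD(3)[OF triD(1)[OF d]] orth_lieD(3)[OF triD(1)[OF e]] by simp
    qed
  qed
  have 1: "x = y" if "\<And>p. n x (bd 0 p) = n y (bd 0 p)" for x y
    using expand[of x 0] expand[of y 0] that by simp
  have 2: "?e 0 (bd 0 p) = d 0 (bd 0 p)" for p
    by (rule 1) (rule all)
  show "d 0 = ?e 0"
  proof (intro ext 1)
    fix x p
    show "n (d 0 x) (bd 0 p) = n (?e 0 x) (bd 0 p)"
      unfolding triD(4)[OF d, of 0 x] triD(4)[OF e, of 0 x] 2 ..
  qed
qed

end

section \<open>The Lie algebra of a pair of symmetric composition algebras\<close>

definition tri_elt :: "(3 \<Rightarrow> 'v \<Rightarrow> 'v) \<Rightarrow> (3 \<Rightarrow> 'w \<Rightarrow> 'w)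
    \<Rightarrow> ('k::field, 'v::ab_group_add, 'w::ab_group_add) g_elt"
  where "tri_elt d d' = (d, d', 0)"

definition iota :: "3 \<Rightarrow> ('k::field, 'v::ab_group_add, 'w::ab_group_add) tensor \<Rightarrow> ('k, 'v, 'w) g_elt"
  where "iota m T = (0, 0, \<lambda>k. if k = m then T else 0)"

locale g_pair = A: symcomp8 S b bd + B: symcomp8 S' b' bd'
  for S :: "('k::field, 'v::ab_group_add) normed_alg" and b bd
    and S' :: "('k, 'w::ab_group_add) normed_alg" and b' bd'
begin

lemma tp: "tensor_pair (scl S) (scl S') (b i) (\<lambda>p x. polar S x (bd i p)) (b' i) (\<lambda>p x. polar S' x (bd' i p))"
proof (intro tensor_pair.intro tensor_pair_axioms.intro A.vs B.vs)
  show "x = (\<Sum>p\<in>UNIV. scl S (polar S x (bd i p)) (b i p))" for x by (rule A.expand)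
  show "x = (\<Sum>p\<in>UNIV. scl S' (polar S' x (bd' i p)) (b' i p))" for x by (rule B.expand)
  show "Vector_Spaces.linear (scl S) (*) (\<lambda>x. polar S x (bd i p))" for p
    using A.polar_bilin unfolding bilin_def by blast
  show "Vector_Spaces.linear (scl S') (*) (\<lambda>x. polar S' x (bd' i p))" for p
    using B.polar_bilin unfolding bilin_def by blast
qed

sublocale T: tensor_pair "scl S" "scl S'" "b 0" "\<lambda>p x. polar S x (bd 0 p)" "b' 0" "\<lambda>p x. polar S' x (bd' 0 p)"
  by (rule tp)

abbreviation tns where "tns \<equiv> tensor (scl S) (scl S')"
abbreviation TS where "TS \<equiv> tensor_space (scl S) (scl S') UNIV UNIV"
abbreviation L where "L \<equiv> g_space S S'"
abbreviation br where "br \<equiv> g_bracket S S'"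
abbreviation gs where "gs \<equiv> g_scale S S'"

lemma gs_simp: "gs a (d, d', T) = (fs S a d, fs S' a d', fun_scale (fun_scale (*)) a T)"
  by (simp add: g_scale_def)

lemma vs_tensor: "vector_space (fun_scale ((*) :: 'k \<Rightarrow> _) :: _ \<Rightarrow> ('k, 'v, 'w) tensor \<Rightarrow> _)"
  by (intro vector_space_fun_scale vector_space_field)

sublocale U: vector_space "fun_scale ((*) :: 'k \<Rightarrow> _) :: _ \<Rightarrow> ('k, 'v, 'w) tensor \<Rightarrow> _"
  by (rule vs_tensor)

lemma vs_g: "vector_space gs"
proof -
  interpret T3: vector_space "fun_scale (fun_scale ((*) :: 'k \<Rightarrow> _)) :: _ \<Rightarrow> (3 \<Rightarrow> ('k, 'v, 'w) tensor) \<Rightarrow> _"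
    by (intro vector_space_fun_scale vector_space_field)
  show ?thesis
  proof
    fix a c and x y :: "('k, 'v, 'w) g_elt"
    show "gs a (x + y) = gs a x + gs a y"
      by (cases x; cases y) (simp add: gs_simp A.F.scale_right_distrib B.F.scale_right_distrib T3.scale_right_distrib)
    show "gs (a + c) x = gs a x + gs c x"
      by (cases x) (simp add: gs_simp A.F.scale_left_distrib B.F.scale_left_distrib T3.scale_left_distrib)
    show "gs a (gs c x) = gs (a * c) x"
      by (cases x) (simp add: gs_simp)
    show "gs 1 x = x"
      by (cases x) (simp add: gs_simp)
  qed
qed

sublocale G: vector_space gs by (rule vs_g)

lemma L_iff: "(d, d', T) \<in> L \<longleftrightarrow> d \<in> tri S \<and> d' \<in> tri S' \<and> (\<forall>i. T i \<in> TS)"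
  by (simp add: g_space_def)

lemma L_subspace: "G.subspace L"
proof (rule G.subspaceI)
  show "0 \<in> L"
    by (simp add: zero_prod_def L_iff A.tri_closed B.tri_closed fun_apply tensor_space_closed)
  show "x + y \<in> L" if "x \<in> L" "y \<in> L" for x y
    using that by (cases x; cases y) (simp add: L_iff A.tri_closed B.tri_closed fun_apply tensor_space_closed)
  show "gs c x \<in> L" if "x \<in> L" for c x
    using that by (cases x) (simp add: gs_simp L_iff A.tri_closed B.tri_closed fun_scale_def[of "fun_scale (*)"] tensor_space_closed)
qed

lemma tri_elt_L: "d \<in> tri S \<Longrightarrow> d' \<in> tri S' \<Longrightarrow> tri_elt d d' \<in> L"
  by (simp add: tri_elt_def L_iff fun_apply tensor_space_closed)

lemma iota_L: "T \<in> TS \<Longrightarrow> iota i T \<in> L"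
  by (simp add: iota_def L_iff A.tri_closed B.tri_closed tensor_space_closed)

lemma g_split: "(d, d', T) = tri_elt d d' + iota 0 (T 0) + iota 1 (T 1) + iota 2 (T 2)"
proof -
  have "T = (\<lambda>k. if k = 0 then T 0 else 0) + (\<lambda>k. if k = 1 then T 1 else 0) + (\<lambda>k. if k = 2 then T 2 else 0)"
  proof
    fix k show "T k = ((\<lambda>k. if k = 0 then T 0 else 0) + (\<lambda>k. if k = 1 then T 1 else 0) + (\<lambda>k. if k = 2 then T 2 else 0)) k"
      using exhaust_3[of k] by (auto simp: fun_apply)
  qed
  then show ?thesis by (simp add: tri_elt_def iota_def)
qed

lemma iota_linear: "iota m (T + U) = iota m T + iota m U" "iota m (fun_scale (*) c T) = gs c (iota m T)"
  "iota m 0 = 0" "iota m (T - U) = iota m T - iota m U" "iota m (- T) = - iota m T"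
  by (auto simp: iota_def gs_simp fun_eq_iff fun_apply zero_prod_def fun_scale_def)

lemma iota_sum: "iota m (sum f A :: ('k, 'v, 'w) tensor) = (\<Sum>i\<in>A. iota m (f i))"
  by (induct A rule: infinite_finite_induct) (simp_all add: iota_linear)

lemma tri_elt_linear: "tri_elt (d + e) (d' + e') = tri_elt d d' + tri_elt e e'"
  "tri_elt (fs S c d) (fs S' c d') = gs c (tri_elt d d')" "tri_elt 0 0 = 0"
  "tri_elt (- d) (- d') = - tri_elt d d'"
  by (simp_all add: tri_elt_def gs_simp zero_prod_def) (simp add: fun_scale_def fun_eq_iff fun_apply)

lemma L_induct [consumes 1, case_names add tri iota]:
  assumes x: "x \<in> L" and a: "\<And>x y. x \<in> L \<Longrightarrow> y \<in> L \<Longrightarrow> P x \<Longrightarrow> P y \<Longrightarrow> P (x + y)"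
    and t: "\<And>d d'. d \<in> tri S \<Longrightarrow> d' \<in> tri S' \<Longrightarrow> P (tri_elt d d')"
    and i: "\<And>m x x'. P (iota m (tns x x'))"
  shows "P x"
proof -
  obtain d d' T where xe: "x = (d, d', T)" by (metis prod_cases3)
  have D: "d \<in> tri S" "d' \<in> tri S'" and T: "T i \<in> TS" for i using x unfolding xe L_iff by auto
  have z: "P 0" using t[OF A.tri_closed(1) B.tri_closed(1)] by (simp add: tri_elt_linear)
  have I: "P (iota m U) \<and> iota m U \<in> L" if "U \<in> TS" for m U
    using that
    by (induct rule: T.TS_induct)
       (auto simp: iota_linear z i iota_L a G.subspace_add[OF L_subspace] G.subspace_0[OF L_subspace] tensor_space_tensor)
  show ?thesis unfolding xe g_split
    by (intro a t D I[OF T, THEN conjunct1] I[OF T, THEN conjunct2] G.subspace_add[OF L_subspace] tri_elt_L)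
qed

subsection \<open>The bracket on generators\<close>

lemma act_bilin:
  assumes "d \<in> tri S" "d' \<in> tri S'"
  shows "bilin (scl S) (scl S') (fun_scale (*)) (\<lambda>x x'. tns (d i x) x' + tns x (d' i x'))"
  by (intro bilinI A.vs B.vs vs_tensor)
     (simp_all add: linearD[OF A.triD(2)[OF assms(1)]] linearD[OF B.triD(2)[OF assms(2)]]
       bilinD[OF T.tns_bilin] U.scale_right_distrib)

lemma mul_bilin4: "T.bilin4 (fun_scale (*)) (\<lambda>x x' y y'. tns (mul S x y) (mul S' x' y'))"
  unfolding T.bilin4_def
  by (intro conjI allI bilinI A.vs B.vs vs_tensor) (simp_all add: bilinD[OF T.tns_bilin])

lemma pair1_bilin4: "T.bilin4 (fs S) (\<lambda>x x' y y'. fs S (polar S' x' y') (shift i (t_elt S x y)))"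
proof -
  have [simp]: "shift i (d + e) = shift i d + shift i e" "shift i (fs S c d) = fs S c (shift i d)" for d e c
    by (simp_all add: shift_def fun_scale_def fun_eq_iff fun_apply)
  show ?thesis
    unfolding T.bilin4_def
    by (intro conjI allI bilinI A.vs B.vs A.F.vector_space_axioms)
       (simp_all add: bilinD[OF A.t_bilin] A.F.scale_left_distrib A.F.scale_right_distrib mult.commute)
qed

lemma pair2_bilin4: "T.bilin4 (fs S') (\<lambda>x x' y y'. fs S' (polar S x y) (shift i (t_elt S' x' y')))"
proof -
  have [simp]: "shift i (d + e) = shift i d + shift i e" "shift i (fs S' c d) = fs S' c (shift i d)" for d e c
    by (simp_all add: shift_def fun_scale_def fun_eq_iff fun_apply)
  show ?thesis
    unfolding T.bilin4_def
    by (intro conjI allI bilinI A.vs B.vs B.F.vector_space_axioms)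
       (simp_all add: bilinD[OF B.t_bilin] B.F.scale_left_distrib B.F.scale_right_distrib mult.commute)
qed

lemma tensor_mul_lift2: "tensor_mul S S' = T.lift2 (\<lambda>x x' y y'. tns (mul S x y) (mul S' x' y'))"
  by (simp add: tensor_mul_def T.lift2_def fun_eq_iff)

lemma pair1_lift2: "iota_pair\<^sub>1 S S' i = T.lift2 (\<lambda>x x' y y'. fs S (polar S' x' y') (shift i (t_elt S x y)))"
  by (simp add: iota_pair\<^sub>1_def T.lift2_def fun_eq_iff)

lemma pair2_lift2: "iota_pair\<^sub>2 S S' i = T.lift2 (\<lambda>x x' y y'. fs S' (polar S x y) (shift i (t_elt S' x' y')))"
  by (simp add: iota_pair\<^sub>2_def T.lift2_def fun_eq_iff)

lemmas mul_lin = T.lift2_linear[OF mul_bilin4, folded tensor_mul_lift2]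
lemmas pair1_lin = T.lift2_linear[OF pair1_bilin4, folded pair1_lift2]
lemmas pair2_lin = T.lift2_linear[OF pair2_bilin4, folded pair2_lift2]
lemmas mul_tns = T.lift2_tensor[OF mul_bilin4, folded tensor_mul_lift2]
lemmas pair1_tns = T.lift2_tensor[OF pair1_bilin4, folded pair1_lift2]
lemmas pair2_tns = T.lift2_tensor[OF pair2_bilin4, folded pair2_lift2]

lemma TS0: "0 \<in> TS" by (rule tensor_space_closed)

lemma lin0: "tensor_mul S S' 0 U = 0" "tensor_mul S S' U 0 = 0"
  "iota_pair\<^sub>1 S S' i 0 U = 0" "iota_pair\<^sub>1 S S' i U 0 = 0"
  "iota_pair\<^sub>2 S S' i 0 U = 0" "iota_pair\<^sub>2 S S' i U 0 = 0" if "U \<in> TS"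
  using mul_lin(5,6)[OF that that that] pair1_lin(5,6)[OF that that that] pair2_lin(5,6)[OF that that that]
  by auto

lemma act_lin:
  assumes "d \<in> tri S" "d' \<in> tri S'" "T \<in> TS" "U \<in> TS"
  shows "tri_action S S' d d' i (T + U) = tri_action S S' d d' i T + tri_action S S' d d' i U"
    "tri_action S S' d d' i (fun_scale (*) c T) = fun_scale (*) c (tri_action S S' d d' i T)"
    "tri_action S S' d d' i 0 = 0"
    "tri_action S S' d d' i (tns x x') = tns (d i x) x' + tns x (d' i x')"
  unfolding tri_action_def
  using T.tensor_lift_linear[OF act_bilin[OF assms(1,2)] assms(3,4)] T.tensor_lift_tensor[OF act_bilin[OF assms(1,2)]]
  by auto

lemma act_lin':
  assumes "d \<in> tri S" "d' \<in> tri S'" "e \<in> tri S" "e' \<in> tri S'" "T \<in> TS"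
  shows "tri_action S S' (d + e) (d' + e') i T = tri_action S S' d d' i T + tri_action S S' e e' i T"
    "tri_action S S' (fs S c d) (fs S' c d') i T = fun_scale (*) c (tri_action S S' d d' i T)"
    "tri_action S S' 0 0 i T = 0"
proof -
  have exp: "tri_action S S' f f' i T = (\<Sum>p\<in>UNIV. \<Sum>q\<in>UNIV. fun_scale (*) (T.tco T p q)
      (tns (f i (b 0 p)) (b' 0 q) + tns (b 0 p) (f' i (b' 0 q))))" if "f \<in> tri S" "f' \<in> tri S'" for f f'
    unfolding tri_action_def by (rule T.tensor_lift_expand[OF act_bilin[OF that] assms(5)])
  show "tri_action S S' (d + e) (d' + e') i T = tri_action S S' d d' i T + tri_action S S' e e' i T"
    using assms
    by (simp add: exp A.tri_closed B.tri_closed fun_apply bilinD[OF T.tns_bilin]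
        U.scale_right_distrib sum.distrib algebra_simps)
  show "tri_action S S' (fs S c d) (fs S' c d') i T = fun_scale (*) c (tri_action S S' d d' i T)"
    using assms
    by (simp add: exp A.tri_closed B.tri_closed fs_apply bilinD[OF T.tns_bilin]
        U.scale_right_distrib sum.distrib U.scale_sum_right mult.commute)
  show "tri_action S S' 0 0 i T = 0"
    by (simp add: exp A.tri_closed B.tri_closed fun_apply bilinD[OF T.tns_bilin])
qed

lemma act_TS: assumes "d \<in> tri S" "d' \<in> tri S'" "T \<in> TS" shows "tri_action S S' d d' i T \<in> TS"
  unfolding tri_action_def
  by (rule T.tensor_lift_in[OF act_bilin[OF assms(1,2)] assms(3) tensor_space_subspace])
     (auto intro!: tensor_space_closed tensor_space_tensor)

lemma mul_TS: "T \<in> TS \<Longrightarrow> U \<in> TS \<Longrightarrow> tensor_mul S S' T U \<in> TS"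
  unfolding tensor_mul_lift2
  by (rule T.lift2_in[OF mul_bilin4 _ _ tensor_space_subspace]) (auto intro!: tensor_space_tensor)

lemma pair_tri:
  assumes "T \<in> TS" "U \<in> TS"
  shows "iota_pair\<^sub>1 S S' i T U \<in> tri S" "iota_pair\<^sub>2 S S' i T U \<in> tri S'"
  unfolding pair1_lift2 pair2_lift2
  by (rule T.lift2_in[OF pair1_bilin4 assms A.tri_subspace] T.lift2_in[OF pair2_bilin4 assms B.tri_subspace],
      intro A.tri_closed A.tri_shift A.t_tri B.tri_closed B.tri_shift B.t_tri)+

lemma pair_swap:
  assumes "T \<in> TS" "U \<in> TS"
  shows "iota_pair\<^sub>1 S S' i T U = - iota_pair\<^sub>1 S S' i U T" "iota_pair\<^sub>2 S S' i T U = - iota_pair\<^sub>2 S S' i U T"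
proof -
  have sn: "shift i (- d) = - shift i d" for d :: "3 \<Rightarrow> 'z \<Rightarrow> 'z::ab_group_add"
    by (simp add: shift_def fun_eq_iff fun_apply)
  have p: "iota_pair\<^sub>1 S S' i (tns x x') (tns y y') = - iota_pair\<^sub>1 S S' i (tns y y') (tns x x')"
    "iota_pair\<^sub>2 S S' i (tns x x') (tns y y') = - iota_pair\<^sub>2 S S' i (tns y y') (tns x x')" for x x' y y'
    unfolding pair1_tns pair2_tns
    by (simp_all add: A.t_swap[of x y] B.t_swap[of x' y'] A.polar_sym[of x y] B.polar_sym[of x' y'] sn)
  have q: "U \<in> TS \<and> iota_pair\<^sub>1 S S' i (tns x x') U = - iota_pair\<^sub>1 S S' i U (tns x x')
      \<and> iota_pair\<^sub>2 S S' i (tns x x') U = - iota_pair\<^sub>2 S S' i U (tns x x')" for x x'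
    using assms(2)
  proof (induct rule: T.TS_induct)
    case (add T U)
    then show ?case
      using pair1_lin(1,2)[of T U "tns x x'"] pair2_lin(1,2)[of T U "tns x x'"]
      by (simp add: tensor_space_tensor tensor_space_closed)
  next
    case zero
    show ?case by (simp add: lin0 tensor_space_tensor TS0)
  next
    case (tensor y y')
    show ?case by (intro conjI p tensor_space_tensor) simp_all
  qed
  have "T \<in> TS \<and> iota_pair\<^sub>1 S S' i T U = - iota_pair\<^sub>1 S S' i U T
      \<and> iota_pair\<^sub>2 S S' i T U = - iota_pair\<^sub>2 S S' i U T"
    using assms(1)
  proof (induct rule: T.TS_induct)
    case (add T T')
    then show ?case
      using pair1_lin(1,2)[of T T' U] pair2_lin(1,2)[of T T' U] assms(2)
      by (simp add: tensor_space_closed)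
  next
    case zero
    show ?case by (simp add: lin0 assms(2) TS0)
  next
    case (tensor y y')
    show ?case using q by (intro conjI tensor_space_tensor) simp_all
  qed
  then show "iota_pair\<^sub>1 S S' i T U = - iota_pair\<^sub>1 S S' i U T" "iota_pair\<^sub>2 S S' i T U = - iota_pair\<^sub>2 S S' i U T"
    by auto
qed

lemma br_L: assumes "x \<in> L" "y \<in> L" shows "br x y \<in> L"
  using assms
  by (cases x; cases y)
     (auto simp: g_bracket_def L_iff sum_3 intro!: A.tri_closed B.tri_closed A.tri_bracket_tri
       B.tri_bracket_tri pair_tri tensor_space_closed act_TS mul_TS)

lemma br_swap: assumes "x \<in> L" "y \<in> L" shows "br x y = - br y x"
proof -
  obtain d d' T e e' U where xy: "x = (d, d', T)" "y = (e, e', U)" by (metis prod_cases3)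
  have T: "T i \<in> TS" and U: "U i \<in> TS" for i using assms unfolding xy L_iff by auto
  have "tri_bracket d e = - tri_bracket e d" "tri_bracket d' e' = - tri_bracket e' d'"
    by (simp_all add: tri_bracket_def fun_eq_iff fun_apply)
  then show ?thesis
    using pair_swap[OF T U]
    by (simp add: xy g_bracket_def sum_3) (simp add: fun_eq_iff fun_apply)
qed

lemma br_add_left: assumes "x \<in> L" "y \<in> L" "z \<in> L" shows "br (x + y) z = br x z + br y z"
proof -
  obtain d d' T e e' U f f' W where xyz: "x = (d, d', T)" "y = (e, e', U)" "z = (f, f', W)"
    by (metis prod_cases3)
  have D: "d \<in> tri S" "d' \<in> tri S'" "e \<in> tri S" "e' \<in> tri S'" "f \<in> tri S" "f' \<in> tri S'"
    and T: "T i \<in> TS" and U: "U i \<in> TS" and W: "W i \<in> TS" for i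
    using assms unfolding xyz L_iff by auto
  have 1: "tri_bracket (d + e) f = tri_bracket d f + tri_bracket e f"
    "tri_bracket (d' + e') f' = tri_bracket d' f' + tri_bracket e' f'"
    using linearD(1)[OF A.triD(2)[OF D(5)]] linearD(1)[OF B.triD(2)[OF D(6)]]
    by (simp_all add: tri_bracket_def fun_eq_iff fun_apply)
  have 2: "(T + U) i = T i + U i" for i by (simp add: fun_apply)
  show ?thesis
    by (simp add: xyz g_bracket_def 1 2 sum_3 mul_lin[OF T U W] pair1_lin[OF T U W] pair2_lin[OF T U W]
        act_lin[OF D(5,6) T U] act_lin'[OF D(1-4) W]) (simp add: fun_eq_iff fun_apply)
qed

lemma br_scale_left: assumes "x \<in> L" "z \<in> L" shows "br (gs c x) z = gs c (br x z)"
proof -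
  obtain d d' T f f' W where xyz: "x = (d, d', T)" "z = (f, f', W)"
    by (metis prod_cases3)
  have D: "d \<in> tri S" "d' \<in> tri S'" "f \<in> tri S" "f' \<in> tri S'"
    and T: "T i \<in> TS" and W: "W i \<in> TS" for i
    using assms unfolding xyz L_iff by auto
  have 1: "tri_bracket (fs S c d) f = fs S c (tri_bracket d f)"
    "tri_bracket (fs S' c d') f' = fs S' c (tri_bracket d' f')"
    using linearD(2)[OF A.triD(2)[OF D(3)]] linearD(2)[OF B.triD(2)[OF D(4)]]
    by (simp_all add: tri_bracket_def fun_eq_iff fs_apply A.V.scale_right_diff_distrib B.V.scale_right_diff_distrib)
  have 2: "fun_scale (fun_scale (*)) c T i = fun_scale (*) c (T i)" for i by (simp add: fun_scale_def)
  have 3: "fun_scale (fun_scale (*)) c (\<lambda>k. f k) = (\<lambda>k. fun_scale (*) c (f k))" for f :: "3 \<Rightarrow> ('k,'v,'w) tensor"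
    by (simp add: fun_scale_def)
  show ?thesis
    by (simp add: xyz gs_simp g_bracket_def 1 2 3 sum_3 mul_lin[OF T T W] pair1_lin[OF T T W] pair2_lin[OF T T W]
        act_lin[OF D(3,4) T T] act_lin'[OF D(1,2) D(1,2) W] A.F.scale_right_distrib B.F.scale_right_distrib
        U.scale_right_distrib U.scale_right_diff_distrib)
qed

lemma br_add_right: assumes "x \<in> L" "y \<in> L" "z \<in> L" shows "br z (x + y) = br z x + br z y"
  unfolding br_swap[OF assms(3) assms(1)] br_swap[OF assms(3) assms(2)]
    br_swap[OF assms(3) G.subspace_add[OF L_subspace assms(1,2)]] br_add_left[OF assms]
  by simp

lemma br_scale_right: assumes "x \<in> L" "z \<in> L" shows "br z (gs c x) = gs c (br z x)"
  unfolding br_swap[OF assms(2,1)] br_swap[OF assms(2) G.subspace_scale[OF L_subspace assms(1)]]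
    br_scale_left[OF assms] by simp

lemma br_self: assumes "x \<in> L" shows "br x x = 0"
proof -
  have "br x x + br x x = 0" using br_swap[OF assms assms] by (simp only: eq_neg_iff_add_eq_0)
  then have "gs 2 (br x x) = 0"
    by (metis G.scale_left_distrib G.scale_one one_add_one)
  then show ?thesis using A.two by simp
qed

lemma br_tri_tri:
  assumes "d \<in> tri S" "d' \<in> tri S'" "e \<in> tri S" "e' \<in> tri S'"
  shows "br (tri_elt d d') (tri_elt e e') = tri_elt (tri_bracket d e) (tri_bracket d' e')"
  by (simp add: tri_elt_def g_bracket_def fun_apply lin0 TS0 act_lin[OF assms(1,2) TS0 TS0]
      act_lin[OF assms(3,4) TS0 TS0]) (simp add: fun_eq_iff fun_apply)

lemma br_tri_iota:
  assumes "d \<in> tri S" "d' \<in> tri S'"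
  shows "br (tri_elt d d') (iota m (tns x x')) = iota m (tns (d m x) x' + tns x (d' m x'))"
proof -
  have TT: "tns x x' \<in> TS" by (simp add: tensor_space_tensor)
  have "tri_bracket d 0 = 0" "tri_bracket d' 0 = 0"
    using linearD(5)[OF A.triD(2)[OF assms(1)]] linearD(5)[OF B.triD(2)[OF assms(2)]]
    by (simp_all add: tri_bracket_def fun_eq_iff fun_apply)
  moreover have "tri_action S S' 0 0 k 0 = 0" for k
    by (rule act_lin'(3)[OF assms assms TS0])
  ultimately show ?thesis
    by (auto simp: tri_elt_def iota_def g_bracket_def fun_apply lin0[OF TT] lin0[OF TS0] sum_3
        act_lin[OF assms TT TT] fun_eq_iff)
qed

lemma br_iota_tri:
  assumes "d \<in> tri S" "d' \<in> tri S'"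
  shows "br (iota m (tns x x')) (tri_elt d d') = - iota m (tns (d m x) x' + tns x (d' m x'))"
  unfolding br_tri_iota[OF assms, symmetric]
  by (rule br_swap) (simp_all add: iota_L tensor_space_tensor tri_elt_L assms)

lemma br_iota_same:
  "br (iota m (tns x x')) (iota m (tns y y')) =
    tri_elt (fs S (polar S' x' y') (shift m (t_elt S x y))) (fs S' (polar S x y) (shift m (t_elt S' x' y')))"
proof -
  have TT: "tns x x' \<in> TS" "tns y y' \<in> TS" by (simp_all add: tensor_space_tensor)
  have z: "tri_bracket 0 0 = 0" by (simp add: tri_bracket_def fun_eq_iff fun_apply)
  have a: "tri_action S S' 0 0 k U = 0" if "U \<in> TS" for k U
    by (rule act_lin'(3)[OF _ _ _ _ that]) (rule A.tri_closed B.tri_closed)+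
  have ne: "k + 1 \<noteq> k + 2" "k + 2 \<noteq> k + 1" for k :: 3
    using exhaust_3[of k] by auto
  have m: "tensor_mul S S' (if k + 1 = m then T else 0) (if k + 2 = m then U else 0) = 0"
    if "T \<in> TS" "U \<in> TS" for k T U
    using ne[of k] lin0[OF that(1)] lin0[OF that(2)] lin0[OF TS0] by auto
  have p: "(\<Sum>i\<in>UNIV. iota_pair\<^sub>1 S S' i (if i = m then T else 0) (if i = m then U else 0)) = iota_pair\<^sub>1 S S' m T U"
    "(\<Sum>i\<in>UNIV. iota_pair\<^sub>2 S S' i (if i = m then T else 0) (if i = m then U else 0)) = iota_pair\<^sub>2 S S' m T U" for T U
    using exhaust_3[of m] by (auto simp: sum_3 lin0[OF TS0])
  show ?thesis
    using TT by (simp add: iota_def tri_elt_def g_bracket_def z a m p pair1_tns pair2_tns TS0)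
      (simp add: fun_eq_iff fun_apply a TS0)
qed

lemma br_iota_next:
  "br (iota m (tns x x')) (iota (m + 1) (tns y y')) = iota (m + 2) (tns (mul S x y) (mul S' x' y'))"
proof -
  have TT: "tns x x' \<in> TS" "tns y y' \<in> TS" by (simp_all add: tensor_space_tensor)
  have z: "tri_bracket 0 0 = 0" by (simp add: tri_bracket_def fun_eq_iff fun_apply)
  have a: "tri_action S S' 0 0 k U = 0" if "U \<in> TS" for k U
    by (rule act_lin'(3)[OF _ _ _ _ that]) (rule A.tri_closed B.tri_closed)+
  have p: "iota_pair\<^sub>1 S S' i (if i = m then tns x x' else 0) (if i = m + 1 then tns y y' else 0) = 0"
    "iota_pair\<^sub>2 S S' i (if i = m then tns x x' else 0) (if i = m + 1 then tns y y' else 0) = 0" for i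
    using exhaust_3[of m] exhaust_3[of i] by (auto simp: lin0[OF TS0] lin0[OF TT(1)] lin0[OF TT(2)])
  have sub: "k + 1 = m \<longleftrightarrow> k = m + 2" "k + 2 = m + 1 \<longleftrightarrow> k = m + 2" for k
    using exhaust_3[of m] exhaust_3[of k] by auto
  have q: "tri_action S S' 0 0 k (if k = m + 1 then tns y y' else 0) - tri_action S S' 0 0 k (if k = m then tns x x' else 0)
       + tensor_mul S S' (if k + 1 = m then tns x x' else 0) (if k + 2 = m + 1 then tns y y' else 0)
       - tensor_mul S S' (if k + 1 = m + 1 then tns y y' else 0) (if k + 2 = m then tns x x' else 0)
     = (if k = m + 2 then tns (mul S x y) (mul S' x' y') else 0)" for k
    using exhaust_3[of m] exhaust_3[of k]
    by (elim disjE) (simp_all add: a TT TS0 lin0[OF TS0] lin0[OF TT(1)] lin0[OF TT(2)] mul_tns)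
  show ?thesis
    unfolding iota_def g_bracket_def by (simp only: z p q prod.case fun_apply sum.neutral_const add_0_left)
qed

lemma br_iota_prev:
  "br (iota (m + 1) (tns y y')) (iota m (tns x x')) = - iota (m + 2) (tns (mul S x y) (mul S' x' y'))"
  unfolding br_iota_next[symmetric]
  by (rule br_swap) (simp_all add: iota_L tensor_space_tensor)

end

lemma shift_lin: "shift i (d + e) = shift i d + shift i e" "shift i (- d) = - shift i d" "shift i 0 = 0"
  for d e :: "3 \<Rightarrow> 'z \<Rightarrow> 'z::ab_group_add"
  by (simp_all add: shift_def fun_eq_iff fun_apply)

lemma shift_fs: "shift i (fs Q c d) = fs Q c (shift i d)"
  by (simp add: shift_def fun_eq_iff fs_apply)

lemma shift_shift: "shift i (shift j d) = shift (i + j) d"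
  by (simp add: shift_def fun_eq_iff algebra_simps)

subsection \<open>The Jacobi identity\<close>

context g_pair
begin

lemma br_minus_right: assumes "x \<in> L" "z \<in> L" shows "br z (- x) = - br z x"
  using br_scale_right[OF assms, of "-1"] by simp

lemma tns_L [simp]: "iota m (tns x x') \<in> L" "tns x x' \<in> TS"
  by (simp_all add: iota_L tensor_space_tensor)

lemma iota_L2 [simp]: "iota m (tns x x' + tns y y') \<in> L"
  by (intro iota_L tensor_space_closed tensor_space_tensor UNIV_I)

lemma br_iota_cases:
  "br (iota m (tns x x')) (iota (m + 1) (tns y y')) = iota (m + 2) (tns (mul S x y) (mul S' x' y'))"
  "br (iota (m + 1) (tns x x')) (iota (m + 2) (tns y y')) = iota m (tns (mul S x y) (mul S' x' y'))"
  "br (iota (m + 2) (tns x x')) (iota m (tns y y')) = iota (m + 1) (tns (mul S x y) (mul S' x' y'))"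
  "br (iota (m + 1) (tns x x')) (iota m (tns y y')) = - iota (m + 2) (tns (mul S y x) (mul S' y' x'))"
  "br (iota (m + 2) (tns x x')) (iota (m + 1) (tns y y')) = - iota m (tns (mul S y x) (mul S' y' x'))"
  "br (iota m (tns x x')) (iota (m + 2) (tns y y')) = - iota (m + 1) (tns (mul S y x) (mul S' y' x'))"
proof -
  have e: "m + 1 + 1 = m + 2" "m + 1 + 2 = m" "m + 2 + 1 = m" "m + 2 + 2 = m + 1"
    using exhaust_3[of m] by auto
  show "br (iota m (tns x x')) (iota (m + 1) (tns y y')) = iota (m + 2) (tns (mul S x y) (mul S' x' y'))"
    and "br (iota (m + 1) (tns x x')) (iota (m + 2) (tns y y')) = iota m (tns (mul S x y) (mul S' x' y'))"
    and "br (iota (m + 2) (tns x x')) (iota m (tns y y')) = iota (m + 1) (tns (mul S x y) (mul S' x' y'))"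
    and "br (iota (m + 1) (tns x x')) (iota m (tns y y')) = - iota (m + 2) (tns (mul S y x) (mul S' y' x'))"
    and "br (iota (m + 2) (tns x x')) (iota (m + 1) (tns y y')) = - iota m (tns (mul S y x) (mul S' y' x'))"
    and "br (iota m (tns x x')) (iota (m + 2) (tns y y')) = - iota (m + 1) (tns (mul S y x) (mul S' y' x'))"
    using br_iota_next[of m] br_iota_next[of "m + 1"] br_iota_next[of "m + 2"]
      br_iota_prev[of m] br_iota_prev[of "m + 1"] br_iota_prev[of "m + 2"] unfolding e by auto
qed

lemma tri_elt_diff: "tri_elt d d' - tri_elt e e' = tri_elt (d - e) (d' - e')"
  by (simp add: tri_elt_def)

definition jac where "jac x y z = br x (br y z) + br y (br z x) + br z (br x y)"

lemma jac_cyc: "jac x y z = jac y z x"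
  by (simp add: jac_def ac_simps)

lemma jac_swap: assumes "x \<in> L" "y \<in> L" "z \<in> L" shows "jac y x z = - jac x y z"
proof -
  have "br y (br x z) = - br y (br z x)" "br x (br z y) = - br x (br y z)" "br z (br y x) = - br z (br x y)"
    using br_swap[of x z] br_swap[of z y] br_swap[of y x] br_minus_right br_L assms by metis+
  then show ?thesis by (simp add: jac_def)
qed

lemma jac_add: assumes "x \<in> L" "x' \<in> L" "y \<in> L" "z \<in> L"
  shows "jac (x + x') y z = jac x y z + jac x' y z"
  using assms by (simp add: jac_def br_add_left br_add_right br_L algebra_simps)

lemma A_bracket_fs: "d \<in> tri S \<Longrightarrow> tri_bracket d (fs S c e) = fs S c (tri_bracket d e)"
  and B_bracket_fs: "d' \<in> tri S' \<Longrightarrow> tri_bracket d' (fs S' c e') = fs S' c (tri_bracket d' e')"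
  by (simp_all add: tri_bracket_def fun_eq_iff fs_apply linearD(2)[OF A.triD(2)] linearD(2)[OF B.triD(2)]
     A.V.scale_right_diff_distrib B.V.scale_right_diff_distrib)

lemma shift_tri [simp]: "fs S c (shift i (t_elt S x y)) \<in> tri S" "fs S' c (shift i (t_elt S' x' y')) \<in> tri S'"
  by (intro A.tri_closed A.tri_shift A.t_tri B.tri_closed B.tri_shift B.t_tri)+

lemma jac_TTT:
  assumes "d \<in> tri S" "d' \<in> tri S'" "e \<in> tri S" "e' \<in> tri S'" "f \<in> tri S" "f' \<in> tri S'"
  shows "jac (tri_elt d d') (tri_elt e e') (tri_elt f f') = 0"
proof -
  note lin = linearD(7)[OF A.triD(2)[OF assms(1)]] linearD(7)[OF A.triD(2)[OF assms(3)]]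
    linearD(7)[OF A.triD(2)[OF assms(5)]] linearD(7)[OF B.triD(2)[OF assms(2)]]
    linearD(7)[OF B.triD(2)[OF assms(4)]] linearD(7)[OF B.triD(2)[OF assms(6)]]
  show ?thesis
    using assms
    by (simp add: jac_def br_tri_tri A.tri_bracket_tri B.tri_bracket_tri tri_elt_linear(1)[symmetric])
       (simp add: tri_elt_def zero_prod_def fun_eq_iff fun_apply tri_bracket_def lin)
qed

lemma jac_TTI:
  assumes "d \<in> tri S" "d' \<in> tri S'" "e \<in> tri S" "e' \<in> tri S'"
  shows "jac (tri_elt d d') (tri_elt e e') (iota m (tns x x')) = 0"
  using assms
  by (simp add: jac_def br_tri_iota br_iota_tri br_tri_tri A.tri_bracket_tri B.tri_bracket_tri
      br_minus_right tri_elt_L)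
     (simp add: iota_linear br_add_right tri_elt_L br_tri_iota tri_bracket_def bilinD[OF T.tns_bilin] algebra_simps)

lemma jac_TII_same:
  assumes "d \<in> tri S" "d' \<in> tri S'"
  shows "jac (tri_elt d d') (iota m (tns x x')) (iota m (tns y y')) = 0"
proof -
  have 1: "polar S' y' (d' m x') = - polar S' x' (d' m y')" "polar S y (d m x) = - polar S x (d m y)"
    using A.triD(4)[OF assms(1)] B.triD(4)[OF assms(2)] A.polar_sym B.polar_sym by metis+
  have 2: "t_elt S y (d m x) = - t_elt S (d m x) y" "t_elt S' y' (d' m x') = - t_elt S' (d' m x') y'"
    "t_elt S y x = - t_elt S x y" "t_elt S' y' x' = - t_elt S' x' y'"
    by (rule A.t_swap B.t_swap)+
  have 3: "polar S' y' x' = polar S' x' y'" "polar S y x = polar S x y"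
    by (rule A.polar_sym B.polar_sym)+
  show ?thesis
    using assms
    by (simp add: jac_def br_iota_same br_tri_iota br_iota_tri br_tri_tri br_minus_right A_bracket_fs
        B_bracket_fs A.tri_bracket_shift_t B.tri_bracket_shift_t)
      (simp add: iota_linear br_add_right br_iota_same tri_elt_linear(1)[symmetric] tri_elt_linear(4)[symmetric]
        tri_elt_linear(3)[symmetric] 1 2 3 shift_lin A.F.scale_right_distrib B.F.scale_right_distrib tri_elt_diff del: minus_add_distrib)
qed

lemma jac_TII_next:
  assumes "d \<in> tri S" "d' \<in> tri S'"
  shows "jac (tri_elt d d') (iota m (tns x x')) (iota (m + 1) (tns y y')) = 0"
proof -
  have e: "m + 2 + 1 = m" "m + 2 + 2 = m + 1" using exhaust_3[of m] by auto
  show ?thesis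
    using assms A.tri_rule[OF assms(1), of "m + 2" x y] B.tri_rule[OF assms(2), of "m + 2" x' y'] unfolding e
    by (simp add: jac_def br_iota_cases br_tri_iota br_iota_tri br_minus_right)
       (simp add: iota_linear br_add_right br_iota_cases bilinD[OF T.tns_bilin])
qed

lemma br_iota_pair:
  "br (iota k (tns z z')) (tri_elt (fs S c (shift m (t_elt S x y))) (fs S' c' (shift m (t_elt S' x' y'))))
    = - iota k (tns (scl S c (t_elt S x y (k - m) z)) z' + tns z (scl S' c' (t_elt S' x' y' (k - m) z')))"
  by (subst br_iota_tri[OF shift_tri]) (simp add: fs_apply shift_def)

lemma jac_III_same: "jac (iota m (tns x x')) (iota m (tns y y')) (iota m (tns z z')) = 0"
proof -
  have s: "polar S y x = polar S x y" "polar S z x = polar S x z" "polar S z y = polar S y z"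
    "polar S' y' x' = polar S' x' y'" "polar S' z' x' = polar S' x' z'" "polar S' z' y' = polar S' y' z'"
    by (rule A.polar_sym B.polar_sym)+
  show ?thesis
    by (simp add: jac_def br_iota_same br_iota_pair)
       (simp add: A.t_0 B.t_0 s bilinD[OF T.tns_bilin] iota_linear A.V.scale_right_diff_distrib
          B.V.scale_right_diff_distrib algebra_simps)
qed

lemma half_sum: "(fun_scale (*) (c' * (c / 2)) T :: ('k, 'v, 'w) tensor) + fun_scale (*) (c * (c' / 2)) T = fun_scale (*) (c * c') T"
proof -
  have "c' * (c / 2) + c * (c' / 2) = c * c'" using A.two by (simp add: field_simps)
  then show ?thesis by (metis U.scale_left_distrib)
qed

text \<open>The reason for the halves in \<open>t_elt\<close>: the term
  \<open>c c' z \<otimes> z'\<close> is contributed half by the triality algebra of \<open>S\<close>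
  and half by that of \<open>S'\<close>, while the mixed terms match one by one.\<close>

lemma jac_half:
  assumes "z1 = scl S c z - y1" "z1' = scl S' c' z' - y1'"
  shows "tns z1 z1' - tns y1 y1'
    = tns (scl S c' (scl S (c / 2) z - y1)) z' + tns z (scl S' c (scl S' (c' / 2) z' - y1'))"
  unfolding assms using half_sum[of c' c "tns z z'"]
  by (simp add: bilinD[OF T.tns_bilin] A.V.scale_right_diff_distrib B.V.scale_right_diff_distrib
      U.scale_right_diff_distrib algebra_simps)

lemma jac_III_next: "jac (iota m (tns x x')) (iota m (tns y y')) (iota (m + 1) (tns z z')) = 0"
proof -
  have "mul S (mul S x z) y = scl S (polar S x y) z - mul S (mul S y z) x"
    "mul S' (mul S' x' z') y' = scl S' (polar S' x' y') z' - mul S' (mul S' y' z') x'"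
    by (rule A.mul_left' B.mul_left')+
  note h = jac_half[OF this]
  show ?thesis
    unfolding jac_def br_iota_cases br_iota_same br_iota_pair
    by (simp add: br_minus_right br_iota_cases A.t_1 B.t_1 h[symmetric] iota_linear)
qed

lemma jac_III_prev: "jac (iota m (tns x x')) (iota m (tns y y')) (iota (m + 2) (tns z z')) = 0"
proof -
  have "mul S y (mul S z x) = scl S (polar S x y) z - mul S x (mul S z y)"
    "mul S' y' (mul S' z' x') = scl S' (polar S' x' y') z' - mul S' x' (mul S' z' y')"
    using A.mul_right'[of y z x] B.mul_right'[of y' z' x'] by (simp_all add: A.polar_sym[of x y] B.polar_sym[of x' y'])
  note h = jac_half[OF this]
  show ?thesis
    unfolding jac_def br_iota_cases br_iota_same br_iota_pair
    by (simp add: br_minus_right br_iota_cases A.t_2 B.t_2 h[symmetric] iota_linear)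
qed

text \<open>By cyclicity of \<open>n (x \<star> y) z\<close> the three brackets carry the same
  scalar, which can be pulled out; what remains is \<open>t_cyclic\<close> in each of the two
  factors.\<close>

lemma jac_III_distinct: "jac (iota m (tns x x')) (iota (m + 1) (tns y y')) (iota (m + 2) (tns z z')) = 0"
proof -
  have p: "polar S y (mul S z x) = polar S x (mul S y z)" "polar S z (mul S x y) = polar S x (mul S y z)"
    "polar S' y' (mul S' z' x') = polar S' x' (mul S' y' z')" "polar S' z' (mul S' x' y') = polar S' x' (mul S' y' z')"
    using A.polar_cyc A.polar_sym B.polar_cyc B.polar_sym by metis+
  have "shift m (t_elt S x (mul S y z)) + shift (m + 1) (t_elt S y (mul S z x)) + shift (m + 2) (t_elt S z (mul S x y))
      = - shift m (t_elt S (mul S y z) x + shift 1 (t_elt S (mul S z x) y) + shift 2 (t_elt S (mul S x y) z))"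
    unfolding A.t_swap[of x] A.t_swap[of y] A.t_swap[of z] by (simp add: shift_lin shift_shift)
  then have a: "shift m (t_elt S x (mul S y z)) + shift (m + 1) (t_elt S y (mul S z x)) + shift (m + 2) (t_elt S z (mul S x y)) = 0"
    unfolding A.t_cyclic by (simp add: shift_lin)
  have "shift m (t_elt S' x' (mul S' y' z')) + shift (m + 1) (t_elt S' y' (mul S' z' x')) + shift (m + 2) (t_elt S' z' (mul S' x' y'))
      = - shift m (t_elt S' (mul S' y' z') x' + shift 1 (t_elt S' (mul S' z' x') y') + shift 2 (t_elt S' (mul S' x' y') z'))"
    unfolding B.t_swap[of x'] B.t_swap[of y'] B.t_swap[of z'] by (simp add: shift_lin shift_shift)
  then have b: "shift m (t_elt S' x' (mul S' y' z')) + shift (m + 1) (t_elt S' y' (mul S' z' x')) + shift (m + 2) (t_elt S' z' (mul S' x' y')) = 0"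
    unfolding B.t_cyclic by (simp add: shift_lin)
  show ?thesis
    unfolding jac_def br_iota_cases br_iota_same p
    by (simp only: tri_elt_linear(1)[symmetric] A.F.scale_right_distrib[symmetric] B.F.scale_right_distrib[symmetric] a b)
       (simp add: tri_elt_linear)
qed

text \<open>The relative position of three indices modulo \<open>3\<close> has nine cases.
  Rotations, and one transposition when the three indices come in reversed order, reduce them to the
  four cases treated above.\<close>

lemma jac_III: "jac (iota i (tns x x')) (iota j (tns y y')) (iota k (tns z z')) = 0"
proof -
  have e: "i = j + 2" if "j = i + 1" for i j :: 3 using exhaust_3[of i] exhaust_3[of j] that by auto
  have e': "i = j + 1" if "j = i + 2" for i j :: 3 using exhaust_3[of i] exhaust_3[of j] that by auto
  have c: "j = i \<or> j = i + 1 \<or> j = i + 2" for i j :: 3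
    using exhaust_3[of i] exhaust_3[of j] by auto
  have sw: "jac (iota i (tns x x')) (iota j (tns y y')) (iota k (tns z z'))
      = - jac (iota i (tns x x')) (iota k (tns z z')) (iota j (tns y y'))"
    using jac_cyc jac_swap[OF tns_L(1) tns_L(1) tns_L(1)] by metis
  consider "i = j" "k = i" | "i = j" "k = i + 1" | "i = j" "k = i + 2" | "j = i + 1" "k = i" | "j = i + 2" "k = i"
    | "j = i + 1" "k = i + 1" | "j = i + 2" "k = i + 2" | "j = i + 1" "k = i + 2" | "j = i + 2" "k = i + 1"
    using c[of j i] c[of k i] by metis
  then show ?thesis
  proof cases
    case 6 then show ?thesis using jac_III_prev[of j y y' z z' x x'] e[OF 6(1)] jac_cyc by metis
  next
    case 7 then show ?thesis using jac_III_next[of j y y' z z' x x'] e'[OF 7(1)] jac_cyc by metis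
  next
    case 9 then show ?thesis unfolding sw using jac_III_distinct by simp
  next
    case 4 then show ?thesis using jac_III_next jac_cyc by metis
  next
    case 5 then show ?thesis using jac_III_prev jac_cyc by metis
  qed (simp_all add: jac_III_same jac_III_next jac_III_prev jac_III_distinct)
qed

lemma jac_TII:
  assumes "d \<in> tri S" "d' \<in> tri S'"
  shows "jac (tri_elt d d') (iota i (tns x x')) (iota j (tns y y')) = 0"
proof -
  have "j = i \<or> j = i + 1 \<or> i = j + 1"
    using exhaust_3[of i] exhaust_3[of j] by auto
  moreover have "jac (tri_elt d d') (iota i (tns x x')) (iota j (tns y y'))
      = - jac (tri_elt d d') (iota j (tns y y')) (iota i (tns x x'))"
    using jac_cyc jac_swap[OF tns_L(1) tns_L(1) tri_elt_L[OF assms]] by metis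
  ultimately show ?thesis
    using jac_TII_same[OF assms] jac_TII_next[OF assms] by auto
qed

lemma jac_perm: "jac y z x = 0 \<Longrightarrow> jac x y z = 0" "jac z x y = 0 \<Longrightarrow> jac x y z = 0"
  using jac_cyc[of x y z] jac_cyc[of z x y] by simp_all

text \<open>The identity is additive in each argument, and rotation by \<open>jac_cyc\<close> brings
  every argument to the first place, where \<open>L_induct\<close> reduces it to generators.\<close>

lemma jacobi: assumes "x \<in> L" "y \<in> L" "z \<in> L" shows "jac x y z = 0"
proof -
  define gen where "gen v \<longleftrightarrow> (\<exists>d\<in>tri S. \<exists>d'\<in>tri S'. v = tri_elt d d') \<or> (\<exists>m x x'. v = iota m (tns x x'))" for v
  have genI: "d \<in> tri S \<Longrightarrow> d' \<in> tri S' \<Longrightarrow> gen (tri_elt d d')" "gen (iota m (tns x x'))" for d d' m x x'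
    unfolding gen_def by blast+
  have genL: "v \<in> L" if "gen v" for v using that tri_elt_L unfolding gen_def by auto
  have 1: "jac u v w = 0" if "gen u" "gen v" "gen w" for u v w
    using that unfolding gen_def
    by (elim disjE bexE exE)
       (simp_all add: jac_TTT jac_TTI jac_TII jac_III jac_perm[OF jac_TTI] jac_perm[OF jac_TII])
  have 2: "jac u v w = 0" if "u \<in> L" and v: "gen v" and w: "gen w" for u v w
    using that(1)
  proof (induct rule: L_induct)
    case (add x y)
    then show ?case by (simp add: jac_add genL v w)
  qed (intro 1[OF _ v w] genI; assumption?)+
  have 3: "jac u v w = 0" if u: "u \<in> L" and "v \<in> L" and w: "gen w" for u v w
  proof -
    have "jac v w u = 0"
      using that(2)
    proof (induct rule: L_induct)
      case (add x y)
      then show ?case by (simp add: jac_add genL u w)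
    qed (intro jac_perm(2)[OF 2[OF u _ w]] genI; assumption?)+
    then show ?thesis by (rule jac_perm)
  qed
  have "jac z x y = 0"
    using assms(3)
  proof (induct rule: L_induct)
    case (add x' y')
    then show ?case by (simp add: jac_add assms)
  qed (intro jac_perm(1)[OF 3[OF assms(1,2)]] genI; assumption?)+
  then show ?thesis by (rule jac_perm)
qed

theorem g_lie_algebra: "lie_algebra gs L br"
  unfolding lie_algebra_def
proof (intro conjI ballI allI)
  show "vector_space gs" by (rule vs_g)
  show "G.subspace L" by (rule L_subspace)
qed (use jacobi in \<open>auto simp: br_L br_add_left br_add_right br_scale_left br_scale_right br_self jac_def\<close>)

end

subsection \<open>The standard basis\<close>

datatype gi = TA ix ix | TB ix ix | TI 3 ix ix

abbreviation Lam :: "(ix \<times> ix) set" where "Lam \<equiv> {(p, q). rk p < rk q}"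

text \<open>\<open>28 + 28 + 3 * 64 = 248\<close> labels.\<close>

definition GI :: "gi set"
  where "GI = case_prod TA ` Lam \<union> case_prod TB ` Lam \<union> range (\<lambda>(m, p, q). TI m p q)"

lemma GI_iff [simp]: "TA p q \<in> GI \<longleftrightarrow> rk p < rk q" "TB p q \<in> GI \<longleftrightarrow> rk p < rk q" "TI m p q \<in> GI"
  unfolding GI_def by (auto simp: image_iff)

lemma finite_GI: "finite GI" by (simp add: GI_def)

lemma sum_GI: "(\<Sum>r\<in>GI. f r) = (\<Sum>(p, q)\<in>Lam. f (TA p q)) + (\<Sum>(p, q)\<in>Lam. f (TB p q))
    + (\<Sum>m\<in>UNIV. \<Sum>p\<in>UNIV. \<Sum>q\<in>UNIV. f (TI m p q))"
proof -
  have i: "inj_on (case_prod TA) Lam" "inj_on (case_prod TB) Lam" "inj (\<lambda>(m, p, q). TI m p q)"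
    by (auto simp: inj_on_def)
  have "(\<Sum>r\<in>GI. f r) = (\<Sum>r\<in>case_prod TA ` Lam. f r) + (\<Sum>r\<in>case_prod TB ` Lam. f r)
      + (\<Sum>r\<in>range (\<lambda>(m, p, q). TI m p q). f r)"
    unfolding GI_def by (subst sum.union_disjoint; auto)+
  also have "(\<Sum>r\<in>range (\<lambda>(m, p, q). TI m p q). f r) = (\<Sum>(m, p, q)\<in>UNIV. f (TI m p q))"
    using sum.reindex[OF i(3), of f] by (simp add: split_def o_def)
  also have "\<dots> = (\<Sum>m\<in>UNIV. \<Sum>p\<in>UNIV. \<Sum>q\<in>UNIV. f (TI m p q))"
    by (simp add: sum.cartesian_product split_def)
  finally show ?thesis
    using sum.reindex[OF i(1), of f] sum.reindex[OF i(2), of f] by (simp add: split_def o_def)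
qed

context g_pair
begin

fun Bg :: "gi \<Rightarrow> ('k, 'v, 'w) g_elt" where
  "Bg (TA p q) = tri_elt (t_elt S (b 0 p) (b 0 q)) 0"
| "Bg (TB p q) = tri_elt 0 (t_elt S' (b' 0 p) (b' 0 q))"
| "Bg (TI m p q) = iota m (tns (b m p) (b' m q))"

text \<open>The triality parts are read off from their component at \<open>0\<close>, which
  determines them. The \<iota>-part at \<open>m\<close> uses the basis belonging to
  \<open>m\<close>, so that in the split case its labels are weights of the right
  representation.\<close>

fun cog :: "('k, 'v, 'w) g_elt \<Rightarrow> gi \<Rightarrow> 'k" where
  "cog (d, d', T) (TA p q) = polar S (d 0 (bd 0 p)) (bd 0 q)"
| "cog (d, d', T) (TB p q) = polar S' (d' 0 (bd' 0 p)) (bd' 0 q)"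
| "cog (d, d', T) (TI m p q) = T m (\<lambda>x x'. polar S x (bd m p) * polar S' x' (bd' m q))"

lemma cog_linear: "cog (x + y) r = cog x r + cog y r" "cog (gs c x) r = c * cog x r" "cog 0 r = 0"
proof -
  show "cog (x + y) r = cog x r + cog y r"
    by (cases x; cases y; cases r) (simp_all add: fun_apply)
  show "cog (gs c x) r = c * cog x r"
    by (cases x; cases r) (simp_all add: gs_simp fun_scale_def)
  show "cog 0 r = 0"
    by (cases r) (simp_all add: zero_prod_def fun_apply)
qed

lemma cog_sum: "cog (sum f I) r = (\<Sum>i\<in>I. cog (f i) r)"
  by (induct I rule: infinite_finite_induct) (simp_all add: cog_linear)

lemma tns_eval: "tns x x' (\<lambda>x x'. polar S x (bd m p) * polar S' x' (bd' m q)) = polar S x (bd m p) * polar S' x' (bd' m q)"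
  using tensor_pair.tco_simps(5)[OF tp[of m], of x x' p q] unfolding tensor_pair.tco_def[OF tp[of m]] .

lemma cog_Bg:
  assumes "r \<in> GI" "s \<in> GI" shows "cog (Bg r) s = (if r = s then 1 else 0)"
proof -
  have "rk p < rk q \<Longrightarrow> p \<noteq> q" for p q by auto
  then show ?thesis
    using assms
    by (cases r; cases s)
       (auto simp: tri_elt_def iota_def fun_apply A.t_0 B.t_0 A.dual B.dual tns_eval)
qed

lemma g_coord: "coord_system gs L GI Bg cog"
  unfolding coord_system_def
proof (intro conjI ballI allI)
  show "finite GI" by (rule finite_GI)
  show "G.subspace L" by (rule L_subspace)
  show "Bg ` GI \<subseteq> L"
  proof
    fix v assume "v \<in> Bg ` GI"
    then obtain r where "v = Bg r" by auto
    then show "v \<in> L" by (cases r) (auto intro!: tri_elt_L A.t_tri B.t_tri A.tri_closed B.tri_closed)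
  qed
next
  fix c and s assume s: "s \<in> GI"
  show "cog (\<Sum>r\<in>GI. gs (c r) (Bg r)) s = c s"
    using s by (simp add: cog_sum cog_linear cog_Bg finite_GI if_distrib[of "\<lambda>a. _ * a"] cong: if_cong)
next
  fix v assume v: "v \<in> L"
  obtain d d' T where ve: "v = (d, d', T)" by (metis prod_cases3)
  have D: "d \<in> tri S" "d' \<in> tri S'" and T: "T i \<in> TS" for i using v unfolding ve L_iff by auto
  have 1: "tri_elt d 0 = (\<Sum>(p, q)\<in>Lam. gs (cog v (TA p q)) (Bg (TA p q)))"
  proof -
    have "tri_elt (\<Sum>r\<in>I. f r) 0 = (\<Sum>r\<in>I. tri_elt (f r) (0 :: 3 \<Rightarrow> 'w \<Rightarrow> 'w))" for I and f :: "_ \<Rightarrow> 3 \<Rightarrow> 'v \<Rightarrow> 'v"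
      by (induct I rule: infinite_finite_induct) (simp_all add: tri_elt_linear tri_elt_linear(1)[of _ _ 0 0, simplified])
    moreover have "gs c (tri_elt e 0) = tri_elt (fs S c e) 0" for c e
      using tri_elt_linear(2)[of c e 0] by simp
    ultimately show ?thesis
      by (subst A.tri_coord[OF D(1)]) (simp add: ve split_def)
  qed
  have 2: "tri_elt 0 d' = (\<Sum>(p, q)\<in>Lam. gs (cog v (TB p q)) (Bg (TB p q)))"
  proof -
    have "tri_elt 0 (\<Sum>r\<in>I. f r) = (\<Sum>r\<in>I. tri_elt (0 :: 3 \<Rightarrow> 'v \<Rightarrow> 'v) (f r))" for I and f :: "_ \<Rightarrow> 3 \<Rightarrow> 'w \<Rightarrow> 'w"
      by (induct I rule: infinite_finite_induct) (simp_all add: tri_elt_linear tri_elt_linear(1)[of 0 0, simplified])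
    moreover have "gs c (tri_elt 0 e) = tri_elt 0 (fs S' c e)" for c e
      using tri_elt_linear(2)[of c 0 e] by simp
    ultimately show ?thesis
      by (subst B.tri_coord[OF D(2)]) (simp add: ve split_def)
  qed
  have 3: "iota m (T m) = (\<Sum>p\<in>UNIV. \<Sum>q\<in>UNIV. gs (cog v (TI m p q)) (Bg (TI m p q)))" for m
    by (subst tensor_pair.tensor_expand[OF tp[of m] T])
       (simp add: iota_sum iota_linear ve tensor_pair.tco_def[OF tp[of m]])
  have "v = tri_elt d 0 + tri_elt 0 d' + (iota 0 (T 0) + iota 1 (T 1) + iota 2 (T 2))"
    unfolding ve g_split tri_elt_linear(1)[symmetric] by (simp add: add.assoc)
  also have "\<dots> = (\<Sum>r\<in>GI. gs (cog v r) (Bg r))"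
    unfolding sum_GI sum_3 1 2 3 by (simp only: add.assoc)
  finally show "v = (\<Sum>r\<in>GI. gs (cog v r) (Bg r))" .
qed

end

section \<open>Extension of scalars\<close>

text \<open>Extension of scalars, on coordinate vectors with respect to the basis \<open>c\<close>
  with dual family \<open>cd\<close>. The quadratic form is recovered from the polar form by
  halving.\<close>

definition ext_alg ::
  "('k::field, 'v::ab_group_add) normed_alg \<Rightarrow> (ix \<Rightarrow> 'v) \<Rightarrow> (ix \<Rightarrow> 'v) \<Rightarrow> ('k alg_closure, ix \<Rightarrow> 'k alg_closure) normed_alg"
  where "ext_alg S c cd = \<lparr>
    scl = fun_scale (*),
    mul = (\<lambda>u v l. \<Sum>i\<in>UNIV. \<Sum>j\<in>UNIV. u i * v j * to_ac (polar S (mul S (c i) (c j)) (cd l))),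
    nrm = (\<lambda>u. (\<Sum>i\<in>UNIV. \<Sum>j\<in>UNIV. u i * u j * to_ac (polar S (c i) (c j))) / 2)\<rparr>"

locale symcomp_basis = symcomp S for S :: "('k::field, 'v::ab_group_add) normed_alg" +
  fixes c cd :: "ix \<Rightarrow> 'v"
  assumes c_dual: "polar S (c p) (cd q) = (if p = q then 1 else 0)"
    and c_expand: "x = (\<Sum>p\<in>UNIV. scl S (polar S x (cd p)) (c p))"
begin

abbreviation SK where "SK \<equiv> ext_alg S c cd"

definition ext :: "'v \<Rightarrow> ix \<Rightarrow> 'k alg_closure" where "ext x = (\<lambda>l. to_ac (n x (cd l)))"

lemma SK_simps: "scl SK = fun_scale (*)"
  "mul SK u v = (\<lambda>l. \<Sum>i\<in>UNIV. \<Sum>j\<in>UNIV. u i * v j * to_ac (n (c i \<star> c j) (cd l)))"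
  "nrm SK u = (\<Sum>i\<in>UNIV. \<Sum>j\<in>UNIV. u i * u j * to_ac (n (c i) (c j))) / 2"
  by (simp_all add: ext_alg_def)

lemma two_K: "(2 :: 'k alg_closure) \<noteq> 0"
  using two by (metis to_ac_numeral to_ac_eq_0_iff)

lemma SK_polar: "polar SK u v = (\<Sum>i\<in>UNIV. \<Sum>j\<in>UNIV. u i * v j * to_ac (n (c i) (c j)))"
proof -
  let ?q = "\<lambda>u v. (\<Sum>i\<in>UNIV. \<Sum>j\<in>UNIV. u i * v j * to_ac (n (c i) (c j)))"
  have s: "?q v u = ?q u v"
  proof -
    have "v i * u j * to_ac (n (c i) (c j)) = u j * v i * to_ac (n (c j) (c i))" for i j
      using polar_sym[of "c i" "c j"] by (simp add: mult.commute)
    then show ?thesis by (subst sum.swap) (simp only:)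
  qed
  have "?q (u + v) (u + v) = ?q u u + ?q u v + ?q v u + ?q v v"
    by (simp add: fun_apply algebra_simps sum.distrib)
  moreover have alg: "(x + y + y + z) / 2 - x / 2 - z / 2 = y" for x y z :: "'k alg_closure"
  proof -
    have "(x + y + y + z) / 2 - x / 2 - z / 2 = y / 2 + y / 2" by (simp add: add_divide_distrib)
    also have "\<dots> = y" using two_K by (simp add: add_divide_distrib[symmetric] mult_2[symmetric])
    finally show ?thesis .
  qed
  ultimately have "polar SK u v = (?q u u + ?q u v + ?q u v + ?q v v) / 2 - ?q u u / 2 - ?q v v / 2"
    unfolding polar_def[of SK] SK_simps s by simp
  also have "\<dots> = ?q u v" by (rule alg)
  finally show ?thesis .
qed

lemma vs_K: "vector_space (fun_scale (*) :: 'k alg_closure \<Rightarrow> (ix \<Rightarrow> 'k alg_closure) \<Rightarrow> _)"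
  by (intro vector_space_fun_scale vector_space_field)

lemma SK_mul_bilin: "bilin (scl SK) (scl SK) (scl SK) (mul SK)"
  unfolding SK_simps(1)
proof (intro bilinI vs_K)
qed (auto simp: SK_simps fun_eq_iff fun_apply fun_scale_def algebra_simps sum.distrib sum_distrib_left)

lemma SK_polar_bilin: "bilin (scl SK) (scl SK) (*) (polar SK)"
  unfolding SK_simps(1)
proof (intro bilinI vs_K vector_space_field)
qed (auto simp: SK_polar fun_eq_iff fun_apply fun_scale_def algebra_simps sum.distrib sum_distrib_left)

lemma ext_add: "ext (x + y) = ext x + ext y"
  and ext_scale: "ext (a \<odot> x) = fun_scale (*) (to_ac a) (ext x)"
  and ext_zero: "ext 0 = 0"
  by (simp_all add: ext_def fun_eq_iff fun_apply fun_scale_def)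

lemma ext_diff: "ext (x - y) = ext x - ext y"
  by (simp add: ext_def fun_eq_iff fun_apply)

lemma ext_c: "ext (c p) = (\<lambda>l. if l = p then 1 else 0)"
  by (auto simp: ext_def c_dual fun_eq_iff)

lemma ext_decomp: "u = (\<Sum>p\<in>UNIV. fun_scale (*) (u p) (ext (c p)))"
  by (auto simp: fun_eq_iff sum_fun_apply fun_scale_def ext_c if_distrib[of "\<lambda>a. _ * a"] cong: if_cong)

lemma ext_inj: "ext x = 0 \<Longrightarrow> x = 0"
  using c_expand[of x] by (simp add: ext_def fun_eq_iff fun_apply)

lemma n_expand: "n x y = (\<Sum>i\<in>UNIV. \<Sum>j\<in>UNIV. n x (cd i) * n y (cd j) * n (c i) (c j))"
proof -
  have 1: "n x y = (\<Sum>i\<in>UNIV. n x (cd i) * n (c i) y)" for x y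
    by (subst c_expand[of x]) simp
  have 2: "n x y = (\<Sum>j\<in>UNIV. n y (cd j) * n x (c j))" for x y
    by (subst c_expand[of y]) simp
  show ?thesis by (subst 1, subst 2) (simp add: sum_distrib_left mult.assoc)
qed

lemma mul_expand: "x \<star> y = (\<Sum>i\<in>UNIV. \<Sum>j\<in>UNIV. (n x (cd i) * n y (cd j)) \<odot> (c i \<star> c j))"
proof -
  have 1: "x \<star> y = (\<Sum>i\<in>UNIV. n x (cd i) \<odot> (c i \<star> y))" for x y
    by (subst c_expand[of x]) simp
  have 2: "x \<star> y = (\<Sum>j\<in>UNIV. n y (cd j) \<odot> (x \<star> c j))" for x y
    by (subst c_expand[of y]) simp
  show ?thesis by (subst 1, subst 2) (simp add: V.scale_sum_right)
qed

lemma ext_polar: "polar SK (ext x) (ext y) = to_ac (n x y)"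
  by (subst n_expand[of x y]) (simp add: SK_polar ext_def to_ac_sum)

lemma ext_mul: "mul SK (ext x) (ext y) = ext (x \<star> y)"
  by (subst mul_expand[of x y]) (simp add: SK_simps ext_def to_ac_sum)

lemma ext_induct:
  assumes "\<And>x. P (ext x)" "\<And>u v. P u \<Longrightarrow> P v \<Longrightarrow> P (u + v)" "\<And>a u. P u \<Longrightarrow> P (fun_scale (*) a u)"
  shows "P u"
proof -
  have "P (\<Sum>p\<in>A. fun_scale (*) (u p) (ext (c p)))" if "finite A" for A
    using that by induct (use assms assms(1)[of 0] in \<open>simp_all add: ext_zero\<close>)
  then show ?thesis using ext_decomp[of u] by (metis finite)
qed

lemmas SK_mul_lin = bilinD[OF SK_mul_bilin, unfolded SK_simps(1)]
lemmas SK_polar_lin = bilinD[OF SK_polar_bilin, unfolded SK_simps(1)]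

lemma SK_symcomp: "symcomp SK"
proof -
  interpret K: vector_space "fun_scale (*) :: 'k alg_closure \<Rightarrow> (ix \<Rightarrow> 'k alg_closure) \<Rightarrow> _" by (rule vs_K)
  show ?thesis
  proof (rule symcomp.intro)
    show "(2 :: 'k alg_closure) \<noteq> 0" by (rule two_K)
    show "bilin (scl SK) (scl SK) (scl SK) (mul SK)" "bilin (scl SK) (scl SK) (*) (polar SK)"
      by (rule SK_mul_bilin SK_polar_bilin)+
    show "u = 0" if "\<And>v. polar SK u v = 0" for u
    proof -
      have "polar SK u (ext (cd q)) = u q" for q
        by (subst ext_decomp[of u]) (simp add: SK_polar_lin ext_polar c_dual if_distrib[of to_ac] if_distrib[of "\<lambda>a. _ * a"] cong: if_cong)
      then show "u = 0" using that by (simp add: fun_eq_iff fun_apply)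
    qed
    show "polar SK (mul SK u v) w = polar SK u (mul SK v w)" for u v w
    proof (induct u rule: ext_induct)
      case (1 x)
      show ?case
      proof (induct v rule: ext_induct)
        case (1 y)
        show ?case
          by (induct w rule: ext_induct)
             (simp_all add: ext_mul ext_polar polar_assoc SK_mul_lin SK_polar_lin)
      qed (simp_all add: SK_mul_lin SK_polar_lin)
    qed (simp_all add: SK_mul_lin SK_polar_lin)
    show "mul SK (mul SK u v) w + mul SK (mul SK w v) u = scl SK (polar SK u w) v" for u v w
      unfolding SK_simps(1)
    proof (induct u rule: ext_induct)
      case (1 x)
      show ?case
      proof (induct v rule: ext_induct)
        case (1 y)
        show ?case
        proof (induct w rule: ext_induct)
          case (1 z)
          show ?case by (simp add: ext_mul ext_polar ext_add[symmetric] mul_left ext_scale)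
        next
          case (2 w w')
          then show ?case by (simp add: SK_mul_lin SK_polar_lin K.scale_left_distrib algebra_simps)
        next
          case (3 a w)
          then show ?case by (simp add: SK_mul_lin SK_polar_lin K.scale_right_distrib[symmetric] K.scale_scale[symmetric] del: K.scale_scale)
        qed
      next
        case (2 w w')
        then show ?case by (simp add: SK_mul_lin K.scale_right_distrib algebra_simps)
      next
        case (3 a w)
        then show ?case by (simp add: SK_mul_lin K.scale_right_distrib[symmetric] K.scale_left_commute[of _ a] del: K.scale_scale)
      qed
    next
      case (2 w w')
      then show ?case by (simp add: SK_mul_lin SK_polar_lin K.scale_left_distrib algebra_simps)
    next
      case (3 a w)
      then show ?case by (simp add: SK_mul_lin SK_polar_lin K.scale_right_distrib[symmetric] K.scale_scale[symmetric] del: K.scale_scale)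
    qed
  next
    show "vector_space (scl SK)" unfolding SK_simps(1) by (rule vs_K)
  qed
qed

lemma SK_dual: "polar SK (ext (c p)) (ext (cd q)) = (if p = q then 1 else 0)"
  by (simp add: ext_polar c_dual)

lemma SK_expand: "u = (\<Sum>p\<in>UNIV. scl SK (polar SK u (ext (cd p))) (ext (c p)))"
proof -
  have "polar SK u (ext (cd q)) = u q" for q
    by (subst ext_decomp[of u]) (simp add: SK_polar_lin SK_dual if_distrib[of "\<lambda>a. _ * a"] cong: if_cong)
  then show ?thesis using ext_decomp[of u] by (simp add: SK_simps(1))
qed

lemma ext_t: "t_elt SK (ext x) (ext y) i (ext z) = ext (t x y i z)"
proof -
  interpret K: symcomp SK by (rule SK_symcomp)
  consider "i = 0" | "i = 1" | "i = 2" using exhaust_3[of i] by auto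
  then show ?thesis
    by cases (simp_all add: K.t_0 K.t_1 K.t_2 t_0 t_1 t_2 ext_mul ext_polar ext_diff ext_scale SK_simps(1))
qed

text \<open>A triple over the base field extends linearly to one over the closure with the same
  vanishing component, and \<open>ext\<close> is injective.\<close>

lemma tri_inj_descent:
  assumes inj: "\<And>d. d \<in> tri SK \<Longrightarrow> d 0 = 0 \<Longrightarrow> d = 0" and d: "d \<in> tri S" and d0: "d 0 = 0"
  shows "d = 0"
proof -
  interpret K: symcomp SK by (rule SK_symcomp)
  interpret KV: vector_space "fun_scale (*) :: 'k alg_closure \<Rightarrow> (ix \<Rightarrow> 'k alg_closure) \<Rightarrow> _" by (rule vs_K)
  note lin = linearD[OF triD(2)[OF d]]
  define e where "e i u = (\<Sum>p\<in>UNIV. fun_scale (*) (u p) (ext (d i (c p))))" for i u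
  have e_lin: "e i (u + v) = e i u + e i v" "e i (fun_scale (*) a u) = fun_scale (*) a (e i u)" for i u v a
  proof -
    show "e i (u + v) = e i u + e i v"
      by (simp add: e_def fun_apply KV.scale_left_distrib sum.distrib)
    show "e i (fun_scale (*) a u) = fun_scale (*) a (e i u)"
      unfolding e_def KV.scale_sum_right KV.scale_scale by (simp add: fun_scale_def)
  qed
  have e_ext: "e i (ext x) = ext (d i x)" for i x
  proof -
    have ext_sum: "ext (sum f A) = (\<Sum>p\<in>A. ext (f p))" for f and A :: "ix set"
      by (induct A rule: infinite_finite_induct) (simp_all add: ext_zero ext_add)
    have "ext (d i x) = ext (d i (\<Sum>p\<in>UNIV. n x (cd p) \<odot> c p))" using c_expand[of x] by simp
    also have "\<dots> = e i (ext x)" by (simp add: lin e_def ext_sum ext_scale) (simp add: ext_def)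
    finally show ?thesis ..
  qed
  have "e \<in> tri SK"
    unfolding tri_def orth_lie_def
  proof (intro CollectI conjI allI)
    show "Vector_Spaces.linear (scl SK) (scl SK) (e i)" for i
      unfolding SK_simps(1) by (intro linearI vs_K e_lin)
    show "polar SK (e i u) v + polar SK u (e i v) = 0" for i u v
    proof (induct u rule: ext_induct)
      case (1 x)
      show ?case
      proof (induct v rule: ext_induct)
        case (1 y)
        show ?case using triD(4)[OF d, of i x y] by (simp add: e_ext ext_polar)
      next
        case (2 v w)
        then show ?case by (simp add: e_lin SK_polar_lin algebra_simps eq_neg_iff_add_eq_0[symmetric])
      next
        case (3 a v)
        then show ?case by (simp add: e_lin SK_polar_lin distrib_left[symmetric])
      qed
    next
      case (2 v w)
      then show ?case by (simp add: e_lin SK_polar_lin algebra_simps eq_neg_iff_add_eq_0[symmetric])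
    next
      case (3 a v)
      then show ?case by (simp add: e_lin SK_polar_lin distrib_left[symmetric])
    qed
    show "e 0 (mul SK u v) = mul SK (e 1 u) v + mul SK u (e 2 v)" for u v
    proof (induct u rule: ext_induct)
      case (1 x)
      show ?case
      proof (induct v rule: ext_induct)
        case (1 y)
        show ?case by (simp add: e_ext ext_mul triD(3)[OF d] ext_add)
      qed (simp_all add: e_lin SK_mul_lin KV.scale_right_distrib algebra_simps)
    qed (simp_all add: e_lin SK_mul_lin KV.scale_right_distrib algebra_simps)
  qed
  moreover have "e 0 = 0"
    unfolding e_def d0 by (simp add: fun_eq_iff fun_apply ext_zero)
  ultimately have "e = 0" by (rule inj)
  then have "ext (d i x) = 0" for i x using e_ext[of i x] by (simp add: fun_apply)
  then show ?thesis using ext_inj by (simp add: fun_eq_iff fun_apply)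
qed

end

section \<open>The split triple\<close>

text \<open>
  The table below is the multiplication table of the Okubo algebra with \<open>\<alpha> = \<beta> = 1\<close>, where
  \<open>X0, X1, \<dots>, X7\<close> have the degrees \<open>(1,0)\<close>, \<open>(-1,0)\<close>, \<open>(0,1)\<close>, \<open>(0,-1)\<close>, \<open>(1,1)\<close>, \<open>(-1,-1)\<close>, \<open>(-1,1)\<close>,
  \<open>(1,-1)\<close>: the product of \<open>p\<close> and \<open>q\<close> is \<open>sg p q\<close> times \<open>pr p q\<close>.
\<close>

primrec neg :: "ix \<Rightarrow> ix" where
  "neg X0 = X1"
| "neg X1 = X0"
| "neg X2 = X3"
| "neg X3 = X2"
| "neg X4 = X5"
| "neg X5 = X4"
| "neg X6 = X7"
| "neg X7 = X6"

fun sg :: "ix \<Rightarrow> ix \<Rightarrow> int" where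
  "sg X0 X0 = - 1" | "sg X0 X1 = 0" | "sg X0 X2 = 0" | "sg X0 X3 = 1" | "sg X0 X4 = 0" | "sg X0 X5 = 1" | "sg X0 X6 = 0" | "sg X0 X7 = 1"
| "sg X1 X0 = 0" | "sg X1 X1 = - 1" | "sg X1 X2 = 1" | "sg X1 X3 = 0" | "sg X1 X4 = 1" | "sg X1 X5 = 0" | "sg X1 X6 = 1" | "sg X1 X7 = 0"
| "sg X2 X0 = 1" | "sg X2 X1 = 0" | "sg X2 X2 = - 1" | "sg X2 X3 = 0" | "sg X2 X4 = 1" | "sg X2 X5 = 0" | "sg X2 X6 = 0" | "sg X2 X7 = 1"
| "sg X3 X0 = 0" | "sg X3 X1 = 1" | "sg X3 X2 = 0" | "sg X3 X3 = - 1" | "sg X3 X4 = 0" | "sg X3 X5 = 1" | "sg X3 X6 = 1" | "sg X3 X7 = 0"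
| "sg X4 X0 = 1" | "sg X4 X1 = 0" | "sg X4 X2 = 0" | "sg X4 X3 = 1" | "sg X4 X4 = - 1" | "sg X4 X5 = 0" | "sg X4 X6 = 1" | "sg X4 X7 = 0"
| "sg X5 X0 = 0" | "sg X5 X1 = 1" | "sg X5 X2 = 1" | "sg X5 X3 = 0" | "sg X5 X4 = 0" | "sg X5 X5 = - 1" | "sg X5 X6 = 0" | "sg X5 X7 = 1"
| "sg X6 X0 = 1" | "sg X6 X1 = 0" | "sg X6 X2 = 1" | "sg X6 X3 = 0" | "sg X6 X4 = 0" | "sg X6 X5 = 1" | "sg X6 X6 = - 1" | "sg X6 X7 = 0"
| "sg X7 X0 = 0" | "sg X7 X1 = 1" | "sg X7 X2 = 0" | "sg X7 X3 = 1" | "sg X7 X4 = 1" | "sg X7 X5 = 0" | "sg X7 X6 = 0" | "sg X7 X7 = - 1"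

text \<open>\<open>X0\<close> stands as a placeholder wherever \<open>sg\<close> vanishes.\<close>

fun pr :: "ix \<Rightarrow> ix \<Rightarrow> ix" where
  "pr X0 X0 = X1" | "pr X0 X1 = X0" | "pr X0 X2 = X0" | "pr X0 X3 = X7" | "pr X0 X4 = X0" | "pr X0 X5 = X3" | "pr X0 X6 = X0" | "pr X0 X7 = X5"
| "pr X1 X0 = X0" | "pr X1 X1 = X0" | "pr X1 X2 = X6" | "pr X1 X3 = X0" | "pr X1 X4 = X2" | "pr X1 X5 = X0" | "pr X1 X6 = X4" | "pr X1 X7 = X0"
| "pr X2 X0 = X4" | "pr X2 X1 = X0" | "pr X2 X2 = X3" | "pr X2 X3 = X0" | "pr X2 X4 = X7" | "pr X2 X5 = X0" | "pr X2 X6 = X0" | "pr X2 X7 = X0"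
| "pr X3 X0 = X0" | "pr X3 X1 = X5" | "pr X3 X2 = X0" | "pr X3 X3 = X2" | "pr X3 X4 = X0" | "pr X3 X5 = X6" | "pr X3 X6 = X1" | "pr X3 X7 = X0"
| "pr X4 X0 = X6" | "pr X4 X1 = X0" | "pr X4 X2 = X0" | "pr X4 X3 = X0" | "pr X4 X4 = X5" | "pr X4 X5 = X0" | "pr X4 X6 = X3" | "pr X4 X7 = X0"
| "pr X5 X0 = X0" | "pr X5 X1 = X7" | "pr X5 X2 = X1" | "pr X5 X3 = X0" | "pr X5 X4 = X0" | "pr X5 X5 = X4" | "pr X5 X6 = X0" | "pr X5 X7 = X2"
| "pr X6 X0 = X2" | "pr X6 X1 = X0" | "pr X6 X2 = X5" | "pr X6 X3 = X0" | "pr X6 X4 = X0" | "pr X6 X5 = X0" | "pr X6 X6 = X7" | "pr X6 X7 = X0"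
| "pr X7 X0 = X0" | "pr X7 X1 = X3" | "pr X7 X2 = X0" | "pr X7 X3 = X4" | "pr X7 X4 = X1" | "pr X7 X5 = X0" | "pr X7 X6 = X0" | "pr X7 X7 = X6"

text \<open>Doubled weights of the three eight-dimensional representations of
  \<open>D\<^sub>4\<close>: the vector representation in \<open>w0\<close>, the half-spin
  representations in \<open>w1\<close> (even number of minus signs) and \<open>w2\<close> (odd
  number). The labelling is such that nonzero products add weights, from \<open>w0\<close> and
  \<open>w1\<close> to \<open>w2\<close> and cyclically.\<close>

primrec w0 :: "ix \<Rightarrow> int \<times> int \<times> int \<times> int" where
  "w0 X0 = (2, 0, 0, 0)"
| "w0 X1 = (- 2, 0, 0, 0)"
| "w0 X2 = (0, 2, 0, 0)"
| "w0 X3 = (0, - 2, 0, 0)"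
| "w0 X4 = (0, 0, 2, 0)"
| "w0 X5 = (0, 0, - 2, 0)"
| "w0 X6 = (0, 0, 0, 2)"
| "w0 X7 = (0, 0, 0, - 2)"

primrec w1 :: "ix \<Rightarrow> int \<times> int \<times> int \<times> int" where
  "w1 X0 = (- 1, - 1, - 1, - 1)"
| "w1 X1 = (1, 1, 1, 1)"
| "w1 X2 = (1, - 1, 1, - 1)"
| "w1 X3 = (- 1, 1, - 1, 1)"
| "w1 X4 = (1, - 1, - 1, 1)"
| "w1 X5 = (- 1, 1, 1, - 1)"
| "w1 X6 = (1, 1, - 1, - 1)"
| "w1 X7 = (- 1, - 1, 1, 1)"

primrec w2 :: "ix \<Rightarrow> int \<times> int \<times> int \<times> int" where
  "w2 X0 = (- 1, 1, 1, 1)"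
| "w2 X1 = (1, - 1, - 1, - 1)"
| "w2 X2 = (- 1, - 1, - 1, 1)"
| "w2 X3 = (1, 1, 1, - 1)"
| "w2 X4 = (- 1, 1, - 1, - 1)"
| "w2 X5 = (1, - 1, 1, 1)"
| "w2 X6 = (- 1, - 1, 1, - 1)"
| "w2 X7 = (1, 1, - 1, 1)"


section \<open>Weights and signs, by inspection of the tables\<close>

definition wt :: "3 \<Rightarrow> ix \<Rightarrow> int \<times> int \<times> int \<times> int"
  where "wt m = (if m = 0 then w0 else if m = 1 then w1 else w2)"

lemma wt_simps [simp]: "wt 0 = w0" "wt 1 = w1" "wt 2 = w2"
  by (simp_all add: wt_def)

fun dot :: "int \<times> int \<times> int \<times> int \<Rightarrow> int \<times> int \<times> int \<times> int \<Rightarrow> int"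
  where "dot (a, b, c, d) (a', b', c', d') = a * a' + b * b' + c * c' + d * d'"

abbreviation nq :: "int \<times> int \<times> int \<times> int \<Rightarrow> int" where "nq v \<equiv> dot v v"

text \<open>The coordinate of a weight that belongs to the Cartan element of index \<open>X0\<close>, \<open>X2\<close>, \<open>X4\<close> or \<open>X6\<close>.\<close>

fun cmp :: "ix \<Rightarrow> int \<times> int \<times> int \<times> int \<Rightarrow> int" where
  "cmp p (a, b, c, d) = (case p of X0 \<Rightarrow> a | X2 \<Rightarrow> b | X4 \<Rightarrow> c | X6 \<Rightarrow> d | _ \<Rightarrow> 0)"

text \<open>For \<open>q \<noteq> neg p\<close> the component at \<open>1\<close> of
  \<open>t (b m p) (b m q)\<close> sends the basis vector \<open>d\<close> to
  \<open>K1 p q d\<close> times the basis vector \<open>E1 p q d\<close>; \<open>K2\<close> and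
  \<open>E2\<close> serve the component at \<open>2\<close>. For \<open>q = neg p\<close> the scalar
  \<open>1/2\<close> is added.\<close>

definition K1 :: "ix \<Rightarrow> ix \<Rightarrow> ix \<Rightarrow> int" where "K1 p q d = - (sg q d * sg (pr q d) p)"
definition E1 :: "ix \<Rightarrow> ix \<Rightarrow> ix \<Rightarrow> ix" where "E1 p q d = pr (pr q d) p"
definition K2 :: "ix \<Rightarrow> ix \<Rightarrow> ix \<Rightarrow> int" where "K2 p q d = - (sg d q * sg p (pr d q))"
definition E2 :: "ix \<Rightarrow> ix \<Rightarrow> ix \<Rightarrow> ix" where "E2 p q d = pr p (pr d q)"

lemmas KE = K1_def K2_def E1_def E2_def

lemma neg_neg [simp]: "neg (neg p) = p" by (cases p) simp_all
lemma neg_eq_iff [simp]: "neg p = neg q \<longleftrightarrow> p = q" by (metis neg_neg)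
lemma neg_ne [simp]: "neg p \<noteq> p" "p \<noteq> neg p" by (cases p; simp)+
lemma wt_neg: "wt m (neg p) = - wt m p"
  using exhaust_3[of m] by (cases p) auto
lemma w0_neg: "w0 (neg p) = - w0 p" by (cases p) auto

lemma nq_wt: "nq (wt m p) = 4"
  using exhaust_3[of m] by (cases p) auto

text \<open>In doubled coordinates weights have norm \<open>4\<close> and roots of
  \<open>E\<^sub>8\<close> norm \<open>8\<close>. The value \<open>12\<close> guards against
  accidents: where a product vanishes, the other half contributes at least \<open>4\<close>, so the
  total norm is at least \<open>16\<close> and the sum of the two roots is neither a root nor
  zero.\<close>

lemma wt_mul: "sg p q \<noteq> 0 \<Longrightarrow> wt m p + wt (m + 1) q = wt (m + 2) (pr p q)"
  and wt_mul_0: "sg p q = 0 \<Longrightarrow> nq (wt m p + wt (m + 1) q) = 12"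
  and sg_cases: "sg p q = 0 \<or> sg p q = 1 \<or> sg p q = - 1"
proof -
  have "(sg p q \<noteq> 0 \<longrightarrow> w0 p + w1 q = w2 (pr p q) \<and> w1 p + w2 q = w0 (pr p q) \<and> w2 p + w0 q = w1 (pr p q))
    \<and> (sg p q = 0 \<longrightarrow> nq (w0 p + w1 q) = 12 \<and> nq (w1 p + w2 q) = 12 \<and> nq (w2 p + w0 q) = 12)
    \<and> (sg p q = 0 \<or> sg p q = 1 \<or> sg p q = - 1)"
    by (cases p; cases q) simp_all
  then show "sg p q \<noteq> 0 \<Longrightarrow> wt m p + wt (m + 1) q = wt (m + 2) (pr p q)"
    "sg p q = 0 \<Longrightarrow> nq (wt m p + wt (m + 1) q) = 12" "sg p q = 0 \<or> sg p q = 1 \<or> sg p q = - 1"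
    using exhaust_3[of m] by (auto simp: Z3_simps)
qed

text \<open>The bound \<open>12\<close> plays the same part as in \<open>wt_mul\<close>: together
  with the norm \<open>4\<close> of the weight in the other factor it exceeds the norm
  \<open>8\<close> of a root.\<close>

lemma wt_act:
  assumes "q \<noteq> p" "q \<noteq> neg p"
  shows "K1 p q d \<noteq> 0 \<Longrightarrow> w1 d + (w0 p + w0 q) = w1 (E1 p q d) \<and> (K1 p q d = 1 \<or> K1 p q d = - 1)"
    and "K1 p q d = 0 \<Longrightarrow> nq (w1 d + (w0 p + w0 q)) \<ge> 12"
    and "K2 p q d \<noteq> 0 \<Longrightarrow> w2 d + (w0 p + w0 q) = w2 (E2 p q d) \<and> (K2 p q d = 1 \<or> K2 p q d = - 1)"
    and "K2 p q d = 0 \<Longrightarrow> nq (w2 d + (w0 p + w0 q)) \<ge> 12"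
    and "d \<noteq> neg p \<Longrightarrow> d \<noteq> neg q \<Longrightarrow> nq (w0 d + (w0 p + w0 q)) \<ge> 12"
proof -
  have "q \<noteq> p \<and> q \<noteq> neg p \<longrightarrow>
    (K1 p q d \<noteq> 0 \<longrightarrow> w1 d + (w0 p + w0 q) = w1 (E1 p q d) \<and> (K1 p q d = 1 \<or> K1 p q d = - 1)) \<and>
    (K1 p q d = 0 \<longrightarrow> nq (w1 d + (w0 p + w0 q)) \<ge> 12) \<and>
    (K2 p q d \<noteq> 0 \<longrightarrow> w2 d + (w0 p + w0 q) = w2 (E2 p q d) \<and> (K2 p q d = 1 \<or> K2 p q d = - 1)) \<and>
    (K2 p q d = 0 \<longrightarrow> nq (w2 d + (w0 p + w0 q)) \<ge> 12) \<and>
    (d \<noteq> neg p \<and> d \<noteq> neg q \<longrightarrow> nq (w0 d + (w0 p + w0 q)) \<ge> 12)"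
    by (cases p; cases q; simp only: neg.simps ix.distinct simp_thms; cases d; simp add: KE)
  then show "K1 p q d \<noteq> 0 \<Longrightarrow> w1 d + (w0 p + w0 q) = w1 (E1 p q d) \<and> (K1 p q d = 1 \<or> K1 p q d = - 1)"
    "K1 p q d = 0 \<Longrightarrow> nq (w1 d + (w0 p + w0 q)) \<ge> 12"
    "K2 p q d \<noteq> 0 \<Longrightarrow> w2 d + (w0 p + w0 q) = w2 (E2 p q d) \<and> (K2 p q d = 1 \<or> K2 p q d = - 1)"
    "K2 p q d = 0 \<Longrightarrow> nq (w2 d + (w0 p + w0 q)) \<ge> 12"
    "d \<noteq> neg p \<Longrightarrow> d \<noteq> neg q \<Longrightarrow> nq (w0 d + (w0 p + w0 q)) \<ge> 12"
    using assms by blast+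
qed

text \<open>The pair \<open>(p, q)\<close> with \<open>w0 p + w0 q\<close> a given root of $D_4$.\<close>

fun dec :: "int \<times> int \<times> int \<times> int \<Rightarrow> ix \<times> ix" where
  "dec (a, b, c, d) =
    (let x = (if a > 0 then X0 else X1); y = (if b > 0 then X2 else X3);
         z = (if c > 0 then X4 else X5); w = (if d > 0 then X6 else X7)
     in if a \<noteq> 0 then (x, if b \<noteq> 0 then y else if c \<noteq> 0 then z else w)
        else if b \<noteq> 0 then (y, if c \<noteq> 0 then z else w) else (z, w))"

text \<open>For \<open>m = 1, 2\<close> the sum of two half-spin weights of the same kind, neither
  equal nor opposite, is a root of \<open>D\<^sub>4\<close>, and the operator with coefficients
  \<open>K\<close> and labels \<open>E\<close> is, up to sign, the elementary skew map of the pair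
  found by \<open>dec\<close>. The indices cross, \<open>m = 1\<close> with \<open>K2\<close> and
  \<open>m = 2\<close> with \<open>K1\<close>, because the component at \<open>0\<close> of
  \<open>shift m d\<close> is \<open>d (- m)\<close>.\<close>

lemma dec_12:
  assumes "q \<noteq> p" "q \<noteq> neg p" "(m = 1 \<and> K = K2 p q \<and> E = E2 p q) \<or> (m = 2 \<and> K = K1 p q \<and> E = E1 p q)"
    "dec (wt m p + wt m q) = (p', q')"
  shows "rk p' < rk q'" "q' \<noteq> neg p'" "w0 p' + w0 q' = wt m p + wt m q"
    "K (neg p') = 1 \<or> K (neg p') = - 1"
    "K d = (if d = neg p' then K (neg p') else if d = neg q' then - K (neg p') else 0)"
    "E (neg p') = q'" "E (neg q') = p'"
proof -
  have 1: "q \<noteq> p \<and> q \<noteq> neg p \<longrightarrow> (case dec (w1 p + w1 q) of (p', q') \<Rightarrow>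
      rk p' < rk q' \<and> q' \<noteq> neg p' \<and> w0 p' + w0 q' = w1 p + w1 q \<and>
      (K2 p q (neg p') = 1 \<or> K2 p q (neg p') = - 1) \<and>
      K2 p q d = (if d = neg p' then K2 p q (neg p') else if d = neg q' then - K2 p q (neg p') else 0) \<and>
      E2 p q (neg p') = q' \<and> E2 p q (neg q') = p')"
    by (cases p; cases q; simp only: neg.simps ix.distinct simp_thms; cases d; simp add: KE)
  have 2: "q \<noteq> p \<and> q \<noteq> neg p \<longrightarrow> (case dec (w2 p + w2 q) of (p', q') \<Rightarrow>
      rk p' < rk q' \<and> q' \<noteq> neg p' \<and> w0 p' + w0 q' = w2 p + w2 q \<and>
      (K1 p q (neg p') = 1 \<or> K1 p q (neg p') = - 1) \<and>
      K1 p q d = (if d = neg p' then K1 p q (neg p') else if d = neg q' then - K1 p q (neg p') else 0) \<and>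
      E1 p q (neg p') = q' \<and> E1 p q (neg q') = p')"
    by (cases p; cases q; simp only: neg.simps ix.distinct simp_thms; cases d; simp add: KE)
  show "rk p' < rk q'" "q' \<noteq> neg p'" "w0 p' + w0 q' = wt m p + wt m q"
    "K (neg p') = 1 \<or> K (neg p') = - 1"
    "K d = (if d = neg p' then K (neg p') else if d = neg q' then - K (neg p') else 0)"
    "E (neg p') = q'" "E (neg q') = p'"
    using assms(3)
    by (rule disjE; use 1 2 assms in simp)+
qed

text \<open>The eigenvalue, up to the factor \<open>1/2\<close>, of a Cartan element on \<open>b 0 d\<close>.\<close>

fun dd :: "int \<times> int \<times> int \<times> int \<Rightarrow> ix \<Rightarrow> int" where
  "dd (a, b, c, e) d = (case d of X0 \<Rightarrow> - a | X1 \<Rightarrow> a | X2 \<Rightarrow> - b | X3 \<Rightarrow> b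
     | X4 \<Rightarrow> - c | X5 \<Rightarrow> c | X6 \<Rightarrow> - e | X7 \<Rightarrow> e)"

text \<open>With \<open>q = neg p\<close> the eigenvalue on the basis vector \<open>d\<close> is
  \<open>1/2 + K\<close>, twice which is the integer \<open>1 + 2 * K\<close>.\<close>

lemma dd_wt: "1 + 2 * K2 p (neg p) d = dd (w1 p) d" "1 + 2 * K1 p (neg p) d = dd (w2 p) d"
    "dd (w0 p) d = (if d = p then - 2 else if d = neg p then 2 else 0)"
    "K1 p (neg p) d \<noteq> 0 \<Longrightarrow> E1 p (neg p) d = d" "K2 p (neg p) d \<noteq> 0 \<Longrightarrow> E2 p (neg p) d = d"
  by (cases p; cases d; simp add: KE)+

text \<open>One label from each opposite pair; the elements \<open>B0 p (neg p)\<close> for these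
  labels form a basis of the Cartan subalgebra of \<open>D\<^sub>4\<close>.\<close>

definition CX :: "ix set" where "CX = {X0, X2, X4, X6}"

lemma cmp_wt: assumes "p \<in> CX"
  shows "1 + 2 * K1 p (neg p) d = - cmp p (w1 d)" "1 + 2 * K2 p (neg p) d = - cmp p (w2 d)"
    "cmp p (w0 d) = (if d = p then 2 else if d = neg p then - 2 else 0)"
  using assms unfolding CX_def by (cases d; auto simp: KE)+

section \<open>Local triality and the root vectors of D4 in a split triple\<close>

locale split_triple = symcomp S for S :: "('k::field, 'v::ab_group_add) normed_alg" +
  fixes b :: "3 \<Rightarrow> ix \<Rightarrow> 'v"
  assumes b_dual: "polar S (b i p) (b i q) = (if q = neg p then 1 else 0)"
    and b_expand: "x = (\<Sum>p\<in>UNIV. scl S (polar S x (b i (neg p))) (b i p))"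
    and b_mul: "mul S (b i p) (b (i + 1) q) = scl S (of_int (sg p q)) (b (i + 2) (pr p q))"
begin

lemma b_mul_cases:
  "b m p \<star> b (m + 1) q = of_int (sg p q) \<odot> b (m + 2) (pr p q)"
  "b (m + 1) p \<star> b (m + 2) q = of_int (sg p q) \<odot> b m (pr p q)"
  "b (m + 2) p \<star> b m q = of_int (sg p q) \<odot> b (m + 1) (pr p q)"
proof -
  have e: "m + 1 + 1 = m + 2" "m + 1 + 2 = m" "m + 2 + 1 = m" "m + 2 + 2 = m + 1"
    using exhaust_3[of m] by auto
  show "b m p \<star> b (m + 1) q = of_int (sg p q) \<odot> b (m + 2) (pr p q)"
    "b (m + 1) p \<star> b (m + 2) q = of_int (sg p q) \<odot> b m (pr p q)"
    "b (m + 2) p \<star> b m q = of_int (sg p q) \<odot> b (m + 1) (pr p q)"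
    using b_mul[of m p q] b_mul[of "m + 1" p q] b_mul[of "m + 2" p q] unfolding e by auto
qed

lemma b_t_1: "t (b m p) (b m q) 1 (b (m + 1) d)
    = ((if q = neg p then 1 else 0) / 2) \<odot> b (m + 1) d + of_int (K1 p q d) \<odot> b (m + 1) (E1 p q d)"
  by (simp add: t_1 b_mul_cases b_dual KE)

lemma b_t_2: "t (b m p) (b m q) 2 (b (m + 2) d)
    = ((if q = neg p then 1 else 0) / 2) \<odot> b (m + 2) d + of_int (K2 p q d) \<odot> b (m + 2) (E2 p q d)"
  by (simp add: t_2 b_mul_cases b_dual KE)

lemma b_t_0: "t (b m p) (b m q) 0 (b m d)
    = (if d = neg p then b m q else 0) - (if d = neg q then b m p else 0)"
  by (simp add: t_0 b_dual)

lemma eq_on_basis: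
  assumes f: "Vector_Spaces.linear (scl S) (scl S) f" and g: "Vector_Spaces.linear (scl S) (scl S) g"
    and eq: "\<And>d. f (b i d) = g (b i d)"
  shows "f = g"
proof
  fix x
  have "f x = f (\<Sum>p\<in>UNIV. scl S (n x (b i (neg p))) (b i p))" using b_expand[of x i] by simp
  also have "\<dots> = (\<Sum>p\<in>UNIV. scl S (n x (b i (neg p))) (g (b i p)))"
    by (simp add: linearD[OF f] eq)
  also have "\<dots> = g (\<Sum>p\<in>UNIV. scl S (n x (b i (neg p))) (b i p))" by (simp add: linearD[OF g])
  also have "\<dots> = g x" using b_expand[of x i] by simp
  finally show "f x = g x" .
qed

text \<open>If \<open>d 0 = 0\<close>, the triality rules make \<open>d 1\<close> commute with all
  maps \<open>z \<mapsto> (y \<star> z) \<star> x\<close>. On the weight basis some of these are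
  projections that separate the weights, so \<open>d 1\<close> is diagonal; others move one weight
  vector to another, so the entries at \<open>c\<close> and \<open>neg c\<close> agree. Skewness
  makes these entries opposite, hence zero. Then \<open>d 2\<close> vanishes on products, and the
  products of basis vectors reach all of \<open>b 2\<close>.\<close>

lemma tri_inj:
  assumes d: "d \<in> tri S" and d0: "d 0 = 0"
  shows "d = 0"
proof -
  note lin = linearD[OF triD(2)[OF d]]
  have d1: "d 1 (u \<star> x) = d 2 u \<star> x" and d2: "d 2 (y \<star> z) = y \<star> d 1 z" for u x y z
    using tri_rule[OF d, of 1 u x] tri_rule[OF d, of 2 y z] by (simp_all add: Z3_simps d0 fun_apply)
  have com: "d 1 ((y \<star> z) \<star> x) = (y \<star> d 1 z) \<star> x" for x y z
    by (simp add: d1 d2)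
  have e01: "b 0 q \<star> b 1 c = of_int (sg q c) \<odot> b 2 (pr q c)" and e20: "b 2 q \<star> b 0 c = of_int (sg q c) \<odot> b 1 (pr q c)" for q c
    using b_mul_cases(1)[of 0 q c] b_mul_cases(3)[of 0 q c] by simp_all
  have act: "(b 0 q \<star> b 1 c) \<star> b 0 p = of_int (- K1 p q c) \<odot> b 1 (E1 p q c)" for p q c
    by (simp add: e01 e20 KE)
  define F where "F c e = n (d 1 (b 1 c)) (b 1 (neg e))" for c e
  have dF: "d 1 (b 1 c) = (\<Sum>e\<in>UNIV. F c e \<odot> b 1 e)" for c
    unfolding F_def by (rule b_expand)
  have F0: "F c e = 0" if "e \<noteq> c" for c e
  proof -
    \<comment> \<open>The map for the pair \<open>(p, neg p)\<close> multiplies \<open>b 1 c\<close>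
      by \<open>0\<close> or \<open>1\<close>, according to the sign of one coordinate of the weight
      \<open>w1 c\<close>.\<close>
    have "\<exists>p\<in>CX. K1 p (neg p) c \<noteq> K1 p (neg p) e"
      using that unfolding CX_def by (cases c; cases e; simp add: KE)
    then obtain p where p: "K1 p (neg p) c \<noteq> K1 p (neg p) e" by blast
    have self: "(b 0 (neg p) \<star> b 1 c) \<star> b 0 p = of_int (- K1 p (neg p) c) \<odot> b 1 c" for c
      using dd_wt(4)[of p c] unfolding act by (cases "K1 p (neg p) c = 0") auto
    have "of_int (- K1 p (neg p) c) \<odot> d 1 (b 1 c) = (b 0 (neg p) \<star> d 1 (b 1 c)) \<star> b 0 p"
      using com[of "b 0 (neg p)" "b 1 c" "b 0 p"] unfolding self by (simp add: lin)
    also have "\<dots> = (\<Sum>e\<in>UNIV. F c e \<odot> (of_int (- K1 p (neg p) e) \<odot> b 1 e))"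
      unfolding dF by (simp only: mul_lin self)
    finally have "n (of_int (- K1 p (neg p) c) \<odot> d 1 (b 1 c)) (b 1 (neg e))
      = n (\<Sum>e\<in>UNIV. F c e \<odot> (of_int (- K1 p (neg p) e) \<odot> b 1 e)) (b 1 (neg e))" by simp
    then have eq: "of_int (- K1 p (neg p) c) * F c e = F c e * of_int (- K1 p (neg p) e)"
      by (simp add: F_def[symmetric] b_dual mult.assoc sum_negf if_distrib[of "\<lambda>a. _ * a"] cong: if_cong)
    have K: "K1 p (neg p) c \<in> {0, - 1}" for c
      by (cases p; cases c; simp add: KE)
    have "K1 p (neg p) c = 0 \<and> K1 p (neg p) e = - 1 \<or> K1 p (neg p) c = - 1 \<and> K1 p (neg p) e = 0"
      using K[of c] K[of e] p by auto
    then show ?thesis using eq by auto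
  qed
  have dc: "d 1 (b 1 c) = F c c \<odot> b 1 c" for c
  proof -
    have "(\<Sum>e\<in>UNIV. F c e \<odot> b 1 e) = (\<Sum>e\<in>UNIV. if e = c then F c c \<odot> b 1 c else 0)"
      by (intro sum.cong) (auto simp: F0)
    then show ?thesis unfolding dF by simp
  qed
  have step: "F (E1 p q c) (E1 p q c) = F c c" if "K1 p q c \<noteq> 0" for p q c
  proof -
    have k: "K1 p q c = 1 \<or> K1 p q c = - 1"
      using that sg_cases[of q c] sg_cases[of "pr q c" p] by (auto simp: K1_def)
    have "of_int (- K1 p q c) \<odot> d 1 (b 1 (E1 p q c)) = F c c \<odot> (of_int (- K1 p q c) \<odot> b 1 (E1 p q c))"
      using com[of "b 0 q" "b 1 c" "b 0 p"] unfolding act by (simp add: lin dc act)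
    then have "n (d 1 (b 1 (E1 p q c))) (b 1 (neg (E1 p q c))) = n (F c c \<odot> b 1 (E1 p q c)) (b 1 (neg (E1 p q c)))"
      using k by auto
    then show ?thesis by (simp add: dc b_dual)
  qed
  have "F (neg c) (neg c) = F c c" for c
  proof -
    \<comment> \<open>A root of \<open>D\<^sub>4\<close> that moves the weight \<open>w1 c\<close>
      to another one reverses two of its signs; reversing all four takes two such steps.\<close>
    have "\<exists>p q p' q'. K1 p q c \<noteq> 0 \<and> K1 p' q' (E1 p q c) \<noteq> 0 \<and> E1 p' q' (E1 p q c) = neg c"
    proof (cases c)
      case X0 then show ?thesis by (intro exI[of _ X0] exI[of _ X2] exI[of _ X4] exI[of _ X6]) (simp add: KE)
    next
      case X1 then show ?thesis by (intro exI[of _ X1] exI[of _ X3] exI[of _ X5] exI[of _ X7]) (simp add: KE)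
    next
      case X2 then show ?thesis by (intro exI[of _ X1] exI[of _ X2] exI[of _ X5] exI[of _ X6]) (simp add: KE)
    next
      case X3 then show ?thesis by (intro exI[of _ X0] exI[of _ X3] exI[of _ X4] exI[of _ X7]) (simp add: KE)
    next
      case X4 then show ?thesis by (intro exI[of _ X1] exI[of _ X2] exI[of _ X4] exI[of _ X7]) (simp add: KE)
    next
      case X5 then show ?thesis by (intro exI[of _ X0] exI[of _ X3] exI[of _ X5] exI[of _ X6]) (simp add: KE)
    next
      case X6 then show ?thesis by (intro exI[of _ X1] exI[of _ X3] exI[of _ X4] exI[of _ X6]) (simp add: KE)
    next
      case X7 then show ?thesis by (intro exI[of _ X0] exI[of _ X2] exI[of _ X5] exI[of _ X7]) (simp add: KE)
    qed
    then show ?thesis using step by metis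
  qed
  moreover have "F c c + F (neg c) (neg c) = 0" for c
    using triD(4)[OF d, of 1 "b 1 c" "b 1 (neg c)"] by (simp add: dc b_dual)
  ultimately have "2 * F c c = 0" for c by (metis mult_2)
  then have "F c c = 0" for c using two by simp
  then have "d 1 (b 1 c) = 0" for c by (simp add: dc)
  then have z1: "d 1 = (\<lambda>x. 0)"
    by (intro eq_on_basis[OF triD(2)[OF d], where i = 1]) (auto intro!: linearI vs)
  have "d 2 (b 2 c) = 0" for c
  proof -
    have "\<exists>p q. sg p q \<noteq> 0 \<and> pr p q = c"
    proof (cases c)
      case X0 then show ?thesis by (intro exI[of _ X1] exI[of _ X1]) simp
    next
      case X1 then show ?thesis by (intro exI[of _ X0] exI[of _ X0]) simp
    next
      case X2 then show ?thesis by (intro exI[of _ X1] exI[of _ X4]) simp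
    next
      case X3 then show ?thesis by (intro exI[of _ X0] exI[of _ X5]) simp
    next
      case X4 then show ?thesis by (intro exI[of _ X1] exI[of _ X6]) simp
    next
      case X5 then show ?thesis by (intro exI[of _ X0] exI[of _ X7]) simp
    next
      case X6 then show ?thesis by (intro exI[of _ X1] exI[of _ X2]) simp
    next
      case X7 then show ?thesis by (intro exI[of _ X0] exI[of _ X3]) simp
    qed
    then obtain p q where pq: "sg p q \<noteq> 0" "pr p q = c" by blast
    have "d 2 (of_int (sg p q) \<odot> b 2 c) = 0"
      using d2[of "b 0 p" "b 1 q"] unfolding e01 pq z1 by simp
    then show ?thesis using pq sg_cases[of p q] by (auto simp: lin)
  qed
  then have "d 2 = (\<lambda>x. 0)"
    by (intro eq_on_basis[OF triD(2)[OF d], where i = 2]) (auto intro!: linearI vs)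
  then have "d i = 0" for i
    using exhaust_3[of i] z1 d0 by (auto simp: fun_eq_iff fun_apply)
  then show ?thesis by (simp add: fun_eq_iff fun_apply)
qed

sublocale symcomp8 S b "\<lambda>i p. b i (neg p)"
proof
  show "n (b i p) (b i (neg q)) = (if p = q then 1 else 0)" for i p q
    by (auto simp: b_dual)
qed (fact b_expand tri_inj)+

abbreviation B0 where "B0 p q \<equiv> t (b 0 p) (b 0 q)"

lemma tri_eq_on_basis:
  assumes "d \<in> tri S" "e \<in> tri S" "\<And>c. d 0 (b 0 c) = e 0 (b 0 c)"
  shows "d = e"
  by (rule tri_eqI[OF assms(1,2)], rule eq_on_basis[where i = 0]) (use assms triD in auto)

lemma act_B0:
  assumes "q \<noteq> p" "q \<noteq> neg p"
  shows "(\<exists>e. wt m d + (w0 p + w0 q) = wt m e \<and> (B0 p q m (b m d) = b m e \<or> B0 p q m (b m d) = - b m e))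
    \<or> nq (wt m d + (w0 p + w0 q)) \<ge> 12 \<and> B0 p q m (b m d) = 0"
proof -
  consider "m = 0" | "m = 1" | "m = 2" using exhaust_3[of m] by auto
  then show ?thesis
  proof cases
    case 1
    show ?thesis
    proof (cases "d = neg p \<or> d = neg q")
      case True
      then show ?thesis
        using assms unfolding 1 b_t_0 by (auto simp: w0_neg intro: exI[of _ q] exI[of _ p])
    next
      case False
      then show ?thesis using wt_act(5)[OF assms] unfolding 1 b_t_0 by auto
    qed
  next
    case 2
    have e: "B0 p q m (b m d) = of_int (K1 p q d) \<odot> b m (E1 p q d)"
      using b_t_1[of 0 p q d] assms 2 by simp
    show ?thesis
    proof (cases "K1 p q d = 0")
      case True
      then show ?thesis using wt_act(2)[OF assms True] e 2 by simp
    next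
      case False
      then show ?thesis using wt_act(1)[OF assms False] e 2 by (auto intro!: exI[of _ "E1 p q d"])
    qed
  next
    case 3
    have e: "B0 p q m (b m d) = of_int (K2 p q d) \<odot> b m (E2 p q d)"
      using b_t_2[of 0 p q d] assms 3 by simp
    show ?thesis
    proof (cases "K2 p q d = 0")
      case True
      then show ?thesis using wt_act(4)[OF assms True] e 3 by simp
    next
      case False
      then show ?thesis using wt_act(3)[OF assms False] e 3 by (auto intro!: exI[of _ "E2 p q d"])
    qed
  qed
qed

lemma act_B0_cartan:
  assumes "p \<in> CX"
  shows "B0 p (neg p) m (b m d) = - (of_int (cmp p (wt m d)) / 2) \<odot> b m d"
proof -
  have half: "(1 / 2 + of_int K :: 'k) = of_int (1 + 2 * K) / 2" for K
    using two by (simp add: field_simps)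
  consider "m = 0" | "m = 1" | "m = 2" using exhaust_3[of m] by auto
  then show ?thesis
  proof cases
    case 1
    then show ?thesis using two by (auto simp: b_t_0 cmp_wt(3)[OF assms])
  next
    case 2
    have "B0 p (neg p) m (b m d) = (1 / 2 + of_int (K1 p (neg p) d)) \<odot> b m d"
      using b_t_1[of 0 p "neg p" d] dd_wt(4)[of p d] 2 by (cases "K1 p (neg p) d = 0") (auto simp: V.scale_left_distrib)
    then show ?thesis using 2 unfolding half cmp_wt(1)[OF assms] by simp
  next
    case 3
    have "B0 p (neg p) m (b m d) = (1 / 2 + of_int (K2 p (neg p) d)) \<odot> b m d"
      using b_t_2[of 0 p "neg p" d] dd_wt(5)[of p d] 3 by (cases "K2 p (neg p) d = 0") (auto simp: V.scale_left_distrib)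
    then show ?thesis using 3 unfolding half cmp_wt(2)[OF assms] by simp
  qed
qed

text \<open>Triality permutes the root vectors of \<open>D\<^sub>4\<close> up to sign. By
  \<open>tri_inj\<close> the comparison is made at the component \<open>0\<close> and on the basis
  \<open>b 0\<close>, where \<open>dec_12\<close> gives the matrix.\<close>

lemma shift_t_root:
  assumes "q \<noteq> p" "q \<noteq> neg p"
  shows "\<exists>p' q'. rk p' < rk q' \<and> q' \<noteq> neg p' \<and> w0 p' + w0 q' = wt m p + wt m q \<and>
    (shift m (t (b m p) (b m q)) = B0 p' q' \<or> shift m (t (b m p) (b m q)) = - B0 p' q')"
proof -
  have sm: "shift 0 d = d" for d :: "3 \<Rightarrow> 'v \<Rightarrow> 'v" by (simp add: shift_def)
  consider "m = 0" | "m = 1" | "m = 2" using exhaust_3[of m] by auto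
  then show ?thesis
  proof cases
    case 1
    show ?thesis
    proof (cases "rk p < rk q")
      case True
      then show ?thesis using assms 1 sm by (intro exI[of _ p] exI[of _ q]) auto
    next
      case False
      then have "rk q < rk p" using assms rk_inj by (metis linorder_less_linear)
      moreover have "p \<noteq> neg q" using assms by auto
      ultimately show ?thesis
        using 1 sm t_swap[of "b 0 q" "b 0 p"] by (intro exI[of _ q] exI[of _ p]) (auto simp: add.commute)
    qed
  next
    case 2
    obtain p' q' where pq: "dec (wt m p + wt m q) = (p', q')" by force
    note D = dec_12[OF assms _ pq, of "K2 p q" "E2 p q"]
    have qp: "q' \<noteq> p'" using D(1) 2 by auto
    have 0: "(shift m (t (b m p) (b m q))) 0 (b 0 c) = of_int (K2 p q c) \<odot> b 0 (E2 p q c)" for c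
      using b_t_2[of 1 p q c] assms 2 by (simp add: shift_def Z3_simps)
    have "shift m (t (b m p) (b m q)) = fs S (of_int (K2 p q (neg p'))) (B0 p' q')"
    proof (rule tri_eq_on_basis)
      fix c
      show "shift m (t (b m p) (b m q)) 0 (b 0 c) = fs S (of_int (K2 p q (neg p'))) (B0 p' q') 0 (b 0 c)"
        unfolding 0 fs_apply b_t_0 using D(5)[of c] D(2,6,7) qp 2 by auto
    qed (intro tri_closed tri_shift t_tri)+
    then show ?thesis using D(1-4) 2 by (intro exI[of _ p'] exI[of _ q']) auto
  next
    case 3
    obtain p' q' where pq: "dec (wt m p + wt m q) = (p', q')" by force
    note D = dec_12[OF assms _ pq, of "K1 p q" "E1 p q"]
    have qp: "q' \<noteq> p'" using D(1) 3 by auto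
    have 0: "(shift m (t (b m p) (b m q))) 0 (b 0 c) = of_int (K1 p q c) \<odot> b 0 (E1 p q c)" for c
      using b_t_1[of 2 p q c] assms 3 by (simp add: shift_def Z3_simps)
    have "shift m (t (b m p) (b m q)) = fs S (of_int (K1 p q (neg p'))) (B0 p' q')"
    proof (rule tri_eq_on_basis)
      fix c
      show "shift m (t (b m p) (b m q)) 0 (b 0 c) = fs S (of_int (K1 p q (neg p'))) (B0 p' q') 0 (b 0 c)"
        unfolding 0 fs_apply b_t_0 using D(5)[of c] D(2,6,7) qp 3 by auto
    qed (intro tri_closed tri_shift t_tri)+
    then show ?thesis using D(1-4) 3 by (intro exI[of _ p'] exI[of _ q']) auto
  qed
qed

lemma cartan_sum_act:
  "(\<Sum>p\<in>CX. fs S (of_int (cmp p v) / 2) (B0 p (neg p))) 0 (b 0 c) = (of_int (dd v c) / 2) \<odot> b 0 c"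
  by (cases v; cases c) (auto simp: CX_def fun_apply fs_apply b_t_0)

text \<open>Triality preserves the Cartan subalgebra. The coefficients are half the coordinates of
  the doubled weight \<open>wt m p\<close>, which is how weights of all three representations turn
  into coroots of \<open>E\<^sub>8\<close>.\<close>

lemma shift_t_cartan:
  "shift m (t (b m p) (b m (neg p))) = (\<Sum>q\<in>CX. fs S (of_int (cmp q (wt m p)) / 2) (B0 q (neg q)))"
proof (rule tri_eq_on_basis)
  fix c
  have half: "(1 / 2 + of_int K :: 'k) = of_int (1 + 2 * K) / 2" for K
    using two by (simp add: field_simps)
  consider "m = 0" | "m = 1" | "m = 2" using exhaust_3[of m] by auto
  then show "shift m (t (b m p) (b m (neg p))) 0 (b 0 c)
      = (\<Sum>q\<in>CX. fs S (of_int (cmp q (wt m p)) / 2) (B0 q (neg q))) 0 (b 0 c)"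
  proof cases
    case 1
    then show ?thesis using two
      unfolding cartan_sum_act by (auto simp: shift_def b_t_0 dd_wt(3))
  next
    case 2
    have "shift m (t (b m p) (b m (neg p))) 0 (b 0 c) = (1 / 2 + of_int (K2 p (neg p) c)) \<odot> b 0 c"
      using b_t_2[of 1 p "neg p" c] dd_wt(5)[of p c] 2
      by (cases "K2 p (neg p) c = 0") (auto simp: V.scale_left_distrib shift_def Z3_simps)
    then show ?thesis unfolding cartan_sum_act half dd_wt(1) using 2 by simp
  next
    case 3
    have "shift m (t (b m p) (b m (neg p))) 0 (b 0 c) = (1 / 2 + of_int (K1 p (neg p) c)) \<odot> b 0 c"
      using b_t_1[of 2 p "neg p" c] dd_wt(4)[of p c] 3
      by (cases "K1 p (neg p) c = 0") (auto simp: V.scale_left_distrib shift_def Z3_simps)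
    then show ?thesis unfolding cartan_sum_act half dd_wt(2) using 3 by simp
  qed
qed (intro tri_closed tri_shift t_tri F.subspace_sum tri_subspace)+

lemma B0_bracket: "tri_bracket (B0 p q) (B0 r s)
  = (if r = neg p then B0 q s else 0) - (if r = neg q then B0 p s else 0)
    + ((if s = neg p then B0 r q else 0) - (if s = neg q then B0 r p else 0))"
  unfolding tri_bracket_t[OF t_tri] b_t_0
  using bilinD[OF t_bilin] by simp

lemma cartan_bracket:
  assumes "c \<in> CX"
  shows "tri_bracket (B0 c (neg c)) (B0 p q) = fs S (- (of_int (cmp c (w0 p + w0 q)) / 2)) (B0 p q)"
proof -
  have "cmp c (w0 p + w0 q) = cmp c (w0 p) + cmp c (w0 q)"
    by (cases "w0 p"; cases "w0 q"; cases c) auto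
  then show ?thesis
    unfolding tri_bracket_t[OF t_tri] using act_B0_cartan[OF assms, of 0]
    by (simp add: bilinD[OF t_bilin] add_divide_distrib F.scale_left_distrib F.scale_left_diff_distrib)
qed

end

subsection \<open>The roots of $E_8$ in terms of those of $D_4 \times D_4$\<close>

lemma UNIV_8: "(UNIV :: 8 set) = {0, 1, 2, 3, 4, 5, 6, 7}"
proof -
  have "x \<in> {0, 1, 2, 3, 4, 5, 6, 7}" for x :: 8
  proof (induct x)
    case (of_int z)
    then have "z \<in> {0, 1, 2, 3, 4, 5, 6, 7}" by auto
    then show ?case by auto
  qed
  then show ?thesis by auto
qed

lemma sum_8: "(\<Sum>i\<in>(UNIV :: 8 set). f i) = f 0 + f 1 + f 2 + f 3 + f 4 + f 5 + f 6 + f 7"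
proof -
  have "(0::8) \<notin> {1, 2, 3, 4, 5, 6, 7}" "(1::8) \<notin> {2, 3, 4, 5, 6, 7}" "(2::8) \<notin> {3, 4, 5, 6, 7}"
    "(3::8) \<notin> {4, 5, 6, 7}" "(4::8) \<notin> {5, 6, 7}" "(5::8) \<notin> {6, 7}" "(6::8) \<notin> {7}" by simp_all
  then show ?thesis unfolding UNIV_8 by (simp add: add.assoc)
qed

lemma all_8: "(\<forall>i :: 8. P i) \<longleftrightarrow> P 0 \<and> P 1 \<and> P 2 \<and> P 3 \<and> P 4 \<and> P 5 \<and> P 6 \<and> P 7"
proof -
  have "(\<forall>i. P i) \<longleftrightarrow> (\<forall>i\<in>(UNIV :: 8 set). P i)" by blast
  then show ?thesis unfolding UNIV_8 by (simp only: ball_simps simp_thms)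
qed

type_synonym v4 = "int \<times> int \<times> int \<times> int"

definition mk :: "v4 \<Rightarrow> v4 \<Rightarrow> 8 \<Rightarrow> int" where
  "mk u v i = (case (u, v) of ((a, b, c, d), (a', b', c', d')) \<Rightarrow>
    if i = 0 then a else if i = 1 then b else if i = 2 then c else if i = 3 then d
    else if i = 4 then a' else if i = 5 then b' else if i = 6 then c' else d')"

lemma mk_simps [simp]:
  "mk (a, b, c, d) v 0 = a" "mk (a, b, c, d) v 1 = b" "mk (a, b, c, d) v 2 = c" "mk (a, b, c, d) v 3 = d"
  "mk v (a, b, c, d) 4 = a" "mk v (a, b, c, d) 5 = b" "mk v (a, b, c, d) 6 = c" "mk v (a, b, c, d) 7 = d"
  by (cases v; simp add: mk_def)+

lemma mk_eq: "mk u v = mk u' v' \<longleftrightarrow> u = u' \<and> v = v'"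
proof
  assume e: "mk u v = mk u' v'"
  obtain a b c d a' b' c' d' where 1: "u = (a, b, c, d)" "v = (a', b', c', d')" by (metis prod_cases4)
  obtain e f g h e' f' g' h' where 2: "u' = (e, f, g, h)" "v' = (e', f', g', h')" by (metis prod_cases4)
  show "u = u' \<and> v = v'"
    using fun_cong[OF e, of 0] fun_cong[OF e, of 1] fun_cong[OF e, of 2] fun_cong[OF e, of 3]
      fun_cong[OF e, of 4] fun_cong[OF e, of 5] fun_cong[OF e, of 6] fun_cong[OF e, of 7]
    unfolding 1 2 by simp
qed simp

lemma mk_surj: "\<exists>u v. w = mk u v"
proof (intro exI)
  have "w i = mk (w 0, w 1, w 2, w 3) (w 4, w 5, w 6, w 7) i" for i
  proof -
    have "\<forall>i. w i = mk (w 0, w 1, w 2, w 3) (w 4, w 5, w 6, w 7) i" unfolding all_8 by simp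
    then show ?thesis ..
  qed
  then show "w = mk (w 0, w 1, w 2, w 3) (w 4, w 5, w 6, w 7)" ..
qed

lemma mk_add: "mk u v + mk u' v' = mk (u + u') (v + v')"
  by (cases u; cases v; cases u'; cases v') (auto simp: mk_def fun_eq_iff fun_apply)

lemma mk_zero: "mk u v = 0 \<longleftrightarrow> u = 0 \<and> v = 0"
proof -
  have "mk 0 0 = (0 :: 8 \<Rightarrow> int)" by (simp add: mk_def fun_eq_iff fun_apply zero_prod_def)
  then show ?thesis using mk_eq[of u v 0 0] by simp
qed

fun sm4 :: "v4 \<Rightarrow> int" where "sm4 (a, b, c, d) = a + b + c + d"
fun ev4 :: "v4 \<Rightarrow> bool" where "ev4 (a, b, c, d) \<longleftrightarrow> even a \<and> even b \<and> even c \<and> even d"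
fun od4 :: "v4 \<Rightarrow> bool" where "od4 (a, b, c, d) \<longleftrightarrow> odd a \<and> odd b \<and> odd c \<and> odd d"

lemma mk_root: "mk u v \<in> E8_double_roots \<longleftrightarrow>
  (ev4 u \<and> ev4 v \<or> od4 u \<and> od4 v) \<and> nq u + nq v = 8 \<and> 4 dvd (sm4 u + sm4 v)"
  by (cases u; cases v) (simp add: E8_double_roots_def sum_8 all_8 power2_eq_square add.assoc)

lemma nq_0: "nq (0 :: v4) = 0" by (simp add: zero_prod_def)

lemma mk_not_root': "nq u + nq v \<noteq> 8 \<Longrightarrow> nq u + nq v \<noteq> 0 \<Longrightarrow> mk u v \<noteq> 0 \<and> mk u v \<notin> E8_double_roots"
  using nq_0 by (auto simp: mk_root mk_zero)

fun rt :: "gi \<Rightarrow> 8 \<Rightarrow> int" where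
  "rt (TA p q) = mk (w0 p + w0 q) 0"
| "rt (TB p q) = mk 0 (w0 p + w0 q)"
| "rt (TI m p q) = mk (wt m p) (wt m q)"

text \<open>The Cartan labels in the order of the coordinates of \<open>mk\<close>, so that the
  coordinate \<open>i\<close> of a root is, up to sign and a half, its value on the element of label
  \<open>hc i\<close>.\<close>

definition hc :: "8 \<Rightarrow> gi" where
  "hc i = (if i = 0 then TA X0 X1 else if i = 1 then TA X2 X3 else if i = 2 then TA X4 X5 else if i = 3 then TA X6 X7
    else if i = 4 then TB X0 X1 else if i = 5 then TB X2 X3 else if i = 6 then TB X4 X5 else TB X6 X7)"

lemma hc_simps [simp]: "hc 0 = TA X0 X1" "hc 1 = TA X2 X3" "hc 2 = TA X4 X5" "hc 3 = TA X6 X7"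
  "hc 4 = TB X0 X1" "hc 5 = TB X2 X3" "hc 6 = TB X4 X5" "hc 7 = TB X6 X7"
  by (simp_all add: hc_def)

definition RI :: "gi set" where "RI = GI - range hc"

lemma hc_range: "range hc = {TA X0 X1, TA X2 X3, TA X4 X5, TA X6 X7, TB X0 X1, TB X2 X3, TB X4 X5, TB X6 X7}"
  unfolding UNIV_8 by auto

lemma hc_inj: "inj hc"
proof -
  have "\<forall>i j :: 8. hc i = hc j \<longrightarrow> i = j" unfolding all_8 by simp
  then show ?thesis by (simp add: inj_def)
qed

lemma GI_hc: "GI = range hc \<union> RI" "range hc \<inter> RI = {}"
  by (auto simp: RI_def hc_range)

lemma RI_TA: "TA p q \<in> RI \<longleftrightarrow> rk p < rk q \<and> q \<noteq> neg p" and RI_TB: "TB p q \<in> RI \<longleftrightarrow> rk p < rk q \<and> q \<noteq> neg p"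
  unfolding RI_def hc_range by (cases p; cases q; simp)+

lemma RI_TI: "TI m p q \<in> RI"
  by (auto simp: RI_def hc_range)

lemma D4_root: assumes "q \<noteq> p" "q \<noteq> neg p" shows "ev4 (w0 p + w0 q)" "nq (w0 p + w0 q) = 8" "4 dvd sm4 (w0 p + w0 q)"
proof -
  have "q \<noteq> p \<and> q \<noteq> neg p \<longrightarrow> ev4 (w0 p + w0 q) \<and> nq (w0 p + w0 q) = 8 \<and> 4 dvd sm4 (w0 p + w0 q)"
    by (cases p; cases q; simp)
  then show "ev4 (w0 p + w0 q)" "nq (w0 p + w0 q) = 8" "4 dvd sm4 (w0 p + w0 q)" using assms by auto
qed

text \<open>Two weights of the same representation have entry sums in the same class modulo
  \<open>4\<close>, either \<open>0\<close> or \<open>2\<close>, so their total is divisible by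
  \<open>4\<close>, as a root of \<open>E\<^sub>8\<close> requires.\<close>

lemma wt_parity:
  "ev4 (w0 p)" "sm4 (w0 p) = 2 \<or> sm4 (w0 p) = - 2"
  "od4 (w1 p)" "4 dvd sm4 (w1 p)" "od4 (w2 p)" "sm4 (w2 p) = 2 \<or> sm4 (w2 p) = - 2"
  by (cases p; simp)+

lemma rt_root: assumes "p \<in> RI" shows "rt p \<in> E8_double_roots"
proof (cases p)
  case (TA x y)
  then show ?thesis using D4_root[of y x] assms by (auto simp: mk_root RI_TA zero_prod_def)
next
  case (TB x y)
  then show ?thesis using D4_root[of y x] assms by (auto simp: mk_root RI_TB zero_prod_def)
next
  case (TI m x y)
  consider "m = 0" | "m = 1" | "m = 2" using exhaust_3[of m] by auto
  then show ?thesis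
  proof cases
    case 1
    then show ?thesis using TI nq_wt[of 0] wt_parity(1,2)[of x] wt_parity(1,2)[of y] by (auto simp: mk_root)
  next
    case 2
    then show ?thesis using TI nq_wt[of 1] wt_parity(3,4)[of x] wt_parity(3,4)[of y] by (auto simp: mk_root)
  next
    case 3
    then show ?thesis using TI nq_wt[of 2] wt_parity(5,6)[of x] wt_parity(5,6)[of y] by (auto simp: mk_root)
  qed
qed

lemma w0_sum_inj:
  assumes "rk p < rk q" "q \<noteq> neg p" "rk p' < rk q'" "q' \<noteq> neg p'" "w0 p + w0 q = w0 p' + w0 q'"
  shows "p = p' \<and> q = q'"
proof -
  have d: "dec (w0 p + w0 q) = (p, q)" if "rk p < rk q" "q \<noteq> neg p" for p q
    using that by (cases p; cases q; simp)
  have "(p, q) = (p', q')"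
    unfolding d[OF assms(1,2), symmetric] d[OF assms(3,4), symmetric] assms(5) ..
  then show ?thesis by simp
qed

lemma wt_inj: assumes "wt m p = wt m' p'" shows "m = m' \<and> p = p'"
proof -
  have "(w0 p = w0 p' \<longrightarrow> p = p') \<and> (w1 p = w1 p' \<longrightarrow> p = p') \<and> (w2 p = w2 p' \<longrightarrow> p = p') \<and>
      w0 p \<noteq> w1 p' \<and> w0 p \<noteq> w2 p' \<and> w1 p \<noteq> w2 p'" for p p'
    by (cases p; cases p'; simp)
  from this[of p p'] this[of p' p] show ?thesis
    using assms exhaust_3[of m] exhaust_3[of m'] by auto
qed

lemma rt_inj: "inj_on rt RI"
proof (rule inj_onI)
  fix r s assume rs: "r \<in> RI" "s \<in> RI" "rt r = rt s"
  have wz: "wt m p \<noteq> 0" for m p using nq_wt[of m p] nq_0 by (metis zero_neq_numeral)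
  have dz: "w0 p + w0 q \<noteq> 0" if "rk p < rk q" "q \<noteq> neg p" for p q
    using D4_root(2)[of q p] that nq_0 by (metis less_irrefl zero_neq_numeral)
  show "r = s"
  proof (cases r)
    case (TA p q)
    then have *: "rk p < rk q" "q \<noteq> neg p" using rs by (auto simp: RI_TA)
    show ?thesis
      by (cases s) (use TA rs wz dz[OF *] w0_sum_inj[OF *] in \<open>auto simp: mk_eq RI_TA RI_TB\<close>)
  next
    case (TB p q)
    then have *: "rk p < rk q" "q \<noteq> neg p" using rs by (auto simp: RI_TB)
    show ?thesis
      by (cases s) (use TB rs wz dz[OF *] w0_sum_inj[OF *] in \<open>auto simp: mk_eq RI_TA RI_TB\<close>)
  next
    case (TI m p q)
    show ?thesis
    proof (cases s)
      case (TI m' p' q')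
      then show ?thesis using \<open>r = TI m p q\<close> rs wt_inj[of m p m' p'] wt_inj[of m q m' q'] by (auto simp: mk_eq)
    qed (use TI rs wz in \<open>auto simp: mk_eq\<close>)
  qed
qed

text \<open>An odd root splits into two half-spin weights, of the same kind since the total of the
  entries is divisible by \<open>4\<close>. An even root has exactly two nonzero entries: in the
  same half they form a root of one \<open>D\<^sub>4\<close>, in different halves a pair of vector
  weights.\<close>

lemma rt_surj: assumes v: "v \<in> E8_double_roots" shows "\<exists>p\<in>RI. rt p = v"
  using v
proof (cases rule: E8_root_shape)
  case 1
  obtain a b where ab: "v = mk a b" using mk_surj by blast
  obtain a0 a1 a2 a3 b0 b1 b2 b3 where c: "a = (a0, a1, a2, a3)" "b = (b0, b1, b2, b3)" by (metis prod_cases4)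
  have pm: "a0 = 1 \<or> a0 = - 1" "a1 = 1 \<or> a1 = - 1" "a2 = 1 \<or> a2 = - 1" "a3 = 1 \<or> a3 = - 1"
    "b0 = 1 \<or> b0 = - 1" "b1 = 1 \<or> b1 = - 1" "b2 = 1 \<or> b2 = - 1" "b3 = 1 \<or> b3 = - 1"
    using 1[of 0] 1[of 1] 1[of 2] 1[of 3] 1[of 4] 1[of 5] 1[of 6] 1[of 7] unfolding ab c by simp_all
  have sp: "(\<exists>p. x = w1 p) \<and> 4 dvd sm4 x \<or> (\<exists>p. x = w2 p) \<and> \<not> 4 dvd sm4 x"
    if "x = (x0, x1, x2, x3)" "x0 = 1 \<or> x0 = - 1" "x1 = 1 \<or> x1 = - 1" "x2 = 1 \<or> x2 = - 1" "x3 = 1 \<or> x3 = - 1" for x x0 x1 x2 x3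
  proof -
    have ex: "(\<exists>p. P p) \<longleftrightarrow> P X0 \<or> P X1 \<or> P X2 \<or> P X3 \<or> P X4 \<or> P X5 \<or> P X6 \<or> P X7" for P
      by (metis ix.exhaust)
    show ?thesis using that(2-5) unfolding that(1) ex by (elim disjE; simp)
  qed
  have d: "4 dvd (sm4 a + sm4 b)" using v unfolding ab mk_root by blast
  have "4 dvd sm4 a \<longleftrightarrow> 4 dvd sm4 b" using d by (meson dvd_add_right_iff dvd_add_left_iff)
  then obtain m p q where "a = wt m p" "b = wt m q"
    using sp[OF c(1) pm(1-4)] sp[OF c(2) pm(5-8)] wt_simps by metis
  then show ?thesis using RI_TI by (intro bexI[of _ "TI m p q"]) (auto simp: ab)
next
  case (2 k m)
  have ev: "even (v i)" for i
    using v 2(2) by (auto simp: E8_double_roots_def) (metis even_zero)+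
  have s: "(\<Sum>i\<in>UNIV. (v i)\<^sup>2) = 8" using v by (simp add: E8_double_roots_def)
  have vk: "(v k)\<^sup>2 = 4" using 2 by auto
  have "(\<Sum>i\<in>UNIV. (v i)\<^sup>2) = (v k)\<^sup>2 + (\<Sum>i\<in>UNIV - {k}. (v i)\<^sup>2)"
    by (rule sum.remove) auto
  then have sk: "(\<Sum>i\<in>UNIV - {k}. (v i)\<^sup>2) = 4" using s vk by simp
  have "\<exists>l\<in>UNIV - {k}. v l \<noteq> 0"
  proof (rule ccontr)
    assume "\<not> ?thesis"
    then have "(\<Sum>i\<in>UNIV - {k}. (v i)\<^sup>2) = 0" by simp
    then show False using sk by simp
  qed
  then obtain l where l: "l \<noteq> k" "v l \<noteq> 0" by blast
  have sl: "(\<Sum>i\<in>UNIV - {k}. (v i)\<^sup>2) = (v l)\<^sup>2 + (\<Sum>i\<in>UNIV - {k} - {l}. (v i)\<^sup>2)"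
    by (rule sum.remove) (use l in auto)
  obtain w where w: "v l = 2 * w" using ev by blast
  have "w \<noteq> 0" using w l by auto
  then have "1 \<le> w\<^sup>2" by (simp add: int_one_le_iff_zero_less)
  moreover have nn: "0 \<le> (\<Sum>i\<in>UNIV - {k} - {l}. (v i)\<^sup>2)" by (rule sum_nonneg) auto
  ultimately have w1: "w\<^sup>2 = 1" and rest: "(\<Sum>i\<in>UNIV - {k} - {l}. (v i)\<^sup>2) = 0"
    using sl sk unfolding w by (auto simp: power2_eq_square)
  have vl: "v l = 2 \<or> v l = - 2" using w1 w by (auto simp: power2_eq_1_iff)
  have z: "v i = 0" if "i \<noteq> k" "i \<noteq> l" for i
    using rest that sum_nonneg_eq_0_iff[of "UNIV - {k} - {l}" "\<lambda>i. (v i)\<^sup>2"] by auto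
  define unit where "unit x \<longleftrightarrow> (\<exists>p. x = mk (w0 p) 0) \<or> (\<exists>p. x = mk 0 (w0 p))" for x
  have un: "unit (\<lambda>i. if i = j then c else 0)" if "c = 2 \<or> c = - 2" for c j
  proof -
    have ex: "(\<exists>p. P p) \<longleftrightarrow> P X0 \<or> P X1 \<or> P X2 \<or> P X3 \<or> P X4 \<or> P X5 \<or> P X6 \<or> P X7" for P
      by (metis ix.exhaust)
    have "\<forall>j. unit (\<lambda>i. if i = j then c else 0)"
      unfolding all_8 unit_def fun_eq_iff
      using that by (elim disjE; simp only: ex all_8; simp add: zero_prod_def)
    then show ?thesis ..
  qed
  have vs: "v = (\<lambda>i. if i = k then v k else 0) + (\<lambda>i. if i = l then v l else 0)"
    using z l by (auto simp: fun_eq_iff fun_apply)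
  have nz: "v \<noteq> 0" using 2 by (auto simp: fun_apply)
  have A: "\<exists>r\<in>RI. rt r = mk (w0 p + w0 q) 0" if "q \<noteq> p" "q \<noteq> neg p" for p q
  proof (cases "rk p < rk q")
    case True
    then show ?thesis using that by (intro bexI[of _ "TA p q"]) (auto simp: RI_TA)
  next
    case False
    then have "rk q < rk p" using that rk_inj by (metis linorder_less_linear)
    then show ?thesis using that by (intro bexI[of _ "TA q p"]) (auto simp: RI_TA add.commute)
  qed
  have B: "\<exists>r\<in>RI. rt r = mk 0 (w0 p + w0 q)" if "q \<noteq> p" "q \<noteq> neg p" for p q
  proof (cases "rk p < rk q")
    case True
    then show ?thesis using that by (intro bexI[of _ "TB p q"]) (auto simp: RI_TB)
  next
    case False
    then have "rk q < rk p" using that rk_inj by (metis linorder_less_linear)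
    then show ?thesis using that by (intro bexI[of _ "TB q p"]) (auto simp: RI_TB add.commute)
  qed
  have ne: "q \<noteq> p \<and> q \<noteq> neg p" if "nq (w0 p + w0 q) = 8" for p q
    using that by (cases p; cases q; simp)
  have v8: "nq a + nq b = 8" if "v = mk a b" for a b using v that mk_root by auto
  have nz0: "nq (0 :: v4) = 0" by (simp add: zero_prod_def)
  have "unit (\<lambda>i. if i = k then v k else 0)" "unit (\<lambda>i. if i = l then v l else 0)"
    using un 2(1) vl by blast+
  then consider p q where "v = mk (w0 p) 0 + mk (w0 q) 0" | p q where "v = mk (w0 p) 0 + mk 0 (w0 q)"
    | p q where "v = mk 0 (w0 p) + mk (w0 q) 0" | p q where "v = mk 0 (w0 p) + mk 0 (w0 q)"
    unfolding unit_def using vs by metis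
  then show ?thesis
  proof cases
    case (1 p q)
    then have e: "v = mk (w0 p + w0 q) 0" by (simp add: mk_add)
    then show ?thesis using A ne v8[OF e] nz0 by auto
  next
    case (2 p q)
    then show ?thesis using RI_TI by (intro bexI[of _ "TI 0 p q"]) (auto simp: mk_add)
  next
    case (3 p q)
    then show ?thesis using RI_TI by (intro bexI[of _ "TI 0 q p"]) (auto simp: mk_add)
  next
    case (4 p q)
    then have e: "v = mk 0 (w0 p + w0 q)" by (simp add: mk_add)
    then show ?thesis using B ne v8[OF e] nz0 by auto
  qed
qed

lemma rt_bij: "bij_betw rt RI E8_double_roots"
  unfolding bij_betw_def using rt_inj rt_root rt_surj by fastforce

lemma dot_add: "dot (u + v) w = dot u w + dot v w" "dot w (u + v) = dot w u + dot w v"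
  by (cases u; cases v; cases w; simp add: algebra_simps)+

lemma dot_w0: "dot (w0 p) (w0 q) = (if q = p then 4 else if q = neg p then - 4 else 0)"
  by (cases p; cases q) auto

section \<open>Brackets of the root vectors of D4\<close>

context split_triple
begin

definition Hs :: "v4 \<Rightarrow> 3 \<Rightarrow> 'v \<Rightarrow> 'v" where "Hs v = (\<Sum>q\<in>CX. fs S (of_int (cmp q v) / 2) (B0 q (neg q)))"

lemma Hs_add: "Hs (u + v) = Hs u + Hs v"
proof -
  have "cmp q (u + v) = cmp q u + cmp q v" for q by (cases u; cases v; cases q) auto
  then show ?thesis by (simp add: Hs_def add_divide_distrib F.scale_left_distrib sum.distrib)
qed

lemma B0_cartan: "B0 p (neg p) = Hs (w0 p)" "B0 (neg p) p = - Hs (w0 p)"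
proof -
  show *: "B0 p (neg p) = Hs (w0 p)"
    using shift_t_cartan[of 0 p] by (simp add: Hs_def shift_def)
  show "B0 (neg p) p = - Hs (w0 p)" unfolding t_swap[of "b 0 (neg p)" "b 0 p"] * ..
qed

lemma B0_sorted:
  assumes "y \<noteq> neg x" "y \<noteq> x" "d = B0 x y \<or> d = - B0 x y"
  shows "\<exists>x' y'. rk x' < rk y' \<and> y' \<noteq> neg x' \<and> w0 x' + w0 y' = w0 x + w0 y \<and> (d = B0 x' y' \<or> d = - B0 x' y')"
proof -
  have "shift 0 d = d" for d :: "3 \<Rightarrow> 'v \<Rightarrow> 'v" by (simp add: shift_def)
  then obtain x' y' where "rk x' < rk y'" "y' \<noteq> neg x'" "w0 x' + w0 y' = w0 x + w0 y" "B0 x y = B0 x' y' \<or> B0 x y = - B0 x' y'"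
    using shift_t_root[OF assms(2,1), of 0] by auto
  then show ?thesis using assms(3) by (intro exI[of _ x'] exI[of _ y']) auto
qed

text \<open>If no label of the first pair is opposite to one of the second, all mixed inner products
  are nonnegative, so the norm is at least \<open>4 * 4 = 16\<close>, and the bracket vanishes term
  by term. Otherwise either one opposite pair cancels and a pair of labels remains, or both cancel
  and the Cartan part appears. Two equal remaining labels give norm \<open>16\<close> and
  \<open>t x x = 0\<close>.\<close>

lemma D4_bracket:
  assumes "q \<noteq> p" "q \<noteq> neg p" "s \<noteq> r" "s \<noteq> neg r"
  defines "w \<equiv> (w0 p + w0 q) + (w0 r + w0 s)"
  shows "(\<exists>x y. rk x < rk y \<and> y \<noteq> neg x \<and> w0 x + w0 y = w \<and>
      (tri_bracket (B0 p q) (B0 r s) = B0 x y \<or> tri_bracket (B0 p q) (B0 r s) = - B0 x y))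
    \<or> (nq w \<noteq> 8 \<and> nq w \<noteq> 0 \<and> tri_bracket (B0 p q) (B0 r s) = 0)
    \<or> (w = 0 \<and> (tri_bracket (B0 p q) (B0 r s) = Hs (w0 p + w0 q) \<or> tri_bracket (B0 p q) (B0 r s) = - Hs (w0 p + w0 q)))"
proof -
  have n16: "nq (w0 x + w0 x) = 16" for x by (cases x) auto
  have one: ?thesis if xy: "w = w0 x + w0 y" "tri_bracket (B0 p q) (B0 r s) = B0 x y \<or> tri_bracket (B0 p q) (B0 r s) = - B0 x y" "y \<noteq> neg x" for x y
  proof (cases "y = x")
    case True
    then show ?thesis using xy n16[of x] t_same by auto
  next
    case False
    show ?thesis using B0_sorted[OF xy(3) False xy(2)] xy(1) by auto
  qed
  consider "r = neg p" "s = neg q" | "r = neg q" "s = neg p" | "r = neg p" "s \<noteq> neg q" | "r = neg q" "s \<noteq> neg p"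
    | "s = neg p" "r \<noteq> neg q" | "s = neg q" "r \<noteq> neg p" | "r \<noteq> neg p" "s \<noteq> neg p" "r \<noteq> neg q" "s \<noteq> neg q" by blast
  then show ?thesis
  proof cases
    case 1
    then show ?thesis using assms by (auto simp: B0_bracket B0_cartan w0_neg w_def Hs_add)
  next
    case 2
    then show ?thesis using assms by (auto simp: B0_bracket B0_cartan w0_neg w_def Hs_add)
  next
    case 3
    then show ?thesis using assms by (intro one[of q s]) (auto simp: B0_bracket w0_neg w_def)
  next
    case 4
    then show ?thesis using assms by (intro one[of p s]) (auto simp: B0_bracket w0_neg w_def)
  next
    case 5
    then show ?thesis using assms by (intro one[of r q]) (auto simp: B0_bracket w0_neg w_def)
  next
    case 6
    then show ?thesis using assms by (intro one[of r p]) (auto simp: B0_bracket w0_neg w_def)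
  next
    case 7
    then have "p \<noteq> neg r" "p \<noteq> neg s" "q \<noteq> neg r" "q \<noteq> neg s" by auto
    moreover have "dot (w0 x) (w0 y) \<ge> 0" if "y \<noteq> neg x" for x y using that by (simp add: dot_w0)
    moreover have "dot (w0 x) (w0 x) = 4" for x by (simp add: dot_w0)
    moreover have "dot (w0 p) (w0 q) = 0" "dot (w0 q) (w0 p) = 0" "dot (w0 r) (w0 s) = 0" "dot (w0 s) (w0 r) = 0"
      using assms(1-4) by (auto simp: dot_w0)
    ultimately have "nq w \<ge> 16"
      unfolding w_def dot_add using 7 by (smt (verit))
    then show ?thesis using 7 by (simp add: B0_bracket)
  qed
qed

end

subsection \<open>The Chevalley basis\<close>

locale split_pair = A: split_triple S b + B: split_triple S' b'
  for S :: "('k::field, 'v::ab_group_add) normed_alg" and b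
    and S' :: "('k, 'w::ab_group_add) normed_alg" and b'
begin

sublocale g_pair S b "\<lambda>i p. b i (neg p)" S' b' "\<lambda>i p. b' i (neg p)"
  by unfold_locales

sublocale L: bracket_algebra gs L br
  by unfold_locales (rule g_lie_algebra)

definition hsum :: "(8 \<Rightarrow> int) \<Rightarrow> ('k, 'v, 'w) g_elt"
  where "hsum v = (\<Sum>i\<in>UNIV. gs (of_int (v i) / 2) (Bg (hc i)))"

text \<open>The three possibilities for a sum of two roots, each with the bracket it demands up to
  sign. For labels in \<open>RI\<close> the alternatives exclude one another; the predicate is
  symmetric, which saves the mirrored cases.\<close>

definition good :: "gi \<Rightarrow> gi \<Rightarrow> bool" where
  "good p q \<longleftrightarrow>
    (\<exists>r\<in>RI. rt r = rt p + rt q \<and> (br (Bg p) (Bg q) = Bg r \<or> br (Bg p) (Bg q) = - Bg r)) \<or>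
    (rt p + rt q \<noteq> 0 \<and> rt p + rt q \<notin> E8_double_roots \<and> br (Bg p) (Bg q) = 0) \<or>
    (rt p + rt q = 0 \<and> (br (Bg p) (Bg q) = hsum (rt p) \<or> br (Bg p) (Bg q) = - hsum (rt p)))"

lemma Bg_L: "Bg p \<in> L"
  by (cases p) (auto intro!: tri_elt_L A.t_tri B.t_tri A.tri_closed B.tri_closed)

lemma good_sym: assumes "good p q" shows "good q p"
proof -
  have a: "br (Bg q) (Bg p) = - br (Bg p) (Bg q)" by (rule br_swap[OF Bg_L Bg_L])
  have h: "hsum (- v) = - hsum v" for v by (simp add: hsum_def fun_apply sum_negf)
  have q: "rt q = - rt p" if "rt p + rt q = 0" using that by (simp add: eq_neg_iff_add_eq_0 add.commute)
  show ?thesis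
    using assms unfolding good_def a add.commute[of "rt q"] by (auto simp: q h)
qed

lemma goodI_root:
  assumes "br (Bg p) (Bg q) = x" "r \<in> RI" "rt r = rt p + rt q" "x = Bg r \<or> x = - Bg r"
  shows "good p q"
  using assms unfolding good_def by blast

lemma goodI_zero:
  assumes "br (Bg p) (Bg q) = x" "x = 0" "rt p + rt q = mk u v" "nq u + nq v \<noteq> 8" "nq u + nq v \<noteq> 0"
  shows "good p q"
  using assms mk_not_root'[of u v] unfolding good_def by simp

lemma sum_hc: "hsum (mk u v) =
  tri_elt (\<Sum>q\<in>CX. fs S (of_int (cmp q u) / 2) (A.B0 q (neg q))) (\<Sum>q\<in>CX. fs S' (of_int (cmp q v) / 2) (B.B0 q (neg q)))"
proof -
  have g: "gs c (tri_elt d 0) = tri_elt (fs S c d) 0" "gs c (tri_elt 0 d') = tri_elt 0 (fs S' c d')" for c d d'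
    using tri_elt_linear(2)[of c d 0] tri_elt_linear(2)[of c 0 d'] by simp_all
  show ?thesis
    by (cases u; cases v) (simp add: hsum_def sum_8 CX_def g tri_elt_linear(1)[symmetric] add.assoc)
qed

lemma TI_good_next: "good (TI m p q) (TI (m + 1) p' q')"
proof -
  have e: "br (Bg (TI m p q)) (Bg (TI (m + 1) p' q'))
    = iota (m + 2) (tns (scl S (of_int (sg p p')) (b (m + 2) (pr p p'))) (scl S' (of_int (sg q q')) (b' (m + 2) (pr q q'))))"
    by (simp only: Bg.simps br_iota_cases A.b_mul_cases B.b_mul_cases)
  show ?thesis
proof (cases "sg p p' = 0 \<or> sg q q' = 0")
  case True
  have n: "nq (wt m x + wt (m + 1) y) \<ge> 4" for x y
    using wt_mul[of x y m] wt_mul_0[of x y m] nq_wt[of "m + 2" "pr x y"] by (cases "sg x y = 0") auto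
  have "nq (wt m p + wt (m + 1) p') = 12 \<or> nq (wt m q + wt (m + 1) q') = 12" using True wt_mul_0 by blast
  then have "nq (wt m p + wt (m + 1) p') + nq (wt m q + wt (m + 1) q') \<ge> 16"
    using n[of p p'] n[of q q'] by auto
  moreover have "tns (scl S (of_int (sg p p')) (b (m + 2) (pr p p'))) (scl S' (of_int (sg q q')) (b' (m + 2) (pr q q'))) = 0"
    using True by (auto simp: bilinD[OF T.tns_bilin])
  ultimately show ?thesis
    by (intro goodI_zero[OF e]) (auto simp: iota_linear mk_add)
next
  case False
  have "iota (m + 2) (tns (scl S (of_int (sg p p')) (b (m + 2) (pr p p'))) (scl S' (of_int (sg q q')) (b' (m + 2) (pr q q'))))
      = gs (of_int (sg p p') * of_int (sg q q')) (Bg (TI (m + 2) (pr p p') (pr q q')))"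
    by (simp add: bilinD[OF T.tns_bilin] iota_linear mult.commute)
  then show ?thesis
    using False sg_cases[of p p'] sg_cases[of q q']
    by (intro goodI_root[OF e, of "TI (m + 2) (pr p p') (pr q q')"]) (auto simp: RI_TI mk_add wt_mul)
qed
qed

lemma nq_wt_same: "nq (wt m p + wt m q) = (if q = neg p then 0 else if q = p then 16 else 8)"
  using exhaust_3[of m] by (cases p; cases q) auto

lemma TI_good_same: "good (TI m p q) (TI m p' q')"
proof -
  have e: "br (Bg (TI m p q)) (Bg (TI m p' q')) =
    tri_elt (fs S (if q' = neg q then 1 else 0) (shift m (t_elt S (b m p) (b m p'))))
      (fs S' (if p' = neg p then 1 else 0) (shift m (t_elt S' (b' m q) (b' m q'))))"
    by (simp add: br_iota_same A.b_dual B.b_dual)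
  have n: "nq (0 :: v4) = 0" by (simp add: zero_prod_def)
  \<comment> \<open>The part of the bracket in \<open>tri S\<close> survives only for
    \<open>q' = neg q\<close>, the part in \<open>tri S'\<close> only for \<open>p' = neg p\<close>.
    A repeated label in the surviving part gives \<open>t x x = 0\<close> and a sum of norm
    \<open>16\<close>.\<close>
  consider "p' = neg p" "q' = neg q" | "p' = neg p" "q' \<noteq> neg q" "q' \<noteq> q" | "p' \<noteq> neg p" "p' \<noteq> p" "q' = neg q"
    | "p' = neg p" "q' = q" | "p' = p" "q' = neg q" | "p' \<noteq> neg p" "q' \<noteq> neg q" by blast
  then show ?thesis
  proof cases
    case 1
    then have "rt (TI m p q) + rt (TI m p' q') = 0" by (simp add: mk_add wt_neg mk_zero)
    moreover have "br (Bg (TI m p q)) (Bg (TI m p' q')) = hsum (rt (TI m p q))"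
      using 1 unfolding e by (simp add: A.shift_t_cartan B.shift_t_cartan sum_hc)
    ultimately show ?thesis unfolding good_def by blast
  next
    case 2
    obtain x y where xy: "rk x < rk y" "y \<noteq> neg x" "w0 x + w0 y = wt m q + wt m q'"
      "shift m (t_elt S' (b' m q) (b' m q')) = B.B0 x y \<or> shift m (t_elt S' (b' m q) (b' m q')) = - B.B0 x y"
      using B.shift_t_root[OF 2(3,2)] by blast
    have "tri_elt 0 (- d') = (- tri_elt 0 d' :: ('k, 'v, 'w) g_elt)" for d' using tri_elt_linear(4)[of 0 d'] by simp
    then show ?thesis
      using xy 2 by (intro goodI_root[OF e, of "TB x y"]) (auto simp: RI_TB mk_add wt_neg)
  next
    case 3
    obtain x y where xy: "rk x < rk y" "y \<noteq> neg x" "w0 x + w0 y = wt m p + wt m p'"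
      "shift m (t_elt S (b m p) (b m p')) = A.B0 x y \<or> shift m (t_elt S (b m p) (b m p')) = - A.B0 x y"
      using A.shift_t_root[OF 3(2,1)] by blast
    have "tri_elt (- d) 0 = (- tri_elt d 0 :: ('k, 'v, 'w) g_elt)" for d using tri_elt_linear(4)[of d 0] by simp
    then show ?thesis
      using xy 3 by (intro goodI_root[OF e, of "TA x y"]) (auto simp: RI_TA mk_add wt_neg)
  next
    case 4
    then show ?thesis
      by (intro goodI_zero[OF e]) (auto simp: mk_add nq_wt_same B.t_same shift_lin tri_elt_linear)
  next
    case 5
    then show ?thesis
      by (intro goodI_zero[OF e]) (auto simp: mk_add nq_wt_same A.t_same shift_lin tri_elt_linear)
  next
    case 6
    then have "nq (wt m p + wt m p') + nq (wt m q + wt m q') \<ge> 16" by (simp add: nq_wt_same)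
    then show ?thesis using 6
      by (intro goodI_zero[OF e]) (auto simp: mk_add tri_elt_linear)
  qed
qed

lemma TI_good: "good (TI m p q) (TI m' p' q')"
proof -
  have "m' = m \<or> m' = m + 1 \<or> m = m' + 1" using exhaust_3[of m] exhaust_3[of m'] by auto
  then show ?thesis using TI_good_same TI_good_next good_sym by blast
qed

lemma TA_TI_good: assumes "TA p q \<in> RI" shows "good (TA p q) (TI m x y)"
proof -
  have pq: "q \<noteq> p" "q \<noteq> neg p" using assms by (auto simp: RI_TA)
  have e: "br (Bg (TA p q)) (Bg (TI m x y)) = iota m (tns (A.B0 p q m (b m x)) (b' m y))"
    by (simp add: br_tri_iota A.t_tri B.tri_closed fun_apply bilinD[OF T.tns_bilin])
  have r: "rt (TA p q) + rt (TI m x y) = mk (wt m x + (w0 p + w0 q)) (wt m y)"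
    by (simp add: mk_add add.commute)
  from A.act_B0[OF pq, of m x] show ?thesis
  proof
    assume "\<exists>e. wt m x + (w0 p + w0 q) = wt m e \<and> (A.B0 p q m (b m x) = b m e \<or> A.B0 p q m (b m x) = - b m e)"
    then obtain z where z: "wt m x + (w0 p + w0 q) = wt m z" "A.B0 p q m (b m x) = b m z \<or> A.B0 p q m (b m x) = - b m z" by blast
    show ?thesis
      by (rule goodI_root[OF e, of "TI m z y"], unfold r) (use z in \<open>auto simp: RI_TI bilinD[OF T.tns_bilin] iota_linear\<close>)
  next
    assume z: "nq (wt m x + (w0 p + w0 q)) \<ge> 12 \<and> A.B0 p q m (b m x) = 0"
    then have "nq (wt m x + (w0 p + w0 q)) + nq (wt m y) \<ge> 16" by (simp add: nq_wt)
    then show ?thesis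
      by (intro goodI_zero[OF e _ r]) (use z in \<open>auto simp: bilinD[OF T.tns_bilin] iota_linear\<close>)
  qed
qed

lemma TB_TI_good: assumes "TB p q \<in> RI" shows "good (TB p q) (TI m x y)"
proof -
  have pq: "q \<noteq> p" "q \<noteq> neg p" using assms by (auto simp: RI_TB)
  have e: "br (Bg (TB p q)) (Bg (TI m x y)) = iota m (tns (b m x) (B.B0 p q m (b' m y)))"
    by (simp add: br_tri_iota B.t_tri A.tri_closed fun_apply bilinD[OF T.tns_bilin])
  have r: "rt (TB p q) + rt (TI m x y) = mk (wt m x) (wt m y + (w0 p + w0 q))"
    by (simp add: mk_add add.commute)
  from B.act_B0[OF pq, of m y] show ?thesis
  proof
    assume "\<exists>e. wt m y + (w0 p + w0 q) = wt m e \<and> (B.B0 p q m (b' m y) = b' m e \<or> B.B0 p q m (b' m y) = - b' m e)"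
    then obtain z where z: "wt m y + (w0 p + w0 q) = wt m z" "B.B0 p q m (b' m y) = b' m z \<or> B.B0 p q m (b' m y) = - b' m z" by blast
    show ?thesis
      by (rule goodI_root[OF e, of "TI m x z"], unfold r) (use z in \<open>auto simp: RI_TI bilinD[OF T.tns_bilin] iota_linear\<close>)
  next
    assume z: "nq (wt m y + (w0 p + w0 q)) \<ge> 12 \<and> B.B0 p q m (b' m y) = 0"
    then have "nq (wt m x) + nq (wt m y + (w0 p + w0 q)) \<ge> 16" by (simp add: nq_wt)
    then show ?thesis
      by (intro goodI_zero[OF e _ r]) (use z in \<open>auto simp: bilinD[OF T.tns_bilin] iota_linear\<close>)
  qed
qed

lemma TA_TB_good: assumes "TA p q \<in> RI" "TB x y \<in> RI" shows "good (TA p q) (TB x y)"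
proof -
  have z: "tri_bracket d 0 = 0" if "d \<in> tri S" for d
    using linearD(5)[OF A.triD(2)[OF that]] by (simp add: tri_bracket_def fun_eq_iff fun_apply)
  have z': "tri_bracket 0 d = 0" if "d \<in> tri S'" for d
    using linearD(5)[OF B.triD(2)[OF that]] by (simp add: tri_bracket_def fun_eq_iff fun_apply)
  have "br (Bg (TA p q)) (Bg (TB x y)) = 0"
    by (simp add: br_tri_tri A.t_tri B.t_tri A.tri_closed B.tri_closed z z' tri_elt_linear)
  moreover have "nq (w0 p + w0 q) + nq (w0 x + w0 y) = 16"
  proof -
    have "q \<noteq> p" "q \<noteq> neg p" "y \<noteq> x" "y \<noteq> neg x" using assms by (auto simp: RI_TA RI_TB)
    then show ?thesis by (simp add: D4_root)
  qed
  ultimately show ?thesis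
    by (intro goodI_zero[where u = "w0 p + w0 q" and v = "w0 x + w0 y"]) (auto simp: mk_add)
qed

lemma TA_good: assumes "TA p q \<in> RI" "TA x y \<in> RI" shows "good (TA p q) (TA x y)"
proof -
  have n: "q \<noteq> p" "q \<noteq> neg p" "y \<noteq> x" "y \<noteq> neg x" using assms by (auto simp: RI_TA)
  have z: "tri_bracket 0 0 = 0" by (simp add: tri_bracket_def fun_eq_iff fun_apply)
  have e: "br (Bg (TA p q)) (Bg (TA x y)) = tri_elt (tri_bracket (A.B0 p q) (A.B0 x y)) 0"
    by (simp add: br_tri_tri A.t_tri B.tri_closed z)
  have r: "rt (TA p q) + rt (TA x y) = mk ((w0 p + w0 q) + (w0 x + w0 y)) 0"
    by (simp add: mk_add)
  have m: "tri_elt (- d) 0 = (- tri_elt d 0 :: ('k, 'v, 'w) g_elt)" for d using tri_elt_linear(4)[of d 0] by simp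
  have h: "hsum (rt (TA p q)) = tri_elt (A.Hs (w0 p + w0 q)) 0"
    by (simp add: sum_hc A.Hs_def) (simp add: zero_prod_def CX_def)
  have nq0: "nq (0 :: v4) = 0" by (simp add: zero_prod_def)
  from A.D4_bracket[OF n] show ?thesis
  proof (elim disjE conjE exE)
    fix c d assume "rk c < rk d" "d \<noteq> neg c" "w0 c + w0 d = w0 p + w0 q + (w0 x + w0 y)"
      "tri_bracket (A.B0 p q) (A.B0 x y) = A.B0 c d"
    then show ?thesis by (intro goodI_root[OF e, of "TA c d"], unfold r) (simp_all add: RI_TA)
  next
    fix c d assume "rk c < rk d" "d \<noteq> neg c" "w0 c + w0 d = w0 p + w0 q + (w0 x + w0 y)"
      "tri_bracket (A.B0 p q) (A.B0 x y) = - A.B0 c d"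
    then show ?thesis by (intro goodI_root[OF e, of "TA c d"], unfold r) (simp_all add: RI_TA m)
  next
    assume "nq (w0 p + w0 q + (w0 x + w0 y)) \<noteq> 8" "nq (w0 p + w0 q + (w0 x + w0 y)) \<noteq> 0"
      "tri_bracket (A.B0 p q) (A.B0 x y) = 0"
    then show ?thesis
      by (intro goodI_zero[OF e _ r]) (simp_all add: nq0 tri_elt_linear)
  qed (unfold good_def r e h, simp_all add: m mk_zero)
qed

lemma TB_good: assumes "TB p q \<in> RI" "TB x y \<in> RI" shows "good (TB p q) (TB x y)"
proof -
  have n: "q \<noteq> p" "q \<noteq> neg p" "y \<noteq> x" "y \<noteq> neg x" using assms by (auto simp: RI_TB)
  have z: "tri_bracket 0 0 = 0" by (simp add: tri_bracket_def fun_eq_iff fun_apply)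
  have e: "br (Bg (TB p q)) (Bg (TB x y)) = tri_elt 0 (tri_bracket (B.B0 p q) (B.B0 x y))"
    by (simp add: br_tri_tri B.t_tri A.tri_closed z)
  have r: "rt (TB p q) + rt (TB x y) = mk 0 ((w0 p + w0 q) + (w0 x + w0 y))"
    by (simp add: mk_add)
  have m: "tri_elt 0 (- d) = (- tri_elt 0 d :: ('k, 'v, 'w) g_elt)" for d using tri_elt_linear(4)[of 0 d] by simp
  have h: "hsum (rt (TB p q)) = tri_elt 0 (B.Hs (w0 p + w0 q))"
    by (simp add: sum_hc B.Hs_def) (simp add: zero_prod_def CX_def)
  have nq0: "nq (0 :: v4) = 0" by (simp add: zero_prod_def)
  from B.D4_bracket[OF n] show ?thesis
  proof (elim disjE conjE exE)
    fix c d assume "rk c < rk d" "d \<noteq> neg c" "w0 c + w0 d = w0 p + w0 q + (w0 x + w0 y)"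
      "tri_bracket (B.B0 p q) (B.B0 x y) = B.B0 c d"
    then show ?thesis by (intro goodI_root[OF e, of "TB c d"], unfold r) (simp_all add: RI_TB)
  next
    fix c d assume "rk c < rk d" "d \<noteq> neg c" "w0 c + w0 d = w0 p + w0 q + (w0 x + w0 y)"
      "tri_bracket (B.B0 p q) (B.B0 x y) = - B.B0 c d"
    then show ?thesis by (intro goodI_root[OF e, of "TB c d"], unfold r) (simp_all add: RI_TB m)
  next
    assume "nq (w0 p + w0 q + (w0 x + w0 y)) \<noteq> 8" "nq (w0 p + w0 q + (w0 x + w0 y)) \<noteq> 0"
      "tri_bracket (B.B0 p q) (B.B0 x y) = 0"
    then show ?thesis
      by (intro goodI_zero[OF e _ r]) (simp_all add: nq0 tri_elt_linear)
  qed (unfold good_def r e h, simp_all add: m mk_zero)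
qed

lemma all_good: assumes "r \<in> RI" "s \<in> RI" shows "good r s"
proof (cases r)
  case (TA p q)
  then show ?thesis
    using assms TA_good TA_TB_good TA_TI_good by (cases s) auto
next
  case (TB p q)
  then show ?thesis
    using assms TB_good TA_TB_good TB_TI_good good_sym by (cases s) blast+
next
  case (TI m p q)
  then show ?thesis
    using assms TI_good TA_TI_good TB_TI_good good_sym by (cases s) blast+
qed

fun cA :: "ix \<Rightarrow> gi \<Rightarrow> int" where
  "cA c (TA p q) = cmp c (w0 p + w0 q)" | "cA c (TB p q) = 0" | "cA c (TI m p q) = cmp c (wt m p)"

fun cB :: "ix \<Rightarrow> gi \<Rightarrow> int" where
  "cB c (TA p q) = 0" | "cB c (TB p q) = cmp c (w0 p + w0 q)" | "cB c (TI m p q) = cmp c (wt m q)"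

lemma gs_tri_elt: "gs a (tri_elt d 0) = tri_elt (fs S a d) 0" "gs a (tri_elt 0 d') = tri_elt 0 (fs S' a d')"
  using tri_elt_linear(2)[of a d 0] tri_elt_linear(2)[of a 0 d'] by simp_all

lemma tri_bracket_zero: "d \<in> tri S \<Longrightarrow> tri_bracket d 0 = 0" "d' \<in> tri S' \<Longrightarrow> tri_bracket d' 0 = 0"
  "d \<in> tri S \<Longrightarrow> tri_bracket 0 d = 0" "d' \<in> tri S' \<Longrightarrow> tri_bracket 0 d' = 0"
  using linearD(5)[OF A.triD(2)] linearD(5)[OF B.triD(2)]
  by (simp_all add: tri_bracket_def fun_eq_iff fun_apply)

lemma cartan_A: assumes c: "c \<in> CX" shows "br (Bg (TA c (neg c))) (Bg r) = gs (- (of_int (cA c r) / 2)) (Bg r)"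
proof (cases r)
  case (TA p q)
  then show ?thesis
    by (simp add: br_tri_tri A.t_tri B.tri_closed tri_bracket_zero gs_tri_elt A.cartan_bracket[OF c])
next
  case (TB p q)
  then show ?thesis
    by (simp add: br_tri_tri A.t_tri B.t_tri A.tri_closed B.tri_closed tri_bracket_zero tri_elt_linear)
next
  case (TI m p q)
  then show ?thesis
    by (simp add: br_tri_iota A.t_tri B.tri_closed fun_apply A.act_B0_cartan[OF c] bilinD[OF T.tns_bilin] iota_linear)
qed

lemma cartan_B: assumes c: "c \<in> CX" shows "br (Bg (TB c (neg c))) (Bg r) = gs (- (of_int (cB c r) / 2)) (Bg r)"
proof (cases r)
  case (TB p q)
  then show ?thesis
    by (simp add: br_tri_tri B.t_tri A.tri_closed tri_bracket_zero gs_tri_elt B.cartan_bracket[OF c])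
next
  case (TA p q)
  then show ?thesis
    by (simp add: br_tri_tri A.t_tri B.t_tri A.tri_closed B.tri_closed tri_bracket_zero tri_elt_linear)
next
  case (TI m p q)
  then show ?thesis
    by (simp add: br_tri_iota B.t_tri A.tri_closed fun_apply B.act_B0_cartan[OF c] bilinD[OF T.tns_bilin] iota_linear)
qed

lemma cA_rt: "rt r 0 = cA X0 r" "rt r 1 = cA X2 r" "rt r 2 = cA X4 r" "rt r 3 = cA X6 r"
  "rt r 4 = cB X0 r" "rt r 5 = cB X2 r" "rt r 6 = cB X4 r" "rt r 7 = cB X6 r"
proof -
  have c: "mk u v 0 = cmp X0 u" "mk u v 1 = cmp X2 u" "mk u v 2 = cmp X4 u" "mk u v 3 = cmp X6 u"
    "mk u v 4 = cmp X0 v" "mk u v 5 = cmp X2 v" "mk u v 6 = cmp X4 v" "mk u v 7 = cmp X6 v" for u v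
    by (cases u; cases v; simp)+
  have z: "cmp q 0 = 0" for q by (cases q) (simp_all add: zero_prod_def)
  show "rt r 0 = cA X0 r" "rt r 1 = cA X2 r" "rt r 2 = cA X4 r" "rt r 3 = cA X6 r"
    "rt r 4 = cB X0 r" "rt r 5 = cB X2 r" "rt r 6 = cB X4 r" "rt r 7 = cB X6 r"
    by (cases r; simp only: rt.simps cA.simps cB.simps c z)+
qed

lemma cartan_rt: "br (Bg (hc i)) (Bg r) = gs (- (of_int (rt r i) / 2)) (Bg r)"
proof -
  have "\<forall>i. br (Bg (hc i)) (Bg r) = gs (- (of_int (rt r i) / 2)) (Bg r)"
    unfolding all_8 hc_simps cA_rt
    using cartan_A[of X0 r] cartan_A[of X2 r] cartan_A[of X4 r] cartan_A[of X6 r]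
      cartan_B[of X0 r] cartan_B[of X2 r] cartan_B[of X4 r] cartan_B[of X6 r]
    by (simp add: CX_def del: Bg.simps)
  then show ?thesis ..
qed

theorem g_has_E8: "has_E8_chevalley_basis gs L br"
proof (rule L.E8_chevalley_of_signed[where hc = hc and R = RI and B = Bg and rt = rt])
  show "coord_system gs L (range hc \<union> RI) Bg cog" using g_coord GI_hc by simp
  show "range hc \<inter> RI = {}" "inj hc" "bij_betw rt RI E8_double_roots" by (rule GI_hc hc_inj rt_bij)+
  show "br (Bg (hc i)) (Bg (hc j)) = 0" for i j
  proof -
    have "rt (hc j) = 0"
    proof -
      have "\<forall>j. rt (hc j) = 0" unfolding all_8 by (simp add: mk_zero zero_prod_def)
      then show ?thesis ..
    qed
    then show ?thesis unfolding cartan_rt by (simp add: fun_apply)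
  qed
  show "br (Bg (hc i)) (Bg p) = gs (- (of_int (rt p i) / 2)) (Bg p)" for i p by (rule cartan_rt)
  fix p q assume pq: "p \<in> RI" "q \<in> RI"
  have g: "good p q" by (rule all_good[OF pq])
  have R0: "(0 :: 8 \<Rightarrow> int) \<notin> E8_double_roots" using E8_double_rootsD[of 0] by (auto simp: fun_apply)
  have RN: "rt r \<noteq> 0" if "r \<in> RI" for r using rt_root[OF that] R0 by metis
  show "br (Bg p) (Bg q) = (\<Sum>i\<in>UNIV. gs (of_int (rt p i) / 2) (Bg (hc i)))
      \<or> br (Bg p) (Bg q) = - (\<Sum>i\<in>UNIV. gs (of_int (rt p i) / 2) (Bg (hc i)))" if "rt p + rt q = 0"
    using g that RN unfolding good_def hsum_def by auto
  show "br (Bg p) (Bg q) = Bg r \<or> br (Bg p) (Bg q) = - Bg r" if "r \<in> RI" "rt p + rt q = rt r" for r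
    using g unfolding good_def
  proof (elim disjE bexE conjE)
    fix r' assume r': "r' \<in> RI" "rt r' = rt p + rt q"
    then have "r' = r" using inj_onD[OF rt_inj, of r' r] that by simp
    then show "br (Bg p) (Bg q) = Bg r'  \<Longrightarrow> ?thesis" "br (Bg p) (Bg q) = - Bg r' \<Longrightarrow> ?thesis"
      by simp_all
  qed (use that rt_root[OF that(1)] RN[OF that(1)] in simp_all)
  show "br (Bg p) (Bg q) = 0" if "rt p + rt q \<noteq> 0" "rt p + rt q \<notin> E8_double_roots"
  proof -
    have "rt r' \<noteq> rt p + rt q" if "r' \<in> RI" for r'
      using rt_root[OF that] \<open>rt p + rt q \<notin> E8_double_roots\<close> by metis
    then show ?thesis using g that unfolding good_def by blast
  qed
qed

end

subsection \<open>Descent to the base field\<close>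

text \<open>Two bases of the same extended algebra are in play: the image of \<open>c\<close>, whose
  structure constants come from the base field, and a split basis \<open>b\<close>, which gives
  local triality and the Chevalley basis. The Lie algebra over the closure is defined without either
  of them, so what is proved with one can be used with the other.\<close>

locale ext_pair = A: symcomp_basis S c cd + B: symcomp_basis S' c' cd'
  for S :: "('k::field, 'v::ab_group_add) normed_alg" and c cd
    and S' :: "('k, 'w::ab_group_add) normed_alg" and c' cd' +
  fixes b b'
  assumes split: "split_triple (ext_alg S c cd) b" and split': "split_triple (ext_alg S' c' cd') b'"
begin

lemma sc8: "symcomp8 S (\<lambda>_. c) (\<lambda>_. cd)"
proof -
  interpret T: split_triple "ext_alg S c cd" b by (rule split)
  show ?thesis
    by (intro symcomp8.intro symcomp8_axioms.intro A.symcomp_axioms A.c_dual A.c_expand)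
       (rule A.tri_inj_descent[OF T.tri_inj])
qed

lemma sc8': "symcomp8 S' (\<lambda>_. c') (\<lambda>_. cd')"
proof -
  interpret T: split_triple "ext_alg S' c' cd'" b' by (rule split')
  show ?thesis
    by (intro symcomp8.intro symcomp8_axioms.intro B.symcomp_axioms B.c_dual B.c_expand)
       (rule B.tri_inj_descent[OF T.tri_inj])
qed

sublocale G: g_pair S "\<lambda>_. c" "\<lambda>_. cd" S' "\<lambda>_. c'" "\<lambda>_. cd'"
  by (intro g_pair.intro sc8 sc8')

lemma sc8_K: "symcomp8 A.SK (\<lambda>_ p. A.ext (c p)) (\<lambda>_ p. A.ext (cd p))"
proof -
  interpret T: split_triple "ext_alg S c cd" b by (rule split)
  show ?thesis
    by (intro symcomp8.intro symcomp8_axioms.intro A.SK_symcomp A.SK_dual A.SK_expand) (rule T.tri_inj)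
qed

lemma sc8_K': "symcomp8 B.SK (\<lambda>_ p. B.ext (c' p)) (\<lambda>_ p. B.ext (cd' p))"
proof -
  interpret T: split_triple "ext_alg S' c' cd'" b' by (rule split')
  show ?thesis
    by (intro symcomp8.intro symcomp8_axioms.intro B.SK_symcomp B.SK_dual B.SK_expand) (rule T.tri_inj)
qed

sublocale K: g_pair A.SK "\<lambda>_ p. A.ext (c p)" "\<lambda>_ p. A.ext (cd p)" B.SK "\<lambda>_ p. B.ext (c' p)" "\<lambda>_ p. B.ext (cd' p)"
  by (intro g_pair.intro sc8_K sc8_K')

definition cpA where "cpA d D \<longleftrightarrow> d \<in> tri S \<and> D \<in> tri A.SK \<and> (\<forall>i x. D i (A.ext x) = A.ext (d i x))"
definition cpB where "cpB d D \<longleftrightarrow> d \<in> tri S' \<and> D \<in> tri B.SK \<and> (\<forall>i x. D i (B.ext x) = B.ext (d i x))"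

lemma shift_apply: "shift i d j = d (j - i)"
  by (simp add: shift_def)

lemma cpA_I: "cpA 0 0" "cpA d D \<Longrightarrow> cpA e E \<Longrightarrow> cpA (tri_bracket d e) (tri_bracket D E)"
  "cpA (fs S a (shift i (t_elt S x y))) (fs A.SK (to_ac a) (shift i (t_elt A.SK (A.ext x) (A.ext y))))"
  "cpA (t_elt S x y) (t_elt A.SK (A.ext x) (A.ext y))"
proof -
  show "cpA 0 0"
    unfolding cpA_def by (intro conjI A.tri_closed K.A.tri_closed) (simp add: fun_apply A.ext_zero)
  show "cpA d D \<Longrightarrow> cpA e E \<Longrightarrow> cpA (tri_bracket d e) (tri_bracket D E)"
    unfolding cpA_def
    by (intro conjI allI A.tri_bracket_tri K.A.tri_bracket_tri) (simp_all add: tri_bracket_def A.ext_diff)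
  show "cpA (fs S a (shift i (t_elt S x y))) (fs A.SK (to_ac a) (shift i (t_elt A.SK (A.ext x) (A.ext y))))"
    unfolding cpA_def
    by (intro conjI allI A.tri_closed K.A.tri_closed A.tri_shift K.A.tri_shift A.t_tri K.A.t_tri)
       (simp only: fs_apply shift_apply A.ext_t, simp only: A.ext_scale A.SK_simps(1))
  show "cpA (t_elt S x y) (t_elt A.SK (A.ext x) (A.ext y))"
    unfolding cpA_def by (intro conjI allI A.t_tri K.A.t_tri A.ext_t)
qed

lemma cpB_I: "cpB 0 0" "cpB d D \<Longrightarrow> cpB e E \<Longrightarrow> cpB (tri_bracket d e) (tri_bracket D E)"
  "cpB (fs S' a (shift i (t_elt S' x y))) (fs B.SK (to_ac a) (shift i (t_elt B.SK (B.ext x) (B.ext y))))"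
  "cpB (t_elt S' x y) (t_elt B.SK (B.ext x) (B.ext y))"
proof -
  show "cpB 0 0"
    unfolding cpB_def by (intro conjI B.tri_closed K.B.tri_closed) (simp add: fun_apply B.ext_zero)
  show "cpB d D \<Longrightarrow> cpB e E \<Longrightarrow> cpB (tri_bracket d e) (tri_bracket D E)"
    unfolding cpB_def
    by (intro conjI allI B.tri_bracket_tri K.B.tri_bracket_tri) (simp_all add: tri_bracket_def B.ext_diff)
  show "cpB (fs S' a (shift i (t_elt S' x y))) (fs B.SK (to_ac a) (shift i (t_elt B.SK (B.ext x) (B.ext y))))"
    unfolding cpB_def
    by (intro conjI allI B.tri_closed K.B.tri_closed B.tri_shift K.B.tri_shift B.t_tri K.B.t_tri)
       (simp only: fs_apply shift_apply B.ext_t, simp only: B.ext_scale B.SK_simps(1))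
  show "cpB (t_elt S' x y) (t_elt B.SK (B.ext x) (B.ext y))"
    unfolding cpB_def by (intro conjI allI B.t_tri K.B.t_tri B.ext_t)
qed

lemma cog_tri:
  assumes "cpA d D" "cpB d' D'"
  shows "K.cog (tri_elt D D') r = to_ac (G.cog (tri_elt d d') r)"
  using assms by (cases r) (auto simp: tri_elt_def cpA_def cpB_def A.ext_polar B.ext_polar fun_apply)

lemma cog_iota: "K.cog (iota m (K.tns (A.ext x) (B.ext x'))) r = to_ac (G.cog (iota m (G.tns x x')) r)"
  by (cases r) (auto simp: iota_def fun_apply A.ext_polar B.ext_polar K.tns_eval G.tns_eval)

lemma cog_neg: "K.cog (- v) r = - K.cog v r" "G.cog (- x) r = - G.cog x r"
  using K.cog_linear(2)[of "-1" v r] G.cog_linear(2)[of "-1" x r] by simp_all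

text \<open>Confined to generators, the relation avoids a base change map on tensors. Brackets of
  related generators have corresponding coordinates, which is what \<open>compat\<close> asks
  for.\<close>

definition rel where "rel x v \<longleftrightarrow>
  (\<exists>d d' D D'. x = tri_elt d d' \<and> v = tri_elt D D' \<and> cpA d D \<and> cpB d' D') \<or>
  (\<exists>m y y'. x = iota m (G.tns y y') \<and> v = iota m (K.tns (A.ext y) (B.ext y')))"

lemma rel_Bg: "rel (G.Bg p) (K.Bg p)"
proof (cases p)
  case (TA p q)
  then show ?thesis unfolding rel_def using cpA_I(4) cpB_I(1) by fastforce
next
  case (TB p q)
  then show ?thesis unfolding rel_def using cpA_I(1) cpB_I(4) by fastforce
next
  case (TI m p q)
  show ?thesis unfolding rel_def TI G.Bg.simps K.Bg.simps by blast
qed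

lemma relE:
  assumes "rel x v"
  obtains (T) d d' D D' where "x = tri_elt d d'" "v = tri_elt D D'" "cpA d D" "cpB d' D'"
    | (I) m a a' where "x = iota m (G.tns a a')" "v = iota m (K.tns (A.ext a) (B.ext a'))"
  using assms unfolding rel_def by blast

lemma cog_tri_iota:
  assumes "cpA d D" "cpB d' D'"
  shows "K.cog (K.br (tri_elt D D') (iota m (K.tns (A.ext x) (B.ext x')))) r
    = to_ac (G.cog (G.br (tri_elt d d') (iota m (G.tns x x'))) r)"
  using assms
  by (simp add: cpA_def cpB_def K.br_tri_iota G.br_tri_iota)
     (simp add: K.iota_linear G.iota_linear K.cog_linear G.cog_linear cog_iota)

lemma cog_br:
  assumes "rel x v" "rel y w"
  shows "K.cog (K.br v w) r = to_ac (G.cog (G.br x y) r)"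
proof -
  have sw: "K.cog (K.br v w) r = to_ac (G.cog (G.br x y) r)"
    if "K.cog (K.br w v) r = to_ac (G.cog (G.br y x) r)" "v \<in> K.L" "w \<in> K.L" "x \<in> G.L" "y \<in> G.L" for v w x y
    using that K.br_swap[of v w] G.br_swap[of x y] by (simp add: cog_neg)
  have triL: "tri_elt D D' \<in> K.L \<and> tri_elt d d' \<in> G.L" if "cpA d D" "cpB d' D'" for d d' D D'
    using that by (auto simp: cpA_def cpB_def intro!: K.tri_elt_L G.tri_elt_L)
  show ?thesis
    using assms(1)
  proof (cases rule: relE)
    case x: (T d d' D D')
    show ?thesis
      using assms(2)
    proof (cases rule: relE)
      case y: (T e e' E E')
      have "K.br v w = tri_elt (tri_bracket D E) (tri_bracket D' E')"
        unfolding x y using x y by (intro K.br_tri_tri) (auto simp: cpA_def cpB_def)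
      moreover have "G.br x y = tri_elt (tri_bracket d e) (tri_bracket d' e')"
        unfolding x y using x y by (intro G.br_tri_tri) (auto simp: cpA_def cpB_def)
      ultimately show ?thesis
        using cog_tri[OF cpA_I(2)[OF x(3) y(3)] cpB_I(2)[OF x(4) y(4)]] by simp
    next
      case y: (I m z z')
      show ?thesis unfolding x y by (rule cog_tri_iota[OF x(3,4)])
    qed
  next
    case x: (I m a a')
    show ?thesis
      using assms(2)
    proof (cases rule: relE)
      case y: (T d d' D D')
      show ?thesis
        unfolding x y
        by (rule sw[OF cog_tri_iota[OF y(3,4)]]) (use triL[OF y(3,4)] in auto)
    next
      case y: (I k z z')
      consider "k = m" | "k = m + 1" | "m = k + 1" using exhaust_3[of m] exhaust_3[of k] by auto
      then show ?thesis
      proof cases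
        case 1
        show ?thesis
          unfolding x y 1 K.br_iota_same G.br_iota_same A.ext_polar B.ext_polar
          by (rule cog_tri[OF cpA_I(3) cpB_I(3)])
      next
        case 2
        show ?thesis
          unfolding x y 2 K.br_iota_next G.br_iota_next A.ext_mul B.ext_mul by (rule cog_iota)
      next
        case 3
        show ?thesis
          unfolding x y 3 K.br_iota_prev G.br_iota_prev A.ext_mul B.ext_mul by (simp add: cog_neg cog_iota)
      qed
    qed
  qed
qed

lemma SK_E8: "has_E8_chevalley_basis K.gs K.L K.br"
proof -
  interpret P: split_pair "ext_alg S c cd" b "ext_alg S' c' cd'" b'
    by (intro split_pair.intro split split')
  show ?thesis by (rule P.g_has_E8)
qed

sublocale X: E8_extension G.gs G.L G.br K.gs K.L K.br GI G.Bg G.cog K.Bg K.cog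
proof (intro E8_extension.intro E8_extension_axioms.intro bracket_algebra.intro bracket_algebra_axioms.intro)
  show "vector_space G.gs" "vector_space K.gs" by (rule G.vs_g K.vs_g)+
  show "lie_algebra G.gs G.L G.br" "lie_algebra K.gs K.L K.br" by (rule G.g_lie_algebra K.g_lie_algebra)+
  show "(2 :: 'k) \<noteq> 0" by (rule A.two)
  show "coord_system G.gs G.L GI G.Bg G.cog" "coord_system K.gs K.L GI K.Bg K.cog" by (rule G.g_coord K.g_coord)+
  show "K.cog (K.br (K.Bg p) (K.Bg q)) r = to_ac (G.cog (G.br (G.Bg p) (G.Bg q)) r)" for p q r
    by (rule cog_br[OF rel_Bg rel_Bg])
  show "has_E8_chevalley_basis K.gs K.L K.br" by (rule SK_E8)
qed

theorem g_simple_E8: "simple_lie_algebra G.gs G.L G.br" "lie_of_type_E8 G.gs G.L G.br"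
  by (rule X.simple X.type_E8)+

end

section \<open>Okubo algebras\<close>

text \<open>The identities are multilinear, so basis vectors suffice, one argument after the other;
  nondegeneracy comes from the expansion.\<close>

lemma symcomp_basisI:
  fixes S :: "('k::field, 'v::ab_group_add) normed_alg"
  assumes two: "(2 :: 'k) \<noteq> 0" and S: "algebra_with_quadratic_form S"
    and dual: "\<And>p q. polar S (c p) (cd q) = (if p = q then 1 else 0)"
    and expand: "\<And>x. x = (\<Sum>p\<in>UNIV. scl S (polar S x (cd p)) (c p))"
    and assoc: "\<And>p q r. polar S (mul S (c p) (c q)) (c r) = polar S (c p) (mul S (c q) (c r))"
    and left: "\<And>p q r. mul S (mul S (c p) (c q)) (c r) + mul S (mul S (c r) (c q)) (c p)
      = scl S (polar S (c p) (c r)) (c q)"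
  shows "symcomp_basis S c cd"
proof -
  have vs: "vector_space (scl S)" and mb: "bilin (scl S) (scl S) (scl S) (mul S)" and pb: "bilin (scl S) (scl S) (*) (polar S)"
    using S unfolding algebra_with_quadratic_form_def by blast+
  interpret V: vector_space "scl S" by (rule vs)
  note ml = bilinD[OF mb] and pl = bilinD[OF pb]
  have ind: "P x" if "\<And>p. P (c p)" "\<And>x y. P x \<Longrightarrow> P y \<Longrightarrow> P (x + y)" "\<And>a x. P x \<Longrightarrow> P (scl S a x)" for P x
  proof -
    have z: "P 0" using that(3)[OF that(1), of 0 X0] by simp
    have "P (\<Sum>p\<in>A. scl S (polar S x (cd p)) (c p))" if "finite A" for A
      using that by induct (use z \<open>\<And>p. P (c p)\<close> \<open>\<And>x y. P x \<Longrightarrow> P y \<Longrightarrow> P (x + y)\<close> \<open>\<And>a x. P x \<Longrightarrow> P (scl S a x)\<close> in auto)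
    then show ?thesis using expand[of x] by (metis finite)
  qed
  have a: "polar S (mul S x y) z = polar S x (mul S y z)" for x y z
  proof (rule ind[of "\<lambda>x. polar S (mul S x y) z = polar S x (mul S y z)"])
    show "polar S (mul S (c p) y) z = polar S (c p) (mul S y z)" for p
    proof (rule ind[of "\<lambda>y. polar S (mul S (c p) y) z = polar S (c p) (mul S y z)"])
      show "polar S (mul S (c p) (c q)) z = polar S (c p) (mul S (c q) z)" for q
        by (rule ind[of "\<lambda>z. polar S (mul S (c p) (c q)) z = polar S (c p) (mul S (c q) z)"])
          (simp_all add: assoc ml pl)
    qed (simp_all add: ml pl)
  qed (simp_all add: ml pl)
  have l: "mul S (mul S x y) z + mul S (mul S z y) x = scl S (polar S x z) y" for x y z
  proof (rule ind[of "\<lambda>x. mul S (mul S x y) z + mul S (mul S z y) x = scl S (polar S x z) y"])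
    show "mul S (mul S (c p) y) z + mul S (mul S z y) (c p) = scl S (polar S (c p) z) y" for p
    proof (rule ind[of "\<lambda>y. mul S (mul S (c p) y) z + mul S (mul S z y) (c p) = scl S (polar S (c p) z) y"])
      show "mul S (mul S (c p) (c q)) z + mul S (mul S z (c q)) (c p) = scl S (polar S (c p) z) (c q)" for q
      proof (rule ind[of "\<lambda>z. mul S (mul S (c p) (c q)) z + mul S (mul S z (c q)) (c p) = scl S (polar S (c p) z) (c q)"])
        fix z w assume "mul S (mul S (c p) (c q)) z + mul S (mul S z (c q)) (c p) = scl S (polar S (c p) z) (c q)"
          "mul S (mul S (c p) (c q)) w + mul S (mul S w (c q)) (c p) = scl S (polar S (c p) w) (c q)"
        then show "mul S (mul S (c p) (c q)) (z + w) + mul S (mul S (z + w) (c q)) (c p) = scl S (polar S (c p) (z + w)) (c q)"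
          by (simp add: ml pl V.scale_left_distrib algebra_simps)
      next
        fix a z assume "mul S (mul S (c p) (c q)) z + mul S (mul S z (c q)) (c p) = scl S (polar S (c p) z) (c q)"
        then show "mul S (mul S (c p) (c q)) (scl S a z) + mul S (mul S (scl S a z) (c q)) (c p) = scl S (polar S (c p) (scl S a z)) (c q)"
          by (simp add: ml pl V.scale_right_distrib[symmetric] V.scale_scale[symmetric] del: V.scale_scale)
      qed (rule left)
    next
      fix y w assume "mul S (mul S (c p) y) z + mul S (mul S z y) (c p) = scl S (polar S (c p) z) y"
        "mul S (mul S (c p) w) z + mul S (mul S z w) (c p) = scl S (polar S (c p) z) w"
      then show "mul S (mul S (c p) (y + w)) z + mul S (mul S z (y + w)) (c p) = scl S (polar S (c p) z) (y + w)"
        by (simp add: ml V.scale_right_distrib algebra_simps)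
    next
      fix a y assume "mul S (mul S (c p) y) z + mul S (mul S z y) (c p) = scl S (polar S (c p) z) y"
      then show "mul S (mul S (c p) (scl S a y)) z + mul S (mul S z (scl S a y)) (c p) = scl S (polar S (c p) z) (scl S a y)"
        by (simp add: ml V.scale_right_distrib[symmetric] V.scale_left_commute[of _ a] del: V.scale_scale)
    qed
  next
    fix x w assume "mul S (mul S x y) z + mul S (mul S z y) x = scl S (polar S x z) y"
      "mul S (mul S w y) z + mul S (mul S z y) w = scl S (polar S w z) y"
    then show "mul S (mul S (x + w) y) z + mul S (mul S z y) (x + w) = scl S (polar S (x + w) z) y"
      by (simp add: ml pl V.scale_left_distrib algebra_simps)
  next
    fix a x assume "mul S (mul S x y) z + mul S (mul S z y) x = scl S (polar S x z) y"
    then show "mul S (mul S (scl S a x) y) z + mul S (mul S z y) (scl S a x) = scl S (polar S (scl S a x) z) y"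
      by (simp add: ml pl V.scale_right_distrib[symmetric] V.scale_scale[symmetric] del: V.scale_scale)
  qed
  have nd: "x = 0" if "\<And>y. polar S x y = 0" for x using expand[of x] that by simp
  show ?thesis
    by (intro symcomp_basis.intro symcomp.intro symcomp_basis_axioms.intro two vs mb pb a l nd dual expand)
qed

primrec deg :: "ix \<Rightarrow> 3 \<times> 3" where
  "deg X0 = (1, 0)" | "deg X1 = (-1, 0)" | "deg X2 = (0, 1)" | "deg X3 = (0, -1)"
| "deg X4 = (1, 1)" | "deg X5 = (-1, -1)" | "deg X6 = (-1, 1)" | "deg X7 = (1, -1)"

text \<open>\<open>di\<close> and \<open>dj\<close> lift the two coordinates of \<open>deg\<close>
  to the integers \<open>-1, 0, 1\<close>.\<close>

primrec di :: "ix \<Rightarrow> int" where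
  "di X0 = 1" | "di X1 = -1" | "di X2 = 0" | "di X3 = 0"
| "di X4 = 1" | "di X5 = -1" | "di X6 = -1" | "di X7 = 1"

primrec dj :: "ix \<Rightarrow> int" where
  "dj X0 = 0" | "dj X1 = 0" | "dj X2 = 1" | "dj X3 = -1"
| "dj X4 = 1" | "dj X5 = -1" | "dj X6 = 1" | "dj X7 = -1"

text \<open>The carry in adding the lifted degrees modulo \<open>3\<close>. Wherever the product is
  nonzero it is the exponent of \<alpha> in the multiplication table, and \<open>ej\<close> is that
  of \<beta>.\<close>

definition ei where "ei p q = (di p + di q - di (pr p q)) div 3"
definition ej where "ej p q = (dj p + dj q - dj (pr p q)) div 3"

lemma ei: "sg p q \<noteq> 0 \<Longrightarrow> 3 * ei p q = di p + di q - di (pr p q)"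
  and ej: "sg p q \<noteq> 0 \<Longrightarrow> 3 * ej p q = dj p + dj q - dj (pr p q)"
  by (cases p; cases q; simp add: ei_def ej_def)+

lemma di_neg: "di (neg p) = - di p" "dj (neg p) = - dj p" by (cases p; simp)+

lemma sg_assoc: "(if r = neg (pr p q) then sg p q else 0) = (if pr q r = neg p then sg q r else 0)"
  by (cases p; cases q; cases r; simp)

lemma sg_left: "sg p q * sg (pr p q) r + sg r q * sg (pr r q) p = (if r = neg p then 1 else 0) \<and>
   (sg p q * sg (pr p q) r \<noteq> 0 \<and> sg r q * sg (pr r q) p \<noteq> 0 \<longrightarrow> pr (pr p q) r = pr (pr r q) p) \<and>
   (r = neg p \<longrightarrow> (sg p q * sg (pr p q) r \<noteq> 0 \<longrightarrow> pr (pr p q) r = q) \<and> (sg r q * sg (pr r q) p \<noteq> 0 \<longrightarrow> pr (pr r q) p = q))"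
  by (cases p; cases q; cases r; simp)

definition okc :: "'a::field \<Rightarrow> 'a \<Rightarrow> ix \<Rightarrow> ix \<Rightarrow> 'a" where
  "okc \<alpha> \<beta> p q = of_int (sg p q) * (\<alpha> powi ei p q * \<beta> powi ej p q)"

lemma deg_neg: "deg (neg p) = - deg p" by (cases p) simp_all

lemma deg_inj: "inj deg"
proof (rule injI)
  have r: "rk p = (\<lambda>(i, j). if i = 1 then if j = 0 then 0 else if j = 1 then 4 else 7 else
    if i = -1 then if j = 0 then 1 else if j = -1 then 5 else 6 else if j = 1 then 2 else 3) (deg p)" for p
    by (cases p) simp_all
  show "p = q" if "deg p = deg q" for p q using r[of p] r[of q] that rk_inj[of p q] by simp
qed

lemma deg_range: "range deg = - {0}"
proof -
  have "a \<in> range deg" if "a \<noteq> 0" for a :: "3 \<times> 3"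
  proof -
    obtain i j where a: "a = (i, j)" by force
    have r: "range deg = {(1, 0), (-1, 0), (0, 1), (0, -1), (1, 1), (-1, -1), (-1, 1), (1, -1)}"
      unfolding UNIV_ix by auto
    show ?thesis
    proof -
      have "i = 0 \<or> i = 1 \<or> i = -1" "j = 0 \<or> j = 1 \<or> j = -1" using exhaust_3[of i] exhaust_3[of j] by (auto simp: Z3_simps)
      then show ?thesis using that unfolding a r zero_prod_def by (elim disjE) simp_all
    qed
  qed
  moreover have "deg p \<noteq> 0" for p by (cases p) (simp_all add: zero_prod_def)
  ultimately show ?thesis by auto
qed

lemma to_ac_powi: "to_ac (a powi k) = to_ac a powi k"
  by (simp add: power_int_def)

locale okubo =
  fixes \<alpha> \<beta> :: "'k::field" and S :: "('k, 'v::ab_group_add) normed_alg" and x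
  assumes ok: "okubo_algebra \<alpha> \<beta> S x" and two: "(2 :: 'k) \<noteq> 0"
begin

definition c where "c p = x (deg p)"

lemma nz: "\<alpha> \<noteq> 0" "\<beta> \<noteq> 0" and awq: "algebra_with_quadratic_form S"
  using ok unfolding okubo_algebra_def by blast+

sublocale V: vector_space "scl S" using awq unfolding algebra_with_quadratic_form_def by blast

lemma deg_nz: "deg p \<noteq> 0" using deg_range by blast

lemma c_mul: "mul S (c p) (c q) = scl S (okc \<alpha> \<beta> p q) (c (pr p q))"
proof -
  have "mul S (c p) (c q) = (case map_of (okubo_table \<alpha> \<beta>) (deg p, deg q) of None \<Rightarrow> 0 | Some (k, d) \<Rightarrow> scl S k (x d))"
    using ok deg_nz unfolding okubo_algebra_def c_def by blast
  also have "\<dots> = scl S (okc \<alpha> \<beta> p q) (c (pr p q))"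
    by (cases p; cases q; simp add: okubo_table_def okc_def ei_def ej_def power_int_minus c_def)
  finally show ?thesis .
qed

lemma c_polar: "polar S (c p) (c q) = (if q = neg p then 1 else 0)"
proof -
  have "polar S (c p) (c q) = (if deg q = - deg p then 1 else 0)"
    using ok deg_nz unfolding okubo_algebra_def c_def by blast
  then show ?thesis unfolding deg_neg[symmetric] using deg_inj by (simp add: inj_eq)
qed

lemma c_expand: "v = (\<Sum>p\<in>UNIV. scl S (polar S v (c (neg p))) (c p))"
proof -
  have r: "range c = x ` (- {0})" unfolding c_def deg_range[symmetric] by auto
  have inj: "inj c"
    using ok deg_inj deg_nz unfolding okubo_algebra_def c_def inj_on_def by auto
  have "is_basis_of (scl S) UNIV (c ` UNIV)" using ok unfolding okubo_algebra_def r by blast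
  from V.is_basis_coord_system[OF this inj] obtain co where cs: "coord_system (scl S) UNIV UNIV c co" by auto
  have v: "v = (\<Sum>p\<in>UNIV. scl S (co v p) (c p))" using V.coord_systemD(4)[OF cs] by simp
  have pb: "bilin (scl S) (scl S) (*) (polar S)" using awq unfolding algebra_with_quadratic_form_def by blast
  have "polar S v (c (neg q)) = co v q" for q
    by (subst v) (simp add: bilinD[OF pb] c_polar if_distrib[of "\<lambda>a. _ * a"] cong: if_cong)
  then show ?thesis using v by simp
qed

text \<open>The monomial in \<alpha> and \<beta> of a triple product whose result has label
  \<open>s\<close>. Its exponents depend on the sum of the three degrees, so it is the same for all
  orders of \<open>p\<close>, \<open>q\<close>, \<open>r\<close>; the identity
  \<open>mul_left\<close> for general \<alpha>, \<beta> thus follows from that of the signed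
  table.\<close>

definition mo where "mo p q r s = \<alpha> powi ((di p + di q + di r - di s) div 3) * \<beta> powi ((dj p + dj q + dj r - dj s) div 3)"

lemma okc_okc: "okc \<alpha> \<beta> p q * okc \<alpha> \<beta> (pr p q) r = of_int (sg p q * sg (pr p q) r) * mo p q r (pr (pr p q) r)"
proof (cases "sg p q = 0 \<or> sg (pr p q) r = 0")
  case True
  then show ?thesis by (auto simp: okc_def)
next
  case False
  then have "(di p + di q + di r - di (pr (pr p q) r)) div 3 = ei p q + ei (pr p q) r"
    "(dj p + dj q + dj r - dj (pr (pr p q) r)) div 3 = ej p q + ej (pr p q) r"
    using ei[of p q] ei[of "pr p q" r] ej[of p q] ej[of "pr p q" r] by linarith+
  then show ?thesis
    by (simp add: okc_def mo_def power_int_add nz mult_ac)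
qed

sublocale symcomp_basis S c "\<lambda>p. c (neg p)"
proof (rule symcomp_basisI[OF two awq])
  have mb: "bilin (scl S) (scl S) (scl S) (mul S)" and pb: "bilin (scl S) (scl S) (*) (polar S)"
    using awq unfolding algebra_with_quadratic_form_def by blast+
  show "polar S (c p) (c (neg q)) = (if p = q then 1 else 0)" for p q by (auto simp: c_polar)
  show "v = (\<Sum>p\<in>UNIV. scl S (polar S v (c (neg p))) (c p))" for v by (rule c_expand)
  show "polar S (mul S (c p) (c q)) (c r) = polar S (c p) (mul S (c q) (c r))" for p q r
  proof -
    have 1: "okc \<alpha> \<beta> p q = okc \<alpha> \<beta> q r" if r: "r = neg (pr p q)" "pr q r = neg p" 
    proof -
      have s: "sg p q = sg q r" using sg_assoc[of r p q] r by simp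
      show ?thesis
      proof (cases "sg p q = 0")
        case True then show ?thesis using s by (simp add: okc_def)
      next
        case False
        then have "3 * ei p q = 3 * ei q r" "3 * ej p q = 3 * ej q r"
          using ei[of p q] ei[of q r] ej[of p q] ej[of q r] s r(2) arg_cong[OF r(1), of di] arg_cong[OF r(1), of dj]
          by (simp_all add: di_neg)
        then show ?thesis using s by (simp add: okc_def)
      qed
    qed
    have 2: "okc \<alpha> \<beta> p q = 0" if "r = neg (pr p q)" "pr q r \<noteq> neg p"
      using sg_assoc[of r p q] that by (simp add: okc_def)
    have 3: "okc \<alpha> \<beta> q r = 0" if "r \<noteq> neg (pr p q)" "pr q r = neg p"
      using sg_assoc[of r p q] that by (simp add: okc_def)
    have "polar S (mul S (c p) (c q)) (c r) = okc \<alpha> \<beta> p q * (if r = neg (pr p q) then 1 else 0)"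
      "polar S (c p) (mul S (c q) (c r)) = okc \<alpha> \<beta> q r * (if pr q r = neg p then 1 else 0)"
      by (simp_all only: c_mul bilinD[OF pb] c_polar)
    then show ?thesis using 1 2 3
      by (cases "r = neg (pr p q)"; cases "pr q r = neg p") simp_all
  qed
  fix p q r
  let ?s1 = "sg p q * sg (pr p q) r" and ?s2 = "sg r q * sg (pr r q) p"
  \<comment> \<open>The label of the result common to both terms. Where the first coefficient
    vanishes, the label of the second term is taken, since that of the first need not be
    meaningful.\<close>
  define E where "E = (if ?s1 = 0 then pr (pr r q) p else pr (pr p q) r)"
  note O = sg_left[of p q r]
  have m: "mul S (mul S (c p) (c q)) (c r) = scl S (of_int (sg p q * sg (pr p q) r) * mo p q r (pr (pr p q) r)) (c (pr (pr p q) r))" for p q r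
    unfolding okc_okc[symmetric] by (simp add: c_mul bilinD[OF mb])
  have 1: "mul S (mul S (c p) (c q)) (c r) = scl S (of_int ?s1 * mo p q r E) (c E)"
    unfolding m E_def by simp
  have mo: "mo r q p E = mo p q r E" by (simp add: mo_def add_ac)
  have 2: "mul S (mul S (c r) (c q)) (c p) = scl S (of_int ?s2 * mo p q r E) (c E)"
  proof (cases "?s2 = 0")
    case True
    then show ?thesis unfolding m by (simp only: of_int_0 mult_zero_left V.scale_zero_left)
  next
    case False
    then have "pr (pr r q) p = E" using O unfolding E_def by (auto split: if_splits)
    then show ?thesis unfolding m using mo by simp
  qed
  have "mul S (mul S (c p) (c q)) (c r) + mul S (mul S (c r) (c q)) (c p) = scl S (of_int (?s1 + ?s2) * mo p q r E) (c E)"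
    unfolding 1 2 by (simp only: V.scale_left_distrib[symmetric] of_int_add distrib_right)
  moreover have "mo p q r q = 1 \<and> E = q" if r: "r = neg p"
  proof -
    have "E = q" using O r unfolding E_def by (auto split: if_splits)
    moreover have "mo p q r q = 1" unfolding mo_def r by (simp add: di_neg)
    ultimately show ?thesis by simp
  qed
  ultimately show "mul S (mul S (c p) (c q)) (c r) + mul S (mul S (c r) (c q)) (c p) = scl S (polar S (c p) (c r)) (c q)"
    unfolding conjunct1[OF O] c_polar by (cases "r = neg p") simp_all
qed

text \<open>Dividing \<open>c p\<close> by the powers of cube roots of \<alpha> and \<beta> that its
  degree prescribes cancels the monomials in the structure constants and leaves the signs. The same
  basis serves all three indices.\<close>

lemma split_K: "\<exists>b. split_triple SK b"
proof -
  obtain ra where ra: "ra ^ 3 = to_ac \<alpha>" using nth_root_exists[of 3 "to_ac \<alpha>"] by auto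
  obtain rb where rb: "rb ^ 3 = to_ac \<beta>" using nth_root_exists[of 3 "to_ac \<beta>"] by auto
  have nzr: "ra \<noteq> 0" "rb \<noteq> 0" using ra rb nz by (auto simp: power_0_left)
  define t where "t p = ra powi (- di p) * rb powi (- dj p)" for p
  have tn: "t p * t (neg p) = 1" "t (neg p) * t p = 1" for p
    unfolding t_def using nzr by (simp_all add: di_neg power_int_minus field_simps)
  have tm: "t p * t q * to_ac (okc \<alpha> \<beta> p q) = of_int (sg p q) * t (pr p q)" for p q
  proof (cases "sg p q = 0")
    case True
    then show ?thesis by (simp add: okc_def)
  next
    case False
    have a: "to_ac \<alpha> powi k = ra powi (3 * k)" "to_ac \<beta> powi k = rb powi (3 * k)" for k
      unfolding ra[symmetric] rb[symmetric] using power_int_mult[of ra 3 k] power_int_mult[of rb 3 k] by simp_all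
    have "to_ac (okc \<alpha> \<beta> p q) = of_int (sg p q) * (ra powi (3 * ei p q) * rb powi (3 * ej p q))"
      by (simp add: okc_def a[symmetric] to_ac_powi)
    also have "t p * t q * \<dots> = of_int (sg p q) * ((ra powi (- di p) * ra powi (- di q) * ra powi (3 * ei p q)) * (rb powi (- dj p) * rb powi (- dj q) * rb powi (3 * ej p q)))"
      by (simp only: t_def mult_ac)
    also have "\<dots> = of_int (sg p q) * t (pr p q)"
      unfolding t_def by (simp only: power_int_add[symmetric] nzr simp_thms disj_not1 ei[OF False] ej[OF False]) (simp)
    finally show ?thesis .
  qed
  define b :: "3 \<Rightarrow> ix \<Rightarrow> ix \<Rightarrow> 'k alg_closure" where "b m p = scl SK (t p) (ext (c p))" for m p
  interpret K: symcomp SK by (rule SK_symcomp)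
  have "split_triple SK b"
  proof (intro split_triple.intro SK_symcomp split_triple_axioms.intro)
    show "polar SK (b i p) (b i q) = (if q = neg p then 1 else 0)" for i p q
      using tn(1)[of p] by (auto simp: b_def ext_polar c_polar mult.commute)
    show "u = (\<Sum>p\<in>UNIV. scl SK (polar SK u (b i (neg p))) (b i p))" for u i
      using SK_expand[of u] tn(2) by (simp add: b_def mult.assoc mult.left_commute[of "t _" "polar _ _ _"])
    show "mul SK (b i p) (b (i + 1) q) = scl SK (of_int (sg p q)) (b (i + 2) (pr p q))" for i p q
    proof -
      have "t q * (t p * to_ac (okc \<alpha> \<beta> p q)) = of_int (sg p q) * t (pr p q)"
        using tm[of p q] by (simp only: mult_ac)
      then show ?thesis by (simp add: b_def ext_mul c_mul ext_scale SK_simps(1)[symmetric])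
    qed
  qed
  then show ?thesis by (rule exI[of _ b])
qed

end

section \<open>Para-Cayley algebras\<close>

subsection \<open>Standard identities\<close>

locale cayley =
  fixes C :: "('k::field, 'v::ab_group_add) normed_alg" and u :: 'v
  assumes two: "(2 :: 'k) \<noteq> 0" and cay: "cayley_algebra C u"
begin

abbreviation q where "q \<equiv> nrm C"
abbreviation n where "n \<equiv> polar C"
abbreviation prd (infixl "\<cdot>" 70) where "x \<cdot> y \<equiv> mul C x y"
abbreviation sc (infixr "\<odot>" 75) where "a \<odot> x \<equiv> scl C a x"
abbreviation cj where "cj \<equiv> conjugate C u"

lemma
  shows vs: "vector_space (scl C)" and mul_bilin: "bilin (scl C) (scl C) (scl C) (mul C)"
    and q_scale: "q (a \<odot> x) = a\<^sup>2 * q x" and polar_bilin: "bilin (scl C) (scl C) (*) n"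
    and nondeg: "(\<And>y. n x y = 0) \<Longrightarrow> x = 0" and q_mul: "q (x \<cdot> y) = q x * q y"
    and unit [simp]: "u \<cdot> x = x" "x \<cdot> u = x" and dim: "has_dim (scl C) UNIV 8"
  using cay unfolding cayley_algebra_def composition_algebra_def algebra_with_quadratic_form_def by blast+

sublocale V: vector_space "scl C" by (rule vs)

lemmas mul_lin [simp] = bilinD(1-12)[OF mul_bilin]
lemmas polar_lin [simp] = bilinD(1-12)[OF polar_bilin]

lemma polar_sym: "n x y = n y x"
  by (simp add: polar_def add.commute algebra_simps)

lemma q_add: "q (x + y) = q x + q y + n x y"
  by (simp add: polar_def)

lemma polar_self: "n x x = 2 * q x"
proof -
  have "x + x = 2 \<odot> x" by (metis V.scale_left_distrib V.scale_one one_add_one)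
  then have "q (x + x) = 4 * q x" by (simp add: q_scale)
  then show ?thesis using q_add[of x x] by (simp add: algebra_simps)
qed

lemma eq_by_polar: "(\<And>z. n x z = n y z) \<Longrightarrow> x = y"
  using nondeg[of "x - y"] by simp

text \<open>A form with nondegenerate polar form on a nonzero space has a nonzero value at some
  \<open>w\<close>, and \<open>q (u \<cdot> w) = q u * q w\<close> can be cancelled by it.\<close>

lemma q_unit: "q u = 1"
proof -
  have "\<exists>x. x \<noteq> (0 :: 'v)"
  proof (rule ccontr)
    assume "\<nexists>x. x \<noteq> (0 :: 'v)"
    then have z: "UNIV = {0 :: 'v}" by auto
    obtain B :: "'v set" where B: "finite B" "card B = 8"
      using dim unfolding has_dim_def by auto
    have "card B \<le> card {0 :: 'v}" by (rule card_mono) (use z in blast)+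
    then show False using B by simp
  qed
  then obtain x :: 'v where "x \<noteq> 0" by blast
  then obtain y where "n x y \<noteq> 0" using nondeg by blast
  then obtain w where "q w \<noteq> 0" unfolding polar_def by (metis diff_zero)
  then show ?thesis using q_mul[of u w] by simp
qed

lemma polar_mul_left: "n (x \<cdot> y) (x \<cdot> z) = q x * n y z"
  unfolding polar_def mul_lin(1)[symmetric] q_mul by (simp add: algebra_simps)

lemma polar_exchange: "n (x \<cdot> y) (w \<cdot> z) + n (w \<cdot> y) (x \<cdot> z) = n x w * n y z"
proof -
  have "n ((x + w) \<cdot> y) ((x + w) \<cdot> z) = (q x + q w + n x w) * n y z"
    unfolding polar_mul_left q_add ..
  then show ?thesis by (simp add: polar_mul_left algebra_simps)
qed

lemma polar_exchange': "n (x \<cdot> y) (w \<cdot> z) + n (x \<cdot> z) (w \<cdot> y) = n x w * n y z"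
  using polar_exchange[of x y w z] polar_sym[of "w \<cdot> y"] by simp

lemma polar_unit: "n u u = 2" by (simp add: polar_self q_unit)

lemma cj_linear [simp]: "cj (x + y) = cj x + cj y" "cj (a \<odot> x) = a \<odot> cj x" "cj (- x) = - cj x" "cj 0 = 0"
  by (simp_all add: conjugate_def V.scale_left_distrib V.scale_right_diff_distrib)

lemma cj_polar: "n (cj x) y = n x (cj y)"
  using polar_sym[of u y] by (simp add: conjugate_def)

lemma cj_cj [simp]: "cj (cj x) = x"
  by (simp add: conjugate_def polar_unit V.scale_left_diff_distrib[symmetric])

lemma polar_adj_left: "n (x \<cdot> y) z = n y (cj x \<cdot> z)"
  using polar_exchange[of x y u z] by (simp add: conjugate_def algebra_simps)

lemma polar_adj_right: "n (x \<cdot> y) z = n x (z \<cdot> cj y)"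
  using polar_exchange'[of x y z u] polar_sym by (simp add: conjugate_def algebra_simps)

lemma cj_mul: "cj (x \<cdot> y) = cj y \<cdot> cj x"
proof (rule eq_by_polar)
  fix z
  have "n (cj y \<cdot> cj x) z = n (cj x) (y \<cdot> z)" by (simp add: polar_adj_left)
  also have "\<dots> = n (cj x \<cdot> cj z) y" by (simp add: polar_adj_right)
  also have "\<dots> = n (cj z) (x \<cdot> y)" by (simp add: polar_adj_left)
  finally show "n (cj (x \<cdot> y)) z = n (cj y \<cdot> cj x) z" by (metis cj_polar polar_sym)
qed

lemma mul_cj_right: "(y \<cdot> x) \<cdot> cj z + (y \<cdot> z) \<cdot> cj x = n x z \<odot> y"
proof (rule eq_by_polar)
  fix w
  have "n ((y \<cdot> x) \<cdot> cj z) w = n (y \<cdot> x) (w \<cdot> z)" "n ((y \<cdot> z) \<cdot> cj x) w = n (y \<cdot> z) (w \<cdot> x)"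
    by (simp_all add: polar_adj_right[of _ "cj _"])
  then show "n ((y \<cdot> x) \<cdot> cj z + (y \<cdot> z) \<cdot> cj x) w = n (n x z \<odot> y) w"
    using polar_exchange'[of y x w z] by simp
qed

lemma cj_mul_left: "cj x \<cdot> y + cj y \<cdot> x = n x y \<odot> u"
proof (rule eq_by_polar)
  fix w
  have "n (cj x \<cdot> y) w = n y (x \<cdot> w)" "n (cj y \<cdot> x) w = n x (y \<cdot> w)"
    by (simp_all add: polar_adj_left)
  then show "n (cj x \<cdot> y + cj y \<cdot> x) w = n (n x y \<odot> u) w"
    using polar_exchange[of x u y w] polar_sym[of y "x \<cdot> w"] by (simp add: add.commute)
qed

abbreviation P where "P \<equiv> para C u"

lemma P_simps [simp]: "scl P = scl C" "mul P = (\<lambda>x y. cj x \<cdot> cj y)" "nrm P = q" "polar P = n"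
  by (simp_all add: para_def polar_def fun_eq_iff)

text \<open>In the para-product, \<open>(x \<bullet> y) \<bullet> z\<close> is
  \<open>(y \<cdot> x) \<cdot> cj z\<close>, so \<open>mul_left\<close> becomes
  \<open>mul_cj_right\<close>.\<close>

lemma P_symcomp: "symcomp P"
proof (rule symcomp.intro)
  show "bilin (scl P) (scl P) (scl P) (mul P)"
    unfolding P_simps by (rule bilinI[OF vs vs vs]) simp_all
  show "polar P (mul P x y) z = polar P x (mul P y z)" for x y z
    using polar_adj_left[of "cj x" "cj y" z] polar_adj_right[of "cj y" "cj z" x] polar_sym by (simp add: polar_sym)
  show "mul P (mul P x y) z + mul P (mul P z y) x = scl P (polar P x z) y" for x y z
    unfolding P_simps cj_mul cj_cj by (rule mul_cj_right)
qed (use two vs polar_bilin nondeg in \<open>simp_all\<close>)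

end

subsection \<open>The grading\<close>

text \<open>The binary digits of the number of the label, lowest first.\<close>

primrec cdeg :: "ix \<Rightarrow> 2 \<times> 2 \<times> 2" where
  "cdeg X0 = (0, 0, 0)" | "cdeg X1 = (1, 0, 0)" | "cdeg X2 = (0, 1, 0)" | "cdeg X3 = (1, 1, 0)"
| "cdeg X4 = (0, 0, 1)" | "cdeg X5 = (1, 0, 1)" | "cdeg X6 = (0, 1, 1)" | "cdeg X7 = (1, 1, 1)"

lemma exhaust_2: "(i :: 2) = 0 \<or> i = 1"
proof (cases i)
  case (of_int z)
  then have "z = 0 \<or> z = 1" by auto
  then show ?thesis using of_int by auto
qed

lemma cdeg_inj: "inj cdeg"
proof (rule injI)
  have r: "rk p = (\<lambda>(i, j, k). (if i = 1 then 1 else 0) + (if j = 1 then 2 else 0) + (if k = 1 then 4 else 0)) (cdeg p)" for p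
    by (cases p) simp_all
  show "p = q" if "cdeg p = cdeg q" for p q using r[of p] r[of q] that rk_inj[of p q] by simp
qed

lemma cdeg_surj: "\<exists>p. cdeg p = a"
proof -
  obtain i j k where a: "a = (i, j, k)" by (metis prod_cases3)
  have "a \<in> {cdeg X0, cdeg X1, cdeg X2, cdeg X3, cdeg X4, cdeg X5, cdeg X6, cdeg X7}"
    using exhaust_2[of i] exhaust_2[of j] exhaust_2[of k] unfolding a by (elim disjE) simp_all
  then show ?thesis by blast
qed

lemma Z2_cubed_self: "(a :: 2 \<times> 2 \<times> 2) + a = 0" "- a = a"
proof -
  have "(i :: 2) + i = 0" for i using exhaust_2[of i] by auto
  then show "a + a = 0" by (cases a) (simp add: zero_prod_def)
  then show "- a = a" by (simp add: minus_unique)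
qed

locale graded_cayley =
  fixes C :: "('k::field, 'v::ab_group_add) normed_alg" and u :: 'v and D
  assumes two0: "(2 :: 'k) \<noteq> 0" and gr: "Z2_cubed_graded_cayley C u D"
begin

sublocale cayley C u
  using two0 gr unfolding Z2_cubed_graded_cayley_def by unfold_locales auto

lemma D_sub: "V.subspace (D \<mu>)"
  and D_unique: "\<exists>!f. (\<forall>\<mu>. f \<mu> \<in> D \<mu>) \<and> v = (\<Sum>\<mu>\<in>UNIV. f \<mu>)"
  and D_mul: "x \<in> D \<mu> \<Longrightarrow> y \<in> D \<nu> \<Longrightarrow> x \<cdot> y \<in> D (\<mu> + \<nu>)"
  and D_dim: "has_dim (scl C) (D \<mu>) 1"
  using gr unfolding Z2_cubed_graded_cayley_def group_grading_def by blast+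

lemmas D_closed = V.subspace_0[OF D_sub] V.subspace_add[OF D_sub] V.subspace_scale[OF D_sub]
  V.subspace_diff[OF D_sub] V.subspace_neg[OF D_sub]

lemma D_eq:
  assumes "\<And>\<mu>. f \<mu> \<in> D \<mu>" "\<And>\<mu>. g \<mu> \<in> D \<mu>" "(\<Sum>\<mu>\<in>UNIV. f \<mu>) = (\<Sum>\<mu>\<in>UNIV. g \<mu>)"
  shows "f = g"
  using D_unique[of "\<Sum>\<mu>\<in>UNIV. f \<mu>"] assms by metis

lemma D_disj: assumes "x \<in> D \<mu>" "x \<in> D \<nu>" "\<mu> \<noteq> \<nu>" shows "x = 0"
proof -
  have "(\<lambda>\<rho>. if \<rho> = \<mu> then x else 0) = (\<lambda>\<rho>. if \<rho> = \<nu> then x else 0)"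
    by (rule D_eq) (auto simp: D_closed assms)
  from fun_cong[OF this, of \<mu>] show ?thesis using assms by simp
qed

lemma D_line: "\<exists>e. e \<noteq> 0 \<and> e \<in> D \<mu> \<and> (\<forall>v\<in>D \<mu>. \<exists>a. v = a \<odot> e)"
proof -
  obtain B where B: "is_basis_of (scl C) (D \<mu>) B" "card B = 1" using D_dim unfolding has_dim_def by blast
  then obtain e where e: "B = {e}" by (meson card_1_singletonE)
  have "e \<in> D \<mu>" "V.independent {e}" "V.span {e} = D \<mu>" using B unfolding e is_basis_of_def by auto
  moreover have "e \<noteq> 0" using V.dependent_zero[of "{e}"] calculation by auto
  ultimately show ?thesis using V.span_singleton by (metis (no_types, lifting) imageE)
qed

lemma D_sum_ind:
  assumes "\<And>\<mu> v. v \<in> D \<mu> \<Longrightarrow> Q v" "Q 0" "\<And>v w. Q v \<Longrightarrow> Q w \<Longrightarrow> Q (v + w)"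
  shows "Q v"
proof -
  obtain f where f: "\<And>\<mu>. f \<mu> \<in> D \<mu>" "v = (\<Sum>\<mu>\<in>UNIV. f \<mu>)" using D_unique[of v] by blast
  have "Q (\<Sum>\<mu>\<in>A. f \<mu>)" if "finite A" for A using that by induct (simp_all add: assms(2) assms(1)[OF f(1)] assms(3))
  then show ?thesis unfolding f(2) by simp
qed

text \<open>Comparing degrees in \<open>u \<cdot> x = x\<close> shows that the component of
  \<open>u\<close> of degree \<open>0\<close> is a left unit for every homogeneous \<open>x\<close>,
  hence for \<open>u\<close> itself, and so it equals \<open>u\<close>.\<close>

lemma unit_D: "u \<in> D 0"
proof -
  obtain f where f: "\<And>\<mu>. f \<mu> \<in> D \<mu>" "u = (\<Sum>\<mu>\<in>UNIV. f \<mu>)" using D_unique[of u] by blast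
  have hom: "f 0 \<cdot> x = x" if x: "x \<in> D \<nu>" for x \<nu>
  proof -
    have "(\<lambda>\<rho>. f (\<rho> - \<nu>) \<cdot> x) = (\<lambda>\<rho>. if \<rho> = \<nu> then x else 0)"
    proof (rule D_eq)
      show "f (\<rho> - \<nu>) \<cdot> x \<in> D \<rho>" for \<rho> using D_mul[OF f(1)[of "\<rho> - \<nu>"] x] by simp
      show "(if \<rho> = \<nu> then x else 0) \<in> D \<rho>" for \<rho> using x D_closed by auto
      have "(\<Sum>\<mu>\<in>UNIV. f \<mu>) \<cdot> x = (\<Sum>\<mu>\<in>UNIV. f \<mu> \<cdot> x)" by simp
      also have "\<dots> = (\<Sum>\<rho>\<in>UNIV. f (\<rho> - \<nu>) \<cdot> x)"
        by (rule sum.reindex_bij_witness[of _ "\<lambda>\<rho>. \<rho> - \<nu>" "\<lambda>\<mu>. \<mu> + \<nu>"]) auto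
      finally show "(\<Sum>\<rho>\<in>UNIV. f (\<rho> - \<nu>) \<cdot> x) = (\<Sum>\<rho>\<in>UNIV. if \<rho> = \<nu> then x else 0)"
        unfolding f(2)[symmetric] by simp
    qed
    from fun_cong[OF this, of \<nu>] show ?thesis by simp
  qed
  have "f 0 \<cdot> u = u" by (rule D_sum_ind[of "\<lambda>x. f 0 \<cdot> x = x"]) (auto intro: hom)
  then show ?thesis using f(1)[of 0] by simp
qed

text \<open>The quadratic equation of \<open>x\<close> writes \<open>2 n(x, u) x\<close> as a
  combination of \<open>u\<close> and \<open>x \<cdot> x\<close>, both of degree
  \<open>0\<close>.\<close>

lemma D_orth_unit: assumes x: "x \<in> D \<mu>" and \<mu>: "\<mu> \<noteq> 0" shows "n x u = 0"
proof (cases "x = 0")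
  case False
  have "cj x \<cdot> x + cj x \<cdot> x = n x x \<odot> u" by (rule cj_mul_left)
  then have "n x u \<odot> x + n x u \<odot> x = n x x \<odot> u + x \<cdot> x + x \<cdot> x"
    by (simp add: conjugate_def algebra_simps)
  moreover have "x \<cdot> x \<in> D 0" using D_mul[OF x x] by (simp add: Z2_cubed_self)
  ultimately have "n x u \<odot> x + n x u \<odot> x \<in> D 0" by (simp add: D_closed unit_D)
  moreover have "n x u \<odot> x + n x u \<odot> x \<in> D \<mu>" by (intro D_closed x)
  ultimately have "n x u \<odot> x + n x u \<odot> x = 0" using D_disj \<mu> by blast
  then have "(2 * n x u) \<odot> x = 0" by (metis V.scale_left_distrib mult_2)
  then show ?thesis using False two by simp
qed simp

lemma D_pure: "x \<in> D \<mu> \<Longrightarrow> \<mu> \<noteq> 0 \<Longrightarrow> cj x = - x"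
  by (simp add: conjugate_def D_orth_unit)

lemma cj_D: assumes x: "x \<in> D \<mu>" shows "cj x \<in> D \<mu>"
proof (cases "\<mu> = 0")
  case True
  then show ?thesis using x unit_D by (simp add: conjugate_def D_closed)
next
  case False
  then show ?thesis using D_pure[OF x] x by (simp add: D_closed)
qed

text \<open>\<open>n x y \<odot> u\<close> is a sum of two products of degree
  \<open>\<mu> + \<nu>\<close>, which is nonzero in an elementary 2-group when the degrees differ,
  whereas \<open>u\<close> has degree \<open>0\<close>.\<close>

lemma D_orth: assumes x: "x \<in> D \<mu>" and y: "y \<in> D \<nu>" and ne: "\<mu> \<noteq> \<nu>" shows "n x y = 0"
proof -
  have "n x y \<odot> u \<in> D (\<mu> + \<nu>)"
    unfolding cj_mul_left[symmetric]
    using D_mul[OF cj_D[OF x] y] D_mul[OF cj_D[OF y] x] by (simp add: D_closed add.commute)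
  moreover have "n x y \<odot> u \<in> D 0" by (intro D_closed unit_D)
  moreover have "\<mu> + \<nu> \<noteq> 0" using ne Z2_cubed_self by (metis add_eq_0_iff)
  ultimately have "n x y \<odot> u = 0" using D_disj by blast
  moreover have "u \<noteq> 0"
  proof
    assume "u = 0"
    then have "n u u = 0" by simp
    then show False using polar_unit two by simp
  qed
  ultimately show ?thesis by simp
qed

text \<open>The component is a line orthogonal to all others, so an isotropic vector in it would lie
  in the radical of the polar form.\<close>

lemma q_nonzero: assumes x: "x \<in> D \<mu>" "x \<noteq> 0" shows "q x \<noteq> 0"
proof
  assume q: "q x = 0"
  obtain e where e: "e \<in> D \<mu>" "\<forall>v\<in>D \<mu>. \<exists>a. v = a \<odot> e" using D_line by blast
  obtain a where a: "x = a \<odot> e" using e x by blast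
  have "a \<noteq> 0" using x a by auto
  then have "q e = 0" using q unfolding a q_scale by simp
  have "n x v = 0" for v
  proof (rule D_sum_ind[of "\<lambda>v. n x v = 0"])
    fix \<nu> v assume v: "v \<in> D \<nu>"
    show "n x v = 0"
    proof (cases "\<nu> = \<mu>")
      case True
      then obtain b where "v = b \<odot> e" using e v by blast
      then show ?thesis unfolding a using \<open>q e = 0\<close> by (simp add: polar_self)
    qed (use D_orth x v in blast)
  qed auto
  then show False using nondeg x by blast
qed

definition el where "el \<mu> = (SOME e. e \<noteq> 0 \<and> e \<in> D \<mu>)"

lemma el: "el \<mu> \<noteq> 0" "el \<mu> \<in> D \<mu>"
  unfolding el_def using someI_ex[of "\<lambda>e. e \<noteq> 0 \<and> e \<in> D \<mu>"] D_line by blast+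

text \<open>Products of three generators, and not arbitrary vectors of the eight lines, so that the
  multiplication table is determined by the norms of the generators.\<close>

primrec c where
  "c X0 = u" | "c X1 = el (1, 0, 0)" | "c X2 = el (0, 1, 0)" | "c X3 = el (1, 0, 0) \<cdot> el (0, 1, 0)"
| "c X4 = el (0, 0, 1)" | "c X5 = el (1, 0, 0) \<cdot> el (0, 0, 1)" | "c X6 = el (0, 1, 0) \<cdot> el (0, 0, 1)"
| "c X7 = (el (1, 0, 0) \<cdot> el (0, 1, 0)) \<cdot> el (0, 0, 1)"

lemma c_D: "c p \<in> D (cdeg p)"
  using unit_D el(2) D_mul[OF el(2) el(2), of "(1, 0, 0)" "(0, 1, 0)"] D_mul[OF el(2) el(2), of "(1, 0, 0)" "(0, 0, 1)"]
    D_mul[OF el(2) el(2), of "(0, 1, 0)" "(0, 0, 1)"]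
    D_mul[OF D_mul[OF el(2) el(2), of "(1, 0, 0)" "(0, 1, 0)"] el(2), of "(0, 0, 1)"]
  by (cases p) (simp_all add: zero_prod_def)

lemma c_q: "q (c p) \<noteq> 0"
  using q_nonzero[OF el(2) el(1)] by (cases p) (simp_all add: q_unit q_mul)

lemma c_orth: "p \<noteq> r \<Longrightarrow> n (c p) (c r) = 0"
  using D_orth[OF c_D c_D] cdeg_inj by (meson injD)

lemma c_span: assumes v: "v \<in> D (cdeg p)" shows "\<exists>a. v = a \<odot> c p"
proof -
  obtain e where e: "\<forall>v\<in>D (cdeg p). \<exists>a. v = a \<odot> e" using D_line by blast
  obtain a b where a: "v = a \<odot> e" and b: "c p = b \<odot> e" using e v c_D by blast
  have "b \<noteq> 0"
  proof
    assume "b = 0"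
    then have "n (c p) (c p) = 0" using b by simp
    then show False using c_q[of p] two by (simp add: polar_self)
  qed
  then have "v = (a / b) \<odot> c p" by (simp add: a b)
  then show ?thesis ..
qed

lemma c_total: "(\<And>p. n v (c p) = 0) \<Longrightarrow> v = 0"
proof (rule nondeg)
  fix w assume v: "\<And>p. n v (c p) = 0"
  show "n v w = 0"
  proof (rule D_sum_ind[of "\<lambda>w. n v w = 0"])
    fix \<mu> w assume "w \<in> D \<mu>"
    moreover obtain p where "cdeg p = \<mu>" using cdeg_surj by blast
    ultimately obtain a where "w = a \<odot> c p" using c_span by blast
    then show "n v w = 0" using v by simp
  qed auto
qed

definition cd where "cd p = (1 / n (c p) (c p)) \<odot> c p"

lemma c_self: "n (c p) (c p) \<noteq> 0" using c_q[of p] two by (simp add: polar_self)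

lemma c_dual: "n (c p) (cd r) = (if p = r then 1 else 0)"
  by (cases "p = r") (simp_all add: cd_def c_orth c_self)

lemma c_expand: "v = (\<Sum>p\<in>UNIV. n v (cd p) \<odot> c p)"
proof -
  have "n (v - (\<Sum>p\<in>UNIV. n v (cd p) \<odot> c p)) (c r) = 0" for r
  proof -
    have "n (\<Sum>p\<in>UNIV. n v (cd p) \<odot> c p) (c r) = (\<Sum>p\<in>UNIV. n v (cd p) * n (c p) (c r))"
      by simp
    also have "\<dots> = (\<Sum>p\<in>UNIV. if p = r then n v (cd r) * n (c r) (c r) else 0)"
      by (rule sum.cong) (auto simp: c_orth)
    also have "\<dots> = n v (c r)" using c_self[of r] by (simp add: cd_def)
    finally show ?thesis by simp
  qed
  from c_total[OF this] show ?thesis by simp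
qed

sublocale Q: symcomp_basis P c cd
  by (intro symcomp_basis.intro symcomp_basis_axioms.intro P_symcomp) (simp_all add: c_dual c_expand[symmetric])

end

subsection \<open>The split form of the para-Cayley algebra\<close>

text \<open>
  \<open>nn p\<close> is the norm of the basis vector \<open>f p\<close> of the Cayley algebra, and \<open>tau\<close> is an automorphism of
  order three of the signed table. The three isotropic bases are the \<open>tau\<close>-twists of one basis \<open>g\<close>,
  up to the factor \<open>-1/2\<close>.
\<close>

primrec nn :: "ix \<Rightarrow> int" where
  "nn X0 = 1" | "nn X1 = -1" | "nn X2 = -1" | "nn X3 = 1" | "nn X4 = -1" | "nn X5 = 1" | "nn X6 = 1" | "nn X7 = -1"

primrec tau :: "ix \<Rightarrow> ix" where
  "tau X0 = X0" | "tau X1 = X1" | "tau X2 = X4" | "tau X4 = X6" | "tau X6 = X2" | "tau X3 = X5" | "tau X5 = X7" | "tau X7 = X3"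

lemma tau_sym: "sg (tau p) (tau q) = sg p q" "pr (tau p) (tau q) = (if sg p q = 0 then pr (tau p) (tau q) else tau (pr p q))"
  "neg (tau p) = tau (neg p)" "tau (tau (tau p)) = p"
  by (cases p; cases q; simp)+

text \<open>The split Cayley algebra seen through its para-product: \<open>f X0\<close> is its unit,
  the other vectors are pure, and the three generators have norm \<open>-1\<close>, that is, polar
  value \<open>-2\<close>.\<close>

locale para_frame = symcomp S for S :: "('k::field, 'v::ab_group_add) normed_alg" +
  fixes f :: "ix \<Rightarrow> 'v"
  assumes f0: "mul S (f X0) (f X0) = f X0" "p \<noteq> X0 \<Longrightarrow> mul S (f X0) (f p) = - f p" "p \<noteq> X0 \<Longrightarrow> mul S (f p) (f X0) = - f p"
    and f_orth: "p \<noteq> r \<Longrightarrow> polar S (f p) (f r) = 0"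
    and f_norm: "polar S (f X0) (f X0) = 2" "polar S (f X1) (f X1) = - 2" "polar S (f X2) (f X2) = - 2" "polar S (f X4) (f X4) = - 2"
    and f_mul: "f X3 = mul S (f X1) (f X2)" "f X5 = mul S (f X1) (f X4)" "f X6 = mul S (f X2) (f X4)" "f X7 = mul S (f X3) (f X4)"
    and f_total: "(\<And>p. polar S v (f p) = 0) \<Longrightarrow> v = 0"
begin

lemma half_eq: assumes "x + x = y + y" shows "x = (y :: 'v)"
proof -
  have "2 \<odot> x = 2 \<odot> y" using assms by (metis V.scale_left_distrib V.scale_one one_add_one)
  then show ?thesis using two by simp
qed

lemma polar_mul_self: "n (x \<star> y) (x \<star> y) + n (x \<star> y) (x \<star> y) = n x x * n y y"
proof -
  have "n (x \<star> y) (x \<star> y) + n (x \<star> y) (x \<star> y) = n x (y \<star> (x \<star> y) + y \<star> (x \<star> y))"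
    unfolding polar_assoc[of x y "x \<star> y"] polar_lin(1) ..
  then show ?thesis unfolding mul_right by simp
qed

lemma polar_f: "n (f p) (f r) = (if p = r then 2 * of_int (nn p) else 0)"
proof -
  have h: "a = b" if "a + a = b + b" for a b :: 'k
  proof -
    have "2 * a = 2 * b" using that by simp
    then show ?thesis using two by simp
  qed
  have 3: "n (f X3) (f X3) = 2" unfolding f_mul by (rule h) (simp add: polar_mul_self f_norm)
  have "n (f X5) (f X5) = 2" "n (f X6) (f X6) = 2" unfolding f_mul by (rule h, simp add: polar_mul_self f_norm)+
  moreover have "n (f X7) (f X7) = - 2" unfolding f_mul(4) by (rule h) (simp add: polar_mul_self 3 f_norm)
  ultimately show ?thesis using f_orth 3 by (cases "p = r"; cases p) (simp_all add: f_norm)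
qed

lemma anti: assumes "p \<noteq> X0" "r \<noteq> X0" shows "f p \<star> f r + f r \<star> f p = - (n (f p) (f r) \<odot> f X0)"
proof -
  have "f p \<star> (f X0 \<star> f r) = - (f p \<star> f r)" "f r \<star> (f X0 \<star> f p) = - (f r \<star> f p)"
    using assms by (simp_all add: f0(2))
  then have "- (f p \<star> f r) + - (f r \<star> f p) = n (f p) (f r) \<odot> f X0"
    using mul_right[of "f p" "f X0" "f r"] by simp
  moreover have "f p \<star> f r + f r \<star> f p = - (- (f p \<star> f r) + - (f r \<star> f p))" by simp
  ultimately show ?thesis by simp
qed

lemma f_sq: assumes "p \<noteq> X0" shows "f p \<star> f p = of_int (- nn p) \<odot> f X0"
proof (rule half_eq)
  have "f p \<star> f p + f p \<star> f p = - ((2 * of_int (nn p)) \<odot> f X0)" using anti[OF assms assms] by (simp add: polar_f)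
  also have "\<dots> = of_int (- nn p) \<odot> f X0 + of_int (- nn p) \<odot> f X0"
  proof -
    have e: "of_int (- nn p) + of_int (- nn p) = - (2 * of_int (nn p) :: 'k)" by simp
    show ?thesis by (simp only: V.scale_left_distrib[symmetric] e V.scale_minus_left)
  qed
  finally show "f p \<star> f p + f p \<star> f p = of_int (- nn p) \<odot> f X0 + of_int (- nn p) \<odot> f X0" .
qed

lemma f_anti: assumes "p \<noteq> X0" "r \<noteq> X0" "p \<noteq> r" shows "f p \<star> f r = - (f r \<star> f p)"
  using anti[OF assms(1,2)] assms(3) by (simp add: polar_f eq_neg_iff_add_eq_0)

lemma dbl: "(2 * a) \<odot> x = a \<odot> x + a \<odot> x"
  by (simp only: mult_2 V.scale_left_distrib)

lemma f_self: "n (f p) (f p) = 2 * of_int (nn p)" by (simp add: polar_f)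

lemma flip: "f p \<star> (x \<star> f p) = of_int (nn p) \<odot> x"
  by (rule half_eq) (simp only: mul_right f_self dbl)

lemma flip': "(f p \<star> x) \<star> f p = of_int (nn p) \<odot> x"
  by (rule half_eq) (simp only: mul_left f_self dbl)

lemma swap: "p \<noteq> r \<Longrightarrow> f p \<star> (x \<star> f r) = - (f r \<star> (x \<star> f p))"
  using mul_right[of "f p" x "f r"] by (simp add: polar_f eq_neg_iff_add_eq_0)

text \<open>A line of the Fano plane: one product of two of its points gives the other five by
  anticommutativity, \<open>flip\<close> and \<open>flip'\<close>.\<close>

lemma line:
  assumes "f p \<star> f r = of_int e \<odot> f s" "p \<noteq> X0" "r \<noteq> X0" "s \<noteq> X0" "p \<noteq> r" "r \<noteq> s" "p \<noteq> s" "e * e = 1"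
  shows "f p \<star> f r = of_int e \<odot> f s" "f r \<star> f p = of_int (- e) \<odot> f s"
    "f p \<star> f s = of_int (- e * nn p) \<odot> f r" "f s \<star> f p = of_int (e * nn p) \<odot> f r"
    "f s \<star> f r = of_int (- e * nn r) \<odot> f p" "f r \<star> f s = of_int (e * nn r) \<odot> f p"
proof -
  have "of_int e * of_int e = (1 :: 'k)" using assms(8) by (metis of_int_1 of_int_mult)
  then have s: "f s = of_int e \<odot> (f p \<star> f r)" using assms(1) by simp
  show "f p \<star> f r = of_int e \<odot> f s" by fact
  show 2: "f r \<star> f p = of_int (- e) \<odot> f s" using f_anti[of r p] assms by simp
  have s': "f s = of_int (- e) \<odot> (f r \<star> f p)" using 2 \<open>of_int e * of_int e = (1 :: 'k)\<close> by simp
  show 3: "f p \<star> f s = of_int (- e * nn p) \<odot> f r" by (subst s') (simp add: flip)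
  show "f s \<star> f p = of_int (e * nn p) \<odot> f r" using f_anti[of s p] 3 assms by simp
  show 4: "f s \<star> f r = of_int (- e * nn r) \<odot> f p" by (subst s') (simp add: flip')
  show "f r \<star> f s = of_int (e * nn r) \<odot> f p" using f_anti[of r s] 4 assms by simp
qed

text \<open>The seven lines. Four define the points; the other three follow by exchanging the outer
  factors of a nested product with \<open>swap\<close>.\<close>

lemma f_table:
  "f X1 \<star> f X2 = of_int 1 \<odot> f X3" "f X1 \<star> f X4 = of_int 1 \<odot> f X5" "f X2 \<star> f X4 = of_int 1 \<odot> f X6"
  "f X3 \<star> f X4 = of_int 1 \<odot> f X7" "f X1 \<star> f X6 = of_int (-1) \<odot> f X7" "f X2 \<star> f X5 = of_int 1 \<odot> f X7" "f X3 \<star> f X5 = of_int 1 \<odot> f X6"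
proof -
  show 1: "f X1 \<star> f X2 = of_int 1 \<odot> f X3" "f X1 \<star> f X4 = of_int 1 \<odot> f X5" "f X2 \<star> f X4 = of_int 1 \<odot> f X6"
    "f X3 \<star> f X4 = of_int 1 \<odot> f X7" by (simp_all add: f_mul)
  have 21: "f X2 \<star> f X1 = - f X3" using f_anti[of X2 X1] 1 by simp
  have 43: "f X4 \<star> f X3 = - f X7" using f_anti[of X4 X3] 1 by simp
  have 13: "f X1 \<star> f X3 = f X2" using line(3)[OF 1(1)] by simp
  have 42: "f X4 \<star> f X2 = - f X6" using f_anti[of X4 X2] 1 by simp
  show "f X1 \<star> f X6 = of_int (-1) \<odot> f X7" using swap[of X1 X4 "f X2"] by (simp add: f_mul(3) 21 43)
  show "f X2 \<star> f X5 = of_int 1 \<odot> f X7" using swap[of X2 X4 "f X1"] 1(1) by (simp add: f_mul(2) 43)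
  show "f X3 \<star> f X5 = of_int 1 \<odot> f X6" using swap[of X3 X4 "f X1"] by (simp add: f_mul(2) 13 42)
qed

lemmas f_mul_table = f0 f_sq f_table[THEN line(1), simplified] f_table[THEN line(2), simplified] f_table[THEN line(3), simplified]
  f_table[THEN line(4), simplified] f_table[THEN line(5), simplified] f_table[THEN line(6), simplified]

primrec g where
  "g X0 = f X0 + f X1" | "g X1 = f X0 - f X1" | "g X2 = f X2 + f X3" | "g X3 = f X3 - f X2"
| "g X4 = f X4 + f X5" | "g X5 = f X5 - f X4" | "g X6 = f X6 - f X7" | "g X7 = f X6 + f X7"

lemma g_mul: "g p \<star> g (tau r) = (if sg p r = 0 then 0 else - (of_int (sg p r) \<odot> (g (tau (tau (pr p r))) + g (tau (tau (pr p r))))))"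
  by (cases p; cases r; simp add: f_mul_table)

lemma g_polar: "n (g p) (g r) = (if r = neg p then 4 else 0)"
  by (cases p; cases r; simp add: polar_f)

definition tw :: "3 \<Rightarrow> ix \<Rightarrow> ix" where "tw i = (if i = 0 then id else if i = 1 then tau else tau \<circ> tau)"

lemma tw: "tw (i + 1) p = tau (tw i p)" "sg (tw i p) (tw i r) = sg p r"
  "sg p r \<noteq> 0 \<Longrightarrow> pr (tw i p) (tw i r) = tw i (pr p r)" "neg (tw i p) = tw i (neg p)" "tw i p = tw i r \<longleftrightarrow> p = r"
proof -
  have t: "sg p r \<noteq> 0 \<Longrightarrow> pr (tau p) (tau r) = tau (pr p r)" for p r using tau_sym(2) by metis
  have ti: "tau p = tau r \<longleftrightarrow> p = r" for p r using tau_sym(4) by metis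
  show "tw (i + 1) p = tau (tw i p)" "sg (tw i p) (tw i r) = sg p r" "neg (tw i p) = tw i (neg p)" "tw i p = tw i r \<longleftrightarrow> p = r"
    using exhaust_3[of i] by (auto simp: tw_def Z3_simps tau_sym(1,3,4) ti)
  show "sg p r \<noteq> 0 \<Longrightarrow> pr (tw i p) (tw i r) = tw i (pr p r)"
    using exhaust_3[of i] by (auto simp: tw_def t tau_sym(1))
qed

text \<open>The vectors \<open>g p\<close> have nonzero polar values \<open>4\<close> and nonzero
  products \<open>\<plusminus>2 g\<close>; the factor \<open>-1/2\<close> normalizes both at once.
  As \<open>g_mul\<close> twists its second factor by \<open>tau\<close>, twisting once more at each
  index makes it the rule for consecutive indices.\<close>

lemma split_triple: "split_triple S (\<lambda>i p. (- 1 / 2) \<odot> g (tw i p))"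
proof (intro split_triple.intro symcomp_axioms split_triple_axioms.intro)
  have four: "(4 :: 'k) \<noteq> 0" using two by (metis mult_eq_0_iff numeral_Bit0_eq_double)
  show dual: "n ((- 1 / 2) \<odot> g (tw i p)) ((- 1 / 2) \<odot> g (tw i r)) = (if r = neg p then 1 else 0)" for i p r
    using two four by (simp add: g_polar tw field_simps)
  show "v = (\<Sum>p\<in>UNIV. n v ((- 1 / 2) \<odot> g (tw i (neg p))) \<odot> (- 1 / 2) \<odot> g (tw i p))" for v i
  proof -
    let ?b = "\<lambda>p. (- 1 / 2) \<odot> g (tw i p)"
    define w where "w = v - (\<Sum>p\<in>UNIV. n v (?b (neg p)) \<odot> ?b p)"
    have b0: "n w (?b r) = 0" for r
    proof -
      have "n (\<Sum>p\<in>UNIV. n v (?b (neg p)) \<odot> ?b p) (?b r) = (\<Sum>p\<in>UNIV. n v (?b (neg p)) * n (?b p) (?b r))"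
        by (simp only: polar_lin(4,12))
      also have "\<dots> = (\<Sum>p\<in>UNIV. if p = neg r then n v (?b r) else 0)"
        unfolding dual by (rule sum.cong) auto
      finally have e: "n (\<Sum>p\<in>UNIV. n v (?b (neg p)) \<odot> ?b p) (?b r) = n v (?b r)" by simp
      show ?thesis unfolding w_def polar_lin(10) e by (rule diff_self)
    qed
    have g0: "n w (g (tw i r)) = 0" for r using b0[of r] two by simp
    have s: "\<exists>r. p = tw i r" for p
      using exhaust_3[of i] tau_sym(4) by (metis tw_def id_apply comp_apply)
    have g: "n w (g p) = 0" for p using g0 s[of p] by blast
    have add: "a = 0 \<and> b = 0" if "a + b = 0" "b - a = 0 \<or> a - b = 0" for a b :: 'k
    proof -
      have "b = a" using that by auto
      then have "2 * a = 0" using that by simp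
      then show ?thesis using two \<open>b = a\<close> by simp
    qed
    have "n w (f p) = 0" for p
    proof -
      have e: "n w (f X0) + n w (f X1) = 0" "n w (f X0) - n w (f X1) = 0" "n w (f X2) + n w (f X3) = 0" "n w (f X3) - n w (f X2) = 0"
        "n w (f X4) + n w (f X5) = 0" "n w (f X5) - n w (f X4) = 0" "n w (f X6) + n w (f X7) = 0" "n w (f X6) - n w (f X7) = 0"
        using g[of X0] g[of X1] g[of X2] g[of X3] g[of X4] g[of X5] g[of X6] g[of X7] unfolding g.simps polar_lin(1) polar_lin(9) by auto
      show ?thesis
        using add[OF e(1) disjI2[OF e(2)]] add[OF e(3) disjI1[OF e(4)]] add[OF e(5) disjI1[OF e(6)]] add[OF e(7) disjI2[OF e(8)]]
        by (cases p) blast+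
    qed
    from f_total[OF this] show ?thesis unfolding w_def by (simp only: right_minus_eq)
  qed
  show "((- 1 / 2) \<odot> g (tw i p)) \<star> ((- 1 / 2) \<odot> g (tw (i + 1) r)) = of_int (sg p r) \<odot> (- 1 / 2) \<odot> g (tw (i + 2) (pr p r))" for i p r
  proof (cases "sg p r = 0")
    case True
    then show ?thesis by (simp add: tw g_mul)
  next
    case False
    have 2: "tw (i + 2) s = tau (tau (tw i s))" for s
      using tw(1)[of "i + 1" s] tw(1)[of i s] by (simp add: add.assoc)
    have "(1 / 2 * (1 / 2)) * (of_int (sg p r) + of_int (sg p r)) = (of_int (sg p r) * (1 / 2) :: 'k)"
      using two four by (simp add: field_simps)
    then show ?thesis
      using False unfolding tw(1) 2 by (simp add: g_mul tw V.scale_left_distrib[symmetric] V.scale_right_distrib)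
  qed
qed

end

context graded_cayley
begin

text \<open>Square roots in the closure rescale the three generators to norm \<open>-1\<close>; the
  remaining factors \<open>k p\<close> are forced because the other basis vectors are products of
  these.\<close>

lemma split_K: "\<exists>b. split_triple Q.SK b"
proof -
  interpret K: symcomp Q.SK by (rule Q.SK_symcomp)
  have ex: "\<exists>a. a\<^sup>2 * to_ac (n (c p) (c p)) = - 2 \<and> a \<noteq> 0" for p
  proof -
    obtain a where a: "a ^ 2 = - 2 / to_ac (n (c p) (c p))" using nth_root_exists[of 2] by auto
    have "a \<noteq> 0" using a c_self[of p] Q.two_K by auto
    then show ?thesis using a c_self[of p] by (intro exI[of _ a]) (simp del: polar_lin)
  qed
  obtain a1 a2 a4 where a: "a1\<^sup>2 * to_ac (n (c X1) (c X1)) = - 2" "a1 \<noteq> 0" "a2\<^sup>2 * to_ac (n (c X2) (c X2)) = - 2" "a2 \<noteq> 0"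
    "a4\<^sup>2 * to_ac (n (c X4) (c X4)) = - 2" "a4 \<noteq> 0"
    using ex[of X1] ex[of X2] ex[of X4] by blast
  define k where "k p = (case p of X0 \<Rightarrow> 1 | X1 \<Rightarrow> a1 | X2 \<Rightarrow> a2 | X3 \<Rightarrow> a1 * a2 | X4 \<Rightarrow> a4 | X5 \<Rightarrow> a1 * a4 | X6 \<Rightarrow> a2 * a4 | X7 \<Rightarrow> a1 * a2 * a4)" for p
  define f where "f p = scl Q.SK (k p) (Q.ext (c p))" for p
  have pure: "cj (c p) = - c p" if "p \<noteq> X0" for p
  proof (rule D_pure[OF c_D])
    show "cdeg p \<noteq> 0" using that by (cases p) (simp_all add: zero_prod_def)
  qed
  have u: "cj u = u" using polar_unit by (simp add: conjugate_def V.scale_left_distrib[symmetric] diff_eq_eq)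
     (metis V.scale_left_distrib V.scale_one one_add_one)
  have ext_neg: "Q.ext (- x) = - Q.ext x" for x using Q.ext_diff[of 0 x] Q.ext_diff[of 0 0] by simp
  have fm: "mul Q.SK (f p) (f r) = scl Q.SK (k p * k r) (Q.ext (mul P (c p) (c r)))" for p r
    by (simp add: f_def Q.ext_mul)
  have fp: "polar Q.SK (f p) (f r) = k p * k r * to_ac (n (c p) (c r))" for p r
    by (simp add: f_def Q.ext_polar)
  have pp: "mul P (c p) (c r) = c p \<cdot> c r" if "p \<noteq> X0" "r \<noteq> X0" for p r using pure that by simp
  interpret F: para_frame Q.SK f
  proof (intro para_frame.intro Q.SK_symcomp para_frame_axioms.intro)
    show "mul Q.SK (f X0) (f X0) = f X0" unfolding fm by (simp add: f_def k_def u)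
    show "mul Q.SK (f X0) (f p) = - f p" "mul Q.SK (f p) (f X0) = - f p" if "p \<noteq> X0" for p
      unfolding fm using that by (simp_all add: f_def k_def u pure ext_neg)
    show "polar Q.SK (f p) (f r) = 0" if "p \<noteq> r" for p r unfolding fp using c_orth[OF that] by simp
    show "polar Q.SK (f X0) (f X0) = 2" unfolding fp by (simp add: k_def polar_unit)
    show "polar Q.SK (f X1) (f X1) = - 2" "polar Q.SK (f X2) (f X2) = - 2" "polar Q.SK (f X4) (f X4) = - 2"
      unfolding fp using a by (simp_all add: k_def power2_eq_square)
    show "f X3 = mul Q.SK (f X1) (f X2)" "f X5 = mul Q.SK (f X1) (f X4)" "f X6 = mul Q.SK (f X2) (f X4)" "f X7 = mul Q.SK (f X3) (f X4)"
      unfolding fm by (simp_all only: pp ix.distinct simp_thms not_False_eq_True) (simp_all add: f_def k_def)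
    show "v = 0" if v: "\<And>p. polar Q.SK v (f p) = 0" for v
    proof -
      have "k p \<noteq> 0" for p using a by (cases p) (simp_all add: k_def)
      then have "polar Q.SK v (Q.ext (c p)) = 0" for p using v[of p] by (simp add: f_def)
      then have "polar Q.SK v (Q.ext (cd p)) = 0" for p by (simp add: cd_def Q.ext_scale[unfolded P_simps] Q.SK_polar_lin)
      then show ?thesis using Q.SK_expand[of v] by simp
    qed
  qed
  show ?thesis using F.split_triple by blast
qed

end

section \<open>Gradings from coordinates\<close>

text \<open>Each basis vector has a degree and the components are coordinate subspaces, so
  decompositions and dimensions become a matter of sorting labels. The bracket enters through
  \<open>hom\<close>, on basis vectors.\<close>

locale graded_coords = bracket_algebra s L br
  for s :: "'k::field \<Rightarrow> 'v::ab_group_add \<Rightarrow> 'v" and L br +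
  fixes I B co and dg :: "'i \<Rightarrow> 'h::{finite,ab_group_add}" and gr
  assumes cs: "coord_system s L I B co"
    and gr_def: "gr \<mu> = {v \<in> L. \<forall>r\<in>I. dg r \<noteq> \<mu> \<longrightarrow> co v r = 0}"
    and hom: "r \<in> I \<Longrightarrow> r' \<in> I \<Longrightarrow> br (B r) (B r') \<in> gr (dg r + dg r')"
begin

lemmas csD = coord_systemD[OF cs]
lemmas co_lin = coord_system_linear[OF cs]

lemma co_zero: "q \<in> I \<Longrightarrow> co 0 q = 0"
  using co_lin(2)[of 0 0 q 0] L_closed(3) by simp

lemma co_sum: assumes "\<And>i. i \<in> A \<Longrightarrow> f i \<in> L" "q \<in> I" shows "co (sum f A) q = (\<Sum>i\<in>A. co (f i) q)"
  using assms(1)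
  by (induct A rule: infinite_finite_induct) (auto simp: co_zero co_lin(1) assms(2) subspace_sum[OF subL])

lemma gr_sub: "subspace (gr \<mu>)"
  unfolding gr_def by (rule subspaceI) (auto simp: L_closed co_zero co_lin)

lemma gr_L: "gr \<mu> \<subseteq> L" by (auto simp: gr_def)

lemma B_gr: "r \<in> I \<Longrightarrow> B r \<in> gr (dg r)"
  using csD(3) coord_system_basis[OF cs] by (auto simp: gr_def)

lemma gr_expand: assumes "v \<in> gr \<mu>" shows "v = (\<Sum>r\<in>{r\<in>I. dg r = \<mu>}. s (co v r) (B r))"
proof -
  have "v = (\<Sum>r\<in>I. s (co v r) (B r))" using csD(4) assms gr_L by blast
  also have "\<dots> = (\<Sum>r\<in>{r\<in>I. dg r = \<mu>}. s (co v r) (B r))"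
    by (rule sum.mono_neutral_right) (use assms csD(1) in \<open>auto simp: gr_def\<close>)
  finally show ?thesis .
qed

lemma gr_coords: "coord_system s (gr \<mu>) {r\<in>I. dg r = \<mu>} B co"
  unfolding coord_system_def
proof (intro conjI ballI allI)
  show "finite {r\<in>I. dg r = \<mu>}" using csD(1) by simp
  show "subspace (gr \<mu>)" by (rule gr_sub)
  show "B ` {r\<in>I. dg r = \<mu>} \<subseteq> gr \<mu>" using B_gr by auto
  show "v = (\<Sum>r\<in>{r\<in>I. dg r = \<mu>}. s (co v r) (B r))" if "v \<in> gr \<mu>" for v by (rule gr_expand[OF that])
  fix c q assume q: "q \<in> {r\<in>I. dg r = \<mu>}"
  have "(\<Sum>r\<in>{r\<in>I. dg r = \<mu>}. s (c r) (B r)) = (\<Sum>r\<in>I. s (if dg r = \<mu> then c r else 0) (B r))"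
    by (rule sum.mono_neutral_cong_left) (use csD(1) in auto)
  then show "co (\<Sum>r\<in>{r\<in>I. dg r = \<mu>}. s (c r) (B r)) q = c q"
    using q csD(5)[of q "\<lambda>r. if dg r = \<mu> then c r else 0"] by simp
qed

lemma gr_dim: "has_dim s (gr \<mu>) (card {r\<in>I. dg r = \<mu>})"
  by (rule coord_system_has_dim[OF gr_coords])

lemma gr_unique: assumes v: "v \<in> L" shows "\<exists>!f. (\<forall>\<mu>. f \<mu> \<in> gr \<mu>) \<and> v = (\<Sum>\<mu>\<in>UNIV. f \<mu>)"
proof (rule ex1I)
  let ?f = "\<lambda>\<mu>. \<Sum>r\<in>{r\<in>I. dg r = \<mu>}. s (co v r) (B r)"
  have 1: "?f \<mu> \<in> gr \<mu>" for \<mu>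
    by (intro subspace_sum gr_sub subspace_scale) (use B_gr in auto)
  have "(\<Sum>\<mu>\<in>UNIV. ?f \<mu>) = (\<Sum>r\<in>I. s (co v r) (B r))"
    by (rule sum.group) (use csD(1) in auto)
  then show "(\<forall>\<mu>. ?f \<mu> \<in> gr \<mu>) \<and> v = (\<Sum>\<mu>\<in>UNIV. ?f \<mu>)" using 1 csD(4)[OF v] by simp
  fix f assume f: "(\<forall>\<mu>. f \<mu> \<in> gr \<mu>) \<and> v = (\<Sum>\<mu>\<in>UNIV. f \<mu>)"
  show "f = ?f"
  proof
    fix \<mu>
    have "co v r = co (f \<mu>) r" if r: "r \<in> I" "dg r = \<mu>" for r
    proof -
      have "co v r = (\<Sum>\<nu>\<in>UNIV. co (f \<nu>) r)" using f gr_L r co_sum[of UNIV f r] by auto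
      also have "\<dots> = (\<Sum>\<nu>\<in>UNIV. if \<nu> = \<mu> then co (f \<mu>) r else 0)"
        by (rule sum.cong) (use f r in \<open>auto simp: gr_def\<close>)
      finally show ?thesis by simp
    qed
    then have "(\<Sum>r\<in>{r\<in>I. dg r = \<mu>}. s (co (f \<mu>) r) (B r)) = ?f \<mu>" by (intro sum.cong) auto
    moreover have "f \<mu> = (\<Sum>r\<in>{r\<in>I. dg r = \<mu>}. s (co (f \<mu>) r) (B r))" using gr_expand f by blast
    ultimately show "f \<mu> = ?f \<mu>" by (rule trans[rotated])
  qed
qed

lemma gr_br: assumes "x \<in> gr \<mu>" "y \<in> gr \<nu>" shows "br x y \<in> gr (\<mu> + \<nu>)"
proof -
  let ?I = "\<lambda>\<mu>. {r\<in>I. dg r = \<mu>}"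
  have x: "x = (\<Sum>r\<in>?I \<mu>. s (co x r) (B r))" and y: "y = (\<Sum>r\<in>?I \<nu>. s (co y r) (B r))"
    using gr_expand assms by blast+
  have BL: "r \<in> I \<Longrightarrow> B r \<in> L" "r \<in> I \<Longrightarrow> s a (B r) \<in> L" for r a using csD(3) L_closed by auto
  have "br (B r) y \<in> gr (\<mu> + \<nu>)" if "r \<in> ?I \<mu>" for r
  proof -
    have "br (B r) y = (\<Sum>r'\<in>?I \<nu>. s (co y r') (br (B r) (B r')))"
      using that by (subst y, subst br_sumr) (auto simp: BL br_scr)
    then show ?thesis using that hom by (auto intro!: subspace_sum gr_sub subspace_scale)
  qed
  moreover have "br x y = (\<Sum>r\<in>?I \<mu>. s (co x r) (br (B r) y))"
    using subsetD[OF gr_L assms(2)] by (subst x, subst br_suml) (auto simp: BL br_scl)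
  ultimately show ?thesis by (auto intro!: subspace_sum gr_sub subspace_scale)
qed

lemma grading: "group_grading s L br gr"
  unfolding group_grading_def using gr_sub gr_L gr_unique gr_br by blast

end

context vector_space
begin

text \<open>Counting in place of independence: the union of the generating sets spans
  \<open>V\<close>, so it has at least \<open>dim V\<close> elements, while the bounds
  \<open>m j\<close> add up to exactly \<open>dim V\<close>. All inequalities are equalities, and
  each \<open>G j\<close> is a basis of \<open>E j\<close>.\<close>

lemma has_dim_summands:
  assumes V: "has_dim scale V (\<Sum>j\<in>J. m j)" and J: "finite J"
    and G: "\<And>j. j \<in> J \<Longrightarrow> finite (G j)" "\<And>j. j \<in> J \<Longrightarrow> card (G j) \<le> m j" "\<And>j. j \<in> J \<Longrightarrow> G j \<subseteq> E j"
    and E: "\<And>j. j \<in> J \<Longrightarrow> subspace (E j)" "\<And>j. j \<in> J \<Longrightarrow> E j \<subseteq> V" "\<And>j. j \<in> J \<Longrightarrow> E j \<subseteq> span (G j)"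
    and VG: "V \<subseteq> span (\<Union>j\<in>J. G j)" and j: "j \<in> J"
  shows "has_dim scale (E j) (m j)"
proof -
  let ?U = "\<Union>j\<in>J. G j"
  have fin: "finite ?U" using J G by auto
  have sub: "subspace V" using V subspace_span unfolding has_dim_def is_basis_of_def by auto
  have U: "?U \<subseteq> V" using G E by blast
  obtain B where B: "B \<subseteq> ?U" "independent B" "?U \<subseteq> span B"
    using maximal_independent_subset[of ?U] by blast
  have "span B = V"
  proof
    show "span B \<subseteq> V" using B U sub by (meson order_trans span_minimal)
    show "V \<subseteq> span B" using VG B(3) by (meson order_trans span_minimal subspace_span)
  qed
  then have "has_dim scale V (card B)"
    using B U finite_subset[OF B(1) fin] unfolding has_dim_def is_basis_of_def by blast
  then have cB: "card B = (\<Sum>j\<in>J. m j)" using has_dim_unique V by blast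
  have c1: "card B \<le> card ?U" using B fin by (simp add: card_mono)
  have c2: "card ?U \<le> (\<Sum>j\<in>J. card (G j))" using card_UN_le[OF J] by blast
  have c3: "(\<Sum>j\<in>J. card (G j)) \<le> (\<Sum>j\<in>J. m j)" using G(2) by (rule sum_mono)
  have "B = ?U" by (rule card_subset_eq[OF fin B(1)]) (use c1 c2 c3 cB in linarith)
  then have "independent (G j)" using B(2) j by (meson UN_upper independent_mono)
  moreover have "card (G j) = m j"
  proof (rule ccontr)
    assume "card (G j) \<noteq> m j"
    then have "card (G j) < m j" using G(2)[OF j] by simp
    then have "(\<Sum>j\<in>J. card (G j)) < (\<Sum>j\<in>J. m j)"
      using sum_strict_mono_ex1[of J "\<lambda>j. card (G j)" m] J G(2) j by blast
    then show False using c1 c2 cB by linarith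
  qed
  moreover have "span (G j) = E j" using E G j by (meson span_minimal subset_antisym)
  ultimately show ?thesis
    unfolding has_dim_def is_basis_of_def using G j by blast
qed

end

subsection \<open>Eigenspaces of an operator of order three\<close>

locale order_three = vector_space s for s :: "'k::field \<Rightarrow> 'v::ab_group_add \<Rightarrow> 'v" +
  fixes T :: "'v \<Rightarrow> 'v" and \<omega> :: 'k
  assumes T_add: "T (x + y) = T x + T y" and T_scale: "T (s a x) = s a (T x)" and T3: "T (T (T x)) = x"
    and om3: "\<omega> ^ 3 = 1" and om1: "\<omega> \<noteq> 1" and three: "(3 :: 'k) \<noteq> 0"
begin

definition lam :: "3 \<Rightarrow> 'k" where "lam j = (if j = 0 then 1 else if j = 1 then \<omega> else \<omega>\<^sup>2)"

lemma om_sum: "1 + \<omega> + \<omega>\<^sup>2 = 0" "\<omega> * \<omega>\<^sup>2 = 1"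
proof -
  have "(\<omega> - 1) * (1 + \<omega> + \<omega>\<^sup>2) = \<omega> ^ 3 - 1" by (simp add: algebra_simps power2_eq_square power3_eq_cube)
  then show "1 + \<omega> + \<omega>\<^sup>2 = 0" using om3 om1 by simp
  show "\<omega> * \<omega>\<^sup>2 = 1" using om3 by (simp add: power2_eq_square power3_eq_cube mult.assoc)
qed

lemma lam_add: "lam (i + j) = lam i * lam j"
proof -
  have "\<omega>\<^sup>2 * \<omega>\<^sup>2 = \<omega>" using om_sum(2) by (metis mult.commute mult.left_commute mult_1_right power2_eq_square)
  then show ?thesis
    using exhaust_3[of i] exhaust_3[of j] om_sum(2)
    by (elim disjE) (simp_all add: lam_def Z3_simps power2_eq_square[symmetric] mult.commute)
qed

lemma lam_0: "lam 0 = 1" by (simp add: lam_def)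

lemma lam_sum: "lam 0 + lam 1 + lam 2 = 0" using om_sum by (simp add: lam_def)

text \<open>The projector onto the eigenspace for \<open>lam j\<close>, by averaging over the group
  of order three generated by \<open>T\<close>.\<close>

definition Pj :: "3 \<Rightarrow> 'v \<Rightarrow> 'v" where
  "Pj j v = s (1 / 3) (v + s (lam (- j)) (T v) + s (lam (- j - j)) (T (T v)))"

lemma Pj_add: "Pj j (v + w) = Pj j v + Pj j w"
  by (simp add: Pj_def T_add scale_right_distrib algebra_simps)

lemma Pj_scale: "Pj j (s a v) = s a (Pj j v)"
  by (simp add: Pj_def T_scale scale_right_distrib mult.commute mult.left_commute)

lemma Pj_eigen: "T (Pj j v) = s (lam j) (Pj j v)"
proof -
  have "lam j * lam (- j) = 1" "lam j * lam (- j - j) = lam (- j)" "lam (- j - j) = lam j"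
    using exhaust_3[of j] by (auto simp: lam_add[symmetric] lam_0 Z3_simps)
  then show ?thesis
    by (simp add: Pj_def T_add T_scale T3 scale_right_distrib mult.left_commute[of "lam j" "1/3"] add_ac)
qed

lemma Pj_sum: "(\<Sum>j\<in>UNIV. Pj j v) = v"
proof -
  have 1: "lam 0 = 1" "lam (- 1) = lam 2" "lam (- 2) = lam 1" "lam (- 1 - 1) = lam 1" "lam (-2 - 2) = lam 2" "lam (- 4) = lam 2"
    by (simp_all add: lam_0 Z3_simps)
  have e: "v + v + v = s (1 + 1 + 1) v" by (simp only: scale_left_distrib scale_one)
  have "(\<Sum>j\<in>UNIV. Pj j v) = s (1/3) (v + v + v + s (lam 0 + lam 1 + lam 2) (T v) + s (lam 0 + lam 1 + lam 2) (T (T v)))"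
    unfolding sum_3 Pj_def scale_right_distrib[symmetric]
    by (rule arg_cong[of _ _ "s (1/3)"]) (simp add: 1 scale_left_distrib add_ac)
  also have "\<dots> = v"
  proof -
    have "(1 / 3 * (1 + 1 + 1) :: 'k) = 1" using three by simp
    then show ?thesis unfolding lam_sum e by (simp only: scale_zero_left add_0_right scale_scale scale_one)
  qed
  finally show ?thesis .
qed

lemma Pj_eigenvector: assumes "T v = s (lam i) v" shows "Pj j v = (if i = j then v else 0)"
proof -
  have "Pj j v = s (1 / 3 * (lam 0 + lam (i - j) + lam (i - j + (i - j)))) v"
    using assms lam_add[of "- j" i] lam_add[of "- j - j" "i + i"] lam_add[of i i]
    by (simp add: Pj_def T_scale lam_0 scale_left_distrib scale_right_distrib algebra_simps mult.commute)
  moreover have "1 / 3 * (lam 0 + lam k + lam (k + k)) = (if k = 0 then 1 else 0)" for k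
    using exhaust_3[of k] lam_sum three by (auto simp: lam_0 Z3_simps add_ac)
  ultimately show ?thesis by (simp only: split: if_splits) auto
qed

definition Ej where "Ej V j = {v \<in> V. T v = s (lam j) v}"

lemma Ej_sub: "subspace V \<Longrightarrow> subspace (Ej V j)"
  unfolding Ej_def subspace_def by (auto simp: T_add T_scale scale_right_distrib mult.commute T_scale[of 0 0, simplified])

lemma Pj_Ej: assumes "subspace V" "T ` V \<subseteq> V" "v \<in> V" shows "Pj j v \<in> Ej V j"
  unfolding Ej_def using assms
  by (auto simp: Pj_eigen) (auto simp: Pj_def intro!: subspace_scale subspace_add)

text \<open>\<open>Pj j (T w)\<close> is a multiple of \<open>Pj j w\<close>, so the projections of
  representatives of the \<open>T\<close>-orbits already span each eigenspace. Their number bounds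
  its dimension, and \<open>has_dim_summands\<close> makes the bounds sharp. Removing
  \<open>0\<close> from the projections matters where an eigenspace is smaller than the number of
  orbits.\<close>

lemma Ej_dim:
  assumes V: "has_dim s V (\<Sum>j\<in>UNIV. m j)" "T ` V \<subseteq> V"
    and W: "finite W" "W \<subseteq> V" "V \<subseteq> span (W \<union> T ` W \<union> T ` T ` W)"
    and m: "\<And>j. card (Pj j ` W - {0}) \<le> m j"
  shows "has_dim s (Ej V j) (m j)"
proof -
  have sub: "subspace V" using V(1) subspace_span unfolding has_dim_def is_basis_of_def by auto
  let ?G = "\<lambda>j. Pj j ` W - {0}"
  have PG: "Pj j w \<in> span (?G j)" if "w \<in> W" for w j
    using that by (cases "Pj j w = 0") (auto intro: span_base simp: span_zero)
  have PT: "Pj j (T w) = s (lam j) (Pj j w)" for w j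
    unfolding Pj_eigen[symmetric] by (simp add: Pj_def T_add T_scale)
  have P0: "Pj j 0 = 0" for j using Pj_scale[of j 0 0] by simp
  have PV: "Pj j v \<in> span (?G j)" if "v \<in> V" for v j
  proof -
    have "subspace {v. Pj j v \<in> span (?G j)}"
      unfolding subspace_def by (auto simp: Pj_add Pj_scale P0 intro: span_add span_scale span_zero)
    moreover have "W \<union> T ` W \<union> T ` T ` W \<subseteq> {v. Pj j v \<in> span (?G j)}"
    proof -
      have "Pj j (T w) \<in> span (?G j)" "Pj j (T (T w)) \<in> span (?G j)" if "w \<in> W" for w
        unfolding PT by (intro span_scale PG that)+
      then show ?thesis using PG by blast
    qed
    ultimately show ?thesis using W(3) that span_minimal by blast
  qed
  show ?thesis
  proof (rule has_dim_summands[OF V(1), where G = ?G])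
    show "?G j \<subseteq> Ej V j" for j using Pj_Ej[OF sub V(2)] W by auto
    show "Ej V j \<subseteq> span (?G j)" for j
    proof
      fix v assume v: "v \<in> Ej V j"
      then have "Pj j v = v" unfolding Ej_def using Pj_eigenvector[of v j j] by simp
      then show "v \<in> span (?G j)" using PV[of v j] v by (simp add: Ej_def)
    qed
    show "V \<subseteq> span (\<Union>j\<in>UNIV. ?G j)"
    proof
      fix v assume "v \<in> V"
      then have "Pj j v \<in> span (\<Union>j\<in>UNIV. ?G j)" for j
        using PV[of v j] span_mono[of "?G j" "\<Union>j\<in>UNIV. ?G j"] by blast
      then show "v \<in> span (\<Union>j\<in>UNIV. ?G j)" using Pj_sum[of v] span_sum[of UNIV "\<lambda>j. Pj j v"] by metis
    qed
  qed (use W m Ej_sub[OF sub] in \<open>auto simp: Ej_def\<close>)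
qed

end

section \<open>The induced gradings\<close>

locale graded_symcomp = symcomp8 S "\<lambda>_. c" "\<lambda>_. cd"
  for S :: "('k::field, 'v::ab_group_add) normed_alg" and c cd +
  fixes \<delta> :: "ix \<Rightarrow> 'h::{finite,ab_group_add}" and D :: "'h \<Rightarrow> 'v set"
  assumes D_iff: "v \<in> D \<mu> \<longleftrightarrow> (\<forall>p. \<delta> p \<noteq> \<mu> \<longrightarrow> polar S v (cd p) = 0)"
    and D_mul: "x \<in> D \<mu> \<Longrightarrow> y \<in> D \<nu> \<Longrightarrow> mul S x y \<in> D (\<mu> + \<nu>)"
    and cd_D: "cd p \<in> D (- \<delta> p)"
    and c_orth: "\<delta> p + \<delta> q \<noteq> 0 \<Longrightarrow> polar S (c p) (c q) = 0"
begin

lemma D_sub: "V.subspace (D \<mu>)"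
  unfolding V.subspace_def by (auto simp: D_iff)

lemmas D_closed = V.subspace_0[OF D_sub] V.subspace_add[OF D_sub] V.subspace_scale[OF D_sub]
  V.subspace_diff[OF D_sub] V.subspace_neg[OF D_sub]

lemma c_D: "c p \<in> D (\<delta> p)"
  using dual by (auto simp: D_iff)

lemma D_orth: assumes x: "x \<in> D \<mu>" and y: "y \<in> D \<nu>" and ne: "\<mu> + \<nu> \<noteq> 0" shows "n x y = 0"
proof -
  have cy: "n (c p) y = 0" if p: "\<delta> p = \<mu>" for p
  proof -
    have "n (c p) y = (\<Sum>q\<in>UNIV. n y (cd q) * n (c p) (c q))"
      by (subst expand[of y]) simp
    also have "\<dots> = 0" using y c_orth[of p] ne p by (intro sum.neutral) (metis D_iff mult_eq_0_iff)
    finally show ?thesis .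
  qed
  have "n x y = (\<Sum>p\<in>UNIV. n x (cd p) * n (c p) y)" by (subst expand[of x]) simp
  also have "\<dots> = 0" using x cy by (intro sum.neutral) (metis D_iff mult_eq_0_iff)
  finally show ?thesis .
qed

abbreviation td where "td \<equiv> tri_deg S D"

lemma td_iff: "d \<in> td \<mu> \<longleftrightarrow> d \<in> tri S \<and> (\<forall>i \<gamma> z. z \<in> D \<gamma> \<longrightarrow> d i z \<in> D (\<gamma> + \<mu>))"
  unfolding tri_deg_def by auto

lemma td_sub: "F.subspace (td \<mu>)"
  unfolding F.subspace_def by (auto simp: td_iff tri_closed fun_apply fs_apply D_closed)

lemmas td_closed = F.subspace_0[OF td_sub] F.subspace_add[OF td_sub] F.subspace_scale[OF td_sub]
  F.subspace_neg[OF td_sub]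

lemma t_td: assumes x: "x \<in> D \<mu>" and y: "y \<in> D \<nu>" shows "t x y \<in> td (\<mu> + \<nu>)"
proof -
  have sc: "n a b \<odot> w \<in> D (\<rho> + \<sigma> + \<tau>)" if "a \<in> D \<rho>" "b \<in> D \<sigma>" "w \<in> D \<tau>" for a b w \<rho> \<sigma> \<tau>
    using D_orth[OF that(1,2)] that(3) by (cases "\<rho> + \<sigma> = 0") (simp_all add: D_closed)
  have sc': "(n a b / 2) \<odot> w \<in> D (\<rho> + \<sigma> + \<tau>)" if "a \<in> D \<rho>" "b \<in> D \<sigma>" "w \<in> D \<tau>" for a b w \<rho> \<sigma> \<tau>
    using D_orth[OF that(1,2)] that(3) by (cases "\<rho> + \<sigma> = 0") (simp_all add: D_closed)
  have "t x y i z \<in> D (\<gamma> + (\<mu> + \<nu>))" if z: "z \<in> D \<gamma>" for i \<gamma> z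
  proof -
    have "t x y 0 z \<in> D (\<gamma> + (\<mu> + \<nu>))"
      using sc[OF x z y] sc[OF y z x] by (simp add: t_0 D_closed add_ac)
    moreover have "t x y 1 z \<in> D (\<gamma> + (\<mu> + \<nu>))"
      using sc'[OF x y z] D_mul[OF D_mul[OF y z] x] by (simp add: t_1 D_closed add_ac)
    moreover have "t x y 2 z \<in> D (\<gamma> + (\<mu> + \<nu>))"
      using sc'[OF x y z] D_mul[OF x D_mul[OF z y]] by (simp add: t_2 D_closed add_ac)
    ultimately show ?thesis using exhaust_3[of i] by auto
  qed
  then show ?thesis by (simp add: td_iff t_tri)
qed

lemma shift_td: "d \<in> td \<mu> \<Longrightarrow> shift i d \<in> td \<mu>"
  by (simp add: td_iff tri_shift) (simp add: shift_def)

lemma bracket_td: "d \<in> td \<mu> \<Longrightarrow> e \<in> td \<nu> \<Longrightarrow> tri_bracket d e \<in> td (\<mu> + \<nu>)"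
proof -
  assume d: "d \<in> td \<mu>" and e: "e \<in> td \<nu>"
  have "d i (e i z) - e i (d i z) \<in> D (\<gamma> + (\<mu> + \<nu>))" if z: "z \<in> D \<gamma>" for i z \<gamma>
  proof -
    have "d i (e i z) \<in> D (\<gamma> + \<nu> + \<mu>)" "e i (d i z) \<in> D (\<gamma> + \<mu> + \<nu>)" using d e z td_iff by blast+
    then show ?thesis by (simp add: D_closed add_ac)
  qed
  then show ?thesis using d e by (simp add: td_iff tri_bracket_tri) (simp add: tri_bracket_def)
qed

lemma td_coord: assumes d: "d \<in> td \<mu>" and ne: "\<delta> p + \<delta> q \<noteq> \<mu>" shows "n (d 0 (cd p)) (cd q) = 0"
proof -
  have "d 0 (cd p) \<in> D (- \<delta> p + \<mu>)" using d cd_D td_iff by blast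
  moreover have "\<delta> q \<noteq> - \<delta> p + \<mu>" using ne by (auto simp: algebra_simps)
  ultimately show ?thesis using D_iff by blast
qed

end

fun deg2 :: "(ix \<Rightarrow> 'h::ab_group_add) \<Rightarrow> (ix \<Rightarrow> 'l::ab_group_add) \<Rightarrow> gi \<Rightarrow> 'h \<times> 'l" where
  "deg2 \<delta> \<delta>' (TA p q) = (\<delta> p + \<delta> q, 0)"
| "deg2 \<delta> \<delta>' (TB p q) = (0, \<delta>' p + \<delta>' q)"
| "deg2 \<delta> \<delta>' (TI m p q) = (\<delta> p, \<delta>' q)"

fun gtype :: "gi \<Rightarrow> 2 \<times> 2" where
  "gtype (TA p q) = 0" | "gtype (TB p q) = 0" | "gtype (TI m p q) = iota_deg m"

locale graded_pair = A: graded_symcomp S c cd \<delta> D + B: graded_symcomp S' c' cd' \<delta>' D'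
  for S :: "('k::field, 'v::ab_group_add) normed_alg" and c cd and \<delta> :: "ix \<Rightarrow> 'h::{finite,ab_group_add}" and D
    and S' :: "('k, 'w::ab_group_add) normed_alg" and c' cd' and \<delta>' :: "ix \<Rightarrow> 'l::{finite,ab_group_add}" and D'
begin

sublocale G: g_pair S "\<lambda>_. c" "\<lambda>_. cd" S' "\<lambda>_. c'" "\<lambda>_. cd'"
  by (intro g_pair.intro A.symcomp8_axioms B.symcomp8_axioms)

abbreviation gd where "gd \<equiv> g_deg S S' D D'"
abbreviation TD where "TD \<mu> \<nu> \<equiv> tensor_space (scl S) (scl S') (D \<mu>) (D' \<nu>)"

lemma gd_iff: "(d, d', T) \<in> gd \<mu> \<nu> \<longleftrightarrow> d \<in> A.td \<mu> \<and> (\<nu> = 0 \<or> d = 0) \<and> d' \<in> B.td \<nu> \<and> (\<mu> = 0 \<or> d' = 0) \<and> (\<forall>i. T i \<in> TD \<mu> \<nu>)"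
  by (auto simp: g_deg_def A.td_closed B.td_closed)

lemma gd_sub: "G.G.subspace (gd \<mu> \<nu>)"
  unfolding G.G.subspace_def
  by (auto simp: gd_iff zero_prod_def plus_prod_def G.gs_simp A.td_closed B.td_closed tensor_space_closed fun_apply)
     (auto simp: fun_scale_def[of "fun_scale (*)"] tensor_space_closed)

lemma gd_L: "gd \<mu> \<nu> \<subseteq> G.L"
proof
  fix v assume v: "v \<in> gd \<mu> \<nu>"
  obtain d d' T where e: "v = (d, d', T)" by (metis prod_cases3)
  show "v \<in> G.L"
    using v tensor_space_mono[of "D \<mu>" UNIV "D' \<nu>" UNIV "scl S" "scl S'"]
    unfolding e by (auto simp: gd_iff G.L_iff A.td_iff B.td_iff)
qed

lemma tri_gd:
  "d \<in> A.td \<mu> \<Longrightarrow> tri_elt d 0 \<in> gd \<mu> 0" "d' \<in> B.td \<nu> \<Longrightarrow> tri_elt 0 d' \<in> gd 0 \<nu>"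
  by (simp_all add: tri_elt_def gd_iff A.td_closed B.td_closed tensor_space_closed fun_apply)

lemma iota_gd: "x \<in> D \<mu> \<Longrightarrow> x' \<in> D' \<nu> \<Longrightarrow> iota m (G.tns x x') \<in> gd \<mu> \<nu>"
  by (simp add: iota_def gd_iff A.td_closed B.td_closed tensor_space_closed tensor_space_tensor)

abbreviation dg where "dg \<equiv> deg2 \<delta> \<delta>'"

lemma Bg_gd: "G.Bg r \<in> gd (fst (dg r)) (snd (dg r))"
  by (cases r) (simp_all add: tri_gd iota_gd A.t_td B.t_td A.c_D B.c_D)

lemma cog_gd: assumes v: "v \<in> gd \<mu> \<nu>" and ne: "dg r \<noteq> (\<mu>, \<nu>)" shows "G.cog v r = 0"
proof -
  obtain d d' T where e: "v = (d, d', T)" by (metis prod_cases3)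
  note g = v[unfolded e gd_iff]
  show ?thesis
  proof (cases r)
    case (TA p q)
    then show ?thesis using g ne A.td_coord[of d \<mu> p q] unfolding e by (cases "\<nu> = 0") (auto simp: fun_apply)
  next
    case (TB p q)
    then show ?thesis using g ne B.td_coord[of d' \<nu> p q] unfolding e by (cases "\<mu> = 0") (auto simp: fun_apply)
  next
    case (TI m p q)
    let ?f = "\<lambda>x x'. polar S x (cd p) * polar S' x' (cd' q)"
    have "T m \<in> TD \<mu> \<nu>" using g by blast
    moreover have "TD \<mu> \<nu> \<subseteq> {U. U ?f = 0}"
      unfolding tensor_space_def
    proof (rule G.U.span_minimal)
      show "{G.tns x y |x y. x \<in> D \<mu> \<and> y \<in> D' \<nu>} \<subseteq> {U. U ?f = 0}"
        using ne TI by (auto simp: G.tns_eval A.D_iff B.D_iff)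
      show "G.U.subspace {U. U ?f = 0}"
        unfolding G.U.subspace_def by (auto simp: fun_apply fun_scale_def)
    qed
    ultimately show ?thesis unfolding e TI by auto
  qed
qed

text \<open>Identifies the prescribed component with a coordinate subspace, the form that
  \<open>graded_coords\<close> requires.\<close>

lemma gd_coord: "v \<in> gd \<mu> \<nu> \<longleftrightarrow> v \<in> G.L \<and> (\<forall>r\<in>GI. dg r \<noteq> (\<mu>, \<nu>) \<longrightarrow> G.cog v r = 0)"
proof
  show "v \<in> gd \<mu> \<nu> \<Longrightarrow> v \<in> G.L \<and> (\<forall>r\<in>GI. dg r \<noteq> (\<mu>, \<nu>) \<longrightarrow> G.cog v r = 0)"
    using gd_L cog_gd by blast
  assume v: "v \<in> G.L \<and> (\<forall>r\<in>GI. dg r \<noteq> (\<mu>, \<nu>) \<longrightarrow> G.cog v r = 0)"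
  then have "v = (\<Sum>r\<in>GI. G.gs (G.cog v r) (G.Bg r))" using G.G.coord_systemD(4)[OF G.g_coord] by blast
  also have "\<dots> \<in> gd \<mu> \<nu>"
  proof (rule G.G.subspace_sum[OF gd_sub])
    fix r assume r: "r \<in> GI"
    show "G.gs (G.cog v r) (G.Bg r) \<in> gd \<mu> \<nu>"
    proof (cases "dg r = (\<mu>, \<nu>)")
      case True
      then show ?thesis using Bg_gd[of r] G.G.subspace_scale[OF gd_sub] by simp
    next
      case False
      then show ?thesis using v r G.G.subspace_0[OF gd_sub] by simp
    qed
  qed
  finally show "v \<in> gd \<mu> \<nu>" .
qed

abbreviation (input) gd' where "gd' \<equiv> \<lambda>(\<mu>, \<nu>). gd \<mu> \<nu>"

lemma tri_bracket_0: "d \<in> tri S \<Longrightarrow> tri_bracket d 0 = 0" "d \<in> tri S \<Longrightarrow> tri_bracket 0 d = 0"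
  "d' \<in> tri S' \<Longrightarrow> tri_bracket d' 0 = 0" "d' \<in> tri S' \<Longrightarrow> tri_bracket 0 d' = 0"
  using linearD[OF A.triD(2)] linearD[OF B.triD(2)] by (simp_all add: tri_bracket_def fun_eq_iff fun_apply)

lemmas gd_closed = G.G.subspace_0[OF gd_sub] G.G.subspace_add[OF gd_sub] G.G.subspace_scale[OF gd_sub]
  G.G.subspace_neg[OF gd_sub]

lemma gd_pair:
  assumes "x \<in> D \<mu>" "x' \<in> D' \<nu>" "y \<in> D \<mu>'" "y' \<in> D' \<nu>'"
  shows "tri_elt (fs S (polar S' x' y') (shift m (t_elt S x y))) (fs S' (polar S x y) (shift m (t_elt S' x' y')))
    \<in> gd (\<mu> + \<mu>') (\<nu> + \<nu>')"
proof -
  have "fs S (polar S' x' y') (shift m (t_elt S x y)) \<in> A.td (\<mu> + \<mu>')"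
    "fs S' (polar S x y) (shift m (t_elt S' x' y')) \<in> B.td (\<nu> + \<nu>')"
    by (intro A.td_closed A.shift_td A.t_td B.td_closed B.shift_td B.t_td assms)+
  then show ?thesis
    using A.D_orth[OF assms(1,3)] B.D_orth[OF assms(2,4)]
    by (auto simp: tri_elt_def gd_iff tensor_space_closed fun_apply)
qed

lemma gd_act:
  assumes "d \<in> A.td \<mu>" "x \<in> D \<mu>'" "x' \<in> D' \<nu>'"
  shows "iota m (G.tns (d m x) x' + G.tns x ((0 :: 3 \<Rightarrow> 'w \<Rightarrow> 'w) m x')) \<in> gd (\<mu> + \<mu>') \<nu>'"
proof -
  have "d m x \<in> D (\<mu> + \<mu>')" using assms unfolding A.td_iff by (metis add.commute)
  then show ?thesis
    using assms by (simp add: fun_apply bilinD(5,6)[OF G.T.tns_bilin] iota_gd)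
qed

lemma gd_act':
  assumes "d \<in> B.td \<nu>" "x \<in> D \<mu>'" "x' \<in> D' \<nu>'"
  shows "iota m (G.tns ((0 :: 3 \<Rightarrow> 'v \<Rightarrow> 'v) m x) x' + G.tns x (d m x')) \<in> gd \<mu>' (\<nu> + \<nu>')"
proof -
  have "d m x' \<in> D' (\<nu> + \<nu>')" using assms unfolding B.td_iff by (metis add.commute)
  then show ?thesis
    using assms by (simp add: fun_apply bilinD(5,6)[OF G.T.tns_bilin] iota_gd)
qed

lemma index_cases: obtains "l = m" | "l = m + 1" | "m = l + (1 :: 3)"
proof -
  have "l = m \<or> l = m + 1 \<or> m = l + 1" using exhaust_3[of l] exhaust_3[of m] by (auto simp: Z3_simps)
  then show ?thesis using that by blast
qed

lemma Bg_br_gd: "G.br (G.Bg r) (G.Bg s) \<in> gd (fst (dg r) + fst (dg s)) (snd (dg r) + snd (dg s))"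
proof -
  have tA: "t_elt S (c p) (c q) \<in> tri S" "t_elt S (c p) (c q) \<in> A.td (\<delta> p + \<delta> q)" for p q
    by (rule A.t_tri, rule A.t_td[OF A.c_D A.c_D])
  have tB: "t_elt S' (c' p) (c' q) \<in> tri S'" "t_elt S' (c' p) (c' q) \<in> B.td (\<delta>' p + \<delta>' q)" for p q
    by (rule B.t_tri, rule B.t_td[OF B.c_D B.c_D])
  note z = A.tri_closed(1) B.tri_closed(1)
  note sim = G.Bg.simps deg2.simps fst_conv snd_conv add_0_left add_0_right
  show ?thesis
  proof (cases r; cases s)
    fix p q p' q' assume [simp]: "r = TA p q" "s = TA p' q'"
    show ?thesis unfolding \<open>r = _\<close> \<open>s = _\<close> sim G.br_tri_tri[OF tA(1) z(2) tA(1) z(2)] tri_bracket_0(3)[OF z(2)]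
      by (intro tri_gd A.bracket_td tA)
  next
    fix p q p' q' assume [simp]: "r = TA p q" "s = TB p' q'"
    show ?thesis unfolding \<open>r = _\<close> \<open>s = _\<close> sim G.br_tri_tri[OF tA(1) z(2) z(1) tB(1)] tri_bracket_0(1)[OF tA(1)] tri_bracket_0(4)[OF tB(1)]
      by (simp add: G.tri_elt_linear gd_closed)
  next
    fix p q m p' q' assume [simp]: "r = TA p q" "s = TI m p' q'"
    show ?thesis unfolding \<open>r = _\<close> \<open>s = _\<close> sim G.br_tri_iota[OF tA(1) z(2)]
      by (intro gd_act tA A.c_D B.c_D)
  next
    fix p q p' q' assume [simp]: "r = TB p q" "s = TA p' q'"
    show ?thesis unfolding \<open>r = _\<close> \<open>s = _\<close> sim G.br_tri_tri[OF z(1) tB(1) tA(1) z(2)] tri_bracket_0(2)[OF tA(1)] tri_bracket_0(3)[OF tB(1)]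
      by (simp add: G.tri_elt_linear gd_closed)
  next
    fix p q p' q' assume [simp]: "r = TB p q" "s = TB p' q'"
    show ?thesis unfolding \<open>r = _\<close> \<open>s = _\<close> sim G.br_tri_tri[OF z(1) tB(1) z(1) tB(1)] tri_bracket_0(1)[OF z(1)]
      by (intro tri_gd B.bracket_td tB)
  next
    fix p q m p' q' assume [simp]: "r = TB p q" "s = TI m p' q'"
    show ?thesis unfolding \<open>r = _\<close> \<open>s = _\<close> sim G.br_tri_iota[OF z(1) tB(1)]
      by (intro gd_act' tB A.c_D B.c_D)
  next
    fix m p q p' q' assume [simp]: "r = TI m p q" "s = TA p' q'"
    show ?thesis unfolding \<open>r = _\<close> \<open>s = _\<close> sim G.br_iota_tri[OF tA(1) z(2)]
      by (subst add.commute) (intro gd_closed(4) gd_act tA A.c_D B.c_D)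
  next
    fix m p q p' q' assume [simp]: "r = TI m p q" "s = TB p' q'"
    show ?thesis unfolding \<open>r = _\<close> \<open>s = _\<close> sim G.br_iota_tri[OF z(1) tB(1)]
      by (subst (2) add.commute) (intro gd_closed(4) gd_act' tB A.c_D B.c_D)
  next
    fix m p q l p' q' assume [simp]: "r = TI m p q" "s = TI l p' q'"
    consider "l = m" | "l = m + 1" | "m = l + 1" by (rule index_cases[of l m])
    then show ?thesis
    proof cases
      case 1
      show ?thesis unfolding \<open>r = _\<close> \<open>s = _\<close> 1 sim G.br_iota_same by (intro gd_pair A.c_D B.c_D)
    next
      case 2
      show ?thesis unfolding \<open>r = _\<close> \<open>s = _\<close> 2 sim G.br_iota_next by (intro iota_gd A.D_mul B.D_mul A.c_D B.c_D)
    next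
      case 3
      show ?thesis unfolding \<open>r = _\<close> \<open>s = _\<close> 3 sim G.br_iota_prev
        by (subst add.commute, subst (2) add.commute) (intro gd_closed(4) iota_gd A.D_mul B.D_mul A.c_D B.c_D)
    qed
  qed
qed

lemma Bg_br_type: assumes "gtype t \<noteq> gtype r + gtype s" shows "G.cog (G.br (G.Bg r) (G.Bg s)) t = 0"
proof -
  have tr: "G.cog (tri_elt d d') t = 0" if "gtype t \<noteq> 0" for d d'
    using that by (cases t) (simp_all add: tri_elt_def fun_apply)
  have io: "G.cog (iota m T) t = 0" if "gtype t \<noteq> iota_deg m" for m T
    using that by (cases t) (auto simp: iota_def fun_apply A.polar_lin B.polar_lin)
  have io': "G.cog (- iota m T) t = 0" if "gtype t \<noteq> iota_deg m" for m and T :: "('k, 'v, 'w) tensor"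
    using io[OF that, of T] G.cog_linear(2)[of "-1" "iota m T" t] by simp
  have tA: "t_elt S (c p) (c q) \<in> tri S" for p q by (rule A.t_tri)
  have tB: "t_elt S' (c' p) (c' q) \<in> tri S'" for p q by (rule B.t_tri)
  note z = A.tri_closed(1) B.tri_closed(1)
  have dbl: "iota_deg m + iota_deg m = 0" "iota_deg m + iota_deg (m + 1) = iota_deg (m + 2)" for m
    using exhaust_3[of m] by (auto simp: iota_deg_def zero_prod_def Z3_simps)
  show ?thesis
  proof (cases r; cases s)
    fix m p q l p' q' assume e: "r = TI m p q" "s = TI l p' q'"
    consider "l = m" | "l = m + 1" | "m = l + 1" by (rule index_cases[of l m])
    then show ?thesis
    proof cases
      case 1
      have "gtype t \<noteq> 0" using assms unfolding e 1 gtype.simps dbl .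
      then show ?thesis unfolding e 1 G.Bg.simps G.br_iota_same by (rule tr)
    next
      case 2
      have "gtype t \<noteq> iota_deg (m + 2)" using assms unfolding e 2 gtype.simps dbl .
      then show ?thesis unfolding e 2 G.Bg.simps G.br_iota_next by (rule io)
    next
      case 3
      have "gtype t \<noteq> iota_deg (l + 2)" using assms dbl(2)[of l] unfolding e 3 gtype.simps by (simp add: add.commute)
      then show ?thesis unfolding e 3 G.Bg.simps G.br_iota_prev by (rule io')
    qed
  qed (use assms tr io io' in \<open>simp_all add: G.br_tri_tri G.br_tri_iota G.br_iota_tri tA tB z\<close>)
qed

lemma bracket_alg: "bracket_algebra G.gs G.L G.br"
  by (intro bracket_algebra.intro bracket_algebra_axioms.intro G.vs_g G.g_lie_algebra)

sublocale H: graded_coords G.gs G.L G.br GI G.Bg G.cog dg gd'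
proof (intro graded_coords.intro bracket_alg graded_coords_axioms.intro G.g_coord)
  show "(case \<mu> of (\<mu>, \<nu>) \<Rightarrow> gd \<mu> \<nu>) = {v \<in> G.L. \<forall>r\<in>GI. dg r \<noteq> \<mu> \<longrightarrow> G.cog v r = 0}" for \<mu>
    by (cases \<mu>) (auto simp: gd_coord)
  show "G.br (G.Bg r) (G.Bg r') \<in> (case dg r + dg r' of (\<mu>, \<nu>) \<Rightarrow> gd \<mu> \<nu>)" for r r'
    using Bg_br_gd[of r r'] by (simp add: plus_prod_def split_def)
qed

end

lemma card_GI: "card {r\<in>GI. Q r} = card {x\<in>Lam. Q (case_prod TA x)} + card {x\<in>Lam. Q (case_prod TB x)} + card {(m, p, q). Q (TI m p q)}"
proof -
  have c: "card {x\<in>A. R x} = (\<Sum>x\<in>A. if R x then 1 else 0)" if "finite A" for A :: "'z set" and R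
    using that by (simp add: sum.If_cases Int_def)
  have "card {(m, p, q). Q (TI m p q)} = (\<Sum>m\<in>UNIV. \<Sum>p\<in>UNIV. \<Sum>q\<in>UNIV. if Q (TI m p q) then 1 else 0)"
    using c[of UNIV "\<lambda>(m, p, q). Q (TI m p q)"] by (simp add: sum.cartesian_product split_def)
  moreover have "card {r\<in>GI. Q r} = (\<Sum>r\<in>GI. if Q r then 1 else 0)" by (rule c[OF finite_GI])
  ultimately show ?thesis
    using c[of Lam "\<lambda>x. Q (case_prod TA x)"] c[of Lam "\<lambda>x. Q (case_prod TB x)"] unfolding sum_GI by (simp add: split_def)
qed

lemma card_Lam: "card {x\<in>Lam. Q x} = (\<Sum>p\<in>UNIV. \<Sum>q\<in>UNIV. if rk p < rk q \<and> Q (p, q) then 1 else 0)"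
proof -
  have "{x\<in>Lam. Q x} = {x\<in>UNIV. rk (fst x) < rk (snd x) \<and> Q x}" by auto
  also have "card \<dots> = (\<Sum>x\<in>UNIV. if rk (fst x) < rk (snd x) \<and> Q x then 1 else 0)"
    by (simp add: sum.If_cases)
  finally show ?thesis by (simp add: sum.cartesian_product split_def)
qed

subsection \<open>The grading by the elementary 2-group\<close>

text \<open>Adding a nonzero \<open>\<mu>\<close> arranges the eight degrees in four pairs, while
  for \<open>\<mu> = 0\<close> the two labels would have to be equal.\<close>

lemma card_Lam_cdeg: "card {x\<in>Lam. cdeg (fst x) + cdeg (snd x) = \<mu>} = (if \<mu> = 0 then 0 else 4)"
proof -
  obtain s where s: "\<mu> = cdeg s" using cdeg_surj by metis
  show ?thesis unfolding s card_Lam by (cases s; simp add: sum_ix zero_prod_def)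
qed

lemma card_TI_cdeg: "card {(m, p, q). cdeg p = \<mu> \<and> cdeg q = \<nu> \<and> iota_deg m = \<epsilon>} = (if \<epsilon> = 0 then 0 else 1)"
proof -
  obtain p q where p: "\<mu> = cdeg p" "\<nu> = cdeg q" using cdeg_surj by metis
  have inj: "cdeg a = cdeg b \<longleftrightarrow> a = b" for a b using cdeg_inj by (auto dest: injD)
  have nz: "iota_deg m \<noteq> 0" for m using exhaust_3[of m] by (auto simp: iota_deg_def zero_prod_def)
  have ij: "iota_deg m = iota_deg l \<longleftrightarrow> m = l" for m l
    using exhaust_3[of m] exhaust_3[of l] by (auto simp: iota_deg_def)
  show ?thesis
  proof (cases "\<epsilon> = 0")
    case True
    then show ?thesis using nz by auto
  next
    case False
    obtain i j where e: "\<epsilon> = (i, j)" by force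
    have "\<epsilon> = iota_deg 0 \<or> \<epsilon> = iota_deg 1 \<or> \<epsilon> = iota_deg 2"
      using False exhaust_2[of i] exhaust_2[of j] unfolding e by (auto simp: iota_deg_def zero_prod_def)
    then obtain l where l: "\<epsilon> = iota_deg l" by blast
    have "{(m, a, b). cdeg a = \<mu> \<and> cdeg b = \<nu> \<and> iota_deg m = \<epsilon>} = {(l, p, q)}"
      unfolding p l inj ij by auto
    then show ?thesis using False by simp
  qed
qed

locale para_pair = graded_pair S c cd cdeg D S' c' cd' cdeg D'
  for S :: "('k::field, 'v::ab_group_add) normed_alg" and c cd D
    and S' :: "('k, 'w::ab_group_add) normed_alg" and c' cd' D'
begin

abbreviation pgr where "pgr \<equiv> para_induced_grading S S' D D'"

lemma cog_L_eq: assumes "v \<in> G.L" "w \<in> G.L" "\<And>r. r \<in> GI \<Longrightarrow> G.cog v r = G.cog w r" shows "v = w"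
  using G.G.coord_systemD(4)[OF G.g_coord assms(1)] G.G.coord_systemD(4)[OF G.g_coord assms(2)] assms(3)
  by (metis (no_types, lifting) sum.cong)

lemma pgr_coord: "v \<in> pgr (\<mu>, \<nu>, \<epsilon>) \<longleftrightarrow> v \<in> gd \<mu> \<nu> \<and> (\<forall>r\<in>GI. gtype r \<noteq> \<epsilon> \<longrightarrow> G.cog v r = 0)"
proof -
  obtain d d' T where e: "v = (d, d', T)" by (metis prod_cases3)
  have "((\<epsilon> \<noteq> 0 \<longrightarrow> d = 0 \<and> d' = 0) \<and> (\<forall>i. \<epsilon> \<noteq> iota_deg i \<longrightarrow> T i = 0)) \<longleftrightarrow> (\<forall>r\<in>GI. gtype r \<noteq> \<epsilon> \<longrightarrow> G.cog v r = 0)"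
    if v: "v \<in> gd \<mu> \<nu>"
  proof
    assume a: "(\<epsilon> \<noteq> 0 \<longrightarrow> d = 0 \<and> d' = 0) \<and> (\<forall>i. \<epsilon> \<noteq> iota_deg i \<longrightarrow> T i = 0)"
    show "\<forall>r\<in>GI. gtype r \<noteq> \<epsilon> \<longrightarrow> G.cog v r = 0"
    proof (intro ballI impI)
      fix r assume "gtype r \<noteq> \<epsilon>"
      then show "G.cog v r = 0" unfolding e using a by (cases r) (auto simp: fun_apply)
    qed
  next
    assume a: "\<forall>r\<in>GI. gtype r \<noteq> \<epsilon> \<longrightarrow> G.cog v r = 0"
    have D: "d \<in> tri S" "d' \<in> tri S'" and T: "T i \<in> G.TS" for i
      using subsetD[OF gd_L v] unfolding e by (auto simp: G.L_iff)
    have "d = 0 \<and> d' = 0" if "\<epsilon> \<noteq> 0"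
    proof -
      have "tri_elt d d' = (0 :: ('k, 'v, 'w) g_elt)"
      proof (rule cog_L_eq)
        show "tri_elt d d' \<in> G.L" "0 \<in> G.L" using D by (auto simp: G.tri_elt_L G.G.subspace_0[OF G.L_subspace])
        show "G.cog (tri_elt d d') r = G.cog 0 r" if "r \<in> GI" for r
          using bspec[OF a that] that \<open>\<epsilon> \<noteq> 0\<close> unfolding G.cog_linear e tri_elt_def by (cases r) (auto simp: fun_apply)
      qed
      then show ?thesis by (simp add: tri_elt_def zero_prod_def)
    qed
    moreover have "T i = 0" if "\<epsilon> \<noteq> iota_deg i" for i
    proof -
      have "iota i (T i) = (0 :: ('k, 'v, 'w) g_elt)"
      proof (rule cog_L_eq)
        show "iota i (T i) \<in> G.L" "0 \<in> G.L" using T by (auto simp: G.iota_L G.G.subspace_0[OF G.L_subspace])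
        show "G.cog (iota i (T i)) r = G.cog 0 r" if "r \<in> GI" for r
          using bspec[OF a that] that \<open>\<epsilon> \<noteq> iota_deg i\<close> unfolding G.cog_linear e iota_def by (cases r) (auto simp: fun_apply)
      qed
      then show ?thesis by (auto simp: iota_def zero_prod_def fun_eq_iff fun_apply split: if_splits)
    qed
    ultimately show "(\<epsilon> \<noteq> 0 \<longrightarrow> d = 0 \<and> d' = 0) \<and> (\<forall>i. \<epsilon> \<noteq> iota_deg i \<longrightarrow> T i = 0)" by blast
  qed
  then show ?thesis unfolding para_induced_grading_def e by auto
qed

definition dg3 where "dg3 r = (fst (dg r), snd (dg r), gtype r)"

lemma pgr_L: "v \<in> pgr h \<longleftrightarrow> v \<in> G.L \<and> (\<forall>r\<in>GI. dg3 r \<noteq> h \<longrightarrow> G.cog v r = 0)"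
proof -
  obtain \<mu> \<nu> \<epsilon> where h: "h = (\<mu>, \<nu>, \<epsilon>)" by (metis prod_cases3)
  show ?thesis unfolding h pgr_coord gd_coord dg3_def by (auto simp: prod_eq_iff)
qed

sublocale P: graded_coords G.gs G.L G.br GI G.Bg G.cog dg3 pgr
proof (intro graded_coords.intro bracket_alg graded_coords_axioms.intro G.g_coord)
  show "pgr h = {v \<in> G.L. \<forall>r\<in>GI. dg3 r \<noteq> h \<longrightarrow> G.cog v r = 0}" for h
    using pgr_L by blast
  show "G.br (G.Bg r) (G.Bg r') \<in> pgr (dg3 r + dg3 r')" for r r'
    using Bg_br_gd[of r r'] Bg_br_type by (simp add: dg3_def plus_prod_def pgr_coord)
qed

definition pdim :: "(2 \<times> 2 \<times> 2) \<times> (2 \<times> 2 \<times> 2) \<times> (2 \<times> 2) \<Rightarrow> nat" where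
  "pdim = (\<lambda>(\<mu>, \<nu>, \<epsilon>). if \<epsilon> \<noteq> 0 then 1 else if (\<mu> = 0) = (\<nu> = 0) then 0 else 4)"

lemma pgr_dim: "has_dim G.gs (pgr h) (pdim h)"
proof -
  obtain \<mu> \<nu> \<epsilon> where h: "h = (\<mu>, \<nu>, \<epsilon>)" by (metis prod_cases3)
  have "card {x\<in>Lam. dg3 (case_prod TA x) = h} = (if \<nu> = 0 \<and> \<epsilon> = 0 \<and> \<mu> \<noteq> 0 then 4 else 0)"
    using card_Lam_cdeg[of \<mu>] unfolding h dg3_def by (cases "\<nu> = 0 \<and> \<epsilon> = 0") (auto simp: split_def)
  moreover have "card {x\<in>Lam. dg3 (case_prod TB x) = h} = (if \<mu> = 0 \<and> \<epsilon> = 0 \<and> \<nu> \<noteq> 0 then 4 else 0)"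
    using card_Lam_cdeg[of \<nu>] unfolding h dg3_def by (cases "\<mu> = 0 \<and> \<epsilon> = 0") (auto simp: split_def)
  moreover have "card {(m, p, q). dg3 (TI m p q) = h} = (if \<epsilon> = 0 then 0 else 1)"
    using card_TI_cdeg[of \<mu> \<nu> \<epsilon>] unfolding h dg3_def by simp
  ultimately have "card {r\<in>GI. dg3 r = h} = pdim h" unfolding card_GI pdim_def h by auto
  then show ?thesis using P.gr_dim[of h] by simp
qed

text \<open>\<open>192 = 8 * 8 * 3\<close> degrees come from the \<iota>-components and
  \<open>14 = 7 + 7\<close> from the two triality algebras, and
  \<open>192 + 4 * 14 = 248\<close>.\<close>

lemma pgr_type: "grading_type G.gs pgr [192, 0, 0, 14]"
proof -
  have hd: "has_dim G.gs (pgr h) i \<longleftrightarrow> pdim h = i" for h i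
    using G.G.has_dim_unique[OF pgr_dim] pgr_dim by metis
  have 1: "{h. pdim h = 1} = UNIV \<times> UNIV \<times> (- {0})"
    by (auto simp: pdim_def split: if_splits)
  have 4: "{h. pdim h = 4} = (- {0}) \<times> {0} \<times> {0} \<union> {0} \<times> (- {0}) \<times> {0}"
    by (auto simp: pdim_def split: if_splits)
  have c8: "card (- {0} :: (2 \<times> 2 \<times> 2) set) = 7" and c4: "card (- {0} :: (2 \<times> 2) set) = 3"
    by (simp_all add: Compl_eq_Diff_UNIV card_Diff_subset)
  have "card {h. pdim h = 1} = 192" unfolding 1 by (simp add: card_cartesian_product c4)
  moreover have "card {h. pdim h = 4} = 14"
    unfolding 4 by (subst card_Un_disjoint) (auto simp: card_cartesian_product c8)
  moreover have "{h. pdim h = 2} = {}" "{h. pdim h = 3} = {}" by (auto simp: pdim_def split: if_splits)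
  moreover have "pdim h \<le> 4" for h by (auto simp: pdim_def split_def)
  moreover have "i \<in> {1..4} \<longleftrightarrow> i = 1 \<or> i = 2 \<or> i = 3 \<or> i = (4 :: nat)" for i by auto
  ultimately show ?thesis unfolding grading_type_def hd by (auto simp: eval_nat_numeral)
qed

end

context graded_cayley
begin

sublocale GS: graded_symcomp P c cd cdeg D
proof (intro graded_symcomp.intro graded_symcomp_axioms.intro)
  show "symcomp8 P (\<lambda>_. c) (\<lambda>_. cd)"
  proof -
    obtain b where "split_triple Q.SK b" using split_K by blast
    then interpret B: split_triple Q.SK b .
    show ?thesis
      by (intro symcomp8.intro symcomp8_axioms.intro P_symcomp Q.c_dual Q.c_expand) (rule Q.tri_inj_descent[OF B.tri_inj])
  qed
  show "v \<in> D \<mu> \<longleftrightarrow> (\<forall>p. cdeg p \<noteq> \<mu> \<longrightarrow> polar P v (cd p) = 0)" for v \<mu>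
  proof
    assume "v \<in> D \<mu>"
    then show "\<forall>p. cdeg p \<noteq> \<mu> \<longrightarrow> polar P v (cd p) = 0" using D_orth[OF _ c_D] by (auto simp: cd_def)
  next
    assume a: "\<forall>p. cdeg p \<noteq> \<mu> \<longrightarrow> polar P v (cd p) = 0"
    have "v = (\<Sum>p\<in>UNIV. n v (cd p) \<odot> c p)" by (rule c_expand)
    also have "\<dots> \<in> D \<mu>"
    proof (rule V.subspace_sum[OF D_sub])
      fix p show "n v (cd p) \<odot> c p \<in> D \<mu>" using a c_D[of p] by (cases "cdeg p = \<mu>") (auto simp: D_closed)
    qed
    finally show "v \<in> D \<mu>" .
  qed
  show "mul P x y \<in> D (\<mu> + \<nu>)" if "x \<in> D \<mu>" "y \<in> D \<nu>" for x y \<mu> \<nu>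
    using D_mul[OF cj_D[OF that(1)] cj_D[OF that(2)]] by simp
  show "cd p \<in> D (- cdeg p)" for p using c_D[of p] by (simp add: cd_def D_closed Z2_cubed_self)
  show "polar P (c p) (c q) = 0" if "cdeg p + cdeg q \<noteq> 0" for p q
    using that c_orth[of p q] by (cases "p = q") (auto simp: Z2_cubed_self)
qed

end

subsection \<open>The grading by the elementary 3-group\<close>

text \<open>
  The pairs of degrees with sum \<open>deg p\<close> form a triality orbit: with \<open>x = ox p\<close>, \<open>y = oy p\<close>, \<open>z = oz p\<close>,
  two consecutive ones are linked by the cyclic relation of \<open>t\<close> at \<open>(x, y, x)\<close> and at \<open>(y, z, y)\<close>,
  where one of the three terms vanishes.
\<close>

primrec ox :: "ix \<Rightarrow> ix" where
  "ox X0 = X2"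
| "ox X1 = X3"
| "ox X2 = X1"
| "ox X3 = X0"
| "ox X4 = X1"
| "ox X5 = X0"
| "ox X6 = X1"
| "ox X7 = X0"

primrec oy :: "ix \<Rightarrow> ix" where
  "oy X0 = X4"
| "oy X1 = X5"
| "oy X2 = X6"
| "oy X3 = X7"
| "oy X4 = X2"
| "oy X5 = X3"
| "oy X6 = X4"
| "oy X7 = X5"

primrec oz :: "ix \<Rightarrow> ix" where
  "oz X0 = X6"
| "oz X1 = X7"
| "oz X2 = X5"
| "oz X3 = X4"
| "oz X4 = X7"
| "oz X5 = X6"
| "oz X6 = X3"
| "oz X7 = X2"

lemma deg_pr: "sg p q \<noteq> 0 \<Longrightarrow> deg (pr p q) = deg p + deg q"
  by (cases p; cases q; simp)

lemma o_table: "sg (oy p) (ox p) = 0" "sg (ox p) (oy p) \<noteq> 0" "sg (oz p) (oy p) = 0" "sg (oy p) (oz p) \<noteq> 0"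
  "pr (oy p) (oz p) = neg (ox p)" "deg (neg (oy p)) + deg (oz p) = deg p" "sg p p \<noteq> 0" "pr p p = neg p"
  by (cases p; simp)+

lemma o_pairs: "deg a + deg b = deg p \<Longrightarrow> a = b \<or>
    (a, b) \<in> {(pr (ox p) (oy p), ox p), (neg (ox p), oy p), (neg (oy p), oz p),
      (ox p, pr (ox p) (oy p)), (oy p, neg (ox p)), (oz p, neg (oy p))}"
  by (cases p; cases a; cases b; simp)

text \<open>For \<open>\<mu> = 0\<close> these are the four opposite pairs. Otherwise the label of
  degree \<open>\<mu>\<close> has no partner and that of degree \<open>- \<mu>\<close> would be its
  own, which leaves six labels in three pairs.\<close>

lemma card_Lam_deg: "card {x\<in>Lam. deg (fst x) + deg (snd x) = \<mu>} = (if \<mu> = 0 then 4 else 3)"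
proof (cases "\<mu> = 0")
  case True
  show ?thesis unfolding card_Lam True by (simp add: sum_ix zero_prod_def)
next
  case False
  then have "\<mu> \<in> range deg" unfolding deg_range by simp
  then obtain s where s: "\<mu> = deg s" by blast
  show ?thesis unfolding s card_Lam by (cases s; simp add: sum_ix zero_prod_def)
qed

lemma card_TI_deg: "card {(m :: 3, p, q). deg p = \<mu> \<and> deg q = \<nu>} = (if \<mu> = 0 \<or> \<nu> = 0 then 0 else 3)"
proof (cases "\<mu> = 0 \<or> \<nu> = 0")
  case True
  moreover have "deg p \<noteq> 0" for p using deg_range by blast
  ultimately show ?thesis by auto
next
  case False
  then obtain p q where p: "\<mu> = deg p" "\<nu> = deg q" using deg_range by (metis ComplI imageE singletonD)
  have "{(m :: 3, a, b). deg a = \<mu> \<and> deg b = \<nu>} = UNIV \<times> {(p, q)}"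
    unfolding p using deg_inj by (auto dest: injD)
  then show ?thesis using False by (simp add: card_cartesian_product)
qed

context okubo
begin

lemma okc_nz: "sg p q \<noteq> 0 \<Longrightarrow> okc \<alpha> \<beta> p q \<noteq> 0"
proof -
  assume "sg p q \<noteq> 0"
  then have "sg p q = 1 \<or> sg p q = - 1" by (cases p; cases q; simp)
  then show ?thesis using nz by (auto simp: okc_def)
qed

lemma grading_iff: "v \<in> okubo_grading S x \<mu> \<longleftrightarrow> (\<forall>p. deg p \<noteq> \<mu> \<longrightarrow> polar S v (c (neg p)) = 0)"
proof (cases "\<mu> = 0")
  case True
  then show ?thesis using deg_nz c_expand[of v] by (auto simp: okubo_grading_def)
next
  case False
  then have "\<mu> \<in> range deg" unfolding deg_range by simp
  then obtain s where s: "\<mu> = deg s" by blast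
  have inj: "deg p = deg s \<longleftrightarrow> p = s" for p using deg_inj by (auto dest: injD)
  have D: "okubo_grading S x \<mu> = range (\<lambda>a. scl S a (c s))"
    unfolding okubo_grading_def c_def s using False by (simp add: V.span_singleton s)
  show ?thesis
  proof
    assume "v \<in> okubo_grading S x \<mu>"
    then show "\<forall>p. deg p \<noteq> \<mu> \<longrightarrow> polar S v (c (neg p)) = 0" unfolding D unfolding s by (auto simp: c_polar)
  next
    assume a: "\<forall>p. deg p \<noteq> \<mu> \<longrightarrow> polar S v (c (neg p)) = 0"
    have "v = (\<Sum>p\<in>UNIV. scl S (polar S v (c (neg p))) (c p))" by (rule c_expand)
    also have "\<dots> = (\<Sum>p\<in>UNIV. if p = s then scl S (polar S v (c (neg s))) (c s) else 0)"
      by (rule sum.cong) (use a in \<open>auto simp: s inj\<close>)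
    finally have "v = scl S (polar S v (c (neg s))) (c s)" by simp
    then show "v \<in> okubo_grading S x \<mu>" unfolding D by blast
  qed
qed

sublocale GS: graded_symcomp S c "\<lambda>p. c (neg p)" deg "okubo_grading S x"
proof (intro graded_symcomp.intro graded_symcomp_axioms.intro grading_iff)
  show "symcomp8 S (\<lambda>_. c) (\<lambda>_ p. c (neg p))"
  proof -
    obtain b where "split_triple SK b" using split_K by blast
    then interpret B: split_triple SK b .
    show ?thesis
      by (intro symcomp8.intro symcomp8_axioms.intro symcomp_axioms c_dual c_expand) (rule tri_inj_descent[OF B.tri_inj])
  qed
  have mem: "c p \<in> okubo_grading S x (deg p)" for p
    unfolding grading_iff by (auto simp: c_polar)
  show "mul S y z \<in> okubo_grading S x (\<mu> + \<nu>)" if y: "y \<in> okubo_grading S x \<mu>" and z: "z \<in> okubo_grading S x \<nu>" for y z \<mu> \<nu>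
  proof (cases "\<mu> = 0 \<or> \<nu> = 0")
    case True
    then have "y = 0 \<or> z = 0" using y z by (auto simp: okubo_grading_def)
    then show ?thesis unfolding grading_iff by auto
  next
    case False
    then obtain p q where p: "\<mu> = deg p" "\<nu> = deg q" using deg_range by (metis ComplI imageE singletonD)
    obtain a b where ab: "y = scl S a (c p)" "z = scl S b (c q)"
      using y z False unfolding okubo_grading_def p c_def by (auto simp: V.span_singleton)
    show ?thesis
    proof (cases "sg p q = 0")
      case True
      then have "mul S y z = 0" by (simp add: ab c_mul okc_def)
      then show ?thesis unfolding grading_iff by simp
    next
      case False
      show ?thesis unfolding p deg_pr[OF False, symmetric]
        using mem[of "pr p q"] unfolding grading_iff by (simp add: ab c_mul)
    qed
  qed
  show "c (neg p) \<in> okubo_grading S x (- deg p)" for p using mem[of "neg p"] by (simp add: deg_neg)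
  show "polar S (c p) (c q) = 0" if "deg p + deg q \<noteq> 0" for p q
    using that by (auto simp: c_polar deg_neg)
qed

section \<open>Triality orbits of the elements t in an Okubo algebra\<close>

definition orb where "orb w = F.span {w, shift 1 w, shift 2 w}"

lemma orb_sub: "F.subspace (orb w)" unfolding orb_def by (rule F.subspace_span)

lemma shift_0: "shift 0 d = d" by (simp add: shift_def)

lemma orb_base: "shift i w \<in> orb w"
  unfolding orb_def using exhaust_3[of i] by (auto simp: shift_0 intro: F.span_base)

lemma orb_shift: assumes "d \<in> orb w" shows "shift i d \<in> orb w"
proof -
  have "F.subspace {d. shift i d \<in> orb w}"
    unfolding F.subspace_def
    by (auto simp: shift_lin shift_fs F.subspace_0[OF orb_sub] F.subspace_add[OF orb_sub] F.subspace_scale[OF orb_sub])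
  moreover have "{w, shift 1 w, shift 2 w} \<subseteq> {d. shift i d \<in> orb w}"
    using orb_base by (auto simp: shift_shift)
  ultimately show ?thesis using assms F.span_minimal unfolding orb_def by blast
qed

lemma t_lin: "t (scl S a y) z = fs S a (t y z)" "t y (scl S a z) = fs S a (t y z)" "t 0 y = 0"
  by (simp_all add: bilinD[OF t_bilin])

text \<open>The cyclic relation at \<open>(c p, c q, c p)\<close>: its middle term contains the
  vanishing product of \<open>c q\<close> and \<open>c p\<close>, and the square of
  \<open>c p\<close> is a multiple of \<open>c (neg p)\<close>.\<close>

lemma t_link:
  assumes s: "sg q p = 0" "sg p q \<noteq> 0" and U: "t (c (neg p)) (c q) \<in> orb w"
  shows "t (c (pr p q)) (c p) \<in> orb w"
proof -
  have "fs S (okc \<alpha> \<beta> p q) (t (c (pr p q)) (c p)) + fs S (okc \<alpha> \<beta> p p) (shift 2 (t (c (neg p)) (c q))) = 0"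
    using GS.t_cyclic[of "c p" "c q" "c p"] s(1) o_table(8)[of p]
    by (simp add: c_mul t_lin shift_fs shift_lin okc_def[of _ _ q p])
  then have "fs S (okc \<alpha> \<beta> p q) (t (c (pr p q)) (c p)) = - fs S (okc \<alpha> \<beta> p p) (shift 2 (t (c (neg p)) (c q)))"
    by (simp add: eq_neg_iff_add_eq_0)
  also have "\<dots> \<in> orb w"
    by (intro F.subspace_neg[OF orb_sub] F.subspace_scale[OF orb_sub] orb_shift U)
  finally have "fs S (inverse (okc \<alpha> \<beta> p q)) (fs S (okc \<alpha> \<beta> p q) (t (c (pr p q)) (c p))) \<in> orb w"
    by (rule F.subspace_scale[OF orb_sub])
  then show ?thesis using okc_nz[OF s(2)] by simp
qed

lemma tri_orbit: "\<exists>w\<in>GS.td (deg p). \<forall>a b. deg a + deg b = deg p \<longrightarrow> t (c a) (c b) \<in> orb w"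
proof (rule bexI)
  let ?w = "t (c (neg (oy p))) (c (oz p))"
  show "?w \<in> GS.td (deg p)"
    using GS.t_td[OF GS.c_D GS.c_D, of "neg (oy p)" "oz p"] o_table(6)[of p] by simp
  have w: "?w \<in> orb ?w" using orb_base[of 0] by (simp add: shift_0)
  have y: "t (c (neg (ox p))) (c (oy p)) \<in> orb ?w"
    using t_link[OF o_table(3,4) w] by (simp only: o_table(5))
  have x: "t (c (pr (ox p) (oy p))) (c (ox p)) \<in> orb ?w"
    by (rule t_link[OF o_table(1,2) y])
  have sw: "t (c b) (c a) \<in> orb ?w" if "t (c a) (c b) \<in> orb ?w" for a b
    using F.subspace_neg[OF orb_sub that] t_swap[of "c b" "c a"] by metis
  show "\<forall>a b. deg a + deg b = deg p \<longrightarrow> t (c a) (c b) \<in> orb ?w"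
  proof (intro allI impI)
    fix a b assume "deg a + deg b = deg p"
    then show "t (c a) (c b) \<in> orb ?w"
      using o_pairs[of a b p] w x y sw[OF w] sw[OF x] sw[OF y] F.subspace_0[OF orb_sub] by (auto simp: t_same)
  qed
qed

text \<open>The cyclic relation at three equal arguments. It rules out the eigenvalue
  \<open>1\<close> on the triality orbits in degree zero.\<close>

lemma t_fixed: "t (c (neg p)) (c p) + shift 1 (t (c (neg p)) (c p)) + shift 2 (t (c (neg p)) (c p)) = 0"
proof -
  have "fs S (okc \<alpha> \<beta> p p) (t (c (neg p)) (c p) + shift 1 (t (c (neg p)) (c p)) + shift 2 (t (c (neg p)) (c p))) = 0"
    using GS.t_cyclic[of "c p" "c p" "c p"] o_table(8)[of p]
    by (simp add: c_mul t_lin shift_fs F.scale_right_distrib)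
  then show ?thesis using okc_nz[OF o_table(7)] by simp
qed

text \<open>Two orbits suffice for the four opposite pairs: the pairs \<open>X4, X5\<close> and
  \<open>X6, X7\<close> are expressed through the other two by the cyclic relation at
  \<open>(X2, X0, X5)\<close> and at \<open>(X1, X2, X7)\<close>.\<close>

lemma tri_zero: "\<exists>w1\<in>GS.td 0. \<exists>w2\<in>GS.td 0. w1 + shift 1 w1 + shift 2 w1 = 0 \<and> w2 + shift 1 w2 + shift 2 w2 = 0 \<and>
   (\<forall>a b. deg a + deg b = 0 \<longrightarrow> t (c a) (c b) \<in> F.span (orb w1 \<union> orb w2))"
proof -
  let ?w1 = "t (c X1) (c X0)" and ?w2 = "t (c X3) (c X2)"
  let ?U = "F.span (orb ?w1 \<union> orb ?w2)"
  have a: "?w1 \<in> GS.td 0" "?w2 \<in> GS.td 0"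
    using GS.t_td[OF GS.c_D GS.c_D, of X1 X0] GS.t_td[OF GS.c_D GS.c_D, of X3 X2] by (simp_all add: zero_prod_def)
  have b: "?w1 + shift 1 ?w1 + shift 2 ?w1 = 0" "?w2 + shift 1 ?w2 + shift 2 ?w2 = 0"
    using t_fixed[of X0] t_fixed[of X2] by simp_all
  note cl = F.span_add F.span_scale F.span_neg F.span_zero
  have sw: "t (c b) (c a) \<in> ?U" if "t (c a) (c b) \<in> ?U" for a b
    using F.span_neg[OF that] t_swap[of "c b" "c a"] by metis
  have w: "shift i ?w1 \<in> ?U" "shift i ?w2 \<in> ?U" for i using orb_base by (auto intro: F.span_base)
  have w': "shift i (t (c X0) (c X1)) \<in> ?U" "shift i (t (c X2) (c X3)) \<in> ?U" for i
    using F.span_neg[OF w(1)[of i]] F.span_neg[OF w(2)[of i]]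
    unfolding t_swap[of "c X0" "c X1"] t_swap[of "c X2" "c X3"] shift_lin by simp_all
  have dv: "d \<in> ?U" if "fs S a d + e + e' = 0" "a \<noteq> 0" "e \<in> ?U" "e' \<in> ?U" for a d e e'
  proof -
    have "fs S a d = - (e + e')" using that(1) by (simp only: eq_neg_iff_add_eq_0 add.assoc)
    also have "\<dots> \<in> ?U" by (intro cl that)
    finally have "fs S (inverse a) (fs S a d) \<in> ?U" by (rule F.span_scale)
    then show ?thesis using that by simp
  qed
  have 4: "t (c X4) (c X5) \<in> ?U"
  proof (rule dv)
    show "fs S (okc \<alpha> \<beta> X2 X0) (t (c X4) (c X5)) + fs S (okc \<alpha> \<beta> X0 X5) (shift 1 (t (c X3) (c X2)))
      + fs S (okc \<alpha> \<beta> X5 X2) (shift 2 (t (c X1) (c X0))) = 0"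
      using GS.t_cyclic[of "c X2" "c X0" "c X5"] by (simp add: c_mul t_lin shift_fs)
    show "okc \<alpha> \<beta> X2 X0 \<noteq> 0" by (rule okc_nz) simp
    show "fs S (okc \<alpha> \<beta> X0 X5) (shift 1 (t (c X3) (c X2))) \<in> ?U" "fs S (okc \<alpha> \<beta> X5 X2) (shift 2 (t (c X1) (c X0))) \<in> ?U"
      by (intro F.span_scale w)+
  qed
  have 6: "t (c X6) (c X7) \<in> ?U"
  proof (rule dv)
    show "fs S (okc \<alpha> \<beta> X1 X2) (t (c X6) (c X7)) + fs S (okc \<alpha> \<beta> X2 X7) (shift 1 (t (c X0) (c X1)))
      + fs S (okc \<alpha> \<beta> X7 X1) (shift 2 (t (c X3) (c X2))) = 0"
      using GS.t_cyclic[of "c X1" "c X2" "c X7"] by (simp add: c_mul t_lin shift_fs)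
    show "okc \<alpha> \<beta> X1 X2 \<noteq> 0" by (rule okc_nz) simp
    show "fs S (okc \<alpha> \<beta> X2 X7) (shift 1 (t (c X0) (c X1))) \<in> ?U" "fs S (okc \<alpha> \<beta> X7 X1) (shift 2 (t (c X3) (c X2))) \<in> ?U"
      by (intro F.span_scale w w')+
  qed
  have e: "\<forall>a b. deg a + deg b = 0 \<longrightarrow> t (c a) (c b) \<in> ?U"
  proof (intro allI impI)
    fix a b assume "deg a + deg b = 0"
    then have "deg b = deg (neg a)" by (simp add: deg_neg minus_unique)
    then have "b = neg a" using deg_inj by (auto dest: injD)
    then show "t (c a) (c b) \<in> ?U"
      using w(1)[of 0] w(2)[of 0] w'(1)[of 0] w'(2)[of 0] 4 6 sw[OF 4] sw[OF 6] by (cases a) (simp_all add: shift_0)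
  qed
  show ?thesis
    by (rule bexI[of _ ?w1], rule bexI[of _ ?w2]) (intro conjI b e, rule a(2), rule a(1))
qed

end

locale okubo_pair = A: okubo \<alpha> \<beta> S x + B: okubo \<alpha>' \<beta>' S' x'
  for \<alpha> \<beta> and S :: "('k::field, 'v::ab_group_add) normed_alg" and x
    and \<alpha>' \<beta>' and S' :: "('k, 'w::ab_group_add) normed_alg" and x' +
  fixes \<omega> :: 'k
  assumes om: "\<omega> ^ 3 = 1" "\<omega> \<noteq> 1" and three: "(3 :: 'k) \<noteq> 0"
begin

sublocale graded_pair S A.c "\<lambda>p. A.c (neg p)" deg "okubo_grading S x" S' B.c "\<lambda>p. B.c (neg p)" deg "okubo_grading S' x'"
  by (intro graded_pair.intro A.GS.graded_symcomp_axioms B.GS.graded_symcomp_axioms)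

section \<open>The automorphism Theta and its eigenspaces\<close>

abbreviation Th :: "('k, 'v, 'w) g_elt \<Rightarrow> ('k, 'v, 'w) g_elt" where "Th \<equiv> Theta"

sublocale R: order_three G.gs Th \<omega>
proof (intro order_three.intro G.vs_g order_three_axioms.intro om three)
  show "Th (y + z) = Th y + Th z" for y z
    by (cases y; cases z) (simp add: Theta_def shift_def fun_eq_iff fun_apply)
  show "Th (G.gs a y) = G.gs a (Th y)" for a y
    by (cases y) (simp add: Theta_def G.gs_simp shift_def fun_eq_iff fun_scale_def)
  show "Th (Th (Th y)) = y" for y
    by (cases y) (simp add: Theta_def shift_def fun_eq_iff diff_diff_eq Z3_simps)
qed

lemma Th_tri: "Th (tri_elt d d') = tri_elt (shift 1 d) (shift 1 d')"
  by (simp add: Theta_def tri_elt_def shift_def fun_eq_iff fun_apply)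

lemma Th_iota: "Th (iota m T) = iota (m + 1) T"
  by (auto simp: Theta_def iota_def shift_def fun_eq_iff fun_apply diff_eq_eq)

lemma Th_minus: "Th (- y) = - Th y"
  using R.T_scale[of "-1" y] by simp

lemma Th_gd: "Th ` gd \<mu> \<nu> \<subseteq> gd \<mu> \<nu>"
proof (rule image_subsetI)
  fix v assume v: "v \<in> gd \<mu> \<nu>"
  obtain d d' T where e: "v = (d, d', T)" by (rule prod_cases3)
  show "Th v \<in> gd \<mu> \<nu>"
    using v unfolding e Theta_def prod.case gd_iff
    by (elim conjE, intro conjI A.GS.shift_td B.GS.shift_td) (auto simp: shift_def fun_eq_iff fun_apply)
qed

lemma Th_L: "y \<in> G.L \<Longrightarrow> Th y \<in> G.L"
  by (cases y) (simp add: Theta_def G.L_iff A.tri_shift B.tri_shift, simp add: shift_def)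

lemma Th_br_gen:
  assumes d: "d \<in> tri S" "d' \<in> tri S'" and z: "z \<in> G.L"
  shows "Th (G.br (tri_elt d d') z) = G.br (Th (tri_elt d d')) (Th z)"
  using z
proof (induct rule: G.L_induct)
  case (add y z)
  then show ?case
    by (simp add: R.T_add G.br_add_right G.tri_elt_L d Th_L)
next
  case (tri e e')
  then show ?case
    by (simp add: Th_tri G.br_tri_tri d A.tri_shift B.tri_shift A.GS.tri_bracket_shift B.GS.tri_bracket_shift)
next
  case (iota m y y')
  then show ?case
    by (simp add: Th_tri Th_iota G.br_tri_iota d A.tri_shift B.tri_shift) (simp add: shift_def)
qed

lemma Th_br_iota:
  assumes z: "z \<in> G.L"
  shows "Th (G.br (iota m (G.tns y y')) z) = G.br (Th (iota m (G.tns y y'))) (Th z)"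
  using z
proof (induct rule: G.L_induct)
  case (add y z)
  then show ?case
    by (simp add: R.T_add G.br_add_right G.iota_L tensor_space_tensor Th_L)
next
  case (tri e e')
  then show ?case
    by (simp add: Th_tri Th_iota G.br_iota_tri Th_minus A.tri_shift B.tri_shift) (simp add: shift_def)
next
  case (iota l z z')
  consider "l = m" | "l = m + 1" | "m = l + 1" by (rule index_cases[of l m])
  then show ?case
  proof cases
    case 1
    show ?thesis unfolding 1
      by (simp add: Th_tri Th_iota G.br_iota_same shift_fs shift_shift add.commute)
  next
    case 2
    show ?thesis unfolding 2 Th_iota G.br_iota_next by (simp add: add_ac)
  next
    case 3
    show ?thesis unfolding 3 Th_iota G.br_iota_prev Th_minus by (simp add: add_ac)
  qed
qed

text \<open>\<open>Theta\<close> is an automorphism, so eigenvalues multiply under the bracket; this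
  provides the third coordinate of the degree.\<close>

lemma Th_br: assumes y: "y \<in> G.L" and z: "z \<in> G.L" shows "Th (G.br y z) = G.br (Th y) (Th z)"
  using y
proof (induct rule: G.L_induct)
  case (add y y')
  then show ?case by (simp add: R.T_add G.br_add_left z Th_L)
qed (auto intro: Th_br_gen Th_br_iota z)

abbreviation ogr where "ogr \<equiv> okubo_induced_grading \<omega> S S' (okubo_grading S x) (okubo_grading S' x')"

lemma ogr_eq: "ogr (\<mu>, \<nu>, j) = R.Ej (gd \<mu> \<nu>) j"
  by (simp add: okubo_induced_grading_def R.Ej_def R.lam_def)

lemma ogr_gd: "ogr (\<mu>, \<nu>, j) \<subseteq> gd \<mu> \<nu>"
  unfolding ogr_eq R.Ej_def by blast

lemma ogr_grading: "group_grading G.gs G.L G.br ogr"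
  unfolding group_grading_def
proof (intro conjI allI ballI)
  show "G.G.subspace (ogr h)" for h by (cases h) (simp add: ogr_eq R.Ej_sub gd_sub)
  show "ogr h \<subseteq> G.L" for h using ogr_gd gd_L by (cases h) blast
next
  fix h h' y z assume y: "y \<in> ogr h" and z: "z \<in> ogr h'"
  obtain \<mu> \<nu> j \<mu>' \<nu>' j' where h: "h = (\<mu>, \<nu>, j)" "h' = (\<mu>', \<nu>', j')" by (metis prod_cases3)
  have gd: "y \<in> gd \<mu> \<nu>" "z \<in> gd \<mu>' \<nu>'" and e: "Th y = G.gs (R.lam j) y" "Th z = G.gs (R.lam j') z"
    using y z unfolding h ogr_eq R.Ej_def by auto
  have L: "y \<in> G.L" "z \<in> G.L" by (rule subsetD[OF gd_L gd(1)], rule subsetD[OF gd_L gd(2)])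
  have "G.br y z \<in> gd (\<mu> + \<mu>') (\<nu> + \<nu>')"
    using H.gr_br[of y "(\<mu>, \<nu>)" z "(\<mu>', \<nu>')"] gd by simp
  moreover have "Th (G.br y z) = G.gs (R.lam (j + j')) (G.br y z)"
    unfolding Th_br[OF L] e R.lam_add using L
    by (simp add: G.br_scale_left G.br_scale_right G.G.subspace_scale[OF G.L_subspace])
  ultimately show "G.br y z \<in> ogr (h + h')" unfolding h by (simp add: ogr_eq R.Ej_def)
next
  fix v assume v: "v \<in> G.L"
  obtain g where g: "\<And>h. g h \<in> gd (fst h) (snd h)" "v = (\<Sum>h\<in>UNIV. g h)"
    and gu: "\<And>g'. (\<And>h. g' h \<in> gd (fst h) (snd h)) \<Longrightarrow> v = (\<Sum>h\<in>UNIV. g' h) \<Longrightarrow> g' = g"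
    using H.gr_unique[OF v] unfolding split_def by blast
  \<comment> \<open>The projectors refine the decomposition for the coarser grading. Uniqueness goes
    the other way: summing over \<open>j\<close> recovers the coarse components, and projecting
    these recovers \<open>f\<close>.\<close>
  let ?f = "\<lambda>(\<mu>, \<nu>, j). R.Pj j (g (\<mu>, \<nu>))"
  have tot: "(\<Sum>h\<in>UNIV. f h) = (\<Sum>(\<mu>, \<nu>)\<in>UNIV. \<Sum>j\<in>UNIV. f (\<mu>, \<nu>, j))"
    for f :: "(3 \<times> 3) \<times> (3 \<times> 3) \<times> 3 \<Rightarrow> ('k, 'v, 'w) g_elt"
    using sum.cartesian_product[of "\<lambda>\<mu> h. f (\<mu>, h)" UNIV UNIV]
      sum.cartesian_product[of "\<lambda>\<nu> j. f (_, \<nu>, j)" UNIV UNIV]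
      sum.cartesian_product[of "\<lambda>\<mu> \<nu>. \<Sum>j\<in>UNIV. f (\<mu>, \<nu>, j)" UNIV UNIV]
    by (simp add: split_def sum.cartesian_product)
  show "\<exists>!f. (\<forall>h. f h \<in> ogr h) \<and> v = (\<Sum>h\<in>UNIV. f h)"
  proof (rule ex1I)
    have "?f h \<in> ogr h" for h
      using R.Pj_Ej[OF gd_sub Th_gd] g(1) by (cases h) (simp add: ogr_eq, metis fst_conv snd_conv)
    moreover have "(\<Sum>h\<in>UNIV. ?f h) = v"
      unfolding tot g(2) by (simp add: R.Pj_sum split_def)
    ultimately show "(\<forall>h. ?f h \<in> ogr h) \<and> v = (\<Sum>h\<in>UNIV. ?f h)" by simp
    fix f assume f: "(\<forall>h. f h \<in> ogr h) \<and> v = (\<Sum>h\<in>UNIV. f h)"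
    have "(\<lambda>(\<mu>, \<nu>). \<Sum>j\<in>UNIV. f (\<mu>, \<nu>, j)) = g"
    proof (rule gu)
      show "(case h of (\<mu>, \<nu>) \<Rightarrow> \<Sum>j\<in>UNIV. f (\<mu>, \<nu>, j)) \<in> gd (fst h) (snd h)" for h
      proof -
        obtain \<mu> \<nu> where Pair: "h = (\<mu>, \<nu>)" by (rule prod.exhaust)
        have "f (\<mu>, \<nu>, j) \<in> gd \<mu> \<nu>" for j using f ogr_gd by blast
        then show ?thesis unfolding Pair by (simp add: G.G.subspace_sum[OF gd_sub])
      qed
      show "v = (\<Sum>h\<in>UNIV. case h of (\<mu>, \<nu>) \<Rightarrow> \<Sum>j\<in>UNIV. f (\<mu>, \<nu>, j))"
        using f unfolding tot by simp
    qed
    then have gf: "g (\<mu>, \<nu>) = (\<Sum>j\<in>UNIV. f (\<mu>, \<nu>, j))" for \<mu> \<nu> by auto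
    have "R.Pj j (g (\<mu>, \<nu>)) = f (\<mu>, \<nu>, j)" for \<mu> \<nu> j
    proof -
      have e: "R.Pj j (f (\<mu>, \<nu>, i)) = (if i = j then f (\<mu>, \<nu>, i) else 0)" for i
        using f R.Pj_eigenvector[of "f (\<mu>, \<nu>, i)" i j] unfolding ogr_eq[symmetric]
        by (metis (mono_tags, lifting) R.Ej_def mem_Collect_eq ogr_eq)
      show ?thesis unfolding gf sum_3 R.Pj_add e using exhaust_3[of j] by auto
    qed
    then show "f = ?f" by (auto simp: fun_eq_iff)
  qed
qed

subsection \<open>Dimensions\<close>

definition odim :: "(3 \<times> 3) \<times> (3 \<times> 3) \<times> 3 \<Rightarrow> nat" where
  "odim = (\<lambda>(\<mu>, \<nu>, j). if \<mu> = 0 \<and> \<nu> = 0 then (if j = 0 then 0 else 4) else 1)"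

lemma gd_dim: "has_dim G.gs (gd \<mu> \<nu>) (\<Sum>j\<in>UNIV. odim (\<mu>, \<nu>, j))"
proof -
  have "card {y\<in>Lam. dg (case_prod TA y) = (\<mu>, \<nu>)} = (if \<nu> = 0 then if \<mu> = 0 then 4 else 3 else 0)"
    using card_Lam_deg[of \<mu>] by (cases "\<nu> = 0") (auto simp: split_def)
  moreover have "card {y\<in>Lam. dg (case_prod TB y) = (\<mu>, \<nu>)} = (if \<mu> = 0 then if \<nu> = 0 then 4 else 3 else 0)"
    using card_Lam_deg[of \<nu>] by (cases "\<mu> = 0") (auto simp: split_def)
  moreover have "card {(m, p, q). dg (TI m p q) = (\<mu>, \<nu>)} = (if \<mu> = 0 \<or> \<nu> = 0 then 0 else 3)"
    using card_TI_deg[of \<mu> \<nu>] by simp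
  ultimately have "card {r\<in>GI. dg r = (\<mu>, \<nu>)} = (\<Sum>j\<in>UNIV. odim (\<mu>, \<nu>, j))"
    unfolding card_GI sum_3 odim_def by auto
  then show ?thesis using H.gr_dim[of "(\<mu>, \<nu>)"] by simp
qed

lemma ogr_dim_aux:
  assumes W: "finite W" "W \<subseteq> gd \<mu> \<nu>"
    and sp: "\<And>r. dg r = (\<mu>, \<nu>) \<Longrightarrow> G.Bg r \<in> G.G.span (W \<union> Th ` W \<union> Th ` Th ` W)"
    and c: "\<And>j. card (R.Pj j ` W - {0}) \<le> odim (\<mu>, \<nu>, j)"
  shows "has_dim G.gs (ogr (\<mu>, \<nu>, j)) (odim (\<mu>, \<nu>, j))"
  unfolding ogr_eq
proof (rule R.Ej_dim[OF gd_dim Th_gd W _ c])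
  show "gd \<mu> \<nu> \<subseteq> G.G.span (W \<union> Th ` W \<union> Th ` Th ` W)"
  proof
    fix v assume "v \<in> gd \<mu> \<nu>"
    then have "v = (\<Sum>r\<in>{r\<in>GI. dg r = (\<mu>, \<nu>)}. G.gs (G.cog v r) (G.Bg r))" using H.gr_expand[of v "(\<mu>, \<nu>)"] by simp
    also have "\<dots> \<in> G.G.span (W \<union> Th ` W \<union> Th ` Th ` W)"
      by (intro G.G.span_sum G.G.span_scale sp) simp
    finally show "v \<in> G.G.span (W \<union> Th ` W \<union> Th ` Th ` W)" .
  qed
qed

lemma span_lift:
  assumes "d \<in> A.F.span Z" "(\<lambda>d. tri_elt d 0) ` Z \<subseteq> G.G.span V" shows "tri_elt d 0 \<in> G.G.span V"
proof -
  have "A.F.subspace {d. tri_elt d 0 \<in> G.G.span V}"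
    unfolding A.F.subspace_def
  proof (intro conjI ballI allI; unfold mem_Collect_eq)
    show "tri_elt 0 0 \<in> G.G.span V" by (simp add: G.tri_elt_linear G.G.span_zero)
    show "tri_elt (d + e) 0 \<in> G.G.span V" if "tri_elt d 0 \<in> G.G.span V" "tri_elt e 0 \<in> G.G.span V" for d e
      using G.G.span_add[OF that] by (simp add: tri_elt_def)
    show "tri_elt (fs S a d) 0 \<in> G.G.span V" if "tri_elt d 0 \<in> G.G.span V" for a d
      using G.G.span_scale[OF that, of a] G.tri_elt_linear(2)[of a d 0] by simp
  qed
  then show ?thesis using assms A.F.span_minimal[of Z "{d. tri_elt d 0 \<in> G.G.span V}"] by blast
qed

lemma span_lift':
  assumes "d \<in> B.F.span Z" "(\<lambda>d. tri_elt 0 d) ` Z \<subseteq> G.G.span V" shows "tri_elt 0 d \<in> G.G.span V"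
proof -
  have "B.F.subspace {d. tri_elt 0 d \<in> G.G.span V}"
    unfolding B.F.subspace_def
  proof (intro conjI ballI allI; unfold mem_Collect_eq)
    show "tri_elt 0 0 \<in> G.G.span V" by (simp add: G.tri_elt_linear G.G.span_zero)
    show "tri_elt 0 (d + e) \<in> G.G.span V" if "tri_elt 0 d \<in> G.G.span V" "tri_elt 0 e \<in> G.G.span V" for d e
      using G.G.span_add[OF that] by (simp add: tri_elt_def)
    show "tri_elt 0 (fs S' a d) \<in> G.G.span V" if "tri_elt 0 d \<in> G.G.span V" for a d
      using G.G.span_scale[OF that, of a] G.tri_elt_linear(2)[of a 0 d] by simp
  qed
  then show ?thesis using assms B.F.span_minimal[of Z "{d. tri_elt 0 d \<in> G.G.span V}"] by blast
qed

lemma orb_lift: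
  assumes "d \<in> A.orb w" "tri_elt w 0 \<in> W" shows "tri_elt d 0 \<in> G.G.span (W \<union> Th ` W \<union> Th ` Th ` W)"
proof (rule span_lift[OF assms(1)[unfolded A.orb_def]])
  have "tri_elt (shift 1 w) 0 = Th (tri_elt w (0 :: 3 \<Rightarrow> 'w \<Rightarrow> 'w))"
    "tri_elt (shift 2 w) 0 = Th (Th (tri_elt w (0 :: 3 \<Rightarrow> 'w \<Rightarrow> 'w)))"
    by (simp_all add: Th_tri shift_lin shift_shift)
  then show "(\<lambda>d. tri_elt d 0) ` {w, shift 1 w, shift 2 w} \<subseteq> G.G.span (W \<union> Th ` W \<union> Th ` Th ` W)"
    using assms(2) by (auto intro!: G.G.span_base)
qed

lemma orb_lift':
  assumes "d \<in> B.orb w" "tri_elt 0 w \<in> W" shows "tri_elt 0 d \<in> G.G.span (W \<union> Th ` W \<union> Th ` Th ` W)"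
proof (rule span_lift'[OF assms(1)[unfolded B.orb_def]])
  have "tri_elt 0 (shift 1 w) = Th (tri_elt (0 :: 3 \<Rightarrow> 'v \<Rightarrow> 'v) w)"
    "tri_elt 0 (shift 2 w) = Th (Th (tri_elt (0 :: 3 \<Rightarrow> 'v \<Rightarrow> 'v) w))"
    by (simp_all add: Th_tri shift_lin shift_shift)
  then show "(\<lambda>d. tri_elt 0 d) ` {w, shift 1 w, shift 2 w} \<subseteq> G.G.span (W \<union> Th ` W \<union> Th ` Th ` W)"
    using assms(2) by (auto intro!: G.G.span_base)
qed

lemma deg_ex: "\<mu> \<noteq> 0 \<Longrightarrow> \<exists>p. \<mu> = deg p"
  using deg_range by (metis ComplI imageE singletonD)

lemma card_single: "card (f ` {w} - {0}) \<le> 1"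
  using card_mono[of "{f w}" "f ` {w} - {0}"] by auto

lemma ogr_dim: "has_dim G.gs (ogr h) (odim h)"
proof -
  obtain \<mu> \<nu> j where h: "h = (\<mu>, \<nu>, j)" by (metis prod_cases3)
  have d0: "deg p \<noteq> 0" for p using deg_range by blast
  consider "\<mu> \<noteq> 0" "\<nu> \<noteq> 0" | "\<mu> \<noteq> 0" "\<nu> = 0" | "\<mu> = 0" "\<nu> \<noteq> 0" | "\<mu> = 0" "\<nu> = 0" by blast
  then show ?thesis unfolding h
  proof cases
    case 1
    obtain p q where p: "\<mu> = deg p" "\<nu> = deg q" using deg_ex 1 by blast
    let ?w = "iota 0 (G.tns (A.c p) (B.c q))"
    show "has_dim G.gs (ogr (\<mu>, \<nu>, j)) (odim (\<mu>, \<nu>, j))"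
    proof (rule ogr_dim_aux[of "{?w}"])
      show "{?w} \<subseteq> gd \<mu> \<nu>" using iota_gd[OF A.GS.c_D B.GS.c_D] p by simp
      show "card (R.Pj j ` {?w} - {0}) \<le> odim (\<mu>, \<nu>, j)" for j using card_single 1 by (simp add: odim_def)
      fix r assume r: "dg r = (\<mu>, \<nu>)"
      show "G.Bg r \<in> G.G.span ({?w} \<union> Th ` {?w} \<union> Th ` Th ` {?w})"
      proof (cases r)
        case (TI m a b)
        then have "a = p" "b = q" using r deg_inj by (auto simp: p dest: injD)
        then have "G.Bg r = iota m (G.tns (A.c p) (B.c q))" by (simp add: TI)
        then show ?thesis using exhaust_3[of m] by (auto simp: Th_iota intro: G.G.span_base)
      qed (use r 1 in auto)
    qed simp
  next
    case 2
    obtain p where p: "\<mu> = deg p" using deg_ex 2 by blast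
    obtain w where w: "w \<in> A.GS.td (deg p)" "\<And>a b. deg a + deg b = deg p \<Longrightarrow> t_elt S (A.c a) (A.c b) \<in> A.orb w"
      using A.tri_orbit by blast
    let ?w = "tri_elt w 0"
    show "has_dim G.gs (ogr (\<mu>, \<nu>, j)) (odim (\<mu>, \<nu>, j))"
    proof (rule ogr_dim_aux[of "{?w}"])
      show "{?w} \<subseteq> gd \<mu> \<nu>" using tri_gd(1)[OF w(1)] p 2 by simp
      show "card (R.Pj j ` {?w} - {0}) \<le> odim (\<mu>, \<nu>, j)" for j using card_single 2 by (simp add: odim_def)
      fix r assume r: "dg r = (\<mu>, \<nu>)"
      show "G.Bg r \<in> G.G.span ({?w} \<union> Th ` {?w} \<union> Th ` Th ` {?w})"
      proof (cases r)
        case (TA a b)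
        have "deg a + deg b = deg p" using r p unfolding TA by simp
        from orb_lift[OF w(2)[OF this], of "{?w}"] show ?thesis unfolding TA by simp
      qed (use r 2 d0 in auto)
    qed simp
  next
    case 3
    obtain p where p: "\<nu> = deg p" using deg_ex 3 by blast
    obtain w where w: "w \<in> B.GS.td (deg p)" "\<And>a b. deg a + deg b = deg p \<Longrightarrow> t_elt S' (B.c a) (B.c b) \<in> B.orb w"
      using B.tri_orbit by blast
    let ?w = "tri_elt 0 w"
    show "has_dim G.gs (ogr (\<mu>, \<nu>, j)) (odim (\<mu>, \<nu>, j))"
    proof (rule ogr_dim_aux[of "{?w}"])
      show "{?w} \<subseteq> gd \<mu> \<nu>" using tri_gd(2)[OF w(1)] p 3 by simp
      show "card (R.Pj j ` {?w} - {0}) \<le> odim (\<mu>, \<nu>, j)" for j using card_single 3 by (simp add: odim_def)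
      fix r assume r: "dg r = (\<mu>, \<nu>)"
      show "G.Bg r \<in> G.G.span ({?w} \<union> Th ` {?w} \<union> Th ` Th ` {?w})"
      proof (cases r)
        case (TB a b)
        have "deg a + deg b = deg p" using r p unfolding TB by simp
        from orb_lift'[OF w(2)[OF this], of "{?w}"] show ?thesis unfolding TB by simp
      qed (use r 3 d0 in auto)
    qed simp
  next
    case 4
    obtain w1 w2 where w: "w1 \<in> A.GS.td 0" "w2 \<in> A.GS.td 0" "w1 + shift 1 w1 + shift 2 w1 = 0" "w2 + shift 1 w2 + shift 2 w2 = 0"
      and wt: "\<And>a b. deg a + deg b = 0 \<Longrightarrow> t_elt S (A.c a) (A.c b) \<in> A.F.span (A.orb w1 \<union> A.orb w2)"
      using A.tri_zero by blast
    obtain v1 v2 where v: "v1 \<in> B.GS.td 0" "v2 \<in> B.GS.td 0" "v1 + shift 1 v1 + shift 2 v1 = 0" "v2 + shift 1 v2 + shift 2 v2 = 0"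
      and vt: "\<And>a b. deg a + deg b = 0 \<Longrightarrow> t_elt S' (B.c a) (B.c b) \<in> B.F.span (B.orb v1 \<union> B.orb v2)"
      using B.tri_zero by blast
    let ?W = "{tri_elt w1 0, tri_elt w2 0, tri_elt 0 v1, tri_elt 0 v2} :: ('k, 'v, 'w) g_elt set"
    let ?U = "?W \<union> Th ` ?W \<union> Th ` Th ` ?W"
    show "has_dim G.gs (ogr (\<mu>, \<nu>, j)) (odim (\<mu>, \<nu>, j))"
    proof (rule ogr_dim_aux[of ?W])
      show "?W \<subseteq> gd \<mu> \<nu>" using tri_gd(1)[OF w(1)] tri_gd(1)[OF w(2)] tri_gd(2)[OF v(1)] tri_gd(2)[OF v(2)] 4 by simp
      \<comment> \<open>The sum of the three iterates of \<open>Theta\<close> vanishes on all four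
        generators, so for \<open>i = 0\<close> every projection is zero. For the other two
        eigenvalues the number of generators is the bound, and \<open>4 + 4\<close> exhausts the
        dimension \<open>8\<close>.\<close>
      show "card (R.Pj i ` ?W - {0}) \<le> odim (\<mu>, \<nu>, i)" for i
      proof (cases "i = 0")
        case True
        have P0: "R.Pj 0 y = G.gs (1 / 3) (y + Th y + Th (Th y))" for y by (simp add: R.Pj_def R.lam_0)
        have "y + Th y + Th (Th y) = 0" if "y \<in> ?W" for y
        proof -
          have "tri_elt d d' + Th (tri_elt d d') + Th (Th (tri_elt d d')) = tri_elt (d + shift 1 d + shift 2 d) (d' + shift 1 d' + shift 2 d')"
            for d :: "3 \<Rightarrow> 'v \<Rightarrow> 'v" and d' :: "3 \<Rightarrow> 'w \<Rightarrow> 'w"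
            by (simp add: Th_tri shift_shift G.tri_elt_linear)
          then show ?thesis using that w v by (auto simp: shift_lin G.tri_elt_linear(3))
        qed
        then have "R.Pj 0 ` ?W - {0} = {}" unfolding P0 by auto
        then show ?thesis unfolding True by simp
      next
        case False
        have "card (R.Pj i ` ?W - {0}) \<le> card (R.Pj i ` ?W)" by (intro card_mono) auto
        also have "\<dots> \<le> card ?W" by (rule card_image_le) simp
        also have "\<dots> \<le> length ([tri_elt w1 0, tri_elt w2 0, tri_elt 0 v1, tri_elt 0 v2] :: ('k, 'v, 'w) g_elt list)"
          using card_length[of "[tri_elt w1 0, tri_elt w2 0, tri_elt 0 v1, tri_elt 0 v2] :: ('k, 'v, 'w) g_elt list"] by simp
        finally show ?thesis using False 4 by (simp add: odim_def)
      qed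
      fix r assume r: "dg r = (\<mu>, \<nu>)"
      show "G.Bg r \<in> G.G.span ?U"
      proof (cases r)
        case (TA a b)
        have e: "deg a + deg b = 0" using r 4 unfolding TA by simp
        have "tri_elt (t_elt S (A.c a) (A.c b)) 0 \<in> G.G.span ?U"
          by (rule span_lift[OF wt[OF e]]) (use orb_lift[of _ w1 ?W] orb_lift[of _ w2 ?W] in blast)
        then show ?thesis unfolding TA by simp
      next
        case (TB a b)
        have e: "deg a + deg b = 0" using r 4 unfolding TB by simp
        have "tri_elt 0 (t_elt S' (B.c a) (B.c b)) \<in> G.G.span ?U"
          by (rule span_lift'[OF vt[OF e]]) (use orb_lift'[of _ v1 ?W] orb_lift'[of _ v2 ?W] in blast)
        then show ?thesis unfolding TB by simp
      next
        case (TI m a b)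
        then show ?thesis using r 4 d0 by simp
      qed
    qed simp
  qed
qed

text \<open>\<open>240 = 243 - 3\<close> degrees lie over nonzero pairs
  \<open>(\<mu>, \<nu>)\<close>; over the zero pair only the two nontrivial eigenvalues occur, and
  \<open>240 + 4 * 2 = 248\<close>.\<close>

lemma ogr_type: "grading_type G.gs ogr [240, 0, 0, 2]"
proof -
  have hd: "has_dim G.gs (ogr h) i \<longleftrightarrow> odim h = i" for h i
    using G.G.has_dim_unique[OF ogr_dim] ogr_dim by metis
  have 1: "{h. odim h = 1} = UNIV - {0} \<times> {0} \<times> UNIV"
    by (auto simp: odim_def split: if_splits)
  have 4: "{h. odim h = 4} = {0} \<times> {0} \<times> (- {0})"
    by (auto simp: odim_def split: if_splits)
  have "card {h. odim h = 1} = 240" unfolding 1 by (subst card_Diff_subset) (simp_all add: card_cartesian_product)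
  moreover have "card {h. odim h = 4} = 2" unfolding 4 by (simp add: card_cartesian_product Compl_eq_Diff_UNIV card_Diff_subset)
  moreover have "{h. odim h = 2} = {}" "{h. odim h = 3} = {}" by (auto simp: odim_def split: if_splits)
  moreover have "odim h \<le> 4" for h by (auto simp: odim_def split_def)
  moreover have "i \<in> {1..4} \<longleftrightarrow> i = 1 \<or> i = 2 \<or> i = 3 \<or> i = (4 :: nat)" for i by auto
  ultimately show ?thesis unfolding grading_type_def hd by (auto simp: eval_nat_numeral)
qed

end

theorem proposition5p26:
  fixes \<omega> :: "'k::field"
    and C :: "('k, 'c::ab_group_add) normed_alg" and C' :: "('k, 'd::ab_group_add) normed_alg"
    and u :: 'c and u' :: 'd
    and D :: "2 \<times> 2 \<times> 2 \<Rightarrow> 'c set" and D' :: "2 \<times> 2 \<times> 2 \<Rightarrow> 'd set"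
    and S :: "('k, 'o::ab_group_add) normed_alg" and S' :: "('k, 'p::ab_group_add) normed_alg"
    and \<alpha> \<beta> \<alpha>' \<beta>' :: 'k
    and x :: "3 \<times> 3 \<Rightarrow> 'o" and x' :: "3 \<times> 3 \<Rightarrow> 'p"
  assumes "CHAR('k) \<noteq> 2" and "CHAR('k) \<noteq> 3"
    and "\<omega> ^ 3 = 1" and "\<omega> \<noteq> 1"
  shows
    "(Z2_cubed_graded_cayley C u D \<and> Z2_cubed_graded_cayley C' u' D' \<longrightarrow>
       (let g = g_space (para C u) (para C' u');
            br = g_bracket (para C u) (para C' u');
            sc = g_scale (para C u) (para C' u');
            gr = para_induced_grading (para C u) (para C' u') D D'
        in simple_lie_algebra sc g br \<and> lie_of_type_E8 sc g br \<and>
           group_grading sc g br gr \<and> grading_type sc gr [192, 0, 0, 14])) \<and>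
     (okubo_algebra \<alpha> \<beta> S x \<and> okubo_algebra \<alpha>' \<beta>' S' x' \<longrightarrow>
       (let g = g_space S S';
            br = g_bracket S S';
            sc = g_scale S S';
            gr = okubo_induced_grading \<omega> S S' (okubo_grading S x) (okubo_grading S' x')
        in simple_lie_algebra sc g br \<and> lie_of_type_E8 sc g br \<and>
           group_grading sc g br gr \<and> grading_type sc gr [240, 0, 0, 2]))"
proof -
  \<comment> \<open>If a prime vanishes in the field, the characteristic divides it and is not
    \<open>1\<close>, so it equals that prime.\<close>
  have num: "of_nat p \<noteq> (0 :: 'k)" if "prime p" "CHAR('k) \<noteq> p" for p
  proof
    assume "of_nat p = (0 :: 'k)"
    then have "CHAR('k) dvd p" by (simp add: of_nat_eq_0_iff_char_dvd)
    then have "CHAR('k) = 1" using that by (metis prime_nat_iff)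
    then show False using CHAR_not_1' by simp
  qed
  have two: "(2 :: 'k) \<noteq> 0" using num[of 2] assms(1) by (simp add: two_is_prime_nat)
  have three: "(3 :: 'k) \<noteq> 0" using num[of 3] assms(2) by simp
  show ?thesis
    unfolding Let_def
  proof (rule conjI; rule impI)
    assume a: "Z2_cubed_graded_cayley C u D \<and> Z2_cubed_graded_cayley C' u' D'"
    interpret A: graded_cayley C u D using a two by (intro graded_cayley.intro) auto
    interpret B: graded_cayley C' u' D' using a two by (intro graded_cayley.intro) auto
    obtain b b' where b: "split_triple A.Q.SK b" "split_triple B.Q.SK b'" using A.split_K B.split_K by blast
    interpret E: ext_pair "para C u" A.c A.cd "para C' u'" B.c B.cd b b'
      by (intro ext_pair.intro A.Q.symcomp_basis_axioms B.Q.symcomp_basis_axioms ext_pair_axioms.intro b)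
    interpret P: para_pair "para C u" A.c A.cd D "para C' u'" B.c B.cd D'
      by (intro para_pair.intro graded_pair.intro A.GS.graded_symcomp_axioms B.GS.graded_symcomp_axioms)
    show "simple_lie_algebra (g_scale (para C u) (para C' u')) (g_space (para C u) (para C' u')) (g_bracket (para C u) (para C' u')) \<and>
      lie_of_type_E8 (g_scale (para C u) (para C' u')) (g_space (para C u) (para C' u')) (g_bracket (para C u) (para C' u')) \<and>
      group_grading (g_scale (para C u) (para C' u')) (g_space (para C u) (para C' u')) (g_bracket (para C u) (para C' u'))
        (para_induced_grading (para C u) (para C' u') D D') \<and>
      grading_type (g_scale (para C u) (para C' u')) (para_induced_grading (para C u) (para C' u') D D') [192, 0, 0, 14]"
      by (intro conjI E.g_simple_E8 P.P.grading P.pgr_type)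
  next
    assume a: "okubo_algebra \<alpha> \<beta> S x \<and> okubo_algebra \<alpha>' \<beta>' S' x'"
    interpret A: okubo \<alpha> \<beta> S x using a two by (intro okubo.intro) auto
    interpret B: okubo \<alpha>' \<beta>' S' x' using a two by (intro okubo.intro) auto
    obtain b b' where b: "split_triple A.SK b" "split_triple B.SK b'" using A.split_K B.split_K by blast
    interpret E: ext_pair S A.c "\<lambda>p. A.c (neg p)" S' B.c "\<lambda>p. B.c (neg p)" b b'
      by (intro ext_pair.intro A.symcomp_basis_axioms B.symcomp_basis_axioms ext_pair_axioms.intro b)
    interpret P: okubo_pair \<alpha> \<beta> S x \<alpha>' \<beta>' S' x' \<omega>
      by (intro okubo_pair.intro A.okubo_axioms B.okubo_axioms okubo_pair_axioms.intro assms three)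
    show "simple_lie_algebra (g_scale S S') (g_space S S') (g_bracket S S') \<and>
      lie_of_type_E8 (g_scale S S') (g_space S S') (g_bracket S S') \<and>
      group_grading (g_scale S S') (g_space S S') (g_bracket S S') (okubo_induced_grading \<omega> S S' (okubo_grading S x) (okubo_grading S' x')) \<and>
      grading_type (g_scale S S') (okubo_induced_grading \<omega> S S' (okubo_grading S x) (okubo_grading S' x')) [240, 0, 0, 2]"
      by (intro conjI E.g_simple_E8 P.ogr_grading P.ogr_type)
  qed
qed

end
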